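(* (Sufficient conditions for the optimality of a control.) In the control setting described in the context, let $b,\sigma,h,\Phi$ satisfy the hypothesis (H) there. Let $u\in\mathcal U$ with state $X^u$, let $(p,q)$ be the unique adapted solution of the adjoint equation $$\left\{\begin{aligned} -dp_t=&\Big\{b_x^*(t,\Theta_t)p_t+\sigma_x^*(t,\Theta_t)q_t+h_x(t,X^u_t,P_{X^u_t},u_t,u_{t-\delta})\\ &+\mathbb{E}'\big[b_\mu^*(t,\Theta'_t,X^u_t)(p_t)'+\sigma_\mu^*(t,\Theta'_t,X^u_t)(q_t)'+h_\mu(t,(X^u_t)',P_{X^u_t},(u_t)',(u_{t-\delta})',X^u_t)\big]\\ &+\mathbb{E}^{\mathcal F_t}\big[b^*_{x_\delta}(t+\delta,\Theta_{t+\delta})p_{t+\delta}\big]+\mathbb{E}^{\mathcal F_t}\big[\sigma^*_{x_\delta}(t+\delta,\Theta_{t+\delta})q_{t+\delta}\big]\\ &+\mathbb{E}'\Big[\mathbb{E}^{\mathcal F_t}\big[b^*_{\mu_\delta}(t+\delta,\Theta'_{t+\delta},X^u_t)(p_{t+\delta})'\big]+\mathbb{E}^{\mathcal F_t}\big[\sigma^*_{\mu_\delta}(t+\delta,\Theta'_{t+\delta},X^u_t)(q_{t+\delta})'\big]\Big]\Big\}dt-q_t\,dB_t,\quad t\in[0,T],\\ p_T=&\ \Phi_x(X^u_T,P_{X^u_T})+\mathbb{E}'\big[\Phi_\mu((X^u_T)',P_{X^u_T},X^u_T)\big],\\ p_t=&\ 0,\quad q_t=0,\qquad t\in(T,T+\delta],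 \end{aligned}\right.$$ and let $$H(t,x,x_\delta,\mu,\mu_\delta,v,v_\delta,p,q)=b^*(t,x,x_\delta,\mu,\mu_\delta,v,v_\delta)\,p+\sigma^*(t,x,x_\delta,\mu,\mu_\delta,v,v_\delta)\,q+h(t,x,\mu,v,v_\delta).$$ Assume that $u$ satisfies, for all $v\in\mathcal U$, $$\big\langle H_v(t,\Theta_t,p_t,q_t),v_t-u_t\big\rangle+\big\langle\mathbb{E}^{\mathcal F_t}\big[H_{v_\delta}(t+\delta,\Theta_{t+\delta},p_{t+\delta},q_{t+\delta})\big],v_t-u_t\big\rangle\ge0,\quad\text{for a.e. }t\in[0,T],\ P\text{-a.s.},$$ that $\Phi(x,\mu)$ is convex with respect to $(x,\mu)$, and that $H(t,x,x_\delta,\mu,\mu_\delta,v,v_\delta,p_t,q_t)$ is convex with respect to $(x,x_\delta,\mu,\mu_\delta,v,v_\delta)$. Then $u$ is an optimal control, i.e. $J(u)=\min_{v\in\mathcal U}J(v)$.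
   Context: Probability setting: $T>0$, $\delta\in[0,T]$. $(\Omega,\mathcal F,P)$ is a complete probability space with a $d$-dimensional Brownian motion $B$; $\mathcal F_0\subset\mathcal F$ is a sub-$\sigma$-field independent of $B$ and rich enough that $\mathcal P_2(\mathbb{R}^n)=\{P_\xi:\xi\in L^2(\mathcal F_0;\mathbb{R}^n)\}$; $(\mathcal F_t)$ is the filtration generated by $B$, completed and augmented by $\mathcal F_0$; $\mathcal F_t=\mathcal F_0$ for $t<0$; $\mathbb{E}^{\mathcal F_t}$ is conditional expectation. $P_X$ is the law of $X$; $\mathcal P_2(\mathbb{R}^n)$ is the space of square-integrable probability measures with the 2-Wasserstein metric $W_2$. $H^2_{\mathcal F}(s,r;E)$: $E$-valued $\mathcal F_t$-adapted processes with $\mathbb{E}\int_s^r|\phi_t|^2dt<\infty$; $S^2_{\mathcal F}(s,r;E)$: those with $\mathbb{E}\sup_{s\le t\le r}|\phi_t|^2<\infty$. Copies: $(\Omega',\mathcal F',P')$ is a copy of $(\Omega,\mathcal F,P)$; $\xi'$ is the copy on $\Omega'$ of a random variable $\xi$; $\mathbb{E}'[\cdot]=\int_{\Omega'}(\cdot)dP'$ acts only on $\omega'$. Derivative in the measure: $f:\mathcal P_2(\mathbb{R}^n)\to\mathbb{R}$ is differentiable at $\mu=P_{\mathfrak v_0}$ if $\tilde f(\mathfrak v)=f(P_{\mathfrak v})$ is Fréchet differentiable on $L^2(\mathcal F;\mathbb{R}^n)$ at $\mathfrak v_0$; then $D\tilde f(\mathfrak v_0)(\eta)=\mathbb{E}[h_0(\mathfrak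 v_0)\cdot\eta]$ for a Borel $h_0:\mathbb{R}^n\to\mathbb{R}^n$, and $f_\mu(\mu,y):=h_0(y)$ (vector-valued functions componentwise). Subscripts $x,x_\delta,\mu,\mu_\delta,v,v_\delta$ denote derivatives in the corresponding argument; measure derivatives have the extra last argument $y\in\mathbb{R}^n$. Lipschitz/boundedness of a measure derivative refers to a version defined for all $y$, jointly in all arguments (with $W_2$ for measures), uniformly in $t$. Convexity in arguments including measures is understood for the lifted function, e.g. $\Phi$ is convex in $(x,\mu)$ if $(x,\mathfrak v)\mapsto\Phi(x,P_{\mathfrak v})$ is convex on $\mathbb{R}^n\times L^2(\mathcal F;\mathbb{R}^n)$; equivalently for differentiable $\Phi$, $\Phi(x_1,P_{\mathfrak v_1})-\Phi(x_0,P_{\mathfrak v_0})\ge\Phi_x(x_0,P_{\mathfrak v_0})(x_1-x_0)+\mathbb{E}[\Phi_\mu(x_0,P_{\mathfrak v_0},\mathfrak v_0)(\mathfrak v_1-\mathfrak v_0)]$. Similarly for $H$ (lifting $\mu$ and $\mu_\delta$), for a.e. $t$ and a.s. with $(p,q)=(p_t,q_t)$. Control problem: $U\subset\mathbb{R}^k$ convex. $\mathcal U$: processes $v$ on $[-\delta,T]$ with $v|_{[0,T]}\in H^2_{\mathcal F}(0,T;U)$ and $v_t=\gamma_t$ on $[-\delta,0)$, where $\gamma$ is a fixed given square-integrable initial path. Coefficients: $b:[0,T]\times\mathbb{R}^n\times\mathbb{R}^n\times\mathcal P_2(\mathbb{R}^n)\times\mathcal P_2(\mathbb{R}^n)\times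 U\times U\to\mathbb{R}^n$, $\sigma$ on the same domain with values in $\mathbb{R}^{n\times d}$, $h:[0,T]\times\mathbb{R}^n\times\mathcal P_2(\mathbb{R}^n)\times U\times U\to\mathbb{R}$, $\Phi:\mathbb{R}^n\times\mathcal P_2(\mathbb{R}^n)\to\mathbb{R}$, with arguments $(t,x,x_\delta,\mu,\mu_\delta,v,v_\delta)$ for $b,\sigma$, $(t,x,\mu,v,v_\delta)$ for $h$, $(x,\mu)$ for $\Phi$. State equation, for $v\in\mathcal U$: $$dX^v_t=b(t,X^v_t,X^v_{t-\delta},P_{X^v_t},P_{X^v_{t-\delta}},v_t,v_{t-\delta})dt+\sigma(t,X^v_t,X^v_{t-\delta},P_{X^v_t},P_{X^v_{t-\delta}},v_t,v_{t-\delta})dB_t,\ t\in[0,T],$$ with $X^v_t=\xi_t$ on $[-\delta,0]$, $\xi$ a fixed square-integrable initial path. Standing: for every $v\in\mathcal U$ it has a unique square-integrable solution and the cost $$J(v)=\mathbb{E}\Big\{\int_0^Th(t,X^v_t,P_{X^v_t},v_t,v_{t-\delta})dt+\Phi(X^v_T,P_{X^v_T})\Big\}$$ is well defined. Hypothesis (H): (1) $b,\sigma,h,\Phi$ are differentiable with respect to $(x,x_\delta,\mu,\mu_\delta,v,v_\delta)$ (those arguments that occur). (2) $b,\sigma$ are Lipschitz in $(x,x_\delta,\mu,\mu_\delta)$; the derivatives of $b,\sigma$ are Lipschitz continuous and bounded. (3) The derivatives of $h,\Phi$ are Lipschitz continuous and bounded by $C(1+|x|+|x_\delta|+|v|+|v_\delta|)$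 (those arguments that occur). Notation: $\Theta_t=(X^u_t,X^u_{t-\delta},P_{X^u_t},P_{X^u_{t-\delta}},u_t,u_{t-\delta})$, $\Theta'_t=((X^u_t)',(X^u_{t-\delta})',P_{X^u_t},P_{X^u_{t-\delta}},(u_t)',(u_{t-\delta})')$. $^*$ is transpose; $b^*p=\sum_ib_ip_i$; for $\sigma=(\sigma^1,\dots,\sigma^d)$ and $q=(q^1,\dots,q^d)$ in $\mathbb{R}^{n\times d}$ (columns), $\sigma^*q=\sum_{i=1}^d\sigma^i\cdot q^i$ and $\sigma_x^*q=\sum_{i=1}^d(\sigma^i_x)^*q^i$, similarly for the other derivatives. In the adjoint equation the double expectations $\mathbb{E}'[\mathbb{E}^{\mathcal F_t}[\cdot]]$ may be computed simply as $\mathbb{E}'[\cdot]$, as $X^u_t$ is $\mathcal F_t$-measurable. Convention: $b,\sigma,h$ are only defined for times in $[0,T]$; all terms evaluated at a time $t+\delta>T$ are zero. The solution $(p,q)$ is in $S^2_{\mathcal F}(0,T;\mathbb{R}^n)\times H^2_{\mathcal F}(0,T;\mathbb{R}^{n\times d})$, extended by $0$ on $(T,T+\delta]$. *)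

theory Defs
  imports "HOL-Probability.Probability"
begin

section \<open>Square-integrable random variables, their laws, and the Wasserstein metric\<close>

abbreviation law :: "'a measure \<Rightarrow> ('a \<Rightarrow> 'b::topological_space) \<Rightarrow> 'b measure" where
  "law M X \<equiv> distr M borel X"

text \<open>\<open>L2 M N\<close> is the space of square-integrable random variables on \<open>M\<close> that are
  measurable with respect to the sub-sigma-algebra \<open>N\<close>; \<open>L2 M M\<close> is the full space.\<close>

definition L2 :: "'a measure \<Rightarrow> 'a measure \<Rightarrow> ('a \<Rightarrow> 'b::euclidean_space) set" where
  "L2 M N = {\<xi> \<in> borel_measurable N. integrable M (\<lambda>\<omega>. (norm (\<xi> \<omega>))\<^sup>2)}"

definition L2_norm :: "'a measure \<Rightarrow> ('a \<Rightarrow> 'b::euclidean_space) \<Rightarrow> real" where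
  "L2_norm M \<xi> = sqrt (\<integral>\<omega>. (norm (\<xi> \<omega>))\<^sup>2 \<partial>M)"

definition P2 :: "'b::euclidean_space measure set" where
  "P2 = {\<mu>. prob_space \<mu> \<and> sets \<mu> = sets borel \<and> integrable \<mu> (\<lambda>x. (norm x)\<^sup>2)}"

definition couplings :: "'b::euclidean_space measure \<Rightarrow> 'b measure \<Rightarrow> ('b \<times> 'b) measure set" where
  "couplings \<mu> \<nu> = {\<pi>. sets \<pi> = sets (borel \<Otimes>\<^sub>M borel)
     \<and> distr \<pi> borel fst = \<mu> \<and> distr \<pi> borel snd = \<nu>}"

definition W2 :: "'b::euclidean_space measure \<Rightarrow> 'b measure \<Rightarrow> real" where
  "W2 \<mu> \<nu> = sqrt (INF \<pi>\<in>couplings \<mu> \<nu>. \<integral>z. (norm (fst z - snd z))\<^sup>2 \<partial>\<pi>)"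

section \<open>Derivative in the measure\<close>

text \<open>\<open>D\<close> is the derivative of \<open>f\<close> at \<open>\<mu>\<close>: at every \<open>\<zeta> \<in> L\<^sup>2\<close> with law \<open>\<mu>\<close>, the lift
  \<open>\<zeta> \<mapsto> f (law M \<zeta>)\<close> is Frechet differentiable with derivative
  \<open>\<eta> \<mapsto> E [D(\<zeta>) \<eta>]\<close>. The function \<open>f\<close> may be vector-valued; for real-valued \<open>f\<close>
  the linear form \<open>D y\<close> is the inner product with the gradient \<open>f_\<mu>(\<mu>, y)\<close>.\<close>

definition has_measure_derivative ::
  "'a measure \<Rightarrow> ('b::euclidean_space measure \<Rightarrow> 'c::euclidean_space)
     \<Rightarrow> ('b \<Rightarrow> ('b \<Rightarrow>\<^sub>L 'c)) \<Rightarrow> 'b measure \<Rightarrow> bool" where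
  "has_measure_derivative M f D \<mu> \<longleftrightarrow>
     D \<in> borel_measurable borel \<and>
     (\<forall>\<zeta>\<in>L2 M M. law M \<zeta> = \<mu> \<longrightarrow>
        integrable M (\<lambda>\<omega>. (norm (D (\<zeta> \<omega>)))\<^sup>2) \<and>
        (\<forall>e>0. \<exists>r>0. \<forall>\<eta>\<in>L2 M M. L2_norm M \<eta> < r \<longrightarrow>
           norm (f (law M (\<lambda>\<omega>. \<zeta> \<omega> + \<eta> \<omega>)) - f (law M \<zeta>)
                 - (\<integral>\<omega>. blinfun_apply (D (\<zeta> \<omega>)) (\<eta> \<omega>) \<partial>M)) \<le> e * L2_norm M \<eta>))"

section \<open>Stochastic basis, Brownian motion, Ito integral\<close>

definition brownian_motion ::
  "'a measure \<Rightarrow> real \<Rightarrow> (real \<Rightarrow> 'a \<Rightarrow> real^'d) \<Rightarrow> bool" where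
  "brownian_motion M T B \<longleftrightarrow>
     (\<forall>t\<in>{0..T}. B t \<in> borel_measurable M) \<and>
     (AE \<omega> in M. B 0 \<omega> = 0) \<and>
     (AE \<omega> in M. continuous_on {0..T} (\<lambda>t. B t \<omega>)) \<and>
     (\<forall>s t. 0 \<le> s \<and> s < t \<and> t \<le> T \<longrightarrow>
        distributed M lborel (\<lambda>\<omega>. B t \<omega> - B s \<omega>)
          (\<lambda>x. ennreal (\<Prod>i\<in>UNIV. normal_density 0 (sqrt (t - s)) (x $ i))) \<and>
        prob_space.indep_set M
          (sigma_sets (space M) {B r -` A \<inter> space M | r A. r \<in> {0..s} \<and> A \<in> sets borel})
          {(\<lambda>\<omega>. B t \<omega> - B s \<omega>) -` A \<inter> space M | A. A \<in> sets borel})"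

text \<open>The filtration generated by \<open>B\<close>, completed with the null sets and augmented by \<open>G\<close>,
  which is the initial sigma-algebra \<open>F\<^sub>0\<close>. For \<open>t < 0\<close> it does not involve \<open>B\<close>.\<close>

definition bm_filtration ::
  "'a measure \<Rightarrow> 'a measure \<Rightarrow> (real \<Rightarrow> 'a \<Rightarrow> real^'d) \<Rightarrow> real \<Rightarrow> 'a measure" where
  "bm_filtration M G B t = sigma (space M)
     (sets G \<union> null_sets M \<union>
      {B r -` A \<inter> space M | r A. 0 \<le> r \<and> r \<le> t \<and> A \<in> sets borel})"

text \<open>The type \<open>'n\<close> fixes the dimension of the laws that \<open>G\<close> has to realise.\<close>

definition stochastic_basis ::
  "'n::finite itself \<Rightarrow> 'a measure \<Rightarrow> 'a measure \<Rightarrow> real \<Rightarrow> (real \<Rightarrow> 'a \<Rightarrow> real^'d)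
     \<Rightarrow> (real \<Rightarrow> 'a measure) \<Rightarrow> bool" where
  "stochastic_basis TYPE('n) M G T B F \<longleftrightarrow>
     prob_space M \<and> complete_measure M \<and> brownian_motion M T B \<and>
     subalgebra M G \<and>
     prob_space.indep_set M (sets G)
       (sigma_sets (space M) {B r -` A \<inter> space M | r A. r \<in> {0..T} \<and> A \<in> sets borel}) \<and>
     (P2 :: (real^'n) measure set) = {law M \<xi> | \<xi>. \<xi> \<in> L2 M G} \<and>
     F = bm_filtration M G B"

definition adapted_measurable ::
  "'a measure \<Rightarrow> (real \<Rightarrow> 'a measure) \<Rightarrow> real set \<Rightarrow> (real \<Rightarrow> 'a \<Rightarrow> 'e::euclidean_space) \<Rightarrow> bool" where
  "adapted_measurable M F I \<phi> \<longleftrightarrow>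
     (\<lambda>(t, \<omega>). \<phi> t \<omega>) \<in> borel_measurable (restrict_space borel I \<Otimes>\<^sub>M M) \<and>
     (\<forall>t\<in>I. \<phi> t \<in> borel_measurable (F t))"

definition H2 ::
  "'a measure \<Rightarrow> (real \<Rightarrow> 'a measure) \<Rightarrow> real set \<Rightarrow> (real \<Rightarrow> 'a \<Rightarrow> 'e::euclidean_space) set" where
  "H2 M F I = {\<phi>. adapted_measurable M F I \<phi> \<and>
     (\<integral>\<^sup>+\<omega>. (\<integral>\<^sup>+t\<in>I. ennreal ((norm (\<phi> t \<omega>))\<^sup>2) \<partial>lborel) \<partial>M) < \<infinity>}"

definition S2 ::
  "'a measure \<Rightarrow> (real \<Rightarrow> 'a measure) \<Rightarrow> real set \<Rightarrow> (real \<Rightarrow> 'a \<Rightarrow> 'e::euclidean_space) set" where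
  "S2 M F I = {\<phi>. adapted_measurable M F I \<phi> \<and>
     (\<integral>\<^sup>+\<omega>. (SUP t\<in>I. ennreal ((norm (\<phi> t \<omega>))\<^sup>2)) \<partial>M) < \<infinity>}"

text \<open>Simple integrands: the value is \<open>\<eta> j\<close> on the interval \<open>(\<tau> j, \<tau> (j+1)]\<close>, \<open>j < m\<close>.\<close>

definition simple_integrand ::
  "'a measure \<Rightarrow> (real \<Rightarrow> 'a measure) \<Rightarrow> real \<Rightarrow> nat \<Rightarrow> (nat \<Rightarrow> real)
     \<Rightarrow> (nat \<Rightarrow> 'a \<Rightarrow> real^'d^'n) \<Rightarrow> bool" where
  "simple_integrand M F T m \<tau> \<eta> \<longleftrightarrow>
     \<tau> 0 = 0 \<and> \<tau> m = T \<and> (\<forall>j<m. \<tau> j < \<tau> (Suc j)) \<and>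
     (\<forall>j<m. \<eta> j \<in> borel_measurable (F (\<tau> j)) \<and>
        (\<exists>C. \<forall>\<omega>\<in>space M. norm (\<eta> j \<omega>) \<le> C))"

definition simple_process ::
  "nat \<Rightarrow> (nat \<Rightarrow> real) \<Rightarrow> (nat \<Rightarrow> 'a \<Rightarrow> real^'d^'n) \<Rightarrow> real \<Rightarrow> 'a \<Rightarrow> real^'d^'n" where
  "simple_process m \<tau> \<eta> t \<omega> = (\<Sum>j<m. indicator {\<tau> j<..\<tau> (Suc j)} t *\<^sub>R \<eta> j \<omega>)"

definition simple_integral ::
  "(real \<Rightarrow> 'a \<Rightarrow> real^'d) \<Rightarrow> nat \<Rightarrow> (nat \<Rightarrow> real) \<Rightarrow> (nat \<Rightarrow> 'a \<Rightarrow> real^'d^'n)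
     \<Rightarrow> real \<Rightarrow> 'a \<Rightarrow> real^'n" where
  "simple_integral B m \<tau> \<eta> t \<omega> =
     (\<Sum>j<m. \<eta> j \<omega> *v (B (min (\<tau> (Suc j)) t) \<omega> - B (min (\<tau> j) t) \<omega>))"

text \<open>\<open>Y\<close> is a continuous version of the Ito integral process \<open>t \<mapsto> \<integral>\<^sub>0\<^sup>t \<phi> dB\<close>
  of the integrand \<open>\<phi> \<in> H\<^sup>2\<close>: the \<open>L\<^sup>2\<close>-limit of integrals of simple integrands
  converging to \<open>\<phi>\<close>.\<close>

definition ito_integral ::
  "'a measure \<Rightarrow> (real \<Rightarrow> 'a measure) \<Rightarrow> real \<Rightarrow> (real \<Rightarrow> 'a \<Rightarrow> real^'d)
     \<Rightarrow> (real \<Rightarrow> 'a \<Rightarrow> real^'d^'n) \<Rightarrow> (real \<Rightarrow> 'a \<Rightarrow> real^'n) \<Rightarrow> bool" where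
  "ito_integral M F T B \<phi> Y \<longleftrightarrow>
     \<phi> \<in> H2 M F {0..T} \<and>
     (\<forall>t\<in>{0..T}. Y t \<in> L2 M M) \<and>
     (AE \<omega> in M. continuous_on {0..T} (\<lambda>t. Y t \<omega>)) \<and>
     (\<exists>m \<tau> \<eta>. (\<forall>k::nat. simple_integrand M F T (m k) (\<tau> k) (\<eta> k)) \<and>
        (\<lambda>k. \<integral>\<^sup>+\<omega>. (\<integral>\<^sup>+t\<in>{0..T}.
            ennreal ((norm (simple_process (m k) (\<tau> k) (\<eta> k) t \<omega> - \<phi> t \<omega>))\<^sup>2) \<partial>lborel) \<partial>M)
          \<longlonglongrightarrow> 0 \<and>
        (\<forall>t\<in>{0..T}. (\<lambda>k. \<integral>\<^sup>+\<omega>.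
            ennreal ((norm (simple_integral B (m k) (\<tau> k) (\<eta> k) t \<omega> - Y t \<omega>))\<^sup>2) \<partial>M)
          \<longlonglongrightarrow> 0))"

text \<open>Componentwise conditional expectation; the library has the real-valued one.\<close>

definition vec_cond_exp ::
  "'a measure \<Rightarrow> 'a measure \<Rightarrow> ('a \<Rightarrow> real^'m) \<Rightarrow> 'a \<Rightarrow> real^'m" where
  "vec_cond_exp M N f \<omega> = (\<chi> i. real_cond_exp M N (\<lambda>\<omega>'. f \<omega>' $ i) \<omega>)"

section \<open>Coefficients and hypothesis (H)\<close>

text \<open>Arguments \<open>(x, x\<^sub>\<delta>, \<mu>, \<mu>\<^sub>\<delta>, v, v\<^sub>\<delta>)\<close> of \<open>b\<close> and \<open>\<sigma>\<close>,
  arguments \<open>(x, \<mu>, v, v\<^sub>\<delta>)\<close> of \<open>h\<close>, and arguments \<open>(x, \<mu>)\<close> of \<open>\<Phi>\<close>.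
  The functions are only relevant for measures in \<open>P2\<close> and controls in \<open>U\<close>.\<close>

type_synonym ('n, 'k) args6 =
  "(real^'n) \<times> (real^'n) \<times> (real^'n) measure \<times> (real^'n) measure \<times> (real^'k) \<times> (real^'k)"
type_synonym ('n, 'k) args4 =
  "(real^'n) \<times> (real^'n) measure \<times> (real^'k) \<times> (real^'k)"
type_synonym 'n args2 = "(real^'n) \<times> (real^'n) measure"

definition dom6 :: "(real^'k) set \<Rightarrow> ('n::finite, 'k::finite) args6 set" where
  "dom6 U = UNIV \<times> UNIV \<times> P2 \<times> P2 \<times> U \<times> U"

definition dom4 :: "(real^'k) set \<Rightarrow> ('n::finite, 'k::finite) args4 set" where
  "dom4 U = UNIV \<times> P2 \<times> U \<times> U"

definition dom2 :: "'n::finite args2 set" where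
  "dom2 = UNIV \<times> P2"

definition dist6 :: "('n::finite, 'k::finite) args6 \<Rightarrow> ('n, 'k) args6 \<Rightarrow> real" where
  "dist6 = (\<lambda>(x, xd, \<mu>, \<mu>d, v, vd) (x', xd', \<mu>', \<mu>d', v', vd').
     norm (x - x') + norm (xd - xd') + W2 \<mu> \<mu>' + W2 \<mu>d \<mu>d' + norm (v - v') + norm (vd - vd'))"

definition dist4 :: "('n::finite, 'k::finite) args4 \<Rightarrow> ('n, 'k) args4 \<Rightarrow> real" where
  "dist4 = (\<lambda>(x, \<mu>, v, vd) (x', \<mu>', v', vd').
     norm (x - x') + W2 \<mu> \<mu>' + norm (v - v') + norm (vd - vd'))"

definition dist2 :: "'n::finite args2 \<Rightarrow> 'n args2 \<Rightarrow> real" where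
  "dist2 = (\<lambda>(x, \<mu>) (x', \<mu>'). norm (x - x') + W2 \<mu> \<mu>')"

text \<open>A coefficient together with chosen versions of its partial derivatives. The measure
  derivatives have the extra last argument \<open>y\<close>. Derivatives are kept as linear maps into the
  value space, so that for a map into matrices the transposed derivative
  \<open>\<sigma>\<^sub>x\<^sup>* q = \<Sum>\<^sub>i (\<sigma>\<^sup>i\<^sub>x)\<^sup>* q\<^sup>i\<close>
  is the adjoint with respect to the inner product of \<open>real^'d^'n\<close>.\<close>

record (overloaded) ('n::finite, 'k::finite, 'c::euclidean_space) coefficient =
  fn :: "real \<Rightarrow> ('n, 'k) args6 \<Rightarrow> 'c"
  D_x :: "real \<Rightarrow> ('n, 'k) args6 \<Rightarrow> (real^'n) \<Rightarrow>\<^sub>L 'c"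
  D_xd :: "real \<Rightarrow> ('n, 'k) args6 \<Rightarrow> (real^'n) \<Rightarrow>\<^sub>L 'c"
  D_mu :: "real \<Rightarrow> ('n, 'k) args6 \<Rightarrow> real^'n \<Rightarrow> (real^'n) \<Rightarrow>\<^sub>L 'c"
  D_mud :: "real \<Rightarrow> ('n, 'k) args6 \<Rightarrow> real^'n \<Rightarrow> (real^'n) \<Rightarrow>\<^sub>L 'c"
  D_v :: "real \<Rightarrow> ('n, 'k) args6 \<Rightarrow> (real^'k) \<Rightarrow>\<^sub>L 'c"
  D_vd :: "real \<Rightarrow> ('n, 'k) args6 \<Rightarrow> (real^'k) \<Rightarrow>\<^sub>L 'c"

record (overloaded) ('n::finite, 'k::finite) running_cost =
  rc :: "real \<Rightarrow> ('n, 'k) args4 \<Rightarrow> real"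
  rc_x :: "real \<Rightarrow> ('n, 'k) args4 \<Rightarrow> (real^'n) \<Rightarrow>\<^sub>L real"
  rc_mu :: "real \<Rightarrow> ('n, 'k) args4 \<Rightarrow> real^'n \<Rightarrow> (real^'n) \<Rightarrow>\<^sub>L real"
  rc_v :: "real \<Rightarrow> ('n, 'k) args4 \<Rightarrow> (real^'k) \<Rightarrow>\<^sub>L real"
  rc_vd :: "real \<Rightarrow> ('n, 'k) args4 \<Rightarrow> (real^'k) \<Rightarrow>\<^sub>L real"

record (overloaded) 'n::finite terminal_cost =
  tc :: "'n args2 \<Rightarrow> real"
  tc_x :: "'n args2 \<Rightarrow> (real^'n) \<Rightarrow>\<^sub>L real"
  tc_mu :: "'n args2 \<Rightarrow> real^'n \<Rightarrow> (real^'n) \<Rightarrow>\<^sub>L real"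

abbreviation tr :: "('b::euclidean_space \<Rightarrow>\<^sub>L 'c::euclidean_space) \<Rightarrow> 'c \<Rightarrow> 'b" where
  "tr A \<equiv> adjoint (blinfun_apply A)"

abbreviation grad :: "('b::euclidean_space \<Rightarrow>\<^sub>L real) \<Rightarrow> 'b" where
  "grad A \<equiv> tr A 1"

text \<open>Lipschitz continuity and growth, uniformly in the index \<open>t \<in> I\<close>; the variants
  with suffix \<open>_y\<close> are for measure derivatives, jointly in all arguments including \<open>y\<close>.\<close>

definition lip_growth ::
  "'i set \<Rightarrow> 'z set \<Rightarrow> ('z \<Rightarrow> 'z \<Rightarrow> real) \<Rightarrow> ('z \<Rightarrow> real)
     \<Rightarrow> ('i \<Rightarrow> 'z \<Rightarrow> 'c::real_normed_vector) \<Rightarrow> bool" where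
  "lip_growth I Z d g f \<longleftrightarrow>
     (\<exists>L. \<forall>t\<in>I. \<forall>z\<in>Z. \<forall>z'\<in>Z. norm (f t z - f t z') \<le> L * d z z') \<and>
     (\<exists>C. \<forall>t\<in>I. \<forall>z\<in>Z. norm (f t z) \<le> C * g z)"

definition lip_growth_y ::
  "'i set \<Rightarrow> 'z set \<Rightarrow> ('z \<Rightarrow> 'z \<Rightarrow> real) \<Rightarrow> ('z \<Rightarrow> real)
     \<Rightarrow> ('i \<Rightarrow> 'z \<Rightarrow> 'y::real_normed_vector \<Rightarrow> 'c::real_normed_vector) \<Rightarrow> bool" where
  "lip_growth_y I Z d g f \<longleftrightarrow>
     (\<exists>L. \<forall>t\<in>I. \<forall>z\<in>Z. \<forall>z'\<in>Z. \<forall>y y'. norm (f t z y - f t z' y') \<le> L * (d z z' + norm (y - y'))) \<and>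
     (\<exists>C. \<forall>t\<in>I. \<forall>z\<in>Z. \<forall>y. norm (f t z y) \<le> C * g z)"

text \<open>Borel measurability in time, for each value of the remaining arguments: the
  implicit regularity that makes the coefficients and the chosen versions of the
  derivatives usable as integrands. The derivatives are tested on vectors \<open>w\<close>.\<close>

definition time_measurable ::
  "real \<Rightarrow> 'z set \<Rightarrow> (real \<Rightarrow> 'z \<Rightarrow> 'c::euclidean_space) \<Rightarrow> bool" where
  "time_measurable T Z f \<longleftrightarrow>
     (\<forall>z\<in>Z. (\<lambda>t. f t z) \<in> borel_measurable (restrict_space borel {0..T}))"

definition measurable_coefficient ::
  "real \<Rightarrow> (real^'k) set \<Rightarrow> ('n::finite, 'k::finite, 'c::euclidean_space) coefficient \<Rightarrow> bool" where
  "measurable_coefficient T U c \<longleftrightarrow>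
     time_measurable T (dom6 U) (fn c) \<and>
     time_measurable T (dom6 U \<times> UNIV) (\<lambda>t (\<theta>, w). blinfun_apply (D_x c t \<theta>) w) \<and>
     time_measurable T (dom6 U \<times> UNIV) (\<lambda>t (\<theta>, w). blinfun_apply (D_xd c t \<theta>) w) \<and>
     time_measurable T (dom6 U \<times> UNIV \<times> UNIV) (\<lambda>t (\<theta>, y, w). blinfun_apply (D_mu c t \<theta> y) w) \<and>
     time_measurable T (dom6 U \<times> UNIV \<times> UNIV) (\<lambda>t (\<theta>, y, w). blinfun_apply (D_mud c t \<theta> y) w) \<and>
     time_measurable T (dom6 U \<times> UNIV) (\<lambda>t (\<theta>, w). blinfun_apply (D_v c t \<theta>) w) \<and>
     time_measurable T (dom6 U \<times> UNIV) (\<lambda>t (\<theta>, w). blinfun_apply (D_vd c t \<theta>) w)"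

definition measurable_running_cost ::
  "real \<Rightarrow> (real^'k) set \<Rightarrow> ('n::finite, 'k::finite) running_cost \<Rightarrow> bool" where
  "measurable_running_cost T U h \<longleftrightarrow>
     time_measurable T (dom4 U) (rc h) \<and>
     time_measurable T (dom4 U \<times> UNIV) (\<lambda>t (z, w). blinfun_apply (rc_x h t z) w) \<and>
     time_measurable T (dom4 U \<times> UNIV \<times> UNIV) (\<lambda>t (z, y, w). blinfun_apply (rc_mu h t z y) w) \<and>
     time_measurable T (dom4 U \<times> UNIV) (\<lambda>t (z, w). blinfun_apply (rc_v h t z) w) \<and>
     time_measurable T (dom4 U \<times> UNIV) (\<lambda>t (z, w). blinfun_apply (rc_vd h t z) w)"

text \<open>The derivatives in the controls are taken within the convex set \<open>U\<close>.\<close>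

definition differentiable_coefficient ::
  "'a measure \<Rightarrow> real \<Rightarrow> (real^'k) set
     \<Rightarrow> ('n::finite, 'k::finite, 'c::euclidean_space) coefficient \<Rightarrow> bool" where
  "differentiable_coefficient M T U c \<longleftrightarrow>
     (\<forall>t\<in>{0..T}. \<forall>x xd. \<forall>\<mu>\<in>P2. \<forall>\<mu>d\<in>P2. \<forall>v\<in>U. \<forall>vd\<in>U.
        ((\<lambda>z. fn c t (z, xd, \<mu>, \<mu>d, v, vd)) has_derivative
           blinfun_apply (D_x c t (x, xd, \<mu>, \<mu>d, v, vd))) (at x) \<and>
        ((\<lambda>z. fn c t (x, z, \<mu>, \<mu>d, v, vd)) has_derivative
           blinfun_apply (D_xd c t (x, xd, \<mu>, \<mu>d, v, vd))) (at xd) \<and>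
        has_measure_derivative M (\<lambda>m. fn c t (x, xd, m, \<mu>d, v, vd))
           (D_mu c t (x, xd, \<mu>, \<mu>d, v, vd)) \<mu> \<and>
        has_measure_derivative M (\<lambda>m. fn c t (x, xd, \<mu>, m, v, vd))
           (D_mud c t (x, xd, \<mu>, \<mu>d, v, vd)) \<mu>d \<and>
        ((\<lambda>z. fn c t (x, xd, \<mu>, \<mu>d, z, vd)) has_derivative
           blinfun_apply (D_v c t (x, xd, \<mu>, \<mu>d, v, vd))) (at v within U) \<and>
        ((\<lambda>z. fn c t (x, xd, \<mu>, \<mu>d, v, z)) has_derivative
           blinfun_apply (D_vd c t (x, xd, \<mu>, \<mu>d, v, vd))) (at vd within U))"

definition differentiable_running_cost ::
  "'a measure \<Rightarrow> real \<Rightarrow> (real^'k) set \<Rightarrow> ('n::finite, 'k::finite) running_cost \<Rightarrow> bool" where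
  "differentiable_running_cost M T U h \<longleftrightarrow>
     (\<forall>t\<in>{0..T}. \<forall>x. \<forall>\<mu>\<in>P2. \<forall>v\<in>U. \<forall>vd\<in>U.
        ((\<lambda>z. rc h t (z, \<mu>, v, vd)) has_derivative
           blinfun_apply (rc_x h t (x, \<mu>, v, vd))) (at x) \<and>
        has_measure_derivative M (\<lambda>m. rc h t (x, m, v, vd)) (rc_mu h t (x, \<mu>, v, vd)) \<mu> \<and>
        ((\<lambda>z. rc h t (x, \<mu>, z, vd)) has_derivative
           blinfun_apply (rc_v h t (x, \<mu>, v, vd))) (at v within U) \<and>
        ((\<lambda>z. rc h t (x, \<mu>, v, z)) has_derivative
           blinfun_apply (rc_vd h t (x, \<mu>, v, vd))) (at vd within U))"

definition differentiable_terminal_cost ::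
  "'a measure \<Rightarrow> 'n::finite terminal_cost \<Rightarrow> bool" where
  "differentiable_terminal_cost M \<Phi> \<longleftrightarrow>
     (\<forall>x. \<forall>\<mu>\<in>P2.
        ((\<lambda>z. tc \<Phi> (z, \<mu>)) has_derivative blinfun_apply (tc_x \<Phi> (x, \<mu>))) (at x) \<and>
        has_measure_derivative M (\<lambda>m. tc \<Phi> (x, m)) (tc_mu \<Phi> (x, \<mu>)) \<mu>)"

definition H_coefficient ::
  "'a measure \<Rightarrow> real \<Rightarrow> (real^'k) set
     \<Rightarrow> ('n::finite, 'k::finite, 'c::euclidean_space) coefficient \<Rightarrow> bool" where
  "H_coefficient M T U c \<longleftrightarrow>
     differentiable_coefficient M T U c \<and>
     (\<exists>L. \<forall>t\<in>{0..T}. \<forall>x x' xd xd'. \<forall>\<mu>\<in>P2. \<forall>\<mu>'\<in>P2. \<forall>\<mu>d\<in>P2. \<forall>\<mu>d'\<in>P2. \<forall>v\<in>U. \<forall>vd\<in>U.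
        norm (fn c t (x, xd, \<mu>, \<mu>d, v, vd) - fn c t (x', xd', \<mu>', \<mu>d', v, vd))
          \<le> L * (norm (x - x') + norm (xd - xd') + W2 \<mu> \<mu>' + W2 \<mu>d \<mu>d')) \<and>
     lip_growth {0..T} (dom6 U) dist6 (\<lambda>_. 1) (D_x c) \<and>
     lip_growth {0..T} (dom6 U) dist6 (\<lambda>_. 1) (D_xd c) \<and>
     lip_growth_y {0..T} (dom6 U) dist6 (\<lambda>_. 1) (D_mu c) \<and>
     lip_growth_y {0..T} (dom6 U) dist6 (\<lambda>_. 1) (D_mud c) \<and>
     lip_growth {0..T} (dom6 U) dist6 (\<lambda>_. 1) (D_v c) \<and>
     lip_growth {0..T} (dom6 U) dist6 (\<lambda>_. 1) (D_vd c)"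

definition H_running_cost ::
  "'a measure \<Rightarrow> real \<Rightarrow> (real^'k) set \<Rightarrow> ('n::finite, 'k::finite) running_cost \<Rightarrow> bool" where
  "H_running_cost M T U h \<longleftrightarrow>
     differentiable_running_cost M T U h \<and>
     (let g = (\<lambda>(x, \<mu>, v, vd). 1 + norm x + norm v + norm vd) in
        lip_growth {0..T} (dom4 U) dist4 g (rc_x h) \<and>
        lip_growth_y {0..T} (dom4 U) dist4 g (rc_mu h) \<and>
        lip_growth {0..T} (dom4 U) dist4 g (rc_v h) \<and>
        lip_growth {0..T} (dom4 U) dist4 g (rc_vd h))"

definition H_terminal_cost :: "'a measure \<Rightarrow> 'n::finite terminal_cost \<Rightarrow> bool" where
  "H_terminal_cost M \<Phi> \<longleftrightarrow>
     differentiable_terminal_cost M \<Phi> \<and>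
     lip_growth {()} dom2 dist2 (\<lambda>(x, \<mu>). 1 + norm x) (\<lambda>_. tc_x \<Phi>) \<and>
     lip_growth_y {()} dom2 dist2 (\<lambda>(x, \<mu>). 1 + norm x) (\<lambda>_. tc_mu \<Phi>)"

definition hypothesis_H ::
  "'a measure \<Rightarrow> real \<Rightarrow> (real^'k) set
     \<Rightarrow> ('n::finite, 'k::finite, real^'n) coefficient
     \<Rightarrow> ('n, 'k, real^'d::finite^'n) coefficient
     \<Rightarrow> ('n, 'k) running_cost \<Rightarrow> 'n terminal_cost \<Rightarrow> bool" where
  "hypothesis_H M T U b \<sigma> h \<Phi> \<longleftrightarrow>
     H_coefficient M T U b \<and> H_coefficient M T U \<sigma> \<and> H_running_cost M T U h \<and> H_terminal_cost M \<Phi>"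

section \<open>The control problem\<close>

definition admissible ::
  "'a measure \<Rightarrow> (real \<Rightarrow> 'a measure) \<Rightarrow> real \<Rightarrow> real \<Rightarrow> (real^'k) set
     \<Rightarrow> (real \<Rightarrow> 'a \<Rightarrow> real^'k) \<Rightarrow> (real \<Rightarrow> 'a \<Rightarrow> real^'k) set" where
  "admissible M F T \<delta> U \<gamma> = {v. v \<in> H2 M F {0..T} \<and>
     (\<forall>t\<in>{0..T}. \<forall>\<omega>\<in>space M. v t \<omega> \<in> U) \<and>
     (\<forall>t\<in>{-\<delta>..<0}. \<forall>\<omega>\<in>space M. v t \<omega> = \<gamma> t \<omega>)}"

definition initial_data ::
  "'a measure \<Rightarrow> (real \<Rightarrow> 'a measure) \<Rightarrow> real \<Rightarrow> (real^'k) set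
     \<Rightarrow> (real \<Rightarrow> 'a \<Rightarrow> real^'n) \<Rightarrow> (real \<Rightarrow> 'a \<Rightarrow> real^'k) \<Rightarrow> bool" where
  "initial_data M F \<delta> U \<xi> \<gamma> \<longleftrightarrow>
     \<xi> \<in> H2 M F {-\<delta>..0} \<and> \<xi> 0 \<in> L2 M (F 0) \<and>
     \<gamma> \<in> H2 M F {-\<delta>..<0} \<and> (\<forall>t\<in>{-\<delta>..<0}. \<forall>\<omega>\<in>space M. \<gamma> t \<omega> \<in> U)"

definition Theta ::
  "'a measure \<Rightarrow> real \<Rightarrow> (real \<Rightarrow> 'a \<Rightarrow> real^'n) \<Rightarrow> (real \<Rightarrow> 'a \<Rightarrow> real^'k)
     \<Rightarrow> real \<Rightarrow> 'a \<Rightarrow> ('n::finite, 'k::finite) args6" where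
  "Theta M \<delta> X v t \<omega> =
     (X t \<omega>, X (t - \<delta>) \<omega>, law M (X t), law M (X (t - \<delta>)), v t \<omega>, v (t - \<delta>) \<omega>)"

definition Theta_h ::
  "'a measure \<Rightarrow> real \<Rightarrow> (real \<Rightarrow> 'a \<Rightarrow> real^'n) \<Rightarrow> (real \<Rightarrow> 'a \<Rightarrow> real^'k)
     \<Rightarrow> real \<Rightarrow> 'a \<Rightarrow> ('n::finite, 'k::finite) args4" where
  "Theta_h M \<delta> X v t \<omega> = (X t \<omega>, law M (X t), v t \<omega>, v (t - \<delta>) \<omega>)"

definition state_solution ::
  "'a measure \<Rightarrow> (real \<Rightarrow> 'a measure) \<Rightarrow> real \<Rightarrow> real \<Rightarrow> (real \<Rightarrow> 'a \<Rightarrow> real^'d)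
     \<Rightarrow> (real \<Rightarrow> 'a \<Rightarrow> real^'n)
     \<Rightarrow> ('n::finite, 'k::finite, real^'n) coefficient \<Rightarrow> ('n, 'k, real^'d::finite^'n) coefficient
     \<Rightarrow> (real \<Rightarrow> 'a \<Rightarrow> real^'k) \<Rightarrow> (real \<Rightarrow> 'a \<Rightarrow> real^'n) \<Rightarrow> bool" where
  "state_solution M F T \<delta> B \<xi> b \<sigma> v X \<longleftrightarrow>
     X \<in> S2 M F {0..T} \<and>
     (\<forall>t\<in>{-\<delta>..0}. \<forall>\<omega>\<in>space M. X t \<omega> = \<xi> t \<omega>) \<and>
     (AE \<omega> in M. set_integrable lborel {0..T} (\<lambda>s. fn b s (Theta M \<delta> X v s \<omega>))) \<and>
     (\<exists>Y. ito_integral M F T B (\<lambda>s \<omega>. fn \<sigma> s (Theta M \<delta> X v s \<omega>)) Y \<and>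
        (AE \<omega> in M. \<forall>t\<in>{0..T}.
           X t \<omega> = \<xi> 0 \<omega> + (LINT s:{0..t}|lborel. fn b s (Theta M \<delta> X v s \<omega>)) + Y t \<omega>))"

definition cost_at ::
  "'a measure \<Rightarrow> real \<Rightarrow> real \<Rightarrow> ('n::finite, 'k::finite) running_cost \<Rightarrow> 'n terminal_cost
     \<Rightarrow> (real \<Rightarrow> 'a \<Rightarrow> real^'k) \<Rightarrow> (real \<Rightarrow> 'a \<Rightarrow> real^'n) \<Rightarrow> 'a \<Rightarrow> real" where
  "cost_at M T \<delta> h \<Phi> v X \<omega> =
     (LINT t:{0..T}|lborel. rc h t (Theta_h M \<delta> X v t \<omega>)) + tc \<Phi> (X T \<omega>, law M (X T))"

definition cost_well_defined ::
  "'a measure \<Rightarrow> real \<Rightarrow> real \<Rightarrow> ('n::finite, 'k::finite) running_cost \<Rightarrow> 'n terminal_cost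
     \<Rightarrow> (real \<Rightarrow> 'a \<Rightarrow> real^'k) \<Rightarrow> (real \<Rightarrow> 'a \<Rightarrow> real^'n) \<Rightarrow> bool" where
  "cost_well_defined M T \<delta> h \<Phi> v X \<longleftrightarrow>
     (AE \<omega> in M. set_integrable lborel {0..T} (\<lambda>t. rc h t (Theta_h M \<delta> X v t \<omega>))) \<and>
     integrable M (cost_at M T \<delta> h \<Phi> v X)"

definition cost_J ::
  "'a measure \<Rightarrow> real \<Rightarrow> real \<Rightarrow> ('n::finite, 'k::finite) running_cost \<Rightarrow> 'n terminal_cost
     \<Rightarrow> (real \<Rightarrow> 'a \<Rightarrow> real^'k) \<Rightarrow> (real \<Rightarrow> 'a \<Rightarrow> real^'n) \<Rightarrow> real" where
  "cost_J M T \<delta> h \<Phi> v X = (\<integral>\<omega>. cost_at M T \<delta> h \<Phi> v X \<omega> \<partial>M)"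

text \<open>The standing assumption on the state equation and the cost; \<open>X v\<close> is the state
  process \<open>X\<^sup>v\<close>.\<close>

definition state_map ::
  "'a measure \<Rightarrow> (real \<Rightarrow> 'a measure) \<Rightarrow> real \<Rightarrow> real \<Rightarrow> (real \<Rightarrow> 'a \<Rightarrow> real^'d)
     \<Rightarrow> (real^'k) set \<Rightarrow> (real \<Rightarrow> 'a \<Rightarrow> real^'n) \<Rightarrow> (real \<Rightarrow> 'a \<Rightarrow> real^'k)
     \<Rightarrow> ('n::finite, 'k::finite, real^'n) coefficient \<Rightarrow> ('n, 'k, real^'d::finite^'n) coefficient
     \<Rightarrow> ('n, 'k) running_cost \<Rightarrow> 'n terminal_cost
     \<Rightarrow> ((real \<Rightarrow> 'a \<Rightarrow> real^'k) \<Rightarrow> real \<Rightarrow> 'a \<Rightarrow> real^'n) \<Rightarrow> bool" where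
  "state_map M F T \<delta> B U \<xi> \<gamma> b \<sigma> h \<Phi> X \<longleftrightarrow>
     (\<forall>v\<in>admissible M F T \<delta> U \<gamma>.
        state_solution M F T \<delta> B \<xi> b \<sigma> v (X v) \<and>
        (\<forall>Z. state_solution M F T \<delta> B \<xi> b \<sigma> v Z \<longrightarrow>
           (AE \<omega> in M. \<forall>t\<in>{0..T}. Z t \<omega> = X v t \<omega>)) \<and>
        cost_well_defined M T \<delta> h \<Phi> v (X v))"

section \<open>Adjoint equation and Hamiltonian\<close>

text \<open>Convention: terms evaluated at a time after \<open>T\<close> vanish.\<close>

definition zero_after :: "real \<Rightarrow> real \<Rightarrow> 'z::zero \<Rightarrow> 'z" where
  "zero_after T s z = (if s \<le> T then z else 0)"

text \<open>The integrand of the adjoint equation. As the copy of the probability space is the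
  space itself with integration variable \<open>\<omega>'\<close>, a primed process is that process evaluated
  at \<open>\<omega>'\<close>, and \<open>E'\<close> is the integral over \<open>\<omega>'\<close>. In the last line the double
  expectation reduces to \<open>E'\<close>, because \<open>X\<^sub>t\<close> is measurable with respect to \<open>F\<^sub>t\<close>.\<close>

definition adjoint_driver ::
  "'a measure \<Rightarrow> (real \<Rightarrow> 'a measure) \<Rightarrow> real \<Rightarrow> real
     \<Rightarrow> ('n::finite, 'k::finite, real^'n) coefficient \<Rightarrow> ('n, 'k, real^'d::finite^'n) coefficient
     \<Rightarrow> ('n, 'k) running_cost
     \<Rightarrow> (real \<Rightarrow> 'a \<Rightarrow> real^'k) \<Rightarrow> (real \<Rightarrow> 'a \<Rightarrow> real^'n)
     \<Rightarrow> (real \<Rightarrow> 'a \<Rightarrow> real^'n) \<Rightarrow> (real \<Rightarrow> 'a \<Rightarrow> real^'d^'n)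
     \<Rightarrow> real \<Rightarrow> 'a \<Rightarrow> real^'n" where
  "adjoint_driver M F T \<delta> b \<sigma> h u X p q t \<omega> =
     (let \<Theta> = Theta M \<delta> X u; \<theta> = Theta_h M \<delta> X u in
        tr (D_x b t (\<Theta> t \<omega>)) (p t \<omega>) + tr (D_x \<sigma> t (\<Theta> t \<omega>)) (q t \<omega>) + grad (rc_x h t (\<theta> t \<omega>))
      + (\<integral>\<omega>'. tr (D_mu b t (\<Theta> t \<omega>') (X t \<omega>)) (p t \<omega>')
             + tr (D_mu \<sigma> t (\<Theta> t \<omega>') (X t \<omega>)) (q t \<omega>')
             + grad (rc_mu h t (\<theta> t \<omega>') (X t \<omega>)) \<partial>M)
      + vec_cond_exp M (F t)
          (\<lambda>\<omega>'. zero_after T (t + \<delta>) (tr (D_xd b (t + \<delta>) (\<Theta> (t + \<delta>) \<omega>')) (p (t + \<delta>) \<omega>'))) \<omega>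
      + vec_cond_exp M (F t)
          (\<lambda>\<omega>'. zero_after T (t + \<delta>) (tr (D_xd \<sigma> (t + \<delta>) (\<Theta> (t + \<delta>) \<omega>')) (q (t + \<delta>) \<omega>'))) \<omega>
      + (\<integral>\<omega>'. zero_after T (t + \<delta>) (tr (D_mud b (t + \<delta>) (\<Theta> (t + \<delta>) \<omega>') (X t \<omega>)) (p (t + \<delta>) \<omega>'))
             + zero_after T (t + \<delta>) (tr (D_mud \<sigma> (t + \<delta>) (\<Theta> (t + \<delta>) \<omega>') (X t \<omega>)) (q (t + \<delta>) \<omega>')) \<partial>M))"

text \<open>The conditional expectations in the driver are determined, for each \<open>t\<close>, only up to a
  null set. The equation is therefore integrated with a jointly measurable adapted version
  \<open>f\<close> of the driver.\<close>

definition adjoint_solution ::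
  "'a measure \<Rightarrow> (real \<Rightarrow> 'a measure) \<Rightarrow> real \<Rightarrow> real \<Rightarrow> (real \<Rightarrow> 'a \<Rightarrow> real^'d)
     \<Rightarrow> ('n::finite, 'k::finite, real^'n) coefficient \<Rightarrow> ('n, 'k, real^'d::finite^'n) coefficient
     \<Rightarrow> ('n, 'k) running_cost \<Rightarrow> 'n terminal_cost
     \<Rightarrow> (real \<Rightarrow> 'a \<Rightarrow> real^'k) \<Rightarrow> (real \<Rightarrow> 'a \<Rightarrow> real^'n)
     \<Rightarrow> (real \<Rightarrow> 'a \<Rightarrow> real^'n) \<Rightarrow> (real \<Rightarrow> 'a \<Rightarrow> real^'d^'n) \<Rightarrow> bool" where
  "adjoint_solution M F T \<delta> B b \<sigma> h \<Phi> u X p q \<longleftrightarrow>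
     p \<in> S2 M F {0..T} \<and> q \<in> H2 M F {0..T} \<and>
     (\<forall>t\<in>{T<..T + \<delta>}. \<forall>\<omega>\<in>space M. p t \<omega> = 0 \<and> q t \<omega> = 0) \<and>
     (AE \<omega> in M. p T \<omega> = grad (tc_x \<Phi> (X T \<omega>, law M (X T)))
        + (\<integral>\<omega>'. grad (tc_mu \<Phi> (X T \<omega>', law M (X T)) (X T \<omega>)) \<partial>M)) \<and>
     (\<exists>f Y. adapted_measurable M F {0..T} f \<and>
        (AE t in lborel. t \<in> {0..T} \<longrightarrow>
           (AE \<omega> in M. f t \<omega> = adjoint_driver M F T \<delta> b \<sigma> h u X p q t \<omega>)) \<and>
        (AE \<omega> in M. set_integrable lborel {0..T} (\<lambda>s. f s \<omega>)) \<and>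
        ito_integral M F T B q Y \<and>
        (AE \<omega> in M. \<forall>t\<in>{0..T}.
           p t \<omega> = p T \<omega> + (LINT s:{t..T}|lborel. f s \<omega>) - (Y T \<omega> - Y t \<omega>)))"

definition hamiltonian ::
  "('n::finite, 'k::finite, real^'n) coefficient \<Rightarrow> ('n, 'k, real^'d::finite^'n) coefficient
     \<Rightarrow> ('n, 'k) running_cost
     \<Rightarrow> real \<Rightarrow> ('n, 'k) args6 \<Rightarrow> real^'n \<Rightarrow> real^'d^'n \<Rightarrow> real" where
  "hamiltonian b \<sigma> h t = (\<lambda>(x, xd, \<mu>, \<mu>d, v, vd) p q.
     fn b t (x, xd, \<mu>, \<mu>d, v, vd) \<bullet> p + fn \<sigma> t (x, xd, \<mu>, \<mu>d, v, vd) \<bullet> q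
     + rc h t (x, \<mu>, v, vd))"

text \<open>The gradients of the Hamiltonian in \<open>v\<close> and \<open>v\<^sub>\<delta>\<close>, by linearity in terms
  of the chosen derivatives of the coefficients.\<close>

definition hamiltonian_v ::
  "('n::finite, 'k::finite, real^'n) coefficient \<Rightarrow> ('n, 'k, real^'d::finite^'n) coefficient
     \<Rightarrow> ('n, 'k) running_cost
     \<Rightarrow> real \<Rightarrow> ('n, 'k) args6 \<Rightarrow> real^'n \<Rightarrow> real^'d^'n \<Rightarrow> real^'k" where
  "hamiltonian_v b \<sigma> h t = (\<lambda>(x, xd, \<mu>, \<mu>d, v, vd) p q.
     tr (D_v b t (x, xd, \<mu>, \<mu>d, v, vd)) p + tr (D_v \<sigma> t (x, xd, \<mu>, \<mu>d, v, vd)) q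
     + grad (rc_v h t (x, \<mu>, v, vd)))"

definition hamiltonian_vd ::
  "('n::finite, 'k::finite, real^'n) coefficient \<Rightarrow> ('n, 'k, real^'d::finite^'n) coefficient
     \<Rightarrow> ('n, 'k) running_cost
     \<Rightarrow> real \<Rightarrow> ('n, 'k) args6 \<Rightarrow> real^'n \<Rightarrow> real^'d^'n \<Rightarrow> real^'k" where
  "hamiltonian_vd b \<sigma> h t = (\<lambda>(x, xd, \<mu>, \<mu>d, v, vd) p q.
     tr (D_vd b t (x, xd, \<mu>, \<mu>d, v, vd)) p + tr (D_vd \<sigma> t (x, xd, \<mu>, \<mu>d, v, vd)) q
     + grad (rc_vd h t (x, \<mu>, v, vd)))"

text \<open>Convexity of the lifted functions. The elements of \<open>L\<^sup>2\<close> are random variables, which do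
  not form a type of class \<open>real_vector\<close>, so \<open>convex_on\<close> is written out.\<close>

definition lift_convex2 :: "'a measure \<Rightarrow> ('n::finite args2 \<Rightarrow> real) \<Rightarrow> bool" where
  "lift_convex2 M f \<longleftrightarrow>
     (\<forall>x0 x1. \<forall>\<zeta>0\<in>L2 M M. \<forall>\<zeta>1\<in>L2 M M. \<forall>s\<in>{0..1}.
        f ((1 - s) *\<^sub>R x0 + s *\<^sub>R x1, law M (\<lambda>\<omega>. (1 - s) *\<^sub>R \<zeta>0 \<omega> + s *\<^sub>R \<zeta>1 \<omega>))
          \<le> (1 - s) * f (x0, law M \<zeta>0) + s * f (x1, law M \<zeta>1))"

definition lift_convex6 ::
  "'a measure \<Rightarrow> (real^'k) set \<Rightarrow> (('n::finite, 'k::finite) args6 \<Rightarrow> real) \<Rightarrow> bool" where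
  "lift_convex6 M U f \<longleftrightarrow>
     (\<forall>x0 x1 y0 y1. \<forall>\<zeta>0\<in>L2 M M. \<forall>\<zeta>1\<in>L2 M M. \<forall>\<eta>0\<in>L2 M M. \<forall>\<eta>1\<in>L2 M M.
      \<forall>v0\<in>U. \<forall>v1\<in>U. \<forall>w0\<in>U. \<forall>w1\<in>U. \<forall>s\<in>{0..1}.
        f ((1 - s) *\<^sub>R x0 + s *\<^sub>R x1, (1 - s) *\<^sub>R y0 + s *\<^sub>R y1,
           law M (\<lambda>\<omega>. (1 - s) *\<^sub>R \<zeta>0 \<omega> + s *\<^sub>R \<zeta>1 \<omega>),
           law M (\<lambda>\<omega>. (1 - s) *\<^sub>R \<eta>0 \<omega> + s *\<^sub>R \<eta>1 \<omega>),
           (1 - s) *\<^sub>R v0 + s *\<^sub>R v1, (1 - s) *\<^sub>R w0 + s *\<^sub>R w1)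
          \<le> (1 - s) * f (x0, y0, law M \<zeta>0, law M \<eta>0, v0, w0)
             + s * f (x1, y1, law M \<zeta>1, law M \<eta>1, v1, w1))"

end

theory Submission
  imports Defs
begin

text \<open>Write \<open>dX = X\<^sup>v - X\<^sup>u\<close> and \<open>dv = v - u\<close>. The product rule, in the integrated form that only
  needs the orthogonality and the isometry of the Ito integral, gives
  \<open>E[p\<^sub>T dX\<^sub>T] = E \<integral> (p db + q d\<sigma> - f dX) dt\<close>, where \<open>db\<close>, \<open>d\<sigma>\<close> are the differences of the
  coefficients along the two controls and \<open>f\<close> is the adjoint driver. Convexity of \<open>\<Phi>\<close> gives
  \<open>E[d\<Phi>] \<ge> E[p\<^sub>T dX\<^sub>T]\<close>, the two terms of \<open>p\<^sub>T\<close> being exchanged by Fubini, so that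
  \<open>J(v) - J(u) \<ge> E \<integral> (dH - f dX) dt\<close>. For almost every \<open>t\<close> convexity bounds \<open>E[dH]\<close> from below by the
  derivative of \<open>H\<close> in all six arguments. Its delayed part is a function \<open>G\<^sub>t\<close> that vanishes on
  \<open>[0,\<delta>)\<close>, where the two paths have the same past, whereas \<open>f\<close> and the optimality condition contain \<open>G\<close> at
  time \<open>t + \<delta>\<close>. Hence \<open>E[dH - f dX] \<ge> G\<^sub>t - G\<^sub>t\<^sub>+\<^sub>\<delta>\<close>, and the right-hand side integrates to zero.\<close>

section \<open>Square-integrable random variables\<close>

text \<open>Hypothesis (H) provides six separate partial derivatives, while convexity acts on all
  arguments at once. The Lipschitz bounds close this gap: moving the arguments one after the other
  along a segment gives a linear expansion whose remainder is quadratic in the step. The measure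
  arguments move along segments of random variables, since both differentiability and convexity are
  stated for lifts. The costs are embedded as coefficients that ignore the missing arguments, so one
  analysis serves \<open>b\<close>, \<open>\<sigma>\<close>, \<open>h\<close> and
  \<open>\<Phi>\<close>, with multipliers \<open>p\<close>, \<open>q\<close>, 1 and 1. Two questions
  of integrability shape the rest. Delayed states and controls are known to be square-integrable
  only at almost every time, so estimates are made at such times, and measurable versions are built
  by substituting good times for the others. The adjoint equation asks only for pathwise
  integrability of its drift; the square-integrability that the product rule uses is derived from
  the growth bounds and the contraction property of conditional expectation.\<close>

lemma L2_iff: "f \<in> L2 M M \<longleftrightarrow> f \<in> borel_measurable M \<and> integrable M (\<lambda>x. (norm (f x))\<^sup>2)"
  by (auto simp: L2_def)

lemma L2_measurable [measurable_dest]: "f \<in> L2 M M \<Longrightarrow> f \<in> borel_measurable M"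
  by (simp add: L2_iff)

lemma L2_integrable: "f \<in> L2 M M \<Longrightarrow> integrable M (\<lambda>x. (norm (f x))\<^sup>2)"
  by (simp add: L2_iff)

lemma L2_bound_sq:
  fixes f :: "'a \<Rightarrow> 'b::euclidean_space" and g :: "'a \<Rightarrow> real"
  assumes "f \<in> borel_measurable M" "integrable M g" "AE x in M. (norm (f x))\<^sup>2 \<le> g x"
  shows "f \<in> L2 M M"
  unfolding L2_iff using assms
  by (auto intro!: Bochner_Integration.integrable_bound[OF assms(2)])

lemma L2_bound:
  fixes f :: "'a \<Rightarrow> 'b::euclidean_space" and g :: "'a \<Rightarrow> 'c::euclidean_space"
  assumes "f \<in> borel_measurable M" "g \<in> L2 M M" "AE x in M. norm (f x) \<le> C * norm (g x)"
  shows "f \<in> L2 M M"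
proof (rule L2_bound_sq[OF assms(1)])
  show "integrable M (\<lambda>x. C\<^sup>2 * (norm (g x))\<^sup>2)"
    using assms(2) by (auto simp: L2_iff)
  show "AE x in M. (norm (f x))\<^sup>2 \<le> C\<^sup>2 * (norm (g x))\<^sup>2"
    using assms(3)
  proof eventually_elim
    case (elim x)
    then show ?case
      using power_mono[OF elim, of 2] by (simp add: power_mult_distrib)
  qed
qed

lemma L2_norm_fun: "f \<in> L2 M M \<Longrightarrow> (\<lambda>x. norm (f x)) \<in> L2 M M"
  by (auto simp: L2_iff)

lemma norm_add_sq_le: "(norm (x + y))\<^sup>2 \<le> 2 * (norm x)\<^sup>2 + 2 * (norm (y::'a::real_normed_vector))\<^sup>2"
proof -
  have "(norm (x + y))\<^sup>2 \<le> (norm x + norm y)\<^sup>2"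
    by (rule power_mono[OF norm_triangle_ineq]) simp
  also have "\<dots> \<le> 2 * (norm x)\<^sup>2 + 2 * (norm y)\<^sup>2"
    using sum_squares_bound[of "norm x" "norm y"] by (simp add: power2_sum)
  finally show ?thesis .
qed

lemma L2_add:
  assumes "f \<in> L2 M M" "g \<in> L2 M M"
  shows "(\<lambda>x. f x + g x) \<in> L2 M M"
  by (rule L2_bound_sq[where g="\<lambda>x. 2 * (norm (f x))\<^sup>2 + 2 * (norm (g x))\<^sup>2"])
     (use assms in \<open>auto simp: L2_iff norm_add_sq_le\<close>)

lemma L2_scaleR:
  assumes "f \<in> L2 M M"
  shows "(\<lambda>x. c *\<^sub>R f x) \<in> L2 M M"
  using assms by (auto simp: L2_iff power_mult_distrib)

lemma L2_mult:
  fixes f :: "'a \<Rightarrow> real"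
  assumes "f \<in> L2 M M"
  shows "(\<lambda>x. c * f x) \<in> L2 M M"
  using L2_scaleR[OF assms, of c] by simp

lemma L2_diff:
  assumes "f \<in> L2 M M" "g \<in> L2 M M"
  shows "(\<lambda>x. f x - g x) \<in> L2 M M"
  using L2_add[OF assms(1) L2_scaleR[OF assms(2), of "-1"]] by simp

lemma L2_zero: "(\<lambda>_. 0) \<in> L2 M M"
  by (simp add: L2_iff)

lemma L2_sum:
  assumes "\<And>i. i \<in> I \<Longrightarrow> f i \<in> L2 M M"
  shows "(\<lambda>x. \<Sum>i\<in>I. f i x) \<in> L2 M M"
  using assms
proof (induction I rule: infinite_finite_induct)
  case (insert i I)
  then show ?case using L2_add[of "f i" M "\<lambda>x. \<Sum>i\<in>I. f i x"] by simp
qed (auto simp: L2_zero)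

lemma (in finite_measure) L2_const: "(\<lambda>_. c) \<in> L2 M M"
  by (simp add: L2_iff)

lemma L2_integrable_norm_mult:
  assumes "f \<in> L2 M M" "g \<in> L2 M M"
  shows "integrable M (\<lambda>x. norm (f x) * norm (g x))"
proof (rule Bochner_Integration.integrable_bound)
  show "integrable M (\<lambda>x. (norm (f x))\<^sup>2 + (norm (g x))\<^sup>2)"
    using assms by (auto simp: L2_iff)
  have "norm (f x) * norm (g x) \<le> (norm (f x))\<^sup>2 + (norm (g x))\<^sup>2" for x
    using sum_squares_bound[of "norm (f x)" "norm (g x)"] zero_le_power2[of "norm (f x)"]
      zero_le_power2[of "norm (g x)"] by linarith
  then show "AE x in M. norm (norm (f x) * norm (g x)) \<le> norm ((norm (f x))\<^sup>2 + (norm (g x))\<^sup>2)"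
    by (auto simp: abs_mult)
qed (use assms in \<open>auto simp: L2_iff\<close>)

lemma L2_integrable_bound_mult:
  fixes k :: "'a \<Rightarrow> 'e::euclidean_space"
  assumes "f \<in> L2 M M" "g \<in> L2 M M" "k \<in> borel_measurable M"
    and "\<And>x. x \<in> space M \<Longrightarrow> norm (k x) \<le> C * (norm (f x) * norm (g x))"
  shows "integrable M k"
  by (rule Bochner_Integration.integrable_bound[where f="\<lambda>x. C * (norm (f x) * norm (g x))"])
     (use assms L2_integrable_norm_mult[OF assms(1,2)] in \<open>auto intro!: AE_I2 order_trans[OF assms(4)]\<close>)

lemma L2_integrable_inner:
  assumes "f \<in> L2 M M" "g \<in> L2 M M"
  shows "integrable M (\<lambda>x. f x \<bullet> g x)"
  by (rule L2_integrable_bound_mult[OF assms, where C=1])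
     (use assms in \<open>auto simp: L2_iff Cauchy_Schwarz_ineq2\<close>)

lemma L2_integrable_mult:
  fixes f g :: "'a \<Rightarrow> real"
  assumes "f \<in> L2 M M" "g \<in> L2 M M"
  shows "integrable M (\<lambda>x. f x * g x)"
  using L2_integrable_inner[OF assms] by simp

lemma (in finite_measure) L2_integrable1:
  assumes "f \<in> L2 M M"
  shows "integrable M f"
proof -
  have "integrable M (\<lambda>x. norm (f x) * norm (1::real))"
    by (rule L2_integrable_norm_mult[OF assms L2_const])
  then have "integrable M (\<lambda>x. norm (f x))" by simp
  then show ?thesis using integrable_norm_cancel assms L2_measurable by blast
qed

lemma L2_norm_nonneg [simp]: "0 \<le> L2_norm M f"
  by (simp add: L2_norm_def integral_nonneg_AE)

lemma L2_norm_sq: "(L2_norm M f)\<^sup>2 = (\<integral>x. (norm (f x))\<^sup>2 \<partial>M)"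
  by (simp add: L2_norm_def integral_nonneg_AE)

lemma L2_norm_scaleR: "L2_norm M (\<lambda>x. c *\<^sub>R f x) = \<bar>c\<bar> * L2_norm M f"
  by (simp add: L2_norm_def power_mult_distrib real_sqrt_mult)

lemma L2_norm_diff_commute: "L2_norm M (\<lambda>x. f x - g x) = L2_norm M (\<lambda>x. g x - f x)"
  by (simp add: L2_norm_def norm_minus_commute)

lemma L2_norm_cong: "(\<And>x. x \<in> space M \<Longrightarrow> norm (f x) = norm (g x)) \<Longrightarrow> L2_norm M f = L2_norm M g"
  unfolding L2_norm_def by (intro arg_cong[where f=sqrt] Bochner_Integration.integral_cong) auto

text \<open>Young's inequality \<open>2 x y \<le> r x\<^sup>2 + y\<^sup>2 / r\<close> is integrated
  and then optimised over \<open>r\<close>.\<close>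

lemma L2_Cauchy_Schwarz:
  assumes f: "f \<in> L2 M M" and g: "g \<in> L2 M M"
  shows "(\<integral>x. norm (f x) * norm (g x) \<partial>M) \<le> L2_norm M f * L2_norm M g"
proof -
  define a where "a = L2_norm M f" define b where "b = L2_norm M g"
  define I where "I = (\<integral>x. norm (f x) * norm (g x) \<partial>M)"
  note int = L2_integrable_norm_mult[OF f g] L2_integrable[OF f] L2_integrable[OF g]
  have ineq: "2 * I \<le> r * a\<^sup>2 + inverse r * b\<^sup>2" if "r > 0" for r
  proof -
    have "2 * I = (\<integral>x. 2 * (norm (f x) * norm (g x)) \<partial>M)" by (simp add: I_def)
    also have "\<dots> \<le> (\<integral>x. r * (norm (f x))\<^sup>2 + inverse r * (norm (g x))\<^sup>2 \<partial>M)"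
    proof (rule integral_mono)
      fix x
      have "0 \<le> (sqrt r * norm (f x) - inverse (sqrt r) * norm (g x))\<^sup>2" by simp
      also have "\<dots> = r * (norm (f x))\<^sup>2 - 2 * (norm (f x) * norm (g x)) + inverse r * (norm (g x))\<^sup>2"
        using that by (simp add: power2_diff power_mult_distrib field_simps)
      finally show "2 * (norm (f x) * norm (g x)) \<le> r * (norm (f x))\<^sup>2 + inverse r * (norm (g x))\<^sup>2"
        by simp
    qed (use int in auto)
    also have "\<dots> = r * a\<^sup>2 + inverse r * b\<^sup>2"
      using int by (simp add: a_def b_def L2_norm_sq)
    finally show ?thesis .
  qed
  have ab: "0 \<le> a" "0 \<le> b" by (auto simp: a_def b_def)
  have "I \<le> a * b + e" if "e > 0" for e
  proof -
    \<comment> \<open>The optimal weight would be \<open>b / a\<close>. Adding \<open>s > 0\<close>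
      to both norms avoids a separate treatment of vanishing norms.\<close>
    have *: "2 * I \<le> (b + s) / (a + s) * a\<^sup>2 + (a + s) / (b + s) * b\<^sup>2" if "s > 0" for s
      using ineq[of "(b + s) / (a + s)"] that ab by simp
    have **: "2 * I \<le> (b + s) * a + (a + s) * b" if "s > 0" for s
    proof -
      have "a\<^sup>2 / (a + s) \<le> a" "b\<^sup>2 / (b + s) \<le> b"
        using that ab by (auto simp: field_simps power2_eq_square)
      then have "(b + s) * (a\<^sup>2 / (a + s)) \<le> (b + s) * a" "(a + s) * (b\<^sup>2 / (b + s)) \<le> (a + s) * b"
        using that ab by (auto intro: mult_left_mono simp del: times_divide_eq_right)
      with *[OF that] show ?thesis by simp
    qed
    have "2 * I \<le> 2 * (a * b) + (a + b) * s" if "s > 0" for s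
      using **[OF that] by (simp add: algebra_simps)
    \<comment> \<open>This \<open>s\<close> makes the error \<open>(a + b) * s\<close> at most
      \<open>e\<close>; the summand 1 keeps the denominator positive.\<close>
    from this[of "e / (a + b + 1)"] that ab have "2 * I \<le> 2 * (a * b) + (a + b) * (e / (a + b + 1))"
      by simp
    moreover have "(a + b) * (e / (a + b + 1)) \<le> e"
      using that ab by (simp add: field_simps)
    ultimately show ?thesis using that by linarith
  qed
  then show ?thesis
    unfolding I_def a_def b_def using field_le_epsilon by blast
qed

lemma (in prob_space) L2_norm_const: "L2_norm M (\<lambda>_. c) = norm c"
  by (simp add: L2_norm_def prob_space)

lemma (in prob_space) integral_norm_le_L2_norm:
  assumes "f \<in> L2 M M"
  shows "(\<integral>x. norm (f x) \<partial>M) \<le> L2_norm M f"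
  using L2_Cauchy_Schwarz[OF assms L2_const[of "1::real"]] by (simp add: L2_norm_const)

lemma L2_inner_bound:
  assumes "f \<in> L2 M M" "g \<in> L2 M M"
  shows "\<bar>\<integral>x. f x \<bullet> g x \<partial>M\<bar> \<le> L2_norm M f * L2_norm M g"
proof -
  have "\<bar>\<integral>x. f x \<bullet> g x \<partial>M\<bar> \<le> (\<integral>x. \<bar>f x \<bullet> g x\<bar> \<partial>M)"
    using integral_norm_bound[of M "\<lambda>x. f x \<bullet> g x"] by simp
  also have "\<dots> \<le> (\<integral>x. norm (f x) * norm (g x) \<partial>M)"
    by (rule integral_mono)
       (use L2_integrable_inner[OF assms] L2_integrable_norm_mult[OF assms] Cauchy_Schwarz_ineq2 in auto)
  finally show ?thesis using L2_Cauchy_Schwarz[OF assms] by linarith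
qed

text \<open>Expanding around the limits leaves two mixed terms and one product of differences, each
  controlled by Cauchy-Schwarz. Both factors may vary, as the isometry for two different Ito
  integrals requires.\<close>

lemma L2_inner_tendsto:
  assumes f: "\<And>k. f k \<in> L2 M M" "f' \<in> L2 M M" "(\<lambda>k. L2_norm M (\<lambda>x. f k x - f' x)) \<longlonglongrightarrow> 0"
    and g: "\<And>k. g k \<in> L2 M M" "g' \<in> L2 M M" "(\<lambda>k. L2_norm M (\<lambda>x. g k x - g' x)) \<longlonglongrightarrow> 0"
  shows "(\<lambda>k. \<integral>x. f k x \<bullet> g k x \<partial>M) \<longlonglongrightarrow> (\<integral>x. f' x \<bullet> g' x \<partial>M)"
proof (rule Lim_null[THEN iffD2], rule Lim_null_comparison)
  let ?F = "\<lambda>k. L2_norm M (\<lambda>x. f k x - f' x)" and ?G = "\<lambda>k. L2_norm M (\<lambda>x. g k x - g' x)"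
  have "norm ((\<integral>x. f k x \<bullet> g k x \<partial>M) - (\<integral>x. f' x \<bullet> g' x \<partial>M))
      \<le> ?F k * ?G k + ?F k * L2_norm M g' + L2_norm M f' * ?G k" for k
  proof -
    note d = L2_diff[OF f(1,2), of k] L2_diff[OF g(1,2), of k]
    have "(\<integral>x. f k x \<bullet> g k x \<partial>M) - (\<integral>x. f' x \<bullet> g' x \<partial>M)
      = (\<integral>x. (f k x - f' x) \<bullet> (g k x - g' x) + (f k x - f' x) \<bullet> g' x + f' x \<bullet> (g k x - g' x) \<partial>M)"
      by (subst Bochner_Integration.integral_diff[symmetric])
         (use f g in \<open>auto intro!: L2_integrable_inner Bochner_Integration.integral_cong simp: inner_diff algebra_simps\<close>)
    also have "\<dots> = (\<integral>x. (f k x - f' x) \<bullet> (g k x - g' x) \<partial>M) + (\<integral>x. (f k x - f' x) \<bullet> g' x \<partial>M)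
        + (\<integral>x. f' x \<bullet> (g k x - g' x) \<partial>M)"
      by (simp add: L2_integrable_inner d f g)
    finally show ?thesis
      using L2_inner_bound[OF d] L2_inner_bound[OF d(1) g(2)] L2_inner_bound[OF f(2) d(2)]
      by simp
  qed
  then show "\<forall>\<^sub>F k in sequentially. norm ((\<integral>x. f k x \<bullet> g k x \<partial>M) - (\<integral>x. f' x \<bullet> g' x \<partial>M))
      \<le> ?F k * ?G k + ?F k * L2_norm M g' + L2_norm M f' * ?G k" by simp
  have "(\<lambda>k. ?F k * ?G k + ?F k * L2_norm M g' + L2_norm M f' * ?G k) \<longlonglongrightarrow>
    0 * 0 + 0 * L2_norm M g' + L2_norm M f' * 0"
    by (intro tendsto_intros f g)
  then show "(\<lambda>k. ?F k * ?G k + ?F k * L2_norm M g' + L2_norm M f' * ?G k) \<longlonglongrightarrow> 0" by simp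
qed

text \<open>Bridges the extended nonnegative integrals in the definition of the Ito integral and the
  real norm used here; \<open>enn2real\<close> is continuous at the finite limit 0.\<close>

lemma L2_norm_tendsto_of_nn:
  assumes "\<And>k. f k \<in> borel_measurable M"
    and "(\<lambda>k. \<integral>\<^sup>+x. ennreal ((norm (f k x))\<^sup>2) \<partial>M) \<longlonglongrightarrow> 0"
  shows "(\<lambda>k. L2_norm M (f k)) \<longlonglongrightarrow> 0"
proof -
  have "(\<lambda>k. enn2real (\<integral>\<^sup>+x. ennreal ((norm (f k x))\<^sup>2) \<partial>M)) \<longlonglongrightarrow> enn2real 0"
    using assms(2) by (intro tendsto_enn2real) auto
  then have "(\<lambda>k. \<integral>x. (norm (f k x))\<^sup>2 \<partial>M) \<longlonglongrightarrow> 0"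
    using assms(1) by (subst integral_eq_nn_integral) auto
  then have "(\<lambda>k. sqrt (\<integral>x. (norm (f k x))\<^sup>2 \<partial>M)) \<longlonglongrightarrow> sqrt 0" by (rule tendsto_real_sqrt)
  then show ?thesis by (simp add: L2_norm_def)
qed

lemma L2_of_nn:
  assumes "f \<in> borel_measurable M" "(\<integral>\<^sup>+x. ennreal ((norm (f x))\<^sup>2) \<partial>M) < \<infinity>"
  shows "f \<in> L2 M M"
  unfolding L2_iff using assms by (auto intro!: integrableI_bounded)

lemma L2_nn:
  assumes "f \<in> L2 M M"
  shows "(\<integral>\<^sup>+x. ennreal ((norm (f x))\<^sup>2) \<partial>M) < \<infinity>"
  using L2_integrable[OF assms] unfolding integrable_iff_bounded by simp

lemma L2_norm_triangle:
  assumes "f \<in> L2 M M" "g \<in> L2 M M"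
  shows "L2_norm M (\<lambda>x. f x + g x) \<le> L2_norm M f + L2_norm M g"
proof (rule power2_le_imp_le)
  have "(L2_norm M (\<lambda>x. f x + g x))\<^sup>2 = (\<integral>x. (norm (f x))\<^sup>2 + 2 * (f x \<bullet> g x) + (norm (g x))\<^sup>2 \<partial>M)"
    unfolding L2_norm_sq
    by (intro Bochner_Integration.integral_cong) (auto simp: power2_norm_eq_inner inner_add inner_commute)
  also have "\<dots> = (L2_norm M f)\<^sup>2 + 2 * (\<integral>x. f x \<bullet> g x \<partial>M) + (L2_norm M g)\<^sup>2"
    using assms by (simp add: L2_integrable L2_integrable_inner L2_norm_sq)
  also have "\<dots> \<le> (L2_norm M f + L2_norm M g)\<^sup>2"
    using L2_inner_bound[OF assms] by (simp add: power2_sum)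
  finally show "(L2_norm M (\<lambda>x. f x + g x))\<^sup>2 \<le> (L2_norm M f + L2_norm M g)\<^sup>2" .
qed simp

section \<open>Laws of square-integrable variables and the Wasserstein distance\<close>

lemma law_P2:
  assumes "prob_space M" "\<zeta> \<in> L2 M M"
  shows "law M \<zeta> \<in> P2"
proof -
  interpret prob_space M by fact
  have [measurable]: "\<zeta> \<in> borel_measurable M" using assms by (simp add: L2_iff)
  show ?thesis
    unfolding P2_def using assms
    by (auto intro!: prob_space_distr simp: integrable_distr_eq L2_iff)
qed

text \<open>The joint law of the two variables is one of the couplings over which the infimum is
  taken.\<close>

lemma W2_le_L2_norm:
  fixes \<zeta> \<zeta>' :: "'a \<Rightarrow> 'b::euclidean_space"
  assumes "prob_space M" "\<zeta> \<in> L2 M M" "\<zeta>' \<in> L2 M M"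
  shows "W2 (law M \<zeta>) (law M \<zeta>') \<le> L2_norm M (\<lambda>\<omega>. \<zeta> \<omega> - \<zeta>' \<omega>)"
proof -
  interpret prob_space M by fact
  have [measurable]: "\<zeta> \<in> borel_measurable M" "\<zeta>' \<in> borel_measurable M" using assms by (auto simp: L2_iff)
  let ?\<pi> = "distr M (borel \<Otimes>\<^sub>M borel) (\<lambda>\<omega>. (\<zeta> \<omega>, \<zeta>' \<omega>))"
  have "?\<pi> \<in> couplings (law M \<zeta>) (law M \<zeta>')"
    unfolding couplings_def by (auto simp: distr_distr comp_def)
  moreover have "bdd_below ((\<lambda>\<pi>. \<integral>z. (norm (fst z - snd z))\<^sup>2 \<partial>\<pi>) ` couplings (law M \<zeta>) (law M \<zeta>'))"
    by (rule bdd_belowI[of _ 0]) (auto intro!: integral_nonneg_AE)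
  ultimately have "(INF \<pi>\<in>couplings (law M \<zeta>) (law M \<zeta>'). \<integral>z. (norm (fst z - snd z))\<^sup>2 \<partial>\<pi>)
      \<le> (\<integral>z. (norm (fst z - snd z))\<^sup>2 \<partial>?\<pi>)"
    by (intro cINF_lower)
  also have "\<dots> = (\<integral>\<omega>. (norm (\<zeta> \<omega> - \<zeta>' \<omega>))\<^sup>2 \<partial>M)"
    by (subst integral_distr) auto
  finally show ?thesis unfolding W2_def L2_norm_def by (rule real_sqrt_le_mono)
qed

text \<open>Expanding the argument in the standard basis leaves only evaluations at fixed vectors,
  which are continuous in the linear map.\<close>

lemma borel_measurable_blinfun_apply2 [measurable (raw)]:
  fixes A :: "'a \<Rightarrow> ('b::euclidean_space \<Rightarrow>\<^sub>L 'c::euclidean_space)"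
  assumes [measurable]: "A \<in> borel_measurable M" "y \<in> borel_measurable M"
  shows "(\<lambda>x. blinfun_apply (A x) (y x)) \<in> borel_measurable M"
proof -
  have [measurable]: "(\<lambda>x. blinfun_apply (A x) b) \<in> borel_measurable M" for b
    by (rule borel_measurable_continuous_on[OF _ assms(1)]) (intro continuous_intros)
  have "blinfun_apply (A x) (y x) = (\<Sum>b\<in>Basis. (y x \<bullet> b) *\<^sub>R blinfun_apply (A x) b)" for x
    by (subst euclidean_representation[of "y x", symmetric]) (simp only: blinfun.sum_right blinfun.scaleR_right)
  then show ?thesis by simp
qed

section \<open>Increments and derivatives along a real parameter\<close>

lemma integral_norm_le_of_le:
  fixes f :: "'a \<Rightarrow> 'b::{banach, second_countable_topology}"
  assumes "integrable M f" "integrable M g" "\<And>x. norm (f x) \<le> g x"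
  shows "norm (\<integral>x. f x \<partial>M) \<le> (\<integral>x. g x \<partial>M)"
  by (rule order_trans[OF integral_norm_bound]) (rule integral_mono[OF integrable_norm[OF assms(1)] assms(2,3)])

text \<open>Mean value inequality for \<open>g r - r *\<^sub>R A0\<close>, whose derivative is the
  deviation of \<open>A r\<close> from \<open>A0\<close>.\<close>

lemma norm_increment_le:
  fixes g :: "real \<Rightarrow> 'c::real_normed_vector"
  assumes s: "0 \<le> s"
    and d: "\<And>r. r \<in> {0..s} \<Longrightarrow> (g has_vector_derivative A r) (at r within {0..s})"
    and b: "\<And>r. r \<in> {0..s} \<Longrightarrow> norm (A r - A0) \<le> e"
  shows "norm (g s - g 0 - s *\<^sub>R A0) \<le> s * e"
proof -
  have "norm ((g s - s *\<^sub>R A0) - (g 0 - 0 *\<^sub>R A0)) \<le> e * norm (s - 0)"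
  proof (rule differentiable_bound[where S="{0..s}" and f="\<lambda>r. g r - r *\<^sub>R A0" and f'="\<lambda>r h. h *\<^sub>R (A r - A0)"])
    fix r assume r: "r \<in> {0..s}"
    show "((\<lambda>r. g r - r *\<^sub>R A0) has_derivative (\<lambda>h. h *\<^sub>R (A r - A0))) (at r within {0..s})"
      using d[OF r] unfolding has_vector_derivative_def
      by (auto intro!: derivative_eq_intros simp: scaleR_diff_right)
    show "onorm (\<lambda>h. h *\<^sub>R (A r - A0)) \<le> e"
      by (rule onorm_le) (use b[OF r] in \<open>auto simp: mult.commute[of "\<bar>_\<bar>"] intro!: mult_right_mono\<close>)
  qed (use s in auto)
  then show ?thesis using s by (simp add: algebra_simps)
qed

text \<open>The Frechet expansion in the direction \<open>(y - r) *\<^sub>R \<eta>\<close> is linear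
  in the scalar, which turns differentiability of the lift into an ordinary derivative along a line
  of random variables.\<close>

lemma has_vector_derivative_along_L2:
  assumes "prob_space M" and \<zeta>: "\<zeta> \<in> L2 M M" and \<eta>: "\<eta> \<in> L2 M M"
    and D: "has_measure_derivative M g D (law M (\<lambda>\<omega>. \<zeta> \<omega> + r *\<^sub>R \<eta> \<omega>))"
  shows "((\<lambda>r. g (law M (\<lambda>\<omega>. \<zeta> \<omega> + r *\<^sub>R \<eta> \<omega>))) has_vector_derivative
    (\<integral>\<omega>. blinfun_apply (D (\<zeta> \<omega> + r *\<^sub>R \<eta> \<omega>)) (\<eta> \<omega>) \<partial>M)) (at r within S)"
  unfolding has_vector_derivative_def has_derivative_within_alt
proof (intro conjI allI impI)
  let ?A = "\<integral>\<omega>. blinfun_apply (D (\<zeta> \<omega> + r *\<^sub>R \<eta> \<omega>)) (\<eta> \<omega>) \<partial>M"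
  let ?z = "\<lambda>r \<omega>. \<zeta> \<omega> + r *\<^sub>R \<eta> \<omega>"
  show "bounded_linear (\<lambda>h. h *\<^sub>R ?A)" by (rule bounded_linear_scaleR_left)
  fix e :: real assume e: "0 < e"
  \<comment> \<open>The summand 1 keeps the divisor positive when the direction vanishes almost
    surely.\<close>
  define N where "N = L2_norm M \<eta> + 1"
  have N: "0 < N" "L2_norm M \<eta> \<le> N" using L2_norm_nonneg[of M \<eta>] by (simp_all add: N_def add_nonneg_pos)
  have z: "?z r \<in> L2 M M" by (intro L2_add L2_scaleR \<zeta> \<eta>)
  have "\<forall>e>0. \<exists>d>0. \<forall>h\<in>L2 M M. L2_norm M h < d \<longrightarrow>
      norm (g (law M (\<lambda>\<omega>. ?z r \<omega> + h \<omega>)) - g (law M (?z r)) - (\<integral>\<omega>. blinfun_apply (D (?z r \<omega>)) (h \<omega>) \<partial>M))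
        \<le> e * L2_norm M h"
    using D z unfolding has_measure_derivative_def by blast
  moreover have "0 < e / N" using e N by simp
  ultimately obtain d where d: "d > 0" and dd: "\<And>h. h \<in> L2 M M \<Longrightarrow> L2_norm M h < d \<Longrightarrow>
      norm (g (law M (\<lambda>\<omega>. ?z r \<omega> + h \<omega>)) - g (law M (?z r)) - (\<integral>\<omega>. blinfun_apply (D (?z r \<omega>)) (h \<omega>) \<partial>M))
        \<le> (e / N) * L2_norm M h"
    by blast
  show "\<exists>d>0. \<forall>y\<in>S. norm (y - r) < d \<longrightarrow> norm (g (law M (?z y)) - g (law M (?z r)) - (y - r) *\<^sub>R ?A) \<le> e * norm (y - r)"
  proof (intro exI[of _ "d / N"] conjI ballI impI)
    fix y assume y: "norm (y - r) < d / N"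
    have n: "L2_norm M (\<lambda>\<omega>. (y - r) *\<^sub>R \<eta> \<omega>) \<le> \<bar>y - r\<bar> * N"
      unfolding L2_norm_scaleR using N by (intro mult_left_mono) auto
    also have "\<dots> < d" using y N by (simp add: field_simps)
    finally have lt: "L2_norm M (\<lambda>\<omega>. (y - r) *\<^sub>R \<eta> \<omega>) < d" .
    have "norm (g (law M (\<lambda>\<omega>. ?z r \<omega> + (y - r) *\<^sub>R \<eta> \<omega>)) - g (law M (?z r))
        - (\<integral>\<omega>. blinfun_apply (D (?z r \<omega>)) ((y - r) *\<^sub>R \<eta> \<omega>) \<partial>M)) \<le> (e / N) * L2_norm M (\<lambda>\<omega>. (y - r) *\<^sub>R \<eta> \<omega>)"
      by (rule dd[OF L2_scaleR[OF \<eta>] lt])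
    also have "\<dots> \<le> (e / N) * (\<bar>y - r\<bar> * N)" using n e N by (intro mult_left_mono) auto
    also have "\<dots> = e * norm (y - r)" using N by simp
    also have "(\<lambda>\<omega>. ?z r \<omega> + (y - r) *\<^sub>R \<eta> \<omega>) = ?z y" by (auto simp: scaleR_diff_left)
    finally show "norm (g (law M (?z y)) - g (law M (?z r)) - (y - r) *\<^sub>R ?A) \<le> e * norm (y - r)"
      by (simp add: blinfun.scaleR_right)
  qed (use d N in auto)
qed

section \<open>Differentiable coefficients along segments\<close>

text \<open>The measure arguments do not enter, as the bounds in (H) are uniform in them.\<close>

definition growth :: "real \<Rightarrow> ('n::finite, 'k::finite) args6 \<Rightarrow> real" where
  "growth a = (\<lambda>(x, xd, \<mu>, \<mu>d, v, vd). 1 + a * (norm x + norm xd + norm v + norm vd))"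

text \<open>Measure arguments are represented by random variables, so that the Wasserstein distance is
  replaced by the larger \<open>L\<^sup>2\<close> distance of the representatives. The parameter \<open>a\<close> is \<open>0\<close> for bounded
  derivatives (\<open>b\<close>, \<open>\<sigma>\<close>) and \<open>1\<close> for derivatives of linear growth (\<open>h\<close>, \<open>\<Phi>\<close>).\<close>

locale lifted_coefficient = prob_space M for M :: "'a measure" +
  fixes U :: "(real^'k::finite) set" and a L C :: real
    and c :: "('n::finite, 'k, 'c::euclidean_space) coefficient" and t :: real
  assumes convex_U: "convex U" and nn: "0 \<le> a" "0 \<le> L" "0 \<le> C"
    and dx: "\<And>x xd \<zeta> \<eta> v vd. \<zeta> \<in> L2 M M \<Longrightarrow> \<eta> \<in> L2 M M \<Longrightarrow> v \<in> U \<Longrightarrow> vd \<in> U \<Longrightarrow>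
        ((\<lambda>z. fn c t (z, xd, law M \<zeta>, law M \<eta>, v, vd)) has_derivative
           blinfun_apply (D_x c t (x, xd, law M \<zeta>, law M \<eta>, v, vd))) (at x)"
    and dxd: "\<And>x xd \<zeta> \<eta> v vd. \<zeta> \<in> L2 M M \<Longrightarrow> \<eta> \<in> L2 M M \<Longrightarrow> v \<in> U \<Longrightarrow> vd \<in> U \<Longrightarrow>
        ((\<lambda>z. fn c t (x, z, law M \<zeta>, law M \<eta>, v, vd)) has_derivative
           blinfun_apply (D_xd c t (x, xd, law M \<zeta>, law M \<eta>, v, vd))) (at xd)"
    and dm: "\<And>x xd \<zeta> \<eta> v vd. \<zeta> \<in> L2 M M \<Longrightarrow> \<eta> \<in> L2 M M \<Longrightarrow> v \<in> U \<Longrightarrow> vd \<in> U \<Longrightarrow>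
        has_measure_derivative M (\<lambda>m. fn c t (x, xd, m, law M \<eta>, v, vd))
           (D_mu c t (x, xd, law M \<zeta>, law M \<eta>, v, vd)) (law M \<zeta>)"
    and dmd: "\<And>x xd \<zeta> \<eta> v vd. \<zeta> \<in> L2 M M \<Longrightarrow> \<eta> \<in> L2 M M \<Longrightarrow> v \<in> U \<Longrightarrow> vd \<in> U \<Longrightarrow>
        has_measure_derivative M (\<lambda>m. fn c t (x, xd, law M \<zeta>, m, v, vd))
           (D_mud c t (x, xd, law M \<zeta>, law M \<eta>, v, vd)) (law M \<eta>)"
    and dv: "\<And>x xd \<zeta> \<eta> v vd. \<zeta> \<in> L2 M M \<Longrightarrow> \<eta> \<in> L2 M M \<Longrightarrow> v \<in> U \<Longrightarrow> vd \<in> U \<Longrightarrow>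
        ((\<lambda>z. fn c t (x, xd, law M \<zeta>, law M \<eta>, z, vd)) has_derivative
           blinfun_apply (D_v c t (x, xd, law M \<zeta>, law M \<eta>, v, vd))) (at v within U)"
    and dvd: "\<And>x xd \<zeta> \<eta> v vd. \<zeta> \<in> L2 M M \<Longrightarrow> \<eta> \<in> L2 M M \<Longrightarrow> v \<in> U \<Longrightarrow> vd \<in> U \<Longrightarrow>
        ((\<lambda>z. fn c t (x, xd, law M \<zeta>, law M \<eta>, v, z)) has_derivative
           blinfun_apply (D_vd c t (x, xd, law M \<zeta>, law M \<eta>, v, vd))) (at vd within U)"
    and lip: "\<And>x xd \<zeta> \<eta> v vd x' xd' \<zeta>' \<eta>' v' vd' D. \<zeta> \<in> L2 M M \<Longrightarrow> \<eta> \<in> L2 M M \<Longrightarrow> v \<in> U \<Longrightarrow> vd \<in> U \<Longrightarrow>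
        \<zeta>' \<in> L2 M M \<Longrightarrow> \<eta>' \<in> L2 M M \<Longrightarrow> v' \<in> U \<Longrightarrow> vd' \<in> U \<Longrightarrow> D \<in> {D_x c t, D_xd c t} \<Longrightarrow>
        norm (D (x, xd, law M \<zeta>, law M \<eta>, v, vd) - D (x', xd', law M \<zeta>', law M \<eta>', v', vd'))
          \<le> L * (norm (x - x') + norm (xd - xd') + L2_norm M (\<lambda>\<omega>. \<zeta> \<omega> - \<zeta>' \<omega>) + L2_norm M (\<lambda>\<omega>. \<eta> \<omega> - \<eta>' \<omega>)
             + norm (v - v') + norm (vd - vd'))"
    and lip_v: "\<And>x xd \<zeta> \<eta> v vd x' xd' \<zeta>' \<eta>' v' vd' D. \<zeta> \<in> L2 M M \<Longrightarrow> \<eta> \<in> L2 M M \<Longrightarrow> v \<in> U \<Longrightarrow> vd \<in> U \<Longrightarrow>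
        \<zeta>' \<in> L2 M M \<Longrightarrow> \<eta>' \<in> L2 M M \<Longrightarrow> v' \<in> U \<Longrightarrow> vd' \<in> U \<Longrightarrow> D \<in> {D_v c t, D_vd c t} \<Longrightarrow>
        norm (D (x, xd, law M \<zeta>, law M \<eta>, v, vd) - D (x', xd', law M \<zeta>', law M \<eta>', v', vd'))
          \<le> L * (norm (x - x') + norm (xd - xd') + L2_norm M (\<lambda>\<omega>. \<zeta> \<omega> - \<zeta>' \<omega>) + L2_norm M (\<lambda>\<omega>. \<eta> \<omega> - \<eta>' \<omega>)
             + norm (v - v') + norm (vd - vd'))"
    and lip_y: "\<And>x xd \<zeta> \<eta> v vd x' xd' \<zeta>' \<eta>' v' vd' y y' D. \<zeta> \<in> L2 M M \<Longrightarrow> \<eta> \<in> L2 M M \<Longrightarrow> v \<in> U \<Longrightarrow> vd \<in> U \<Longrightarrow>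
        \<zeta>' \<in> L2 M M \<Longrightarrow> \<eta>' \<in> L2 M M \<Longrightarrow> v' \<in> U \<Longrightarrow> vd' \<in> U \<Longrightarrow> D \<in> {D_mu c t, D_mud c t} \<Longrightarrow>
        norm (D (x, xd, law M \<zeta>, law M \<eta>, v, vd) y - D (x', xd', law M \<zeta>', law M \<eta>', v', vd') y')
          \<le> L * (norm (x - x') + norm (xd - xd') + L2_norm M (\<lambda>\<omega>. \<zeta> \<omega> - \<zeta>' \<omega>) + L2_norm M (\<lambda>\<omega>. \<eta> \<omega> - \<eta>' \<omega>)
             + norm (v - v') + norm (vd - vd') + norm (y - y'))"
    and gr: "\<And>x xd \<zeta> \<eta> v vd D. \<zeta> \<in> L2 M M \<Longrightarrow> \<eta> \<in> L2 M M \<Longrightarrow> v \<in> U \<Longrightarrow> vd \<in> U \<Longrightarrow> D \<in> {D_x c t, D_xd c t} \<Longrightarrow>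
        norm (D (x, xd, law M \<zeta>, law M \<eta>, v, vd)) \<le> C * growth a (x, xd, law M \<zeta>, law M \<eta>, v, vd)"
    and gr_v: "\<And>x xd \<zeta> \<eta> v vd D. \<zeta> \<in> L2 M M \<Longrightarrow> \<eta> \<in> L2 M M \<Longrightarrow> v \<in> U \<Longrightarrow> vd \<in> U \<Longrightarrow> D \<in> {D_v c t, D_vd c t} \<Longrightarrow>
        norm (D (x, xd, law M \<zeta>, law M \<eta>, v, vd)) \<le> C * growth a (x, xd, law M \<zeta>, law M \<eta>, v, vd)"
    and gr_y: "\<And>x xd \<zeta> \<eta> v vd y D. \<zeta> \<in> L2 M M \<Longrightarrow> \<eta> \<in> L2 M M \<Longrightarrow> v \<in> U \<Longrightarrow> vd \<in> U \<Longrightarrow> D \<in> {D_mu c t, D_mud c t} \<Longrightarrow>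
        norm (D (x, xd, law M \<zeta>, law M \<eta>, v, vd) y) \<le> C * growth a (x, xd, law M \<zeta>, law M \<eta>, v, vd)"

text \<open>A base point and a direction for each of the six arguments. Only the endpoints of the
  two control segments are assumed to lie in \<open>U\<close>; convexity supplies the points
  between.\<close>

locale coefficient_path = lifted_coefficient M U a L C c t
  for M :: "'a measure" and U :: "(real^'k::finite) set" and a L C :: real
    and c :: "('n::finite, 'k, 'c::euclidean_space) coefficient" and t :: real +
  fixes x xd :: "real^'n" and \<zeta> \<eta> :: "'a \<Rightarrow> real^'n" and v vd :: "real^'k"
    and ex exd :: "real^'n" and e\<zeta> e\<eta> :: "'a \<Rightarrow> real^'n" and ev evd :: "real^'k"
  assumes L2s: "\<zeta> \<in> L2 M M" "\<eta> \<in> L2 M M" "e\<zeta> \<in> L2 M M" "e\<eta> \<in> L2 M M"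
    and Us: "v \<in> U" "vd \<in> U" "v + ev \<in> U" "vd + evd \<in> U"
begin

text \<open>Six independent parameters, because the derivatives are partial: the diagonal move from
  0 to \<open>s\<close> is later replaced by six moves, each changing one parameter.\<close>

abbreviation "pt r1 r2 r3 r4 r5 r6 \<equiv> (x + r1 *\<^sub>R ex, xd + r2 *\<^sub>R exd,
  law M (\<lambda>\<omega>. \<zeta> \<omega> + r3 *\<^sub>R e\<zeta> \<omega>), law M (\<lambda>\<omega>. \<eta> \<omega> + r4 *\<^sub>R e\<eta> \<omega>), v + r5 *\<^sub>R ev, vd + r6 *\<^sub>R evd)"

text \<open>\<open>K\<close> is the length of the direction, with the L2 norm for the measure
  arguments, and \<open>Gr\<close> dominates \<open>growth a\<close> on the whole parameter
  cube.\<close>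

definition "K = norm ex + norm exd + L2_norm M e\<zeta> + L2_norm M e\<eta> + norm ev + norm evd"
definition "Gr = 1 + a * (norm x + norm ex + norm xd + norm exd + norm v + norm ev + norm vd + norm evd)"

definition "A1 r1 r2 r3 r4 r5 r6 = blinfun_apply (D_x c t (pt r1 r2 r3 r4 r5 r6)) ex"
definition "A2 r1 r2 r3 r4 r5 r6 = blinfun_apply (D_xd c t (pt r1 r2 r3 r4 r5 r6)) exd"
definition "A3 r1 r2 r3 r4 r5 r6 = (\<integral>\<omega>. blinfun_apply (D_mu c t (pt r1 r2 r3 r4 r5 r6) (\<zeta> \<omega> + r3 *\<^sub>R e\<zeta> \<omega>)) (e\<zeta> \<omega>) \<partial>M)"
definition "A4 r1 r2 r3 r4 r5 r6 = (\<integral>\<omega>. blinfun_apply (D_mud c t (pt r1 r2 r3 r4 r5 r6) (\<eta> \<omega> + r4 *\<^sub>R e\<eta> \<omega>)) (e\<eta> \<omega>) \<partial>M)"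
definition "A5 r1 r2 r3 r4 r5 r6 = blinfun_apply (D_v c t (pt r1 r2 r3 r4 r5 r6)) ev"
definition "A6 r1 r2 r3 r4 r5 r6 = blinfun_apply (D_vd c t (pt r1 r2 r3 r4 r5 r6)) evd"

lemma path_L2: "(\<lambda>\<omega>. \<zeta> \<omega> + r *\<^sub>R e\<zeta> \<omega>) \<in> L2 M M" "(\<lambda>\<omega>. \<eta> \<omega> + r *\<^sub>R e\<eta> \<omega>) \<in> L2 M M"
  by (intro L2_add L2_scaleR L2s)+

lemma path_U:
  assumes "r \<in> {0..1}"
  shows "v + r *\<^sub>R ev \<in> U" "vd + r *\<^sub>R evd \<in> U"
proof -
  have "(1 - r) *\<^sub>R w + r *\<^sub>R (w + e) = w + r *\<^sub>R e" for w e :: "real^'k" by (simp add: algebra_simps)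
  then show "v + r *\<^sub>R ev \<in> U" "vd + r *\<^sub>R evd \<in> U"
    using convexD_alt[OF convex_U Us(1,3), of r] convexD_alt[OF convex_U Us(2,4), of r] assms by auto
qed

lemma K_ge: "norm ex \<le> K" "norm exd \<le> K" "L2_norm M e\<zeta> \<le> K" "L2_norm M e\<eta> \<le> K" "norm ev \<le> K" "norm evd \<le> K" "0 \<le> K"
  unfolding K_def
  using norm_ge_zero[of ex] norm_ge_zero[of exd] norm_ge_zero[of ev] norm_ge_zero[of evd]
    L2_norm_nonneg[of M e\<zeta>] L2_norm_nonneg[of M e\<eta>] by linarith+

text \<open>Chain rule with the affine paths. The control derivatives exist only within
  \<open>U\<close>, which is why the parameters are confined to \<open>[0, 1]\<close>.\<close>

lemma partial_derivatives:
  assumes r: "r1 \<in> {0..1}" "r2 \<in> {0..1}" "r3 \<in> {0..1}" "r4 \<in> {0..1}" "r5 \<in> {0..1}" "r6 \<in> {0..1}" and S: "S \<subseteq> {0..1}"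
  shows "((\<lambda>r. fn c t (pt r r2 r3 r4 r5 r6)) has_vector_derivative A1 r1 r2 r3 r4 r5 r6) (at r1 within S)"
    "((\<lambda>r. fn c t (pt r1 r r3 r4 r5 r6)) has_vector_derivative A2 r1 r2 r3 r4 r5 r6) (at r2 within S)"
    "((\<lambda>r. fn c t (pt r1 r2 r r4 r5 r6)) has_vector_derivative A3 r1 r2 r3 r4 r5 r6) (at r3 within S)"
    "((\<lambda>r. fn c t (pt r1 r2 r3 r r5 r6)) has_vector_derivative A4 r1 r2 r3 r4 r5 r6) (at r4 within S)"
    "((\<lambda>r. fn c t (pt r1 r2 r3 r4 r r6)) has_vector_derivative A5 r1 r2 r3 r4 r5 r6) (at r5 within S)"
    "((\<lambda>r. fn c t (pt r1 r2 r3 r4 r5 r)) has_vector_derivative A6 r1 r2 r3 r4 r5 r6) (at r6 within S)"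
proof -
  note U = path_U[OF r(5)] path_U[OF r(6)]
  have line: "((\<lambda>r. w + r *\<^sub>R e) has_vector_derivative e) (at r within S)" for w e :: "real^'m" and r
    by (auto intro!: derivative_eq_intros)
  have chain: "((\<lambda>r. f (w + r *\<^sub>R e)) has_vector_derivative blinfun_apply D e) (at r within S)"
    if "(f has_derivative blinfun_apply D) (at (w + r *\<^sub>R e) within V)" "\<And>r. r \<in> S \<Longrightarrow> w + r *\<^sub>R e \<in> V"
    for f :: "real^'m \<Rightarrow> 'c" and D w e r V
  proof -
    have "(f has_derivative blinfun_apply D) (at (w + r *\<^sub>R e) within (\<lambda>r. w + r *\<^sub>R e) ` S)"
      by (rule has_derivative_subset[OF that(1)]) (use that(2) in auto)
    from vector_derivative_diff_chain_within[OF line this] show ?thesis by (simp add: comp_def)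
  qed
  show "((\<lambda>r. fn c t (pt r r2 r3 r4 r5 r6)) has_vector_derivative A1 r1 r2 r3 r4 r5 r6) (at r1 within S)"
    unfolding A1_def by (rule chain[of _ _ _ _ _ UNIV]) (auto intro!: dx path_L2 U)
  show "((\<lambda>r. fn c t (pt r1 r r3 r4 r5 r6)) has_vector_derivative A2 r1 r2 r3 r4 r5 r6) (at r2 within S)"
    unfolding A2_def by (rule chain[of _ _ _ _ _ UNIV]) (auto intro!: dxd path_L2 U)
  show "((\<lambda>r. fn c t (pt r1 r2 r3 r4 r r6)) has_vector_derivative A5 r1 r2 r3 r4 r5 r6) (at r5 within S)"
    unfolding A5_def by (rule chain[of _ _ _ _ _ U]) (use S in \<open>auto intro!: dv path_L2 U path_U\<close>)
  show "((\<lambda>r. fn c t (pt r1 r2 r3 r4 r5 r)) has_vector_derivative A6 r1 r2 r3 r4 r5 r6) (at r6 within S)"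
    unfolding A6_def by (rule chain[of _ _ _ _ _ U]) (use S in \<open>auto intro!: dvd path_L2 U path_U\<close>)
  show "((\<lambda>r. fn c t (pt r1 r2 r r4 r5 r6)) has_vector_derivative A3 r1 r2 r3 r4 r5 r6) (at r3 within S)"
    unfolding A3_def
    by (rule has_vector_derivative_along_L2[OF prob_space_axioms L2s(1,3) dm[OF path_L2(1) path_L2(2) U(1) U(4)]])
  show "((\<lambda>r. fn c t (pt r1 r2 r3 r r5 r6)) has_vector_derivative A4 r1 r2 r3 r4 r5 r6) (at r4 within S)"
    unfolding A4_def
    by (rule has_vector_derivative_along_L2[OF prob_space_axioms L2s(2,4) dmd[OF path_L2(1) path_L2(2) U(1) U(4)]])
qed

lemma growth_pt:
  assumes r: "r1 \<in> {0..1}" "r2 \<in> {0..1}" "r3 \<in> {0..1}" "r4 \<in> {0..1}" "r5 \<in> {0..1}" "r6 \<in> {0..1}"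
  shows "growth a (pt r1 r2 r3 r4 r5 r6) \<le> Gr"
proof -
  have *: "norm (w + r *\<^sub>R e) \<le> norm w + norm e" if "r \<in> {0..1}" for w e :: "'z::real_normed_vector" and r :: real
  proof -
    have "norm (w + r *\<^sub>R e) \<le> norm w + \<bar>r\<bar> * norm e" using norm_triangle_ineq[of w "r *\<^sub>R e"] by simp
    also have "\<bar>r\<bar> * norm e \<le> 1 * norm e" using that by (intro mult_right_mono) auto
    finally show ?thesis by simp
  qed
  show ?thesis
    unfolding growth_def Gr_def prod.case
    using *[OF r(1), of x ex] *[OF r(2), of xd exd] *[OF r(5), of v ev] *[OF r(6), of vd evd] nn(1)
    by (intro add_left_mono mult_left_mono) auto
qed

text \<open>The growth bound on a measure derivative is uniform in its last argument, so at a fixed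
  point the integrand is bounded by a constant times the norm of the direction.\<close>

lemma measure_term_integrable:
  assumes r: "r1 \<in> {0..1}" "r2 \<in> {0..1}" "r3 \<in> {0..1}" "r4 \<in> {0..1}" "r5 \<in> {0..1}" "r6 \<in> {0..1}"
  shows "integrable M (\<lambda>\<omega>. blinfun_apply (D_mu c t (pt r1 r2 r3 r4 r5 r6) (\<zeta> \<omega> + r3 *\<^sub>R e\<zeta> \<omega>)) (e\<zeta> \<omega>))"
    "integrable M (\<lambda>\<omega>. blinfun_apply (D_mud c t (pt r1 r2 r3 r4 r5 r6) (\<eta> \<omega> + r4 *\<^sub>R e\<eta> \<omega>)) (e\<eta> \<omega>))"
proof -
  note U = path_U[OF r(5)] path_U[OF r(6)]
  have [measurable]: "\<zeta> \<in> borel_measurable M" "\<eta> \<in> borel_measurable M" "e\<zeta> \<in> borel_measurable M" "e\<eta> \<in> borel_measurable M"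
    using L2s by (auto simp: L2_iff)
  have [measurable]: "D_mu c t (pt r1 r2 r3 r4 r5 r6) \<in> borel_measurable borel" "D_mud c t (pt r1 r2 r3 r4 r5 r6) \<in> borel_measurable borel"
    using dm[OF path_L2(1) path_L2(2) U(1) U(4)] dmd[OF path_L2(1) path_L2(2) U(1) U(4)]
    by (auto simp: has_measure_derivative_def)
  have b: "norm (blinfun_apply (D (pt r1 r2 r3 r4 r5 r6) y) h) \<le> C * growth a (pt r1 r2 r3 r4 r5 r6) * norm h"
    if "D \<in> {D_mu c t, D_mud c t}" for D y h
    using norm_blinfun[of "D (pt r1 r2 r3 r4 r5 r6) y" h] gr_y[OF path_L2(1) path_L2(2) U(1) U(4) that, of _ _ _ _ y]
    by (meson mult_right_mono norm_ge_zero order_trans)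
  show "integrable M (\<lambda>\<omega>. blinfun_apply (D_mu c t (pt r1 r2 r3 r4 r5 r6) (\<zeta> \<omega> + r3 *\<^sub>R e\<zeta> \<omega>)) (e\<zeta> \<omega>))"
    by (rule L2_integrable_bound_mult[OF L2s(3) L2_const[of "1::real"], where C="C * growth a (pt r1 r2 r3 r4 r5 r6)"])
       (use b in auto)
  show "integrable M (\<lambda>\<omega>. blinfun_apply (D_mud c t (pt r1 r2 r3 r4 r5 r6) (\<eta> \<omega> + r4 *\<^sub>R e\<eta> \<omega>)) (e\<eta> \<omega>))"
    by (rule L2_integrable_bound_mult[OF L2s(4) L2_const[of "1::real"], where C="C * growth a (pt r1 r2 r3 r4 r5 r6)"])
       (use b in auto)
qed

lemma integral_blinfun_le:
  fixes f :: "'a \<Rightarrow> 'c" and h :: "'a \<Rightarrow> 'z::euclidean_space"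
  assumes i: "integrable M (\<lambda>\<omega>. f \<omega>)" and h: "h \<in> L2 M M" and b: "\<And>\<omega>. norm (f \<omega>) \<le> k * norm (h \<omega>)" and k: "0 \<le> k"
  shows "norm (\<integral>\<omega>. f \<omega> \<partial>M) \<le> k * L2_norm M h"
proof -
  have "norm (\<integral>\<omega>. f \<omega> \<partial>M) \<le> (\<integral>\<omega>. k * norm (h \<omega>) \<partial>M)"
    using L2_integrable1[OF h] b i by (intro integral_norm_le_of_le) auto
  also have "\<dots> = k * (\<integral>\<omega>. norm (h \<omega>) \<partial>M)" by simp
  also have "\<dots> \<le> k * L2_norm M h" by (intro mult_left_mono integral_norm_le_L2_norm h k)
  finally show ?thesis .
qed

lemma partial_growth:
  assumes r: "r1 \<in> {0..1}" "r2 \<in> {0..1}" "r3 \<in> {0..1}" "r4 \<in> {0..1}" "r5 \<in> {0..1}" "r6 \<in> {0..1}"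
  shows "norm (A1 r1 r2 r3 r4 r5 r6) \<le> C * Gr * norm ex" "norm (A2 r1 r2 r3 r4 r5 r6) \<le> C * Gr * norm exd"
    "norm (A3 r1 r2 r3 r4 r5 r6) \<le> C * Gr * L2_norm M e\<zeta>" "norm (A4 r1 r2 r3 r4 r5 r6) \<le> C * Gr * L2_norm M e\<eta>"
    "norm (A5 r1 r2 r3 r4 r5 r6) \<le> C * Gr * norm ev" "norm (A6 r1 r2 r3 r4 r5 r6) \<le> C * Gr * norm evd"
proof -
  note U = path_U[OF r(5)] path_U[OF r(6)]
  have Gr0: "0 \<le> C * Gr" unfolding Gr_def using nn by (intro mult_nonneg_nonneg add_nonneg_nonneg) auto
  have g: "C * growth a (pt r1 r2 r3 r4 r5 r6) \<le> C * Gr" by (intro mult_left_mono growth_pt r nn)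
  have b: "norm (blinfun_apply A h) \<le> C * Gr * norm h" if "norm A \<le> C * growth a (pt r1 r2 r3 r4 r5 r6)"
    for A :: "'z::real_normed_vector \<Rightarrow>\<^sub>L 'c" and h
    using norm_blinfun[of A h] order_trans[OF that g] by (meson mult_right_mono norm_ge_zero order_trans)
  note p = path_L2(1)[of r3] path_L2(2)[of r4] U(1) U(4)
  show "norm (A1 r1 r2 r3 r4 r5 r6) \<le> C * Gr * norm ex" unfolding A1_def by (rule b[OF gr[OF p]]) simp
  show "norm (A2 r1 r2 r3 r4 r5 r6) \<le> C * Gr * norm exd" unfolding A2_def by (rule b[OF gr[OF p]]) simp
  show "norm (A5 r1 r2 r3 r4 r5 r6) \<le> C * Gr * norm ev" unfolding A5_def by (rule b[OF gr_v[OF p]]) simp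
  show "norm (A6 r1 r2 r3 r4 r5 r6) \<le> C * Gr * norm evd" unfolding A6_def by (rule b[OF gr_v[OF p]]) simp
  show "norm (A3 r1 r2 r3 r4 r5 r6) \<le> C * Gr * L2_norm M e\<zeta>"
    unfolding A3_def by (rule integral_blinfun_le[OF measure_term_integrable(1)[OF r] L2s(3) _ Gr0]) (rule b[OF gr_y[OF p]], simp)
  show "norm (A4 r1 r2 r3 r4 r5 r6) \<le> C * Gr * L2_norm M e\<eta>"
    unfolding A4_def by (rule integral_blinfun_le[OF measure_term_integrable(2)[OF r] L2s(4) _ Gr0]) (rule b[OF gr_y[OF p]], simp)
qed

lemma dist_pt:
  assumes r: "r1 \<in> {0..s}" "r2 \<in> {0..s}" "r3 \<in> {0..s}" "r4 \<in> {0..s}" "r5 \<in> {0..s}" "r6 \<in> {0..s}"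
  shows "norm (x + r1 *\<^sub>R ex - (x + 0 *\<^sub>R ex)) + norm (xd + r2 *\<^sub>R exd - (xd + 0 *\<^sub>R exd))
     + L2_norm M (\<lambda>\<omega>. \<zeta> \<omega> + r3 *\<^sub>R e\<zeta> \<omega> - (\<zeta> \<omega> + 0 *\<^sub>R e\<zeta> \<omega>)) + L2_norm M (\<lambda>\<omega>. \<eta> \<omega> + r4 *\<^sub>R e\<eta> \<omega> - (\<eta> \<omega> + 0 *\<^sub>R e\<eta> \<omega>))
     + norm (v + r5 *\<^sub>R ev - (v + 0 *\<^sub>R ev)) + norm (vd + r6 *\<^sub>R evd - (vd + 0 *\<^sub>R evd)) \<le> s * K"
proof -
  have m: "\<bar>r\<bar> * k \<le> s * k" if "r \<in> {0..s}" "0 \<le> k" for r k using that by (intro mult_right_mono) auto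
  have "\<bar>r1\<bar> * norm ex + \<bar>r2\<bar> * norm exd + \<bar>r3\<bar> * L2_norm M e\<zeta> + \<bar>r4\<bar> * L2_norm M e\<eta> + \<bar>r5\<bar> * norm ev + \<bar>r6\<bar> * norm evd
     \<le> s * norm ex + s * norm exd + s * L2_norm M e\<zeta> + s * L2_norm M e\<eta> + s * norm ev + s * norm evd"
    by (intro add_mono m r) auto
  then show ?thesis by (simp add: L2_norm_scaleR K_def distrib_left)
qed

text \<open>One factor \<open>K\<close> comes from the distance \<open>s * K\<close> of the points,
  the other from the direction. The factor 2 comes from the measure terms, where the last argument
  moves as well.\<close>

lemma partial_lip:
  assumes s: "s \<in> {0..1}" and r: "r1 \<in> {0..s}" "r2 \<in> {0..s}" "r3 \<in> {0..s}" "r4 \<in> {0..s}" "r5 \<in> {0..s}" "r6 \<in> {0..s}"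
  shows "norm (A1 r1 r2 r3 r4 r5 r6 - A1 0 0 0 0 0 0) \<le> 2 * L * K\<^sup>2 * s" "norm (A2 r1 r2 r3 r4 r5 r6 - A2 0 0 0 0 0 0) \<le> 2 * L * K\<^sup>2 * s"
    "norm (A3 r1 r2 r3 r4 r5 r6 - A3 0 0 0 0 0 0) \<le> 2 * L * K\<^sup>2 * s" "norm (A4 r1 r2 r3 r4 r5 r6 - A4 0 0 0 0 0 0) \<le> 2 * L * K\<^sup>2 * s"
    "norm (A5 r1 r2 r3 r4 r5 r6 - A5 0 0 0 0 0 0) \<le> 2 * L * K\<^sup>2 * s" "norm (A6 r1 r2 r3 r4 r5 r6 - A6 0 0 0 0 0 0) \<le> 2 * L * K\<^sup>2 * s"
proof -
  have r1: "r1 \<in> {0..1}" "r2 \<in> {0..1}" "r3 \<in> {0..1}" "r4 \<in> {0..1}" "r5 \<in> {0..1}" "r6 \<in> {0..1}" using r s by auto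
  have z: "0 \<in> {0..1::real}" "0 \<le> s" using s by auto
  note p = path_L2(1)[of r3] path_L2(2)[of r4] path_U(1)[OF r1(5)] path_U(2)[OF r1(6)]
    path_L2(1)[of 0] path_L2(2)[of 0] path_U(1)[OF z(1)] path_U(2)[OF z(1)]
  note d = mult_left_mono[OF dist_pt[OF r] nn(2)]
  have LK: "0 \<le> L * K\<^sup>2 * s" using nn s by auto
  have b: "norm (blinfun_apply A h - blinfun_apply A' h) \<le> 2 * L * K\<^sup>2 * s" if "norm (A - A') \<le> L * (s * K)" "norm h \<le> K"
    for A A' :: "'z::real_normed_vector \<Rightarrow>\<^sub>L 'c" and h
  proof -
    have "norm (blinfun_apply A h - blinfun_apply A' h) \<le> norm (A - A') * norm h"
      using norm_blinfun[of "A - A'" h] by (simp add: blinfun.diff_left)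
    also have "\<dots> \<le> (L * (s * K)) * K" using that nn z K_ge by (intro mult_mono) auto
    also have "\<dots> \<le> 2 * L * K\<^sup>2 * s" using LK by (simp add: power2_eq_square algebra_simps)
    finally show ?thesis .
  qed
  show "norm (A1 r1 r2 r3 r4 r5 r6 - A1 0 0 0 0 0 0) \<le> 2 * L * K\<^sup>2 * s"
    unfolding A1_def by (intro b order_trans[OF lip[OF p] d] K_ge) simp
  show "norm (A2 r1 r2 r3 r4 r5 r6 - A2 0 0 0 0 0 0) \<le> 2 * L * K\<^sup>2 * s"
    unfolding A2_def by (intro b order_trans[OF lip[OF p] d] K_ge) simp
  show "norm (A5 r1 r2 r3 r4 r5 r6 - A5 0 0 0 0 0 0) \<le> 2 * L * K\<^sup>2 * s"
    unfolding A5_def by (intro b order_trans[OF lip_v[OF p] d] K_ge) simp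
  show "norm (A6 r1 r2 r3 r4 r5 r6 - A6 0 0 0 0 0 0) \<le> 2 * L * K\<^sup>2 * s"
    unfolding A6_def by (intro b order_trans[OF lip_v[OF p] d] K_ge) simp
  have m: "norm ((\<integral>\<omega>. blinfun_apply (D (pt r1 r2 r3 r4 r5 r6) (w \<omega> + r *\<^sub>R e \<omega>)) (e \<omega>) \<partial>M)
      - (\<integral>\<omega>. blinfun_apply (D (pt 0 0 0 0 0 0) (w \<omega> + 0 *\<^sub>R e \<omega>)) (e \<omega>) \<partial>M)) \<le> 2 * L * K\<^sup>2 * s"
    if D: "D \<in> {D_mu c t, D_mud c t}" and e: "e \<in> L2 M M" "L2_norm M e \<le> K" and rr: "r \<in> {0..s}"
      and i: "integrable M (\<lambda>\<omega>. blinfun_apply (D (pt r1 r2 r3 r4 r5 r6) (w \<omega> + r *\<^sub>R e \<omega>)) (e \<omega>))"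
         "integrable M (\<lambda>\<omega>. blinfun_apply (D (pt 0 0 0 0 0 0) (w \<omega> + 0 *\<^sub>R e \<omega>)) (e \<omega>))" for D w e r
  proof -
    let ?f = "\<lambda>\<omega>. blinfun_apply (D (pt r1 r2 r3 r4 r5 r6) (w \<omega> + r *\<^sub>R e \<omega>)) (e \<omega>)
        - blinfun_apply (D (pt 0 0 0 0 0 0) (w \<omega> + 0 *\<^sub>R e \<omega>)) (e \<omega>)"
    \<comment> \<open>The shift of the last argument is proportional to \<open>e \<omega>\<close>,
      hence the quadratic term, which the square-integrability of the direction absorbs.\<close>
    have bd: "norm (?f \<omega>) \<le> L * s * K * norm (e \<omega>) + L * s * (norm (e \<omega>))\<^sup>2" for \<omega>
    proof -
      let ?A = "D (pt r1 r2 r3 r4 r5 r6) (w \<omega> + r *\<^sub>R e \<omega>) - D (pt 0 0 0 0 0 0) (w \<omega> + 0 *\<^sub>R e \<omega>)"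
      have "norm ?A \<le> L * (s * K + norm (w \<omega> + r *\<^sub>R e \<omega> - (w \<omega> + 0 *\<^sub>R e \<omega>)))"
        by (rule order_trans[OF lip_y[OF p D]]) (intro mult_left_mono add_right_mono dist_pt r nn)
      also have "norm (w \<omega> + r *\<^sub>R e \<omega> - (w \<omega> + 0 *\<^sub>R e \<omega>)) \<le> s * norm (e \<omega>)"
        using rr by (simp add: mult_right_mono)
      finally have A: "norm ?A \<le> L * (s * K + s * norm (e \<omega>))" using nn by (simp add: mult_left_mono)
      have "norm (?f \<omega>) \<le> norm ?A * norm (e \<omega>)"
        using norm_blinfun[of ?A "e \<omega>"] by (simp add: blinfun.diff_left)
      also have "\<dots> \<le> L * (s * K + s * norm (e \<omega>)) * norm (e \<omega>)" by (rule mult_right_mono[OF A]) simp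
      finally show ?thesis by (simp add: algebra_simps power2_eq_square)
    qed
    have "norm (\<integral>\<omega>. ?f \<omega> \<partial>M) \<le> (\<integral>\<omega>. L * s * K * norm (e \<omega>) + L * s * (norm (e \<omega>))\<^sup>2 \<partial>M)"
      by (intro integral_norm_le_of_le bd) (use i L2_integrable1[OF e(1)] L2_integrable[OF e(1)] in auto)
    also have "\<dots> = L * s * K * (\<integral>\<omega>. norm (e \<omega>) \<partial>M) + L * s * (L2_norm M e)\<^sup>2"
      using L2_integrable1[OF e(1)] L2_integrable[OF e(1)] by (simp add: L2_norm_sq)
    also have "\<dots> \<le> L * s * K * K + L * s * K\<^sup>2"
      using integral_norm_le_L2_norm[OF e(1)] e(2) nn z K_ge(7)
      by (intro add_mono mult_left_mono power_mono) auto
    finally show ?thesis using i by (simp add: power2_eq_square algebra_simps)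
  qed
  show "norm (A3 r1 r2 r3 r4 r5 r6 - A3 0 0 0 0 0 0) \<le> 2 * L * K\<^sup>2 * s"
    unfolding A3_def by (rule m[OF _ L2s(3) K_ge(3) r(3) measure_term_integrable(1)[OF r1]
        measure_term_integrable(1)[OF z(1) z(1) z(1) z(1) z(1) z(1)]]) simp
  show "norm (A4 r1 r2 r3 r4 r5 r6 - A4 0 0 0 0 0 0) \<le> 2 * L * K\<^sup>2 * s"
    unfolding A4_def by (rule m[OF _ L2s(4) K_ge(4) r(4) measure_term_integrable(2)[OF r1]
        measure_term_integrable(2)[OF z(1) z(1) z(1) z(1) z(1) z(1)]]) simp
qed

text \<open>Telescoping over six edges of the cube, moving one parameter from 0 to \<open>s\<close>
  at a time. The reference values \<open>B1\<close> to \<open>B6\<close> are left free: zeros give a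
  growth bound, the derivatives at the base point a linear expansion.\<close>

lemma six_steps:
  assumes s: "s \<in> {0..1}"
    and b: "\<And>r1 r2 r3 r4 r5 r6. r1 \<in> {0..s} \<Longrightarrow> r2 \<in> {0..s} \<Longrightarrow> r3 \<in> {0..s} \<Longrightarrow> r4 \<in> {0..s} \<Longrightarrow> r5 \<in> {0..s} \<Longrightarrow> r6 \<in> {0..s} \<Longrightarrow>
       norm (A1 r1 r2 r3 r4 r5 r6 - B1) \<le> e1 \<and> norm (A2 r1 r2 r3 r4 r5 r6 - B2) \<le> e2 \<and> norm (A3 r1 r2 r3 r4 r5 r6 - B3) \<le> e3
       \<and> norm (A4 r1 r2 r3 r4 r5 r6 - B4) \<le> e4 \<and> norm (A5 r1 r2 r3 r4 r5 r6 - B5) \<le> e5 \<and> norm (A6 r1 r2 r3 r4 r5 r6 - B6) \<le> e6"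
  shows "norm (fn c t (pt s s s s s s) - fn c t (pt 0 0 0 0 0 0) - s *\<^sub>R (B1 + B2 + B3 + B4 + B5 + B6))
     \<le> s * (e1 + e2 + e3 + e4 + e5 + e6)"
proof -
  have s01: "0 \<le> s" "{0..s} \<subseteq> {0..1}" and e: "0 \<in> {0..s}" "s \<in> {0..s}" using s by auto
  have in1: "r \<in> {0..s} \<Longrightarrow> r \<in> {0..1}" for r using s by auto
  note P = partial_derivatives[OF in1 in1 in1 in1 in1 in1 s01(2)]
  let ?F = "\<lambda>r1 r2 r3 r4 r5 r6. fn c t (pt r1 r2 r3 r4 r5 r6)"
  have h1: "norm (?F s 0 0 0 0 0 - ?F 0 0 0 0 0 0 - s *\<^sub>R B1) \<le> s * e1"
    by (rule norm_increment_le[OF s01(1) P(1)]) (use b e in auto)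
  have h2: "norm (?F s s 0 0 0 0 - ?F s 0 0 0 0 0 - s *\<^sub>R B2) \<le> s * e2"
    by (rule norm_increment_le[OF s01(1) P(2)]) (use b e in auto)
  have h3: "norm (?F s s s 0 0 0 - ?F s s 0 0 0 0 - s *\<^sub>R B3) \<le> s * e3"
    by (rule norm_increment_le[OF s01(1) P(3)]) (use b e in auto)
  have h4: "norm (?F s s s s 0 0 - ?F s s s 0 0 0 - s *\<^sub>R B4) \<le> s * e4"
    by (rule norm_increment_le[OF s01(1) P(4)]) (use b e in auto)
  have h5: "norm (?F s s s s s 0 - ?F s s s s 0 0 - s *\<^sub>R B5) \<le> s * e5"
    by (rule norm_increment_le[OF s01(1) P(5)]) (use b e in auto)
  have h6: "norm (?F s s s s s s - ?F s s s s s 0 - s *\<^sub>R B6) \<le> s * e6"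
    by (rule norm_increment_le[OF s01(1) P(6)]) (use b e in auto)
  have tri: "norm (f6 - f0 - s *\<^sub>R (B1 + B2 + B3 + B4 + B5 + B6)) \<le> norm (f1 - f0 - s *\<^sub>R B1) + norm (f2 - f1 - s *\<^sub>R B2)
     + norm (f3 - f2 - s *\<^sub>R B3) + norm (f4 - f3 - s *\<^sub>R B4) + norm (f5 - f4 - s *\<^sub>R B5) + norm (f6 - f5 - s *\<^sub>R B6)"
    for f0 f1 f2 f3 f4 f5 f6
  proof -
    have "f6 - f0 - s *\<^sub>R (B1 + B2 + B3 + B4 + B5 + B6) = (f1 - f0 - s *\<^sub>R B1) + (f2 - f1 - s *\<^sub>R B2)
     + (f3 - f2 - s *\<^sub>R B3) + (f4 - f3 - s *\<^sub>R B4) + (f5 - f4 - s *\<^sub>R B5) + (f6 - f5 - s *\<^sub>R B6)"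
      by (simp add: scaleR_add_right)
    then show ?thesis
      by (simp only:) (rule order_refl | rule add_mono | rule order_trans[OF norm_triangle_ineq])+
  qed
  show ?thesis
    unfolding distrib_left
    using tri[of "?F s s s s s s" "?F 0 0 0 0 0 0" "?F s 0 0 0 0 0" "?F s s 0 0 0 0" "?F s s s 0 0 0" "?F s s s s 0 0" "?F s s s s s 0"]
      h1 h2 h3 h4 h5 h6 by linarith
qed

text \<open>The whole segment, \<open>s = 1\<close>, with reference values 0. This is the local
  Lipschitz estimate behind all later measurability and integrability of coefficients along
  paths.\<close>

lemma growth_bound:
  "norm (fn c t (x + ex, xd + exd, law M (\<lambda>\<omega>. \<zeta> \<omega> + e\<zeta> \<omega>), law M (\<lambda>\<omega>. \<eta> \<omega> + e\<eta> \<omega>), v + ev, vd + evd)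
      - fn c t (x, xd, law M \<zeta>, law M \<eta>, v, vd)) \<le> C * Gr * K"
proof -
  have "norm (fn c t (pt 1 1 1 1 1 1) - fn c t (pt 0 0 0 0 0 0) - 1 *\<^sub>R (0 + 0 + 0 + 0 + 0 + 0))
      \<le> 1 * (C * Gr * norm ex + C * Gr * norm exd + C * Gr * L2_norm M e\<zeta> + C * Gr * L2_norm M e\<eta> + C * Gr * norm ev + C * Gr * norm evd)"
  proof (rule six_steps, goal_cases)
    case (2 r1 r2 r3 r4 r5 r6)
    from partial_growth[OF 2] show ?case unfolding diff_0_right by blast
  qed simp
  also have "\<dots> = C * Gr * K" by (simp add: K_def distrib_left)
  finally show ?thesis
    unfolding scaleR_zero_left scaleR_one add_0_right diff_0_right .
qed

definition "lin = blinfun_apply (D_x c t (x, xd, law M \<zeta>, law M \<eta>, v, vd)) ex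
  + blinfun_apply (D_xd c t (x, xd, law M \<zeta>, law M \<eta>, v, vd)) exd
  + (\<integral>\<omega>. blinfun_apply (D_mu c t (x, xd, law M \<zeta>, law M \<eta>, v, vd) (\<zeta> \<omega>)) (e\<zeta> \<omega>) \<partial>M)
  + (\<integral>\<omega>. blinfun_apply (D_mud c t (x, xd, law M \<zeta>, law M \<eta>, v, vd) (\<eta> \<omega>)) (e\<eta> \<omega>) \<partial>M)
  + blinfun_apply (D_v c t (x, xd, law M \<zeta>, law M \<eta>, v, vd)) ev
  + blinfun_apply (D_vd c t (x, xd, law M \<zeta>, law M \<eta>, v, vd)) evd"

text \<open>The constant is six arguments times the factor 2 of \<open>partial_lip\<close>; the
  additional power of \<open>s\<close> is the length of the parameter interval.\<close>

lemma linear_approx: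
  assumes s: "s \<in> {0..1}"
  shows "norm (fn c t (pt s s s s s s) - fn c t (x, xd, law M \<zeta>, law M \<eta>, v, vd) - s *\<^sub>R lin) \<le> 12 * L * K\<^sup>2 * s\<^sup>2"
proof -
  let ?X = "2 * L * K\<^sup>2 * s"
  have "norm (fn c t (pt s s s s s s) - fn c t (pt 0 0 0 0 0 0)
      - s *\<^sub>R (A1 0 0 0 0 0 0 + A2 0 0 0 0 0 0 + A3 0 0 0 0 0 0 + A4 0 0 0 0 0 0 + A5 0 0 0 0 0 0 + A6 0 0 0 0 0 0))
      \<le> s * (?X + ?X + ?X + ?X + ?X + ?X)"
    by (rule six_steps[OF s]) (intro conjI partial_lip[OF s])
  also have "s * (?X + ?X + ?X + ?X + ?X + ?X) = 12 * L * K\<^sup>2 * s\<^sup>2"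
    by (simp add: power2_eq_square)
  finally show ?thesis
    unfolding A1_def A2_def A3_def A4_def A5_def A6_def lin_def scaleR_zero_left add_0_right .
qed

end

section \<open>Joint measurability in time and chance\<close>

text \<open>The law of \<open>X\<^sub>t\<close> ranges over a space without a countable basis at hand. Joint measurability makes
  \<open>{X\<^sub>t}\<close> separable in \<open>L\<^sup>2\<close>, so that a coefficient along \<open>X\<close> is a limit of countably valued
  approximations.\<close>

lemma L2_cong: "(\<And>x. x \<in> space M \<Longrightarrow> f x = g x) \<Longrightarrow> f \<in> L2 M M \<longleftrightarrow> g \<in> L2 M M"
  unfolding L2_iff
  by (intro conj_cong measurable_cong Bochner_Integration.integrable_cong) auto

text \<open>Separability of the sections for the pseudometric
  \<open>measure M (sym_diff A B)\<close>, with approximating events that need not be sections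
  themselves.\<close>

definition separable_sections :: "'s measure \<Rightarrow> 'a measure \<Rightarrow> ('s \<times> 'a) set \<Rightarrow> bool" where
  "separable_sections N M A \<longleftrightarrow> (\<exists>\<D>. countable \<D> \<and> \<D> \<subseteq> sets M \<and>
     (\<forall>t\<in>space N. \<forall>e>0. \<exists>D\<in>\<D>. measure M (sym_diff (Pair t -` A) D) < e))"

text \<open>Induction over the sigma-algebra generated by rectangles. A rectangle has at most two
  different sections, and a countable union is approximated by finite unions, of which there are
  only countably many over countable families.\<close>

lemma (in finite_measure) separable_sections:
  assumes "A \<in> sets (N \<Otimes>\<^sub>M M)"
  shows "separable_sections N M A"
proof -
  have "A \<in> sigma_sets (space N \<times> space M) {a \<times> b | a b. a \<in> sets N \<and> b \<in> sets M}"
    using assms by (simp add: sets_pair_measure)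
  then show ?thesis
  proof induction
    case (Basic A)
    then obtain a b where A: "A = a \<times> b" "b \<in> sets M" by auto
    show ?case unfolding separable_sections_def
    proof (intro exI[of _ "{b, {}}"] conjI ballI allI impI)
      fix t and e :: real assume "0 < e"
      then show "\<exists>D\<in>{b, {}}. measure M (sym_diff (Pair t -` A) D) < e" by (cases "t \<in> a") (auto simp: A)
    qed (auto simp: A)
  next
    case Empty
    show ?case unfolding separable_sections_def by (rule exI[of _ "{{}}"]) auto
  next
    case (Compl A)
    have A: "A \<in> sets (N \<Otimes>\<^sub>M M)" using Compl(1) by (simp add: sets_pair_measure)
    obtain \<D> where D: "countable \<D>" "\<D> \<subseteq> sets M"
      "\<And>t e. t \<in> space N \<Longrightarrow> e > 0 \<Longrightarrow> \<exists>D\<in>\<D>. measure M (sym_diff (Pair t -` A) D) < e"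
      using Compl(2) unfolding separable_sections_def by metis
    show ?case unfolding separable_sections_def
    proof (intro exI[of _ "(\<lambda>D. space M - D) ` \<D>"] conjI ballI allI impI)
      fix t and e :: real assume t: "t \<in> space N" and e: "0 < e"
      obtain E where E: "E \<in> \<D>" "measure M (sym_diff (Pair t -` A) E) < e" using D(3)[OF t e] by auto
      have "Pair t -` A \<in> sets M" using sets_Pair1[OF A] .
      then have "sym_diff (Pair t -` (space N \<times> space M - A)) (space M - E) = sym_diff (Pair t -` A) E"
        using t E(1) D(2) sets.sets_into_space by fastforce
      with E show "\<exists>D\<in>(\<lambda>D. space M - D) ` \<D>. measure M (sym_diff (Pair t -` (space N \<times> space M - A)) D) < e"
        by (intro bexI[of _ "space M - E"]) simp_all
    qed (use D in auto)
  next
    case (Union A)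
    have A: "A k \<in> sets (N \<Otimes>\<^sub>M M)" for k using Union(1) by (simp add: sets_pair_measure)
    have "\<forall>k. \<exists>\<D>. countable \<D> \<and> \<D> \<subseteq> sets M \<and>
       (\<forall>t\<in>space N. \<forall>e>0. \<exists>D\<in>\<D>. measure M (sym_diff (Pair t -` A k) D) < e)"
      using Union(2) unfolding separable_sections_def by blast
    then obtain \<D> where "\<forall>k. countable (\<D> k) \<and> \<D> k \<subseteq> sets M \<and>
       (\<forall>t\<in>space N. \<forall>e>0. \<exists>D\<in>\<D> k. measure M (sym_diff (Pair t -` A k) D) < e)" by (rule choice[THEN exE])
    then have D: "\<And>k. countable (\<D> k)" "\<And>k. \<D> k \<subseteq> sets M"
      "\<And>k t e. t \<in> space N \<Longrightarrow> e > 0 \<Longrightarrow> \<exists>D\<in>\<D> k. measure M (sym_diff (Pair t -` A k) D) < e" by auto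
    \<comment> \<open>Finite unions are indexed by lists, since the lists over a countable set are
      countable.\<close>
    let ?E = "(\<lambda>xs. \<Union>(set xs)) ` lists (\<Union>k. \<D> k)"
    show ?case unfolding separable_sections_def
    proof (intro exI[of _ ?E] conjI ballI allI impI)
      show "countable ?E" using D(1) by (intro countable_image countable_lists) auto
      show "?E \<subseteq> sets M" using D(2) by (auto simp: in_lists_conv_set subset_iff intro!: sets.finite_Union)
      fix t and e :: real assume t: "t \<in> space N" and e: "0 < e"
      let ?A = "\<lambda>k. Pair t -` A k"
      have sA: "?A k \<in> sets M" for k using sets_Pair1[OF A] .
      have "(\<lambda>n. measure M (\<Union>k<n. ?A k)) \<longlonglongrightarrow> measure M (\<Union>n. \<Union>k<n. ?A k)"
        by (rule finite_Lim_measure_incseq) (use sA in \<open>auto simp: incseq_def\<close>, fastforce)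
      also have "(\<Union>n. \<Union>k<n. ?A k) = (\<Union>k. ?A k)" by auto
      finally have "(\<lambda>n. measure M (\<Union>k. ?A k) - measure M (\<Union>k<n. ?A k)) \<longlonglongrightarrow> measure M (\<Union>k. ?A k) - measure M (\<Union>k. ?A k)"
        by (intro tendsto_intros)
      then have "\<forall>\<^sub>F n in sequentially. measure M (\<Union>k. ?A k) - measure M (\<Union>k<n. ?A k) < e / 2"
        using e by (intro order_tendstoD(2)) auto
      then obtain n where n: "measure M (\<Union>k. ?A k) - measure M (\<Union>k<n. ?A k) < e / 2"
        unfolding eventually_sequentially by blast
      \<comment> \<open>Half of \<open>e\<close> is spent on the tail of the union and half on the
        \<open>n\<close> approximations; \<open>n + 1\<close> covers the case
        \<open>n = 0\<close>.\<close>
      have "\<forall>k. \<exists>E. E \<in> \<D> k \<and> measure M (sym_diff (?A k) E) < e / (2 * (n + 1))"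
        using D(3)[OF t, of "e / (2 * (n + 1))"] e by auto
      then obtain E where E: "\<And>k. E k \<in> \<D> k" "\<And>k. measure M (sym_diff (?A k) (E k)) < e / (2 * (n + 1))" by metis
      have sE: "E k \<in> sets M" for k using E(1) D(2) by auto
      let ?U = "\<Union>(set (map E [0..<n]))"
      have U: "?U = (\<Union>k<n. E k)" by auto
      have "measure M (sym_diff (Pair t -` (\<Union>k. A k)) ?U)
          \<le> measure M (((\<Union>k. ?A k) - (\<Union>k<n. ?A k)) \<union> (\<Union>k<n. sym_diff (?A k) (E k)))"
        unfolding U by (rule finite_measure_mono) (use sA sE in \<open>auto intro!: sets.Un sets.Diff sets.countable_UN sets.finite_UN\<close>)
      also have "\<dots> \<le> measure M ((\<Union>k. ?A k) - (\<Union>k<n. ?A k)) + measure M (\<Union>k<n. sym_diff (?A k) (E k))"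
        by (rule measure_Un_le) (use sA sE in \<open>auto intro!: sets.Un sets.Diff sets.countable_UN sets.finite_UN\<close>)
      also have "measure M ((\<Union>k. ?A k) - (\<Union>k<n. ?A k)) = measure M (\<Union>k. ?A k) - measure M (\<Union>k<n. ?A k)"
        by (rule finite_measure_Diff) (use sA in auto)
      also have "measure M (\<Union>k<n. sym_diff (?A k) (E k)) \<le> (\<Sum>k<n. measure M (sym_diff (?A k) (E k)))"
        by (rule measure_UNION_le) (use sA sE in auto)
      also have "\<dots> \<le> (\<Sum>k<n. e / (2 * (n + 1)))" by (intro sum_mono less_imp_le E(2))
      also have "\<dots> \<le> e / 2" using e by (simp add: field_simps)
      finally have "measure M (sym_diff (Pair t -` (\<Union>k. A k)) ?U) < e" using n by simp
      moreover have "?U \<in> ?E" using E(1) by (intro imageI) (auto simp: in_lists_conv_set)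
      ultimately show "\<exists>D\<in>?E. measure M (sym_diff (Pair t -` (\<Union> (range A))) D) < e" by blast
    qed
  qed
qed

section \<open>Separability in L2 of jointly measurable families\<close>

definition separable_family :: "'s set \<Rightarrow> 'a measure \<Rightarrow> ('s \<Rightarrow> 'a \<Rightarrow> 'b::euclidean_space) \<Rightarrow> bool" where
  "separable_family S M X \<longleftrightarrow> (\<exists>\<H>. countable \<H> \<and> \<H> \<subseteq> L2 M M \<and>
     (\<forall>t\<in>S. \<forall>e>0. \<exists>\<eta>\<in>\<H>. L2_norm M (\<lambda>\<omega>. X t \<omega> - \<eta> \<omega>) < e))"

lemma separable_family_add:
  assumes X: "separable_family S M X" "\<And>t. t \<in> S \<Longrightarrow> X t \<in> L2 M M"
    and Y: "separable_family S M Y" "\<And>t. t \<in> S \<Longrightarrow> Y t \<in> L2 M M"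
  shows "separable_family S M (\<lambda>t \<omega>. X t \<omega> + Y t \<omega>)"
proof -
  obtain \<H> where H: "countable \<H>" "\<H> \<subseteq> L2 M M" "\<And>t e. t \<in> S \<Longrightarrow> e > 0 \<Longrightarrow> \<exists>\<eta>\<in>\<H>. L2_norm M (\<lambda>\<omega>. X t \<omega> - \<eta> \<omega>) < e"
    using X(1) unfolding separable_family_def by blast
  obtain \<K> where K: "countable \<K>" "\<K> \<subseteq> L2 M M" "\<And>t e. t \<in> S \<Longrightarrow> e > 0 \<Longrightarrow> \<exists>\<eta>\<in>\<K>. L2_norm M (\<lambda>\<omega>. Y t \<omega> - \<eta> \<omega>) < e"
    using Y(1) unfolding separable_family_def by blast
  show ?thesis unfolding separable_family_def
  proof (intro exI[of _ "(\<lambda>(\<eta>, \<theta>) \<omega>. \<eta> \<omega> + \<theta> \<omega>) ` (\<H> \<times> \<K>)"] conjI ballI allI impI)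
    show "countable ((\<lambda>(\<eta>, \<theta>) \<omega>. \<eta> \<omega> + \<theta> \<omega>) ` (\<H> \<times> \<K>))" using H(1) K(1) by auto
    show "(\<lambda>(\<eta>, \<theta>) \<omega>. \<eta> \<omega> + \<theta> \<omega>) ` (\<H> \<times> \<K>) \<subseteq> L2 M M" using H(2) K(2) by (auto intro!: L2_add)
    fix t and e :: real assume t: "t \<in> S" and e: "0 < e"
    obtain \<eta> \<theta> where *: "\<eta> \<in> \<H>" "L2_norm M (\<lambda>\<omega>. X t \<omega> - \<eta> \<omega>) < e / 2" "\<theta> \<in> \<K>" "L2_norm M (\<lambda>\<omega>. Y t \<omega> - \<theta> \<omega>) < e / 2"
      using H(3)[OF t, of "e / 2"] K(3)[OF t, of "e / 2"] e by auto
    have "L2_norm M (\<lambda>\<omega>. (X t \<omega> - \<eta> \<omega>) + (Y t \<omega> - \<theta> \<omega>)) \<le> L2_norm M (\<lambda>\<omega>. X t \<omega> - \<eta> \<omega>) + L2_norm M (\<lambda>\<omega>. Y t \<omega> - \<theta> \<omega>)"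
      by (rule L2_norm_triangle) (use * t H(2) K(2) X(2) Y(2) in \<open>auto intro!: L2_diff\<close>)
    also have "(\<lambda>\<omega>. (X t \<omega> - \<eta> \<omega>) + (Y t \<omega> - \<theta> \<omega>)) = (\<lambda>\<omega>. X t \<omega> + Y t \<omega> - (\<eta> \<omega> + \<theta> \<omega>))" by auto
    finally have "L2_norm M (\<lambda>\<omega>. X t \<omega> + Y t \<omega> - (\<eta> \<omega> + \<theta> \<omega>)) < e" using * by simp
    then show "\<exists>\<eta>\<in>(\<lambda>(\<eta>, \<theta>) \<omega>. \<eta> \<omega> + \<theta> \<omega>) ` (\<H> \<times> \<K>). L2_norm M (\<lambda>\<omega>. X t \<omega> + Y t \<omega> - \<eta> \<omega>) < e"
      using *(1,3) by force
  qed
qed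

context prob_space
begin

text \<open>The squared L2 distance of two indicators scaled by \<open>c\<close> is the square of
  \<open>norm c\<close> times the measure of the symmetric difference, so
  \<open>separable_sections\<close> carries over.\<close>

lemma separable_family_indicator:
  assumes A: "A \<in> sets (N \<Otimes>\<^sub>M M)"
  shows "separable_family (space N) M (\<lambda>t \<omega>. indicator A (t, \<omega>) *\<^sub>R c)" (is ?sep)
    and "t \<in> space N \<Longrightarrow> (\<lambda>\<omega>. indicator A (t, \<omega>) *\<^sub>R c) \<in> L2 M M"
proof -
  have ind: "(\<lambda>\<omega>. indicator D \<omega> *\<^sub>R c) \<in> L2 M M" if "D \<in> sets M" for D
    by (rule L2_bound[OF _ L2_const[of c], where C=1]) (use that in \<open>auto simp: indicator_def\<close>)
  have eq: "indicator A (t, \<omega>) = (indicator (Pair t -` A) \<omega> :: real)" for t \<omega> by (simp add: indicator_def)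
  show "(\<lambda>\<omega>. indicator A (t, \<omega>) *\<^sub>R c) \<in> L2 M M" if "t \<in> space N" for t
    unfolding eq by (rule ind[OF sets_Pair1[OF A]])
  obtain \<D> where D: "countable \<D>" "\<D> \<subseteq> sets M"
    "\<And>t e. t \<in> space N \<Longrightarrow> e > 0 \<Longrightarrow> \<exists>D\<in>\<D>. measure M (sym_diff (Pair t -` A) D) < e"
    using separable_sections[OF A] unfolding separable_sections_def by metis
  show ?sep unfolding separable_family_def
  proof (intro exI[of _ "(\<lambda>D \<omega>. indicator D \<omega> *\<^sub>R c) ` \<D>"] conjI ballI allI impI)
    show "(\<lambda>D \<omega>. indicator D \<omega> *\<^sub>R c) ` \<D> \<subseteq> L2 M M" using D(2) ind by auto
    fix t and e :: real assume t: "t \<in> space N" and e: "0 < e"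
    \<comment> \<open>The summand 1 permits the division when \<open>c = 0\<close>.\<close>
    define k where "k = (norm c)\<^sup>2 + 1"
    have k: "0 < k" "(norm c)\<^sup>2 \<le> k" by (auto simp: k_def add_nonneg_pos)
    obtain E where E: "E \<in> \<D>" "measure M (sym_diff (Pair t -` A) E) < e\<^sup>2 / k"
      using D(3)[OF t, of "e\<^sup>2 / k"] e k by auto
    have sE: "E \<in> sets M" "Pair t -` A \<in> sets M" using E(1) D(2) sets_Pair1[OF A] by auto
    have "(norm (indicator (Pair t -` A) \<omega> *\<^sub>R c - indicator E \<omega> *\<^sub>R c))\<^sup>2 = indicator (sym_diff (Pair t -` A) E) \<omega> * (norm c)\<^sup>2" for \<omega>
      by (auto simp: indicator_def)
    then have "(L2_norm M (\<lambda>\<omega>. indicator (Pair t -` A) \<omega> *\<^sub>R c - indicator E \<omega> *\<^sub>R c))\<^sup>2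
       = measure M (sym_diff (Pair t -` A) E) * (norm c)\<^sup>2"
      unfolding L2_norm_sq using sE by simp
    also have "\<dots> \<le> measure M (sym_diff (Pair t -` A) E) * k" using k by (intro mult_left_mono) auto
    also have "\<dots> < e\<^sup>2" using E(2) k by (simp add: field_simps)
    finally have "L2_norm M (\<lambda>\<omega>. indicator (Pair t -` A) \<omega> *\<^sub>R c - indicator E \<omega> *\<^sub>R c) < e"
      using e by (simp add: power_less_imp_less_base)
    then show "\<exists>\<eta>\<in>(\<lambda>D \<omega>. indicator D \<omega> *\<^sub>R c) ` \<D>. L2_norm M (\<lambda>\<omega>. indicator A (t, \<omega>) *\<^sub>R c - \<eta> \<omega>) < e"
      using E(1) by (auto simp: eq)
  qed (use D in auto)
qed

text \<open>A simple function is a finite sum of scaled indicators of its level sets, and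
  separability is stable under sums.\<close>

lemma separable_family_simple:
  fixes f :: "'s \<times> 'a \<Rightarrow> 'b::euclidean_space"
  assumes f: "simple_function (N \<Otimes>\<^sub>M M) f"
  shows "separable_family (space N) M (\<lambda>t \<omega>. f (t, \<omega>))"
    and "t \<in> space N \<Longrightarrow> (\<lambda>\<omega>. f (t, \<omega>)) \<in> L2 M M"
proof -
  let ?S = "space (N \<Otimes>\<^sub>M M)"
  let ?A = "\<lambda>c. f -` {c} \<inter> ?S"
  have fin: "finite (f ` ?S)" and A: "\<And>c. ?A c \<in> sets (N \<Otimes>\<^sub>M M)"
    using f by (auto simp: simple_function_def intro: simple_functionD)
  have eq: "(\<Sum>c\<in>f ` ?S. indicator (?A c) (t, \<omega>) *\<^sub>R c) = f (t, \<omega>)" if "t \<in> space N" "\<omega> \<in> space M" for t \<omega>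
  proof -
    have S: "(t, \<omega>) \<in> ?S" using that by (simp add: space_pair_measure)
    have "(\<Sum>c\<in>f ` ?S. indicator (?A c) (t, \<omega>) *\<^sub>R c) = (\<Sum>c\<in>f ` ?S. if c = f (t, \<omega>) then c else 0)"
      using S by (intro sum.cong) (auto simp: indicator_def)
    also have "\<dots> = f (t, \<omega>)" using S fin by simp
    finally show ?thesis .
  qed
  have "separable_family (space N) M (\<lambda>t \<omega>. \<Sum>c\<in>C. indicator (?A c) (t, \<omega>) *\<^sub>R c)
     \<and> (\<forall>t\<in>space N. (\<lambda>\<omega>. \<Sum>c\<in>C. indicator (?A c) (t, \<omega>) *\<^sub>R c) \<in> L2 M M)" if "finite C" for C
    using that
  proof induction
    case empty
    have "separable_family (space N) M (\<lambda>t (\<omega>::'a). 0 :: 'b)"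
      unfolding separable_family_def by (rule exI[of _ "{\<lambda>_. 0}"]) (auto simp: L2_zero L2_norm_def)
    then show ?case by (simp add: L2_zero)
  next
    case (insert c C)
    show ?case
      unfolding sum.insert[OF insert(1,2)]
      using separable_family_add[OF separable_family_indicator[OF A[of c], where c=c]] L2_add[OF separable_family_indicator(2)[OF A[of c], where c=c]] insert(3)
      by blast
  qed
  from this[OF fin] have *: "separable_family (space N) M (\<lambda>t \<omega>. \<Sum>c\<in>f ` ?S. indicator (?A c) (t, \<omega>) *\<^sub>R c)"
    "\<And>t. t \<in> space N \<Longrightarrow> (\<lambda>\<omega>. \<Sum>c\<in>f ` ?S. indicator (?A c) (t, \<omega>) *\<^sub>R c) \<in> L2 M M" by auto
  show "(\<lambda>\<omega>. f (t, \<omega>)) \<in> L2 M M" if t: "t \<in> space N" for t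
  proof -
    have "(\<lambda>\<omega>. \<Sum>c\<in>f ` ?S. indicator (?A c) (t, \<omega>) *\<^sub>R c) \<in> L2 M M \<longleftrightarrow> (\<lambda>\<omega>. f (t, \<omega>)) \<in> L2 M M"
      by (rule L2_cong) (rule eq[OF t])
    then show ?thesis using *(2)[OF t] by blast
  qed
  have "L2_norm M (\<lambda>\<omega>. (\<Sum>c\<in>f ` ?S. indicator (?A c) (t, \<omega>) *\<^sub>R c) - \<eta> \<omega>) = L2_norm M (\<lambda>\<omega>. f (t, \<omega>) - \<eta> \<omega>)"
    if "t \<in> space N" for t \<eta>
    by (rule L2_norm_cong) (simp add: eq[OF that])
  with *(1) show "separable_family (space N) M (\<lambda>t \<omega>. f (t, \<omega>))"
    unfolding separable_family_def by (simp cong: ball_cong)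
qed

text \<open>Simple functions of time and chance converge to \<open>X\<close> pointwise and are
  dominated by twice its norm, hence converge in L2 at each single time. The union of their
  countable families is therefore dense.\<close>

lemma separable_family_measurable:
  fixes X :: "'s \<Rightarrow> 'a \<Rightarrow> 'b::euclidean_space"
  assumes X: "(\<lambda>(t, \<omega>). X t \<omega>) \<in> borel_measurable (N \<Otimes>\<^sub>M M)" and L: "\<And>t. t \<in> space N \<Longrightarrow> X t \<in> L2 M M"
  shows "separable_family (space N) M X"
proof -
  let ?S = "space (N \<Otimes>\<^sub>M M)"
  obtain f where "\<forall>i. simple_function (N \<Otimes>\<^sub>M M) (f i)" "\<forall>z\<in>?S. (\<lambda>i. f i z) \<longlonglongrightarrow> (case z of (t, \<omega>) \<Rightarrow> X t \<omega>)"
    "\<forall>i. \<forall>z\<in>?S. dist (f i z) 0 \<le> 2 * dist (case z of (t, \<omega>) \<Rightarrow> X t \<omega>) 0"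
    using borel_measurable_implies_sequence_metric[OF X, of 0] by blast
  then have f: "\<And>i. simple_function (N \<Otimes>\<^sub>M M) (f i)" "\<And>z. z \<in> ?S \<Longrightarrow> (\<lambda>i. f i z) \<longlonglongrightarrow> (case z of (t, \<omega>) \<Rightarrow> X t \<omega>)"
    "\<And>i z. z \<in> ?S \<Longrightarrow> norm (f i z) \<le> 2 * norm (case z of (t, \<omega>) \<Rightarrow> X t \<omega>)"
    by (auto simp only: dist_0_norm dist_norm diff_0_right)
  have "\<forall>i. \<exists>\<H>. countable \<H> \<and> \<H> \<subseteq> L2 M M \<and>
     (\<forall>t\<in>space N. \<forall>e>0. \<exists>\<eta>\<in>\<H>. L2_norm M (\<lambda>\<omega>. f i (t, \<omega>) - \<eta> \<omega>) < e)"
    using separable_family_simple(1)[OF f(1)] unfolding separable_family_def by blast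
  then obtain \<H> where "\<forall>i. countable (\<H> i) \<and> \<H> i \<subseteq> L2 M M \<and>
     (\<forall>t\<in>space N. \<forall>e>0. \<exists>\<eta>\<in>\<H> i. L2_norm M (\<lambda>\<omega>. f i (t, \<omega>) - \<eta> \<omega>) < e)" by (rule choice[THEN exE])
  then have H: "\<And>i. countable (\<H> i)" "\<And>i. \<H> i \<subseteq> L2 M M"
    "\<And>i t e. t \<in> space N \<Longrightarrow> e > 0 \<Longrightarrow> \<exists>\<eta>\<in>\<H> i. L2_norm M (\<lambda>\<omega>. f i (t, \<omega>) - \<eta> \<omega>) < e" by auto
  show ?thesis unfolding separable_family_def
  proof (intro exI[of _ "\<Union>i. \<H> i"] conjI ballI allI impI)
    fix t and e :: real assume t: "t \<in> space N" and e: "0 < e"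
    have S: "(t, \<omega>) \<in> ?S" if "\<omega> \<in> space M" for \<omega> using t that by (simp add: space_pair_measure)
    note Lf = separable_family_simple(2)[OF f(1) t]
    have [measurable]: "X t \<in> borel_measurable M" "\<And>i. (\<lambda>\<omega>. f i (t, \<omega>)) \<in> borel_measurable M"
      using L[OF t] Lf by (auto simp: L2_iff)
    have "(\<lambda>i. \<integral>\<omega>. (norm (X t \<omega> - f i (t, \<omega>)))\<^sup>2 \<partial>M) \<longlonglongrightarrow> (\<integral>\<omega>. 0 \<partial>M)"
    proof (rule integral_dominated_convergence)
      \<comment> \<open>The dominating function is the square of
        \<open>norm (X t \<omega>) + 2 * norm (X t \<omega>)\<close>.\<close>
      show "integrable M (\<lambda>\<omega>. 9 * (norm (X t \<omega>))\<^sup>2)" using L[OF t] by (auto simp: L2_iff)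
      show "AE \<omega> in M. (\<lambda>i. (norm (X t \<omega> - f i (t, \<omega>)))\<^sup>2) \<longlonglongrightarrow> 0"
      proof (rule AE_I2)
        fix \<omega> assume "\<omega> \<in> space M"
        from f(2)[OF S[OF this]] have "(\<lambda>i. f i (t, \<omega>)) \<longlonglongrightarrow> X t \<omega>" by simp
        then have "(\<lambda>i. (norm (X t \<omega> - f i (t, \<omega>)))\<^sup>2) \<longlonglongrightarrow> (norm (X t \<omega> - X t \<omega>))\<^sup>2" by (intro tendsto_intros)
        then show "(\<lambda>i. (norm (X t \<omega> - f i (t, \<omega>)))\<^sup>2) \<longlonglongrightarrow> 0" by simp
      qed
      show "AE \<omega> in M. norm ((norm (X t \<omega> - f i (t, \<omega>)))\<^sup>2) \<le> 9 * (norm (X t \<omega>))\<^sup>2" for i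
      proof (rule AE_I2)
        fix \<omega> assume w: "\<omega> \<in> space M"
        have "norm (X t \<omega> - f i (t, \<omega>)) \<le> norm (X t \<omega>) + norm (f i (t, \<omega>))" by (rule norm_triangle_ineq4)
        also have "\<dots> \<le> 3 * norm (X t \<omega>)" using f(3)[OF S[OF w], of i] by simp
        finally have "(norm (X t \<omega> - f i (t, \<omega>)))\<^sup>2 \<le> (3 * norm (X t \<omega>))\<^sup>2" by (intro power_mono) auto
        then show "norm ((norm (X t \<omega> - f i (t, \<omega>)))\<^sup>2) \<le> 9 * (norm (X t \<omega>))\<^sup>2" by (simp add: power_mult_distrib)
      qed
    qed auto
    then have "(\<lambda>i. sqrt (\<integral>\<omega>. (norm (X t \<omega> - f i (t, \<omega>)))\<^sup>2 \<partial>M)) \<longlonglongrightarrow> sqrt 0" by (intro tendsto_real_sqrt) simp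
    then have "\<forall>\<^sub>F i in sequentially. L2_norm M (\<lambda>\<omega>. X t \<omega> - f i (t, \<omega>)) < e / 2"
      unfolding L2_norm_def using e by (intro order_tendstoD(2)) auto
    then obtain i where i: "L2_norm M (\<lambda>\<omega>. X t \<omega> - f i (t, \<omega>)) < e / 2" unfolding eventually_sequentially by blast
    obtain \<eta> where \<eta>: "\<eta> \<in> \<H> i" "L2_norm M (\<lambda>\<omega>. f i (t, \<omega>) - \<eta> \<omega>) < e / 2" using H(3)[OF t, of "e / 2"] e by auto
    have "L2_norm M (\<lambda>\<omega>. (X t \<omega> - f i (t, \<omega>)) + (f i (t, \<omega>) - \<eta> \<omega>))
       \<le> L2_norm M (\<lambda>\<omega>. X t \<omega> - f i (t, \<omega>)) + L2_norm M (\<lambda>\<omega>. f i (t, \<omega>) - \<eta> \<omega>)"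
      by (intro L2_norm_triangle L2_diff L[OF t] Lf) (use \<eta> H(2) in auto)
    then show "\<exists>\<eta>\<in>\<Union>i. \<H> i. L2_norm M (\<lambda>\<omega>. X t \<omega> - \<eta> \<omega>) < e" using i \<eta> by force
  qed (use H in auto)
qed

end

text \<open>\<open>f\<close> is the limit of \<open>F p x\<close> for the first \<open>p\<close>, in
  a fixed enumeration, that is within \<open>1 / (k + 1)\<close> of \<open>x\<close>. The selected
  index is measurable because only countably many functions \<open>d p\<close> are compared, so each
  \<open>F p\<close> has to be measurable for frozen \<open>p\<close> only.\<close>

lemma borel_measurable_countable_approx:
  fixes f :: "'q \<Rightarrow> 'c::{metric_space}" and d :: "'p \<Rightarrow> 'q \<Rightarrow> real"
  assumes P: "countable P" "P \<noteq> {}"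
    and F: "\<And>p. p \<in> P \<Longrightarrow> F p \<in> borel_measurable Q" and d: "\<And>p. p \<in> P \<Longrightarrow> d p \<in> borel_measurable Q"
    and dense: "\<And>x e. x \<in> space Q \<Longrightarrow> e > 0 \<Longrightarrow> \<exists>p\<in>P. d p x < e"
    and cont: "\<And>x e. x \<in> space Q \<Longrightarrow> e > 0 \<Longrightarrow> \<exists>r>0. \<forall>p\<in>P. d p x < r \<longrightarrow> dist (F p x) (f x) < e"
  shows "f \<in> borel_measurable Q"
proof -
  define p where "p i = from_nat_into P i" for i
  have p: "p i \<in> P" for i using P by (simp add: p_def from_nat_into)
  have [measurable]: "d (p i) \<in> borel_measurable Q" "F (p i) \<in> borel_measurable Q" for i using d F p by auto
  define n where "n k x = (LEAST i. d (p i) x < 1 / Suc k)" for k x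
  have n: "d (p (n k x)) x < 1 / Suc k" if x: "x \<in> space Q" for k x
  proof -
    obtain q where "q \<in> P" "d q x < 1 / Suc k" using dense[OF x, of "1 / Suc k"] by auto
    then obtain i where "d (p i) x < 1 / Suc k" using from_nat_into_surj[OF P(1)] unfolding p_def by metis
    then show ?thesis unfolding n_def by (rule LeastI)
  qed
  have [measurable]: "n k \<in> measurable Q (count_space UNIV)" for k unfolding n_def by measurable
  show ?thesis
  proof (rule borel_measurable_LIMSEQ_metric)
    show "(\<lambda>x. F (p (n k x)) x) \<in> borel_measurable Q" for k
      by (rule measurable_compose_countable[where f="\<lambda>i. F (p i)"]) measurable
    fix x assume x: "x \<in> space Q"
    show "(\<lambda>k. F (p (n k x)) x) \<longlonglongrightarrow> f x"
    proof (rule metric_LIMSEQ_I)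
      fix e :: real assume "0 < e"
      then obtain r where r: "r > 0" "\<And>q. q \<in> P \<Longrightarrow> d q x < r \<Longrightarrow> dist (F q x) (f x) < e" using cont[OF x] by meson
      obtain k0 where k0: "1 / Suc k0 < r" using r(1) nat_approx_posE by blast
      have "dist (F (p (n k x)) x) (f x) < e" if "k \<ge> k0" for k
      proof (rule r(2)[OF p])
        have "1 / real (Suc k) \<le> 1 / Suc k0" using that by (simp add: frac_le)
        then show "d (p (n k x)) x < r" using n[OF x, of k] k0 by linarith
      qed
      then show "\<exists>no. \<forall>k\<ge>no. dist (F (p (n k x)) x) (f x) < e" by blast
    qed
  qed
qed

lemma joint_measurable_coefficient:
  fixes c :: "('n::finite, 'k::finite, 'c::euclidean_space) coefficient" and N :: "'s measure" and \<tau> :: "'s \<Rightarrow> real"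
    and X Xd :: "'s \<Rightarrow> 'a \<Rightarrow> real^'n" and v vd :: "'s \<Rightarrow> 'a \<Rightarrow> real^'k"
  assumes "prob_space M" and coeff: "\<And>t. t \<in> space N \<Longrightarrow> lifted_coefficient M U a L C c (\<tau> t)"
    and fm: "\<And>z. z \<in> dom6 U \<Longrightarrow> (\<lambda>t. fn c (\<tau> t) z) \<in> borel_measurable N"
    and m: "(\<lambda>(t, \<omega>). X t \<omega>) \<in> borel_measurable (N \<Otimes>\<^sub>M M)" "(\<lambda>(t, \<omega>). Xd t \<omega>) \<in> borel_measurable (N \<Otimes>\<^sub>M M)"
      "(\<lambda>(t, \<omega>). v t \<omega>) \<in> borel_measurable (N \<Otimes>\<^sub>M M)" "(\<lambda>(t, \<omega>). vd t \<omega>) \<in> borel_measurable (N \<Otimes>\<^sub>M M)"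
    and L: "\<And>t. t \<in> space N \<Longrightarrow> X t \<in> L2 M M" "\<And>t. t \<in> space N \<Longrightarrow> Xd t \<in> L2 M M"
    and U: "\<And>t \<omega>. t \<in> space N \<Longrightarrow> \<omega> \<in> space M \<Longrightarrow> v t \<omega> \<in> U" "\<And>t \<omega>. t \<in> space N \<Longrightarrow> \<omega> \<in> space M \<Longrightarrow> vd t \<omega> \<in> U"
  shows "(\<lambda>(t, \<omega>). fn c (\<tau> t) (X t \<omega>, Xd t \<omega>, law M (X t), law M (Xd t), v t \<omega>, vd t \<omega>)) \<in> borel_measurable (N \<Otimes>\<^sub>M M)"
\<comment> \<open>The countable set of frozen points has to be nonempty, and a point of
  \<open>N\<close> guarantees this.\<close>
proof (cases "space N = {}")
  case True
  then show ?thesis by (intro measurableI) (auto simp: space_pair_measure)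
next
  case False
  interpret prob_space M by fact
  obtain D :: "(real^'n) set" where D: "countable D" "closure D = UNIV"
    using separable[of "UNIV :: (real^'n) set"] by (metis top.extremum_unique)
  obtain DU where DU: "countable DU" "DU \<subseteq> U" "U \<subseteq> closure DU" using separable[of U] by metis
  obtain \<H> where H: "countable \<H>" "\<H> \<subseteq> L2 M M" "\<And>t e. t \<in> space N \<Longrightarrow> e > 0 \<Longrightarrow> \<exists>\<eta>\<in>\<H>. L2_norm M (\<lambda>\<omega>. X t \<omega> - \<eta> \<omega>) < e"
    using separable_family_measurable[OF m(1) L(1)] unfolding separable_family_def by metis
  obtain \<K> where K: "countable \<K>" "\<K> \<subseteq> L2 M M" "\<And>t e. t \<in> space N \<Longrightarrow> e > 0 \<Longrightarrow> \<exists>\<eta>\<in>\<K>. L2_norm M (\<lambda>\<omega>. Xd t \<omega> - \<eta> \<omega>) < e"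
    using separable_family_measurable[OF m(2) L(2)] unfolding separable_family_def by metis
  have dD: "\<exists>y\<in>D. norm (y - x) < e" if "e > 0" for x e
    using closure_approachable[of x D] D(2) that by (auto simp: dist_norm)
  have dU: "\<exists>y\<in>DU. norm (y - x) < e" if "e > 0" "x \<in> U" for x e
    using closure_approachable[of x DU] DU(3) that by (auto simp: dist_norm)
  let ?P = "D \<times> D \<times> \<H> \<times> \<K> \<times> DU \<times> DU"
  let ?F = "\<lambda>(x, y, \<zeta>, \<eta>, w, w') (t, \<omega>). fn c (\<tau> t) (x, y, law M \<zeta>, law M \<eta>, w, w')"
  let ?d = "\<lambda>(x, y, \<zeta>, \<eta>, w, w') (t, \<omega>). norm (x - X t \<omega>) + norm (y - Xd t \<omega>) + L2_norm M (\<lambda>\<omega>. \<zeta> \<omega> - X t \<omega>)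
     + L2_norm M (\<lambda>\<omega>. \<eta> \<omega> - Xd t \<omega>) + norm (w - v t \<omega>) + norm (w' - vd t \<omega>)"
  have dense: "\<exists>p\<in>?P. ?d p z < e" if z: "z \<in> space (N \<Otimes>\<^sub>M M)" and e: "e > 0" for z e
  proof -
    obtain t \<omega> where z: "z = (t, \<omega>)" "t \<in> space N" "\<omega> \<in> space M" using z by (auto simp: space_pair_measure)
    have e6: "e / 6 > 0" using e by simp
    obtain x where x: "x \<in> D" "norm (x - X t \<omega>) < e / 6" using dD[OF e6] by blast
    obtain y where y: "y \<in> D" "norm (y - Xd t \<omega>) < e / 6" using dD[OF e6] by blast
    obtain \<zeta> where \<zeta>: "\<zeta> \<in> \<H>" "L2_norm M (\<lambda>\<omega>. \<zeta> \<omega> - X t \<omega>) < e / 6"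
      using H(3)[OF z(2) e6] by (auto simp: L2_norm_diff_commute)
    obtain \<eta> where \<eta>: "\<eta> \<in> \<K>" "L2_norm M (\<lambda>\<omega>. \<eta> \<omega> - Xd t \<omega>) < e / 6"
      using K(3)[OF z(2) e6] by (auto simp: L2_norm_diff_commute)
    obtain w where w: "w \<in> DU" "norm (w - v t \<omega>) < e / 6" using dU[OF e6 U(1)[OF z(2,3)]] by blast
    obtain w' where w': "w' \<in> DU" "norm (w' - vd t \<omega>) < e / 6" using dU[OF e6 U(2)[OF z(2,3)]] by blast
    show ?thesis
    proof (rule bexI[of _ "(x, y, \<zeta>, \<eta>, w, w')"])
      show "?d (x, y, \<zeta>, \<eta>, w, w') z < e" unfolding z(1) prod.case
        using x(2) y(2) \<zeta>(2) \<eta>(2) w(2) w'(2) by linarith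
    qed (use x y \<zeta> \<eta> w w' in auto)
  qed
  show ?thesis
  proof (rule borel_measurable_countable_approx[of ?P ?F _ ?d])
    show "countable ?P" using D DU H K by (intro countable_SIGMA) auto
    obtain t where "t \<in> space N" using False by auto
    moreover obtain \<omega> where "\<omega> \<in> space M" using not_empty by auto
    ultimately have "(t, \<omega>) \<in> space (N \<Otimes>\<^sub>M M)" by (simp add: space_pair_measure)
    from dense[OF this, of 1] show "?P \<noteq> {}" by auto
    fix p assume "p \<in> ?P"
    then obtain x y \<zeta> \<eta> w w' where p: "p = (x, y, \<zeta>, \<eta>, w, w')" "\<zeta> \<in> \<H>" "\<eta> \<in> \<K>" "w \<in> DU" "w' \<in> DU"
      by blast
    note p = p(1) subsetD[OF H(2) p(2)] subsetD[OF K(2) p(3)] subsetD[OF DU(2) p(4)] subsetD[OF DU(2) p(5)]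
    have "(x, y, law M \<zeta>, law M \<eta>, w, w') \<in> dom6 U" using p law_P2[OF prob_space_axioms] by (auto simp: dom6_def)
    from fm[OF this] have [measurable]: "(\<lambda>t. fn c (\<tau> t) (x, y, law M \<zeta>, law M \<eta>, w, w')) \<in> borel_measurable N" .
    have "(\<lambda>z. fn c (\<tau> (fst z)) (x, y, law M \<zeta>, law M \<eta>, w, w')) \<in> borel_measurable (N \<Otimes>\<^sub>M M)" by measurable
    then show "?F p \<in> borel_measurable (N \<Otimes>\<^sub>M M)" unfolding p by (simp add: case_prod_unfold)
    have [measurable]: "\<zeta> \<in> borel_measurable M" "\<eta> \<in> borel_measurable M" using p by (auto simp: L2_iff)
    have mX: "(\<lambda>z. X (fst z) (snd z)) \<in> borel_measurable (N \<Otimes>\<^sub>M M)" "(\<lambda>z. Xd (fst z) (snd z)) \<in> borel_measurable (N \<Otimes>\<^sub>M M)"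
       "(\<lambda>z. v (fst z) (snd z)) \<in> borel_measurable (N \<Otimes>\<^sub>M M)" "(\<lambda>z. vd (fst z) (snd z)) \<in> borel_measurable (N \<Otimes>\<^sub>M M)"
      using m by (simp_all add: case_prod_unfold)
    note [measurable] = mX m
    have n: "(\<lambda>t. L2_norm M (\<lambda>\<omega>. \<theta> \<omega> - W t \<omega>)) \<in> borel_measurable N"
      if [measurable]: "\<theta> \<in> borel_measurable M" and W: "(\<lambda>z. W (fst z) (snd z)) \<in> borel_measurable (N \<Otimes>\<^sub>M M)"
      for \<theta> and W :: "'s \<Rightarrow> 'a \<Rightarrow> real^'n"
    proof -
      note [measurable] = W
      have "(\<lambda>(t, \<omega>). (norm (\<theta> \<omega> - W t \<omega>))\<^sup>2) \<in> borel_measurable (N \<Otimes>\<^sub>M M)"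
        unfolding case_prod_unfold by measurable
      from borel_measurable_lebesgue_integral[OF this] show ?thesis unfolding L2_norm_def by measurable
    qed
    note [measurable] = n[OF _ mX(1), of \<zeta>] n[OF _ mX(2), of \<eta>]
    have "(\<lambda>z. norm (x - X (fst z) (snd z)) + norm (y - Xd (fst z) (snd z)) + L2_norm M (\<lambda>\<omega>. \<zeta> \<omega> - X (fst z) \<omega>)
     + L2_norm M (\<lambda>\<omega>. \<eta> \<omega> - Xd (fst z) \<omega>) + norm (w - v (fst z) (snd z)) + norm (w' - vd (fst z) (snd z))) \<in> borel_measurable (N \<Otimes>\<^sub>M M)"
      by measurable
    then show "?d p \<in> borel_measurable (N \<Otimes>\<^sub>M M)" unfolding p by (simp add: case_prod_unfold)
  next
    fix z and e :: real assume zz: "z \<in> space (N \<Otimes>\<^sub>M M)" and e: "0 < e"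
    show "\<exists>p\<in>?P. ?d p z < e" by (rule dense[OF zz e])
    obtain t \<omega> where z: "z = (t, \<omega>)" "t \<in> space N" "\<omega> \<in> space M" using zz by (auto simp: space_pair_measure)
    interpret lifted_coefficient M U a L C c "\<tau> t" by (rule coeff[OF z(2)])
    let ?\<Theta> = "(X t \<omega>, Xd t \<omega>, law M (X t), law M (Xd t), v t \<omega>, vd t \<omega>)"
    \<comment> \<open>Majorant of \<open>C * Gr\<close> over all frozen points at distance at most
      1; it depends on the point \<open>z\<close> alone.\<close>
    define b where "b = C * (1 + a * (norm (X t \<omega>) + norm (Xd t \<omega>) + norm (v t \<omega>) + norm (vd t \<omega>) + 1))"
    have b0: "0 \<le> b" unfolding b_def using nn by (intro mult_nonneg_nonneg add_nonneg_nonneg) auto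
    have est: "norm (?F p z - fn c (\<tau> t) ?\<Theta>) \<le> b * ?d p z" if pP: "p \<in> ?P" and d1: "?d p z \<le> 1" for p
    proof -
      obtain x y \<zeta> \<eta> w w' where p: "p = (x, y, \<zeta>, \<eta>, w, w')" "\<zeta> \<in> \<H>" "\<eta> \<in> \<K>" "w \<in> DU" "w' \<in> DU"
        using pP by blast
      note p = p(1) subsetD[OF H(2) p(2)] subsetD[OF K(2) p(3)] subsetD[OF DU(2) p(4)] subsetD[OF DU(2) p(5)]
      interpret cp: coefficient_path M U a L C c "\<tau> t" "X t \<omega>" "Xd t \<omega>" "X t" "Xd t" "v t \<omega>" "vd t \<omega>"
        "x - X t \<omega>" "y - Xd t \<omega>" "\<lambda>\<omega>'. \<zeta> \<omega>' - X t \<omega>'" "\<lambda>\<omega>'. \<eta> \<omega>' - Xd t \<omega>'" "w - v t \<omega>" "w' - vd t \<omega>"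
        by unfold_locales (use p L z U in \<open>auto intro!: L2_diff\<close>)
      have dK: "?d p z = cp.K" unfolding p z cp.K_def by simp
      have "norm (?F p z - fn c (\<tau> t) ?\<Theta>) \<le> C * cp.Gr * cp.K"
        using cp.growth_bound unfolding p z by simp
      also have "\<dots> \<le> b * cp.K"
      proof (rule mult_right_mono[OF _ cp.K_ge(7)])
        have "norm (x - X t \<omega>) + norm (y - Xd t \<omega>) + norm (w - v t \<omega>) + norm (w' - vd t \<omega>) \<le> cp.K"
          unfolding cp.K_def using L2_norm_nonneg[of M "\<lambda>\<omega>'. \<zeta> \<omega>' - X t \<omega>'"] L2_norm_nonneg[of M "\<lambda>\<omega>'. \<eta> \<omega>' - Xd t \<omega>'"] by linarith
        then have "norm (X t \<omega>) + norm (x - X t \<omega>) + norm (Xd t \<omega>) + norm (y - Xd t \<omega>) + norm (v t \<omega>) + norm (w - v t \<omega>)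
            + norm (vd t \<omega>) + norm (w' - vd t \<omega>) \<le> norm (X t \<omega>) + norm (Xd t \<omega>) + norm (v t \<omega>) + norm (vd t \<omega>) + 1"
          using d1 unfolding dK by linarith
        then show "C * cp.Gr \<le> b" unfolding b_def cp.Gr_def using nn by (intro mult_left_mono add_left_mono) auto
      qed
      finally show ?thesis unfolding dK .
    qed
    show "\<exists>r>0. \<forall>p\<in>?P. ?d p z < r \<longrightarrow> dist (?F p z) (case z of (t, \<omega>) \<Rightarrow> fn c (\<tau> t) (X t \<omega>, Xd t \<omega>, law M (X t), law M (Xd t), v t \<omega>, vd t \<omega>)) < e"
    proof (intro exI[of _ "min 1 (e / (b + 1))"] conjI ballI impI)
      show "0 < min 1 (e / (b + 1))" using e b0 by simp
      fix p assume pP: "p \<in> ?P" and d: "?d p z < min 1 (e / (b + 1))"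
      have d0: "0 \<le> ?d p z" by (cases p; cases z) (auto intro!: add_nonneg_nonneg)
      have "norm (?F p z - fn c (\<tau> t) ?\<Theta>) \<le> b * ?d p z" using est[OF pP] d by simp
      also have "\<dots> \<le> (b + 1) * ?d p z" using d0 by (intro mult_right_mono) auto
      also have "\<dots> < e" using d b0 by (simp add: field_simps)
      finally show "dist (?F p z) (case z of (t, \<omega>) \<Rightarrow> fn c (\<tau> t) (X t \<omega>, Xd t \<omega>, law M (X t), law M (Xd t), v t \<omega>, vd t \<omega>)) < e"
        unfolding z by (simp add: dist_norm)
    qed
  qed
qed

section \<open>Adjoint derivatives and conditional expectation\<close>

lemma (in pair_sigma_finite) integrable_product_mult:
  fixes f :: "'a \<Rightarrow> real" and g :: "'b \<Rightarrow> real"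
  assumes f: "integrable M1 f" and g: "integrable M2 g"
  shows "integrable (M1 \<Otimes>\<^sub>M M2) (\<lambda>z. f (fst z) * g (snd z))"
proof (rule Fubini_integrable)
  have [measurable]: "f \<in> borel_measurable M1" "g \<in> borel_measurable M2" using f g by auto
  show "(\<lambda>z. f (fst z) * g (snd z)) \<in> borel_measurable (M1 \<Otimes>\<^sub>M M2)" by measurable
  show "integrable M1 (\<lambda>x. \<integral>y. norm (f (fst (x, y)) * g (snd (x, y))) \<partial>M2)"
    using f by (simp add: abs_mult)
  show "AE x in M1. integrable M2 (\<lambda>y. f (fst (x, y)) * g (snd (x, y)))" using g by simp
qed

lemma borel_measurable_vec_nth [measurable (raw)]:
  fixes f :: "'a \<Rightarrow> ('b::{second_countable_topology,real_normed_vector})^'n"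
  assumes "f \<in> borel_measurable M"
  shows "(\<lambda>x. f x $ i) \<in> borel_measurable M"
  by (rule borel_measurable_continuous_on[OF _ assms]) (intro continuous_intros)

lemma tr_inner: "tr A p \<bullet> h = p \<bullet> blinfun_apply A h"
  using adjoint_works[OF bounded_linear.linear[OF blinfun.bounded_linear_right], of h A p]
  by (simp add: inner_commute)

lemma norm_tr_le: "norm (tr A p) \<le> norm A * norm p"
proof (cases "tr A p = 0")
  case False
  have "norm (tr A p) * norm (tr A p) = p \<bullet> blinfun_apply A (tr A p)"
    by (simp add: tr_inner[symmetric] power2_norm_eq_inner[symmetric] power2_eq_square)
  also have "\<dots> \<le> norm p * norm (blinfun_apply A (tr A p))" by (rule norm_cauchy_schwarz)
  also have "\<dots> \<le> norm p * (norm A * norm (tr A p))" by (intro mult_left_mono norm_blinfun) auto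
  finally show ?thesis using False by (simp add: mult.assoc[symmetric] mult.commute)
qed simp

text \<open>The inner products of the adjoint with basis vectors are evaluations of
  \<open>A x\<close> paired with \<open>p x\<close>; hence the assumption on fixed vectors
  \<open>h\<close>.\<close>

lemma borel_measurable_tr:
  fixes A :: "'a \<Rightarrow> 'b::euclidean_space \<Rightarrow>\<^sub>L 'c::euclidean_space"
  assumes [measurable]: "\<And>h. (\<lambda>x. blinfun_apply (A x) h) \<in> borel_measurable M" "p \<in> borel_measurable M"
  shows "(\<lambda>x. tr (A x) (p x)) \<in> borel_measurable M"
  by (subst borel_measurable_euclidean_space) (simp add: tr_inner)

lemma measurable_continuous_compose:
  fixes g :: "'b::topological_space \<Rightarrow> 'c::topological_space"
  assumes "continuous_on S g" "f \<in> borel_measurable M" "\<And>x. x \<in> space M \<Longrightarrow> f x \<in> S"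
  shows "(\<lambda>x. g (f x)) \<in> borel_measurable M"
proof -
  have "f \<in> M \<rightarrow>\<^sub>M restrict_space borel S" using assms by (intro measurable_restrict_space2) auto
  from measurable_compose[OF this borel_measurable_continuous_on_restrict[OF assms(1)]] show ?thesis .
qed

lemma continuous_on_of_lipschitz:
  fixes g :: "'b::real_normed_vector \<Rightarrow> 'c::real_normed_vector"
  assumes "\<And>x y. x \<in> S \<Longrightarrow> y \<in> S \<Longrightarrow> norm (g x - g y) \<le> L * norm (x - y)"
  shows "continuous_on S g"
proof -
  \<comment> \<open>\<open>lipschitz_on\<close> demands a nonnegative constant.\<close>
  have "(max L 0)-lipschitz_on S g"
  proof (rule lipschitz_onI)
    fix x y assume "x \<in> S" "y \<in> S"
    then have "dist (g x) (g y) \<le> L * dist x y" using assms by (simp add: dist_norm)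
    also have "\<dots> \<le> max L 0 * dist x y" by (intro mult_right_mono) auto
    finally show "dist (g x) (g y) \<le> max L 0 * dist x y" .
  qed simp
  then show ?thesis by (rule lipschitz_on_continuous_on)
qed

lemma sum4_norm_le: "norm x + norm y + norm v + norm w \<le> 4 * norm (x, y, v, w)"
proof -
  have 1: "norm x \<le> norm (x, y, v, w)" by (rule norm_fst_le[of x "(y, v, w)"])
  have 2: "norm (y, v, w) \<le> norm (x, y, v, w)" by (rule norm_snd_le[of "(y, v, w)" x])
  have 3: "norm y \<le> norm (y, v, w)" by (rule norm_fst_le[of y "(v, w)"])
  have 4: "norm (v, w) \<le> norm (y, v, w)" by (rule norm_snd_le[of "(v, w)" y])
  have 5: "norm v \<le> norm (v, w)" "norm w \<le> norm (v, w)" by (rule norm_fst_le norm_snd_le)+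
  show ?thesis using 1 2 3 4 5 by linarith
qed

section \<open>Measurability of coefficients and derivatives at a fixed time\<close>

context lifted_coefficient
begin

abbreviation "Th X Xd v vd \<omega> \<equiv> (X \<omega>, Xd \<omega>, law M X, law M Xd, v \<omega>, vd \<omega>)"

lemma growth_nonneg: "1 \<le> growth a z"
  unfolding growth_def using nn(1) by (cases z) (simp add: add_nonneg_nonneg mult_nonneg_nonneg)

text \<open>\<open>growth_bound\<close> for the path that joins the two points.\<close>

lemma growth_lipschitz:
  assumes "\<zeta> \<in> L2 M M" "\<eta> \<in> L2 M M" "\<zeta>' \<in> L2 M M" "\<eta>' \<in> L2 M M" "v \<in> U" "vd \<in> U" "v' \<in> U" "vd' \<in> U"
  shows "norm (fn c t (x', xd', law M \<zeta>', law M \<eta>', v', vd') - fn c t (x, xd, law M \<zeta>, law M \<eta>, v, vd))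
    \<le> C * (1 + a * (norm x + norm (x' - x) + norm xd + norm (xd' - xd) + norm v + norm (v' - v) + norm vd + norm (vd' - vd)))
       * (norm (x' - x) + norm (xd' - xd) + L2_norm M (\<lambda>\<omega>. \<zeta>' \<omega> - \<zeta> \<omega>) + L2_norm M (\<lambda>\<omega>. \<eta>' \<omega> - \<eta> \<omega>) + norm (v' - v) + norm (vd' - vd))"
proof -
  interpret cp: coefficient_path M U a L C c t x xd \<zeta> \<eta> v vd
    "x' - x" "xd' - xd" "\<lambda>\<omega>. \<zeta>' \<omega> - \<zeta> \<omega>" "\<lambda>\<omega>. \<eta>' \<omega> - \<eta> \<omega>" "v' - v" "vd' - vd"
    by unfold_locales (use assms in \<open>auto intro!: L2_diff\<close>)
  show ?thesis using cp.growth_bound unfolding cp.Gr_def cp.K_def by simp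
qed

text \<open>At a fixed time the laws are constants, and the coefficient is continuous in the
  remaining four vectors. The sigma-algebra of \<open>N\<close> is left open, so that
  \<open>N = F t\<close> yields adaptedness.\<close>

lemma fn_measurable:
  assumes L: "X \<in> L2 M M" "Xd \<in> L2 M M" and N: "space N = space M"
    and [measurable]: "X \<in> borel_measurable N" "Xd \<in> borel_measurable N" "v \<in> borel_measurable N" "vd \<in> borel_measurable N"
    and U: "\<And>\<omega>. \<omega> \<in> space M \<Longrightarrow> v \<omega> \<in> U" "\<And>\<omega>. \<omega> \<in> space M \<Longrightarrow> vd \<omega> \<in> U"
  shows "(\<lambda>\<omega>. fn c t (Th X Xd v vd \<omega>)) \<in> borel_measurable N"
proof -
  let ?S = "UNIV \<times> UNIV \<times> U \<times> U :: ((real^'n) \<times> (real^'n) \<times> (real^'k) \<times> (real^'k)) set"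
  let ?g = "\<lambda>(x, xd, v, vd). fn c t (x, xd, law M X, law M Xd, v, vd)"
  have "continuous_on ?S ?g"
    unfolding continuous_on_iff
  proof (intro ballI allI impI)
    fix z and e :: real assume z: "z \<in> ?S" and e: "0 < e"
    obtain x xd v vd where z': "z = (x, xd, v, vd)" "v \<in> U" "vd \<in> U" using z by auto
    \<comment> \<open>The inner 4 bounds the four increments within distance 1, the outer 4 the
      ratio between a sum of four norms and the norm of the tuple.\<close>
    define k where "k = C * (1 + a * (norm x + norm xd + norm v + norm vd + 4)) * 4"
    have k: "0 \<le> k" unfolding k_def using nn by (intro mult_nonneg_nonneg add_nonneg_nonneg) auto
    show "\<exists>d>0. \<forall>y\<in>?S. dist y z < d \<longrightarrow> dist (?g y) (?g z) < e"
    proof (intro exI[of _ "min 1 (e / (k + 1))"] conjI ballI impI)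
      show "0 < min 1 (e / (k + 1))" using e k by simp
      fix y assume y: "y \<in> ?S" and d: "dist y z < min 1 (e / (k + 1))"
      obtain x' xd' v' vd' where y': "y = (x', xd', v', vd')" "v' \<in> U" "vd' \<in> U" using y by auto
      let ?s = "norm (x' - x) + norm (xd' - xd) + norm (v' - v) + norm (vd' - vd)"
      have s: "?s \<le> 4 * dist y z"
        using sum4_norm_le[of "x' - x" "xd' - xd" "v' - v" "vd' - vd"] by (simp add: dist_norm z' y')
      have s0: "0 \<le> ?s" by (intro add_nonneg_nonneg norm_ge_zero)
      have "dist (?g y) (?g z) \<le> C * (1 + a * (norm x + norm (x' - x) + norm xd + norm (xd' - xd) + norm v + norm (v' - v) + norm vd + norm (vd' - vd))) * ?s"
        using growth_lipschitz[OF L L z'(2,3) y'(2,3), of x' xd' x xd] by (simp add: dist_norm z' y' L2_norm_def)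
      also have "\<dots> \<le> C * (1 + a * (norm x + norm xd + norm v + norm vd + 4)) * ?s"
        using s d nn s0 by (intro mult_right_mono mult_left_mono add_left_mono) auto
      also have "\<dots> \<le> C * (1 + a * (norm x + norm xd + norm v + norm vd + 4)) * (4 * dist y z)"
        using s k unfolding k_def by (intro mult_left_mono) auto
      also have "\<dots> = k * dist y z" by (simp add: k_def)
      also have "\<dots> \<le> (k + 1) * dist y z" by (intro mult_right_mono) auto
      also have "\<dots> < e" using d k by (simp add: field_simps)
      finally show "dist (?g y) (?g z) < e" .
    qed
  qed
  from measurable_continuous_compose[OF this, of "\<lambda>\<omega>. (X \<omega>, Xd \<omega>, v \<omega>, vd \<omega>)" N]
  show ?thesis using U N by simp
qed

text \<open>With frozen laws the derivatives are Lipschitz in the vector arguments. Measure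
  derivatives are treated jointly in \<open>\<omega>\<close> and in the copy variable that enters
  through \<open>W\<close>, as the later exchange of integrals requires.\<close>

lemma derivative_measurable:
  assumes L: "X \<in> L2 M M" "Xd \<in> L2 M M"
    and [measurable]: "v \<in> borel_measurable M" "vd \<in> borel_measurable M"
    and U: "\<And>\<omega>. \<omega> \<in> space M \<Longrightarrow> v \<omega> \<in> U" "\<And>\<omega>. \<omega> \<in> space M \<Longrightarrow> vd \<omega> \<in> U"
  shows "D \<in> {D_x c t, D_xd c t} \<Longrightarrow> (\<lambda>\<omega>. D (Th X Xd v vd \<omega>)) \<in> borel_measurable M"
    and "D' \<in> {D_v c t, D_vd c t} \<Longrightarrow> (\<lambda>\<omega>. D' (Th X Xd v vd \<omega>)) \<in> borel_measurable M"
    and "E \<in> {D_mu c t, D_mud c t} \<Longrightarrow> W \<in> borel_measurable M \<Longrightarrow>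
      (\<lambda>z. E (Th X Xd v vd (fst z)) (W (snd z))) \<in> borel_measurable (M \<Otimes>\<^sub>M M)"
    and "E \<in> {D_mu c t, D_mud c t} \<Longrightarrow> (\<lambda>\<omega>. E (Th X Xd v vd \<omega>) y) \<in> borel_measurable M"
proof -
  have [measurable]: "X \<in> borel_measurable M" "Xd \<in> borel_measurable M" using L by (auto simp: L2_iff)
  let ?S = "UNIV \<times> UNIV \<times> U \<times> U :: ((real^'n) \<times> (real^'n) \<times> (real^'k) \<times> (real^'k)) set"
  have le: "L * (norm (x - x') + norm (xd - xd') + norm (v - v') + norm (vd - vd')) \<le> (4 * L) * norm ((x, xd, v, vd) - (x', xd', v', vd'))"
    for x xd x' xd' :: "real^'n" and v vd v' vd' :: "real^'k"
    using mult_left_mono[OF sum4_norm_le[of "x - x'" "xd - xd'" "v - v'" "vd - vd'"] nn(2)] by simp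
  {
    assume D: "D \<in> {D_x c t, D_xd c t}"
    have "continuous_on ?S (\<lambda>(x, xd, v, vd). D (x, xd, law M X, law M Xd, v, vd))"
    proof (rule continuous_on_of_lipschitz[where L="4 * L"])
      fix z z' :: "(real^'n) \<times> (real^'n) \<times> (real^'k) \<times> (real^'k)"
      assume "z \<in> ?S" "z' \<in> ?S"
      then obtain x xd v vd x' xd' v' vd' where z: "z = (x, xd, v, vd)" "z' = (x', xd', v', vd')"
        "v \<in> U" "vd \<in> U" "v' \<in> U" "vd' \<in> U" by auto
      show "norm ((case z of (x, xd, v, vd) \<Rightarrow> D (x, xd, law M X, law M Xd, v, vd))
          - (case z' of (x, xd, v, vd) \<Rightarrow> D (x, xd, law M X, law M Xd, v, vd))) \<le> 4 * L * norm (z - z')"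
        unfolding z(1,2) prod.case
        by (rule order_trans[OF _ le]) (use lip[OF L z(3,4) L z(5,6) D, of x xd x' xd'] in \<open>simp add: L2_norm_def\<close>)
    qed
    from measurable_continuous_compose[OF this, of "\<lambda>\<omega>. (X \<omega>, Xd \<omega>, v \<omega>, vd \<omega>)" M]
    show "(\<lambda>\<omega>. D (Th X Xd v vd \<omega>)) \<in> borel_measurable M" using U by simp
  next
    assume D: "D' \<in> {D_v c t, D_vd c t}"
    have "continuous_on ?S (\<lambda>(x, xd, v, vd). D' (x, xd, law M X, law M Xd, v, vd))"
    proof (rule continuous_on_of_lipschitz[where L="4 * L"])
      fix z z' :: "(real^'n) \<times> (real^'n) \<times> (real^'k) \<times> (real^'k)"
      assume "z \<in> ?S" "z' \<in> ?S"
      then obtain x xd v vd x' xd' v' vd' where z: "z = (x, xd, v, vd)" "z' = (x', xd', v', vd')"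
        "v \<in> U" "vd \<in> U" "v' \<in> U" "vd' \<in> U" by auto
      show "norm ((case z of (x, xd, v, vd) \<Rightarrow> D' (x, xd, law M X, law M Xd, v, vd))
          - (case z' of (x, xd, v, vd) \<Rightarrow> D' (x, xd, law M X, law M Xd, v, vd))) \<le> 4 * L * norm (z - z')"
        unfolding z(1,2) prod.case
        by (rule order_trans[OF _ le]) (use lip_v[OF L z(3,4) L z(5,6) D, of x xd x' xd'] in \<open>simp add: L2_norm_def\<close>)
    qed
    from measurable_continuous_compose[OF this, of "\<lambda>\<omega>. (X \<omega>, Xd \<omega>, v \<omega>, vd \<omega>)" M]
    show "(\<lambda>\<omega>. D' (Th X Xd v vd \<omega>)) \<in> borel_measurable M" using U by simp
  next
    assume E: "E \<in> {D_mu c t, D_mud c t}"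
    let ?g = "\<lambda>((x, xd, v, vd), y). E (x, xd, law M X, law M Xd, v, vd) y"
    have ce: "continuous_on (?S \<times> UNIV) ?g"
    proof (rule continuous_on_of_lipschitz[where L="5 * L"])
      fix z z' :: "((real^'n) \<times> (real^'n) \<times> (real^'k) \<times> (real^'k)) \<times> (real^'n)"
      assume "z \<in> ?S \<times> UNIV" "z' \<in> ?S \<times> UNIV"
      then obtain x xd v vd y x' xd' v' vd' y' where z: "z = ((x, xd, v, vd), y)" "z' = ((x', xd', v', vd'), y')"
        "v \<in> U" "vd \<in> U" "v' \<in> U" "vd' \<in> U" by auto
      have "norm (?g z - ?g z') \<le> L * (norm (x - x') + norm (xd - xd') + norm (v - v') + norm (vd - vd') + norm (y - y'))"
        using lip_y[OF L z(3,4) L z(5,6) E, of x xd y x' xd' y'] by (simp add: z L2_norm_def)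
      also have "\<dots> \<le> L * (4 * norm (fst z - fst z') + norm (snd z - snd z'))"
        using sum4_norm_le[of "x - x'" "xd - xd'" "v - v'" "vd - vd'"] nn(2) by (intro mult_left_mono) (auto simp: z)
      also have "\<dots> \<le> L * (5 * norm (z - z'))"
        using norm_fst_le[of "fst z - fst z'" "snd z - snd z'"] norm_snd_le[of "snd z - snd z'" "fst z - fst z'"] nn(2)
        by (intro mult_left_mono) (auto simp: minus_prod_def)
      finally show "norm (?g z - ?g z') \<le> 5 * L * norm (z - z')" by simp
    qed
    show "(\<lambda>z. E (Th X Xd v vd (fst z)) (W (snd z))) \<in> borel_measurable (M \<Otimes>\<^sub>M M)"
      if [measurable]: "W \<in> borel_measurable M"
    proof -
      have "(\<lambda>z. ((X (fst z), Xd (fst z), v (fst z), vd (fst z)), W (snd z))) \<in> borel_measurable (M \<Otimes>\<^sub>M M)"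
        by measurable
      from measurable_continuous_compose[OF ce this] show ?thesis using U by (simp add: space_pair_measure mem_Times_iff)
    qed
    have "(\<lambda>\<omega>. ((X \<omega>, Xd \<omega>, v \<omega>, vd \<omega>), y)) \<in> borel_measurable M" by measurable
    from measurable_continuous_compose[OF ce this] show "(\<lambda>\<omega>. E (Th X Xd v vd \<omega>) y) \<in> borel_measurable M" using U by simp
  }
qed

end

text \<open>\<open>P\<close> is the multiplier with which the coefficient enters the Hamiltonian:
  \<open>p\<close> for \<open>b\<close>, \<open>q\<close> for \<open>\<sigma>\<close>, the constant
  1 for the costs. The weighted square-integrability makes the transposed derivatives applied to
  \<open>P\<close> square-integrable.\<close>

locale weighted_coefficient = lifted_coefficient M U a L C c t
  for M :: "'a measure" and U :: "(real^'k::finite) set" and a L C :: real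
    and c :: "('n::finite, 'k, 'c::euclidean_space) coefficient" and t :: real +
  fixes X Xd :: "'a \<Rightarrow> real^'n" and v vd :: "'a \<Rightarrow> real^'k" and P :: "'a \<Rightarrow> 'c"
  assumes XL: "X \<in> L2 M M" "Xd \<in> L2 M M"
    and vm [measurable]: "v \<in> borel_measurable M" "vd \<in> borel_measurable M"
    and vU: "\<And>\<omega>. \<omega> \<in> space M \<Longrightarrow> v \<omega> \<in> U" "\<And>\<omega>. \<omega> \<in> space M \<Longrightarrow> vd \<omega> \<in> U"
    and P [measurable]: "P \<in> borel_measurable M"
    and w: "(\<lambda>\<omega>. growth a (Th X Xd v vd \<omega>) * norm (P \<omega>)) \<in> L2 M M"
begin

abbreviation "\<Theta> \<equiv> Th X Xd v vd"
definition "w \<omega> = growth a (\<Theta> \<omega>) * norm (P \<omega>)"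

lemma w_nonneg: "0 \<le> w \<omega>"
  unfolding w_def using growth_nonneg[of "\<Theta> \<omega>"] by simp

lemma w_L2: "w \<in> L2 M M"
  using w unfolding w_def .

lemma norm_D_P_le:
  assumes "norm A \<le> C * growth a (\<Theta> \<omega>)"
  shows "norm (A :: 'z::real_normed_vector \<Rightarrow>\<^sub>L 'c) * norm (P \<omega>) \<le> C * w \<omega>"
  using mult_right_mono[OF assms norm_ge_zero[of "P \<omega>"]] by (simp add: w_def mult.assoc)

lemma derivative_term:
  fixes D :: "('n, 'k) args6 \<Rightarrow> 'z::euclidean_space \<Rightarrow>\<^sub>L 'c"
  assumes Dm: "(\<lambda>\<omega>. D (\<Theta> \<omega>)) \<in> borel_measurable M"
    and Dg: "\<And>\<omega>. \<omega> \<in> space M \<Longrightarrow> norm (D (\<Theta> \<omega>)) \<le> C * growth a (\<Theta> \<omega>)"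
  shows "(\<lambda>\<omega>. tr (D (\<Theta> \<omega>)) (P \<omega>)) \<in> L2 M M"
    and "\<And>\<omega>. \<omega> \<in> space M \<Longrightarrow> norm (tr (D (\<Theta> \<omega>)) (P \<omega>)) \<le> C * w \<omega>"
    and "h \<in> L2 M M \<Longrightarrow> integrable M (\<lambda>\<omega>. P \<omega> \<bullet> blinfun_apply (D (\<Theta> \<omega>)) (h \<omega>))"
proof -
  show b: "norm (tr (D (\<Theta> \<omega>)) (P \<omega>)) \<le> C * w \<omega>" if "\<omega> \<in> space M" for \<omega>
    by (rule order_trans[OF norm_tr_le norm_D_P_le[OF Dg[OF that]]])
  note [measurable] = Dm
  have m: "(\<lambda>\<omega>. tr (D (\<Theta> \<omega>)) (P \<omega>)) \<in> borel_measurable M"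
    by (rule borel_measurable_tr) measurable
  show l: "(\<lambda>\<omega>. tr (D (\<Theta> \<omega>)) (P \<omega>)) \<in> L2 M M"
    by (rule L2_bound[OF m w_L2, where C=C]) (use b w_nonneg in \<open>auto intro!: AE_I2\<close>)
  show "integrable M (\<lambda>\<omega>. P \<omega> \<bullet> blinfun_apply (D (\<Theta> \<omega>)) (h \<omega>))" if "h \<in> L2 M M"
    using L2_integrable_inner[OF l that] by (simp add: tr_inner)
qed

lemma space_derivative_term:
  assumes D: "D \<in> {D_x c t, D_xd c t}"
  shows "(\<lambda>\<omega>. tr (D (\<Theta> \<omega>)) (P \<omega>)) \<in> L2 M M"
    and "\<And>\<omega>. \<omega> \<in> space M \<Longrightarrow> norm (tr (D (\<Theta> \<omega>)) (P \<omega>)) \<le> C * w \<omega>"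
    and "h \<in> L2 M M \<Longrightarrow> integrable M (\<lambda>\<omega>. P \<omega> \<bullet> blinfun_apply (D (\<Theta> \<omega>)) (h \<omega>))"
  by (rule derivative_term[OF derivative_measurable(1)[OF XL vm vU D] gr[OF XL vU D]], assumption+)+

lemma control_derivative_term:
  assumes D: "D \<in> {D_v c t, D_vd c t}"
  shows "(\<lambda>\<omega>. tr (D (\<Theta> \<omega>)) (P \<omega>)) \<in> L2 M M"
    and "h \<in> L2 M M \<Longrightarrow> integrable M (\<lambda>\<omega>. P \<omega> \<bullet> blinfun_apply (D (\<Theta> \<omega>)) (h \<omega>))"
  by (rule derivative_term[OF derivative_measurable(2)[OF XL vm vU D] gr_v[OF XL vU D]], assumption+)+

text \<open>Fubini on two copies of the space, the integrand being dominated by the product of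
  \<open>w \<omega>\<close> and \<open>norm (h \<omega>')\<close>. Expanding the Hamiltonian
  averages the direction \<open>h\<close> over the copy, while the adjoint equation averages the
  multiplier \<open>P\<close>; the last claim converts one into the other.\<close>

lemma measure_derivative_term:
  assumes D: "D \<in> {D_mu c t, D_mud c t}" and W: "W \<in> L2 M M" and h: "h \<in> L2 M M"
  shows "integrable M (\<lambda>\<omega>'. tr (D (\<Theta> \<omega>') y) (P \<omega>'))"
    and "norm (\<integral>\<omega>'. tr (D (\<Theta> \<omega>') y) (P \<omega>') \<partial>M) \<le> C * (\<integral>\<omega>. w \<omega> \<partial>M)"
    and "integrable M (\<lambda>\<omega>. P \<omega> \<bullet> (\<integral>\<omega>'. blinfun_apply (D (\<Theta> \<omega>) (W \<omega>')) (h \<omega>') \<partial>M))"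
    and "integrable M (\<lambda>\<omega>. (\<integral>\<omega>'. tr (D (\<Theta> \<omega>') (W \<omega>)) (P \<omega>') \<partial>M) \<bullet> h \<omega>)"
    and "(\<integral>\<omega>. P \<omega> \<bullet> (\<integral>\<omega>'. blinfun_apply (D (\<Theta> \<omega>) (W \<omega>')) (h \<omega>') \<partial>M) \<partial>M)
        = (\<integral>\<omega>. (\<integral>\<omega>'. tr (D (\<Theta> \<omega>') (W \<omega>)) (P \<omega>') \<partial>M) \<bullet> h \<omega> \<partial>M)"
proof -
  interpret MM: pair_sigma_finite M M ..
  have [measurable]: "W \<in> borel_measurable M" "h \<in> borel_measurable M" using W h by (auto simp: L2_iff)
  note [measurable] = derivative_measurable(3)[OF XL vm vU D, of W]
  have g: "norm (D (\<Theta> \<omega>) y) \<le> C * growth a (\<Theta> \<omega>)" if "\<omega> \<in> space M" for \<omega> y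
    by (rule gr_y[OF XL vU D]) (use that in auto)
  have b: "norm (tr (D (\<Theta> \<omega>) y) (P \<omega>)) \<le> C * w \<omega>" if "\<omega> \<in> space M" for \<omega> y
    by (rule order_trans[OF norm_tr_le norm_D_P_le[OF g[OF that]]])
  have wi: "integrable M w" by (rule L2_integrable1[OF w_L2])
  have m1: "(\<lambda>\<omega>'. tr (D (\<Theta> \<omega>') y) (P \<omega>')) \<in> borel_measurable M" for y
  proof (rule borel_measurable_tr)
    have [measurable]: "(\<lambda>\<omega>. D (\<Theta> \<omega>) y) \<in> borel_measurable M" by (rule derivative_measurable(4)[OF XL vm vU D])
    show "(\<lambda>\<omega>. blinfun_apply (D (\<Theta> \<omega>) y) h) \<in> borel_measurable M" for h by measurable
  qed measurable
  show i1: "integrable M (\<lambda>\<omega>'. tr (D (\<Theta> \<omega>') y) (P \<omega>'))" for y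
    by (rule Bochner_Integration.integrable_bound[where f="\<lambda>\<omega>. C * w \<omega>"])
       (use b wi m1 nn w_nonneg in \<open>auto intro!: AE_I2\<close>)
  show "norm (\<integral>\<omega>'. tr (D (\<Theta> \<omega>') y) (P \<omega>') \<partial>M) \<le> C * (\<integral>\<omega>. w \<omega> \<partial>M)"
  proof -
    have "norm (\<integral>\<omega>'. tr (D (\<Theta> \<omega>') y) (P \<omega>') \<partial>M) \<le> (\<integral>\<omega>'. norm (tr (D (\<Theta> \<omega>') y) (P \<omega>')) \<partial>M)"
      by (rule integral_norm_bound)
    also have "\<dots> \<le> (\<integral>\<omega>. C * w \<omega> \<partial>M)"
      by (rule integral_mono) (use i1 wi b in auto)
    finally show ?thesis by simp
  qed
  let ?k = "\<lambda>z. P (fst z) \<bullet> blinfun_apply (D (\<Theta> (fst z)) (W (snd z))) (h (snd z))"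
  have kb: "\<bar>?k z\<bar> \<le> C * (w (fst z) * norm (h (snd z)))" if "z \<in> space (M \<Otimes>\<^sub>M M)" for z
  proof -
    have "\<bar>?k z\<bar> \<le> norm (tr (D (\<Theta> (fst z)) (W (snd z))) (P (fst z))) * norm (h (snd z))"
      unfolding tr_inner[symmetric] by (rule Cauchy_Schwarz_ineq2)
    also have "\<dots> \<le> C * w (fst z) * norm (h (snd z))"
      using that by (intro mult_right_mono b) (auto simp: space_pair_measure)
    finally show ?thesis by (simp add: mult.assoc)
  qed
  have k: "integrable (M \<Otimes>\<^sub>M M) ?k"
  proof (rule Bochner_Integration.integrable_bound)
    show "integrable (M \<Otimes>\<^sub>M M) (\<lambda>z. C * (w (fst z) * norm (h (snd z))))"
      using MM.integrable_product_mult[OF wi integrable_norm[OF L2_integrable1[OF h]]] by simp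
    show "AE z in M \<Otimes>\<^sub>M M. norm (?k z) \<le> norm (C * (w (fst z) * norm (h (snd z))))"
      unfolding real_norm_def by (rule AE_I2) (rule order_trans[OF kb abs_ge_self])
  qed measurable
  have k': "integrable (M \<Otimes>\<^sub>M M) (case_prod (\<lambda>\<omega> \<omega>'. ?k (\<omega>, \<omega>')))" using k by (simp add: case_prod_unfold)
  have e1: "(\<integral>\<omega>'. ?k (\<omega>, \<omega>') \<partial>M) = P \<omega> \<bullet> (\<integral>\<omega>'. blinfun_apply (D (\<Theta> \<omega>) (W \<omega>')) (h \<omega>') \<partial>M)" if w: "\<omega> \<in> space M" for \<omega>
  proof -
    have [measurable]: "D (\<Theta> \<omega>) \<in> borel_measurable borel"
      using dm[OF XL vU(1)[OF w] vU(2)[OF w]] dmd[OF XL vU(1)[OF w] vU(2)[OF w]] D by (auto simp: has_measure_derivative_def)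
    have "integrable M (\<lambda>\<omega>'. blinfun_apply (D (\<Theta> \<omega>) (W \<omega>')) (h \<omega>'))"
    proof (rule L2_integrable_bound_mult[OF h L2_const[of "1::real"], where C="C * growth a (\<Theta> \<omega>)"])
      fix \<omega>'
      show "norm (blinfun_apply (D (\<Theta> \<omega>) (W \<omega>')) (h \<omega>')) \<le> C * growth a (\<Theta> \<omega>) * (norm (h \<omega>') * norm (1::real))"
        using norm_blinfun[of "D (\<Theta> \<omega>) (W \<omega>')" "h \<omega>'"] mult_right_mono[OF g[OF w, of "W \<omega>'"] norm_ge_zero[of "h \<omega>'"]] by simp
    qed measurable
    then show ?thesis by simp
  qed
  have e2: "(\<integral>\<omega>. ?k (\<omega>, \<omega>') \<partial>M) = (\<integral>\<omega>. tr (D (\<Theta> \<omega>) (W \<omega>')) (P \<omega>) \<partial>M) \<bullet> h \<omega>'" for \<omega>'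
    using integral_inner_left[OF i1[of "W \<omega>'"], of "h \<omega>'"] by (simp add: tr_inner)
  show "integrable M (\<lambda>\<omega>. P \<omega> \<bullet> (\<integral>\<omega>'. blinfun_apply (D (\<Theta> \<omega>) (W \<omega>')) (h \<omega>') \<partial>M))"
    using MM.integrable_fst'[OF k] by (subst Bochner_Integration.integrable_cong[OF refl e1[symmetric]])
  show "integrable M (\<lambda>\<omega>. (\<integral>\<omega>'. tr (D (\<Theta> \<omega>') (W \<omega>)) (P \<omega>') \<partial>M) \<bullet> h \<omega>)"
    using MM.integrable_snd[OF k'] unfolding e2 .
  show "(\<integral>\<omega>. P \<omega> \<bullet> (\<integral>\<omega>'. blinfun_apply (D (\<Theta> \<omega>) (W \<omega>')) (h \<omega>') \<partial>M) \<partial>M)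
        = (\<integral>\<omega>. (\<integral>\<omega>'. tr (D (\<Theta> \<omega>') (W \<omega>)) (P \<omega>') \<partial>M) \<bullet> h \<omega> \<partial>M)"
  proof -
    have "(\<integral>\<omega>. P \<omega> \<bullet> (\<integral>\<omega>'. blinfun_apply (D (\<Theta> \<omega>) (W \<omega>')) (h \<omega>') \<partial>M) \<partial>M) = (\<integral>\<omega>. (\<integral>\<omega>'. ?k (\<omega>, \<omega>') \<partial>M) \<partial>M)"
      by (rule Bochner_Integration.integral_cong[OF refl e1[symmetric]])
    also have "\<dots> = (\<integral>\<omega>'. (\<integral>\<omega>. ?k (\<omega>, \<omega>') \<partial>M) \<partial>M)"
      by (rule MM.Fubini_integral[OF k', symmetric])
    finally show ?thesis unfolding e2 .
  qed
qed

end

text \<open>Jensen for the square, componentwise. The contraction bounds the norm of the adjoint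
  driver; the last claim removes the conditional expectation in a pairing with a variable measurable
  for \<open>N\<close>.\<close>

lemma vec_cond_exp_L2:
  fixes Z :: "'a \<Rightarrow> real^'m"
  assumes "prob_space M" "subalgebra M N" and Z: "Z \<in> L2 M M"
  shows "vec_cond_exp M N Z \<in> L2 M M"
    and "(\<integral>\<omega>. (norm (vec_cond_exp M N Z \<omega>))\<^sup>2 \<partial>M) \<le> (\<integral>\<omega>. (norm (Z \<omega>))\<^sup>2 \<partial>M)"
    and "h \<in> L2 M M \<Longrightarrow> h \<in> borel_measurable N \<Longrightarrow> (\<integral>\<omega>. vec_cond_exp M N Z \<omega> \<bullet> h \<omega> \<partial>M) = (\<integral>\<omega>. Z \<omega> \<bullet> h \<omega> \<partial>M)"
proof -
  interpret prob_space M by fact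
  interpret finite_measure_subalgebra M N by unfold_locales fact
  have [measurable]: "Z \<in> borel_measurable M" using Z by (simp add: L2_iff)
  let ?E = "\<lambda>i. real_cond_exp M N (\<lambda>\<omega>. Z \<omega> $ i)"
  have Zi: "(\<lambda>\<omega>. Z \<omega> $ i) \<in> L2 M M" for i
    by (rule L2_bound[OF _ Z, where C=1]) (auto simp: component_le_norm_cart)
  have Zsq: "integrable M (\<lambda>\<omega>. (Z \<omega> $ i)\<^sup>2)" for i using L2_integrable[OF Zi[of i]] by simp
  have cv: "convex_on UNIV (\<lambda>x::real. x\<^sup>2)" by (rule convex_power_even) simp
  have jensen: "AE \<omega> in M. (?E i \<omega>)\<^sup>2 \<le> real_cond_exp M N (\<lambda>\<omega>. (Z \<omega> $ i)\<^sup>2) \<omega>" for i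
    by (rule real_cond_exp_jensens_inequality(2)[where I=UNIV, OF L2_integrable1[OF Zi] _ _ Zsq cv]) auto
  have int_E: "integrable M (\<lambda>\<omega>. (?E i \<omega>)\<^sup>2)" for i
    by (rule Bochner_Integration.integrable_bound[OF real_cond_exp_int(1)[OF Zsq[of i]]])
       (use jensen[of i] in \<open>auto\<close>)
  have le: "(\<integral>\<omega>. (?E i \<omega>)\<^sup>2 \<partial>M) \<le> (\<integral>\<omega>. (Z \<omega> $ i)\<^sup>2 \<partial>M)" for i
  proof -
    have "(\<integral>\<omega>. (?E i \<omega>)\<^sup>2 \<partial>M) \<le> (\<integral>\<omega>. real_cond_exp M N (\<lambda>\<omega>. (Z \<omega> $ i)\<^sup>2) \<omega> \<partial>M)"
      by (rule integral_mono_AE[OF int_E real_cond_exp_int(1)[OF Zsq] jensen])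
    then show ?thesis using real_cond_exp_int(2)[OF Zsq[of i]] by simp
  qed
  have nE: "(norm (vec_cond_exp M N Z \<omega>))\<^sup>2 = (\<Sum>i\<in>UNIV. (?E i \<omega>)\<^sup>2)" for \<omega>
    unfolding power2_norm_eq_inner inner_vec_def by (simp add: vec_cond_exp_def power2_eq_square)
  have nZ: "(norm (Z \<omega>))\<^sup>2 = (\<Sum>i\<in>UNIV. (Z \<omega> $ i)\<^sup>2)" for \<omega>
    unfolding power2_norm_eq_inner inner_vec_def by (simp add: power2_eq_square)
  have m: "vec_cond_exp M N Z \<in> borel_measurable M"
    by (subst borel_measurable_euclidean_space)
       (auto simp: Basis_vec_def inner_axis vec_cond_exp_def cong: measurable_cong)
  show l: "vec_cond_exp M N Z \<in> L2 M M" unfolding L2_iff nE using m int_E by auto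
  show "(\<integral>\<omega>. (norm (vec_cond_exp M N Z \<omega>))\<^sup>2 \<partial>M) \<le> (\<integral>\<omega>. (norm (Z \<omega>))\<^sup>2 \<partial>M)"
    unfolding nE nZ using int_E Zsq le by (simp add: sum_mono)
  show "(\<integral>\<omega>. vec_cond_exp M N Z \<omega> \<bullet> h \<omega> \<partial>M) = (\<integral>\<omega>. Z \<omega> \<bullet> h \<omega> \<partial>M)" if h: "h \<in> L2 M M" and hN: "h \<in> borel_measurable N"
  proof -
    have [measurable]: "h \<in> borel_measurable M" using h by (simp add: L2_iff)
    have hi: "(\<lambda>\<omega>. h \<omega> $ i) \<in> L2 M M" for i
      by (rule L2_bound[OF _ h, where C=1]) (auto simp: component_le_norm_cart)
    have hNi: "(\<lambda>\<omega>. h \<omega> $ i) \<in> borel_measurable N" for i using hN by measurable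
    have i: "integrable M (\<lambda>\<omega>. h \<omega> $ i * Z \<omega> $ i)" for i by (rule L2_integrable_mult[OF hi Zi])
    note r = real_cond_exp_intg[OF i hNi]
    have "(\<integral>\<omega>. vec_cond_exp M N Z \<omega> \<bullet> h \<omega> \<partial>M) = (\<integral>\<omega>. (\<Sum>i\<in>UNIV. h \<omega> $ i * ?E i \<omega>) \<partial>M)"
      by (simp add: inner_vec_def vec_cond_exp_def mult.commute)
    also have "\<dots> = (\<Sum>i\<in>UNIV. \<integral>\<omega>. h \<omega> $ i * Z \<omega> $ i \<partial>M)"
      using r by simp
    also have "\<dots> = (\<integral>\<omega>. Z \<omega> \<bullet> h \<omega> \<partial>M)"
      using i by (simp add: inner_vec_def mult.commute)
    finally show ?thesis .
  qed
qed

text \<open>Divide \<open>\<phi> s - \<phi> 0\<close> by \<open>s\<close> and let \<open>s\<close>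
  tend to 0 from the right: the quadratic remainder disappears, while convexity keeps the quotient
  below \<open>\<phi> 1 - \<phi> 0\<close>.\<close>

lemma convex_gradient_inequality:
  fixes \<phi> :: "real \<Rightarrow> real"
  assumes c: "\<And>s. s \<in> {0..1} \<Longrightarrow> \<phi> s \<le> (1 - s) * \<phi> 0 + s * \<phi> 1"
    and e: "\<And>s. s \<in> {0..1} \<Longrightarrow> \<bar>\<phi> s - \<phi> 0 - s * S\<bar> \<le> k * s\<^sup>2"
  shows "S \<le> \<phi> 1 - \<phi> 0"
proof (rule tendsto_upperbound[where F="at_right (0::real)" and f="\<lambda>s. S - k * s"])
  have "((\<lambda>s. S - k * s) \<longlongrightarrow> S - k * 0) (at_right (0::real))" by (intro tendsto_intros)
  then show "((\<lambda>s. S - k * s) \<longlongrightarrow> S) (at_right (0::real))" by simp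
  have "S - k * s \<le> \<phi> 1 - \<phi> 0" if "0 < s" "s < 1" for s
  proof -
    have "s * S - k * s\<^sup>2 \<le> \<phi> s - \<phi> 0" using e[of s] that by auto
    also have "\<dots> \<le> s * (\<phi> 1 - \<phi> 0)" using c[of s] that by (simp add: algebra_simps)
    finally have "s * (S - k * s) \<le> s * (\<phi> 1 - \<phi> 0)" by (simp add: algebra_simps power2_eq_square)
    then show ?thesis using that by simp
  qed
  then show "\<forall>\<^sub>F s in at_right 0. S - k * s \<le> \<phi> 1 - \<phi> 0"
    unfolding eventually_at_right_field by (intro exI[of _ 1]) auto
qed simp

section \<open>Telescoping over the delay\<close>

lemma AE_lborel_shift:
  assumes "AE t in lborel. P (t::real)"
  shows "AE t in lborel. P (t + s)"
proof -
  have d: "distr lborel borel ((+) s) = (lborel :: real measure)" by (rule lborel_distr_plus)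
  have "AE t in distr lborel borel ((+) s). P t" unfolding d by (rule assms)
  then have "AE t in lborel. P (s + t)" by (rule AE_distrD[rotated]) simp
  then show ?thesis by (simp add: add.commute)
qed

text \<open>The integral over \<open>[0, T]\<close> is folded onto \<open>[0, \<delta>)\<close>. For
  almost every \<open>t\<close> there, the sum of \<open>d (t + k * \<delta>)\<close> over
  \<open>k < n\<close> is at least \<open>G t - G (t + n * \<delta>)\<close>, and both ends vanish.
  As \<open>G\<close> enters only through such sums, it never has to be integrated.\<close>

lemma telescoping_integral_nonneg:
  fixes d G :: "real \<Rightarrow> real"
  assumes \<delta>: "0 < \<delta>" and T: "0 < T"
    and d: "integrable lborel d" "\<And>t. t \<notin> {0..T} \<Longrightarrow> d t = 0"
    and G: "\<And>t. t < \<delta> \<Longrightarrow> G t = 0" "\<And>t. T < t \<Longrightarrow> G t = 0"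
    and le: "AE t in lborel. 0 \<le> t \<longrightarrow> G t - G (t + \<delta>) \<le> d t"
  shows "0 \<le> (\<integral>t. d t \<partial>lborel)"
proof -
  \<comment> \<open>Enough translates to cover \<open>[0, T]\<close>, so that
    \<open>t + n * \<delta>\<close> lies beyond \<open>T\<close> for every
    \<open>t \<ge> 0\<close>.\<close>
  obtain n :: nat where n: "T < n * \<delta>" using reals_Archimedean3[OF \<delta>] by blast
  have shift: "(\<integral>t. indicator {k * \<delta>..<k * \<delta> + \<delta>} t * d t \<partial>lborel) = (\<integral>t. indicator {0..<\<delta>} t * d (t + k * \<delta>) \<partial>lborel)" for k :: nat
    by (subst lborel_integral_real_affine[where c=1 and t="k * \<delta>"])
       (auto simp: indicator_def add.commute intro!: Bochner_Integration.integral_cong)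
  have si: "integrable lborel (\<lambda>t. d (t + k * \<delta>))" for k :: nat
    using lborel_integrable_real_affine[OF d(1), of 1 "k * \<delta>"] by (simp add: add.commute)
  have ii: "integrable lborel (\<lambda>t. indicator S t * d' t)" if "integrable lborel d'" "S \<in> sets borel" for S and d' :: "real \<Rightarrow> real"
    using integrable_mult_indicator[OF _ that(1), of S] that(2) by simp
  have sum_ind: "(\<Sum>k<m. indicator {real k * \<delta>..<real k * \<delta> + \<delta>} t) = (indicator {0..<real m * \<delta>} t :: real)" for m t
  proof (induction m)
    case (Suc m)
    have "(indicator {0..<real m * \<delta>} t :: real) + indicator {real m * \<delta>..<real m * \<delta> + \<delta>} t = indicator {0..<real (Suc m) * \<delta>} t"
      using \<delta> by (auto simp: indicator_def algebra_simps intro: order_trans[OF mult_nonneg_nonneg[of "real m" \<delta>]])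
    then show ?case using Suc by simp
  qed simp
  have "d t = (\<Sum>k<n. indicator {real k * \<delta>..<real k * \<delta> + \<delta>} t * d t)" for t
  proof -
    have "d t = indicator {0..<real n * \<delta>} t * d t"
    proof (cases "t \<in> {0..T}")
      case True
      then show ?thesis using n by (simp add: indicator_def)
    qed (simp add: d(2))
    then show ?thesis unfolding sum_distrib_right[symmetric] sum_ind .
  qed
  then have "(\<integral>t. d t \<partial>lborel) = (\<integral>t. (\<Sum>k<n. indicator {real k * \<delta>..<real k * \<delta> + \<delta>} t * d t) \<partial>lborel)" by presburger
  also have "\<dots> = (\<Sum>k<n. \<integral>t. indicator {real k * \<delta>..<real k * \<delta> + \<delta>} t * d t \<partial>lborel)"
    by (rule Bochner_Integration.integral_sum) (rule ii[OF d(1)], simp)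
  also have "\<dots> = (\<Sum>k<n. \<integral>t. indicator {0..<\<delta>} t * d (t + k * \<delta>) \<partial>lborel)" unfolding shift ..
  also have "\<dots> = (\<integral>t. (\<Sum>k<n. indicator {0..<\<delta>} t * d (t + k * \<delta>)) \<partial>lborel)"
    by (rule Bochner_Integration.integral_sum[symmetric]) (rule ii[OF si], simp)
  also have "\<dots> \<ge> 0"
  proof (rule integral_nonneg_AE)
    \<comment> \<open>One null set for all translates, as countably many shifts of a null set form a
      null set.\<close>
    have "AE t in lborel. \<forall>k::nat. 0 \<le> t + k * \<delta> \<longrightarrow> G (t + k * \<delta>) - G (t + k * \<delta> + \<delta>) \<le> d (t + k * \<delta>)"
      unfolding AE_all_countable by (intro allI AE_lborel_shift[OF le])
    then show "AE t in lborel. 0 \<le> (\<Sum>k<n. indicator {0..<\<delta>} t * d (t + k * \<delta>))"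
    proof eventually_elim
      case (elim t)
      show ?case
      proof (cases "t \<in> {0..<\<delta>}")
        case True
        have "(\<Sum>k<m. G (t + real k * \<delta>) - G (t + real k * \<delta> + \<delta>)) = G t - G (t + real m * \<delta>)" for m
          by (induction m) (auto simp: algebra_simps)
        from this[of n] have "0 = (\<Sum>k<n. G (t + real k * \<delta>) - G (t + real k * \<delta> + \<delta>))"
          using True n G(1)[of t] G(2)[of "t + real n * \<delta>"] by simp
        also have "\<dots> \<le> (\<Sum>k<n. d (t + k * \<delta>))"
          using True \<delta> elim by (intro sum_mono) (simp add: add_nonneg_nonneg)
        finally show ?thesis using True by simp
      qed simp
    qed
  qed
  finally show ?thesis .
qed

text \<open>For zero delay the two occurrences of \<open>G\<close> cancel and the inequality holds
  pointwise; there is no interval to fold onto. Otherwise \<open>G\<close> is cut off outside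
  \<open>[0, T]\<close>, which matches the convention for times after \<open>T\<close>.\<close>

lemma delayed_integral_le:
  fixes \<alpha> \<phi> G :: "real \<Rightarrow> real"
  assumes \<delta>: "0 \<le> \<delta>" and T: "0 < T"
    and i: "integrable (restrict_space lborel {0..T}) \<alpha>" "integrable (restrict_space lborel {0..T}) \<phi>"
    and G: "\<And>t. 0 \<le> t \<Longrightarrow> t < \<delta> \<Longrightarrow> G t = 0"
    and le: "AE t in lborel. t \<in> {0..T} \<longrightarrow> \<phi> t + G t - (if t + \<delta> \<le> T then G (t + \<delta>) else 0) \<le> \<alpha> t"
  shows "(\<integral>t. \<phi> t \<partial>restrict_space lborel {0..T}) \<le> (\<integral>t. \<alpha> t \<partial>restrict_space lborel {0..T})"
proof -
  define d where "d t = indicator {0..T} t * (\<alpha> t - \<phi> t)" for t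
  have di: "integrable lborel d"
    using Bochner_Integration.integrable_diff[OF i] unfolding d_def by (simp add: integrable_restrict_space)
  have deq: "(\<integral>t. \<alpha> t \<partial>restrict_space lborel {0..T}) - (\<integral>t. \<phi> t \<partial>restrict_space lborel {0..T}) = (\<integral>t. d t \<partial>lborel)"
    unfolding Bochner_Integration.integral_diff[OF i, symmetric] d_def by (simp add: integral_restrict_space)
  have "0 \<le> (\<integral>t. d t \<partial>lborel)"
  proof (cases "\<delta> = 0")
    case True
    show ?thesis
      by (rule integral_nonneg_AE) (use le True in \<open>auto simp: d_def indicator_def elim!: eventually_mono\<close>)
  next
    case False
    define G' where "G' t = (if t \<in> {0..T} then G t else 0)" for t
    show ?thesis
    proof (rule telescoping_integral_nonneg[OF _ T di, of \<delta> G'])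
      show "AE t in lborel. 0 \<le> t \<longrightarrow> G' t - G' (t + \<delta>) \<le> d t"
        using le by eventually_elim (use \<delta> in \<open>auto simp: G'_def d_def indicator_def\<close>)
    qed (use \<delta> False G in \<open>auto simp: d_def G'_def\<close>)
  qed
  with deq show ?thesis by simp
qed

section \<open>Hypothesis (H) in lifted form\<close>

text \<open>The costs are viewed as coefficients that ignore the arguments they lack, with zero
  derivatives there, so that everything proved for \<open>b\<close> and \<open>\<sigma>\<close>
  applies to them.\<close>

definition running_coefficient :: "('n::finite, 'k::finite) running_cost \<Rightarrow> ('n, 'k, real) coefficient" where
  "running_coefficient h = \<lparr>
     fn = \<lambda>t (x, xd, \<mu>, \<mu>d, v, vd). rc h t (x, \<mu>, v, vd),
     D_x = \<lambda>t (x, xd, \<mu>, \<mu>d, v, vd). rc_x h t (x, \<mu>, v, vd),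
     D_xd = \<lambda>t z. 0,
     D_mu = \<lambda>t (x, xd, \<mu>, \<mu>d, v, vd). rc_mu h t (x, \<mu>, v, vd),
     D_mud = \<lambda>t z y. 0,
     D_v = \<lambda>t (x, xd, \<mu>, \<mu>d, v, vd). rc_v h t (x, \<mu>, v, vd),
     D_vd = \<lambda>t (x, xd, \<mu>, \<mu>d, v, vd). rc_vd h t (x, \<mu>, v, vd)\<rparr>"

definition terminal_coefficient :: "'n::finite terminal_cost \<Rightarrow> ('n, 'k::finite, real) coefficient" where
  "terminal_coefficient \<Phi> = \<lparr>
     fn = \<lambda>t (x, xd, \<mu>, \<mu>d, v, vd). tc \<Phi> (x, \<mu>),
     D_x = \<lambda>t (x, xd, \<mu>, \<mu>d, v, vd). tc_x \<Phi> (x, \<mu>),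
     D_xd = \<lambda>t z. 0,
     D_mu = \<lambda>t (x, xd, \<mu>, \<mu>d, v, vd). tc_mu \<Phi> (x, \<mu>),
     D_mud = \<lambda>t z y. 0,
     D_v = \<lambda>t z. 0,
     D_vd = \<lambda>t z. 0\<rparr>"

text \<open>The joint law is a coupling, so the infimum is taken over a nonempty set of nonnegative
  numbers.\<close>

lemma W2_nonneg:
  fixes \<zeta> \<zeta>' :: "'a \<Rightarrow> 'b::euclidean_space"
  assumes "prob_space M" "\<zeta> \<in> L2 M M" "\<zeta>' \<in> L2 M M"
  shows "0 \<le> W2 (law M \<zeta>) (law M \<zeta>')"
proof -
  have [measurable]: "\<zeta> \<in> borel_measurable M" "\<zeta>' \<in> borel_measurable M" using assms by (auto simp: L2_iff)
  let ?\<pi> = "distr M (borel \<Otimes>\<^sub>M borel) (\<lambda>\<omega>. (\<zeta> \<omega>, \<zeta>' \<omega>))"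
  have "?\<pi> \<in> couplings (law M \<zeta>) (law M \<zeta>')"
    unfolding couplings_def by (auto simp: distr_distr comp_def)
  then have "0 \<le> (INF \<pi>\<in>couplings (law M \<zeta>) (law M \<zeta>'). \<integral>z. (norm (fst z - snd z))\<^sup>2 \<partial>\<pi>)"
    by (intro cINF_greatest) (auto intro!: integral_nonneg_AE)
  then show ?thesis unfolding W2_def by simp
qed

abbreviation lift_dist where
  "lift_dist M x xd \<zeta> \<eta> v vd x' xd' \<zeta>' \<eta>' v' vd' \<equiv>
     norm (x - x') + norm (xd - xd') + L2_norm M (\<lambda>\<omega>. \<zeta> \<omega> - \<zeta>' \<omega>) + L2_norm M (\<lambda>\<omega>. \<eta> \<omega> - \<eta>' \<omega>)
     + norm (v - v') + norm (vd - vd')"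

text \<open>A derivative without the last argument \<open>y\<close> is passed as a function constant
  in \<open>y\<close>, so that one predicate serves both kinds of derivatives.\<close>

definition lip_lift ::
  "'a measure \<Rightarrow> (real^'k::finite) set \<Rightarrow> real \<Rightarrow> real \<Rightarrow> real
    \<Rightarrow> (('n::finite, 'k) args6 \<Rightarrow> real^'n \<Rightarrow> 'z::real_normed_vector) \<Rightarrow> bool" where
  "lip_lift M U a L C D \<longleftrightarrow>
    (\<forall>x xd x' xd' y y'. \<forall>\<zeta>\<in>L2 M M. \<forall>\<eta>\<in>L2 M M. \<forall>v\<in>U. \<forall>vd\<in>U. \<forall>\<zeta>'\<in>L2 M M. \<forall>\<eta>'\<in>L2 M M. \<forall>v'\<in>U. \<forall>vd'\<in>U.
      norm (D (x, xd, law M \<zeta>, law M \<eta>, v, vd) y - D (x', xd', law M \<zeta>', law M \<eta>', v', vd') y')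
        \<le> L * (lift_dist M x xd \<zeta> \<eta> v vd x' xd' \<zeta>' \<eta>' v' vd' + norm (y - y'))) \<and>
    (\<forall>x xd y. \<forall>\<zeta>\<in>L2 M M. \<forall>\<eta>\<in>L2 M M. \<forall>v\<in>U. \<forall>vd\<in>U.
      norm (D (x, xd, law M \<zeta>, law M \<eta>, v, vd) y) \<le> C * growth a (x, xd, law M \<zeta>, law M \<eta>, v, vd))"

lemma lift_dist_nonneg: "0 \<le> lift_dist M x xd \<zeta> \<eta> v vd x' xd' \<zeta>' \<eta>' v' vd' + norm (y - y')"
  by (intro add_nonneg_nonneg norm_ge_zero L2_norm_nonneg)

lemma growth_ge_1: "0 \<le> a \<Longrightarrow> 1 \<le> growth a z"
  unfolding growth_def by (cases z) (simp add: add_nonneg_nonneg mult_nonneg_nonneg)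

lemma lip_liftD:
  assumes "lip_lift M U a L C D" "\<zeta> \<in> L2 M M" "\<eta> \<in> L2 M M" "v \<in> U" "vd \<in> U"
  shows "\<zeta>' \<in> L2 M M \<Longrightarrow> \<eta>' \<in> L2 M M \<Longrightarrow> v' \<in> U \<Longrightarrow> vd' \<in> U \<Longrightarrow>
      norm (D (x, xd, law M \<zeta>, law M \<eta>, v, vd) y - D (x', xd', law M \<zeta>', law M \<eta>', v', vd') y')
        \<le> L * (lift_dist M x xd \<zeta> \<eta> v vd x' xd' \<zeta>' \<eta>' v' vd' + norm (y - y'))"
    and "norm (D (x, xd, law M \<zeta>, law M \<eta>, v, vd) y) \<le> C * growth a (x, xd, law M \<zeta>, law M \<eta>, v, vd)"
  by (rule conjunct1[OF assms(1)[unfolded lip_lift_def], rule_format] conjunct2[OF assms(1)[unfolded lip_lift_def], rule_format],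
      (assumption | rule assms)+)+

lemma lip_lift_mono:
  assumes "lip_lift M U a L C D" "L \<le> L'" "C \<le> C'" "0 \<le> a"
  shows "lip_lift M U a L' C' D"
proof -
  have g: "0 \<le> growth a z" for z using growth_ge_1[OF assms(4), of z] by simp
  show ?thesis
    unfolding lip_lift_def
    by (intro conjI allI ballI)
      (rule order_trans[OF lip_liftD(1)[OF assms(1)] mult_right_mono[OF assms(2) lift_dist_nonneg]], assumption+,
       rule order_trans[OF lip_liftD(2)[OF assms(1)] mult_right_mono[OF assms(3) g]], assumption+)
qed

lemma lip_lift_zero: "0 \<le> a \<Longrightarrow> lip_lift M U a 0 0 (\<lambda>_ _. 0)"
  unfolding lip_lift_def by simp

lemma mult_le_abs_mult: "L * d \<le> \<bar>L\<bar> * d'" if "0 \<le> d" "d \<le> d'" for L d d' :: real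
proof -
  have "L * d \<le> \<bar>L\<bar> * d" using that by (intro mult_right_mono) auto
  also have "\<dots> \<le> \<bar>L\<bar> * d'" using that by (intro mult_left_mono) auto
  finally show ?thesis .
qed

text \<open>\<open>pr\<close> keeps the arguments that occur in the coefficient at hand. Distance
  and growth of projected points are dominated by those of the full points.\<close>

lemma lip_lift_of_lip_growth_y:
  fixes M :: "'a measure" and U :: "(real^'k::finite) set" and pr :: "('n::finite, 'k::finite) args6 \<Rightarrow> 'z"
  assumes "prob_space M"
    and f: "lip_growth_y I Z d g f"
    and pr: "\<And>x xd \<zeta> \<eta> v vd. \<zeta> \<in> L2 M M \<Longrightarrow> \<eta> \<in> L2 M M \<Longrightarrow> v \<in> U \<Longrightarrow> vd \<in> U \<Longrightarrow> pr (x, xd, law M \<zeta>, law M \<eta>, v, vd) \<in> Z"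
    and g: "\<And>z. 0 \<le> g (pr z) \<and> g (pr z) \<le> growth a z"
    and d: "\<And>x xd \<zeta> \<eta> v vd x' xd' \<zeta>' \<eta>' v' vd'. \<zeta> \<in> L2 M M \<Longrightarrow> \<eta> \<in> L2 M M \<Longrightarrow> \<zeta>' \<in> L2 M M \<Longrightarrow> \<eta>' \<in> L2 M M \<Longrightarrow>
      0 \<le> d (pr (x, xd, law M \<zeta>, law M \<eta>, v, vd)) (pr (x', xd', law M \<zeta>', law M \<eta>', v', vd')) \<and>
      d (pr (x, xd, law M \<zeta>, law M \<eta>, v, vd)) (pr (x', xd', law M \<zeta>', law M \<eta>', v', vd'))
        \<le> lift_dist M x xd \<zeta> \<eta> v vd x' xd' \<zeta>' \<eta>' v' vd'"
  shows "\<exists>L\<ge>0. \<exists>C\<ge>0. \<forall>t\<in>I. lip_lift M U a L C (\<lambda>z. f t (pr z))"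
proof -
  obtain L where L: "\<And>t z z' y y'. t \<in> I \<Longrightarrow> z \<in> Z \<Longrightarrow> z' \<in> Z \<Longrightarrow> norm (f t z y - f t z' y') \<le> L * (d z z' + norm (y - y'))"
    using f unfolding lip_growth_y_def by blast
  obtain C where C: "\<And>t z y. t \<in> I \<Longrightarrow> z \<in> Z \<Longrightarrow> norm (f t z y) \<le> C * g z"
    using f unfolding lip_growth_y_def by blast
  show ?thesis
  \<comment> \<open>Hypothesis (H) leaves the sign of the constants open, hence the absolute
    values.\<close>
  proof (rule exI[of _ "\<bar>L\<bar>"], rule conjI[OF abs_ge_zero], rule exI[of _ "\<bar>C\<bar>"], rule conjI[OF abs_ge_zero], rule ballI)
    fix t assume t: "t \<in> I"
    show "lip_lift M U a \<bar>L\<bar> \<bar>C\<bar> (\<lambda>z. f t (pr z))"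
      unfolding lip_lift_def
    proof (intro conjI allI ballI)
      fix x xd x' xd' y y' :: "real^'n" and \<zeta> \<eta> \<zeta>' \<eta>' :: "'a \<Rightarrow> real^'n" and v vd v' vd' :: "real^'k"
      assume *: "\<zeta> \<in> L2 M M" "\<eta> \<in> L2 M M" "v \<in> U" "vd \<in> U" "\<zeta>' \<in> L2 M M" "\<eta>' \<in> L2 M M" "v' \<in> U" "vd' \<in> U"
      show "norm (f t (pr (x, xd, law M \<zeta>, law M \<eta>, v, vd)) y - f t (pr (x', xd', law M \<zeta>', law M \<eta>', v', vd')) y')
        \<le> \<bar>L\<bar> * (lift_dist M x xd \<zeta> \<eta> v vd x' xd' \<zeta>' \<eta>' v' vd' + norm (y - y'))"
        by (rule order_trans[OF L[OF t pr[OF *(1-4)] pr[OF *(5-8)]] mult_le_abs_mult])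
           (use d[OF *(1,2,5,6)] in \<open>auto intro: add_nonneg_nonneg\<close>)
    next
      fix x xd y :: "real^'n" and \<zeta> \<eta> :: "'a \<Rightarrow> real^'n" and v vd :: "real^'k"
      assume *: "\<zeta> \<in> L2 M M" "\<eta> \<in> L2 M M" "v \<in> U" "vd \<in> U"
      show "norm (f t (pr (x, xd, law M \<zeta>, law M \<eta>, v, vd)) y) \<le> \<bar>C\<bar> * growth a (x, xd, law M \<zeta>, law M \<eta>, v, vd)"
        by (rule order_trans[OF C[OF t pr[OF *]] mult_le_abs_mult]) (use g in auto)
    qed
  qed
qed

lemma lip_lift_of_lip_growth:
  fixes M :: "'a measure" and U :: "(real^'k::finite) set" and pr :: "('n::finite, 'k::finite) args6 \<Rightarrow> 'z"
  assumes "prob_space M"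
    and f: "lip_growth I Z d g f"
    and pr: "\<And>x xd \<zeta> \<eta> v vd. \<zeta> \<in> L2 M M \<Longrightarrow> \<eta> \<in> L2 M M \<Longrightarrow> v \<in> U \<Longrightarrow> vd \<in> U \<Longrightarrow> pr (x, xd, law M \<zeta>, law M \<eta>, v, vd) \<in> Z"
    and g: "\<And>z. 0 \<le> g (pr z) \<and> g (pr z) \<le> growth a z"
    and d: "\<And>x xd \<zeta> \<eta> v vd x' xd' \<zeta>' \<eta>' v' vd'. \<zeta> \<in> L2 M M \<Longrightarrow> \<eta> \<in> L2 M M \<Longrightarrow> \<zeta>' \<in> L2 M M \<Longrightarrow> \<eta>' \<in> L2 M M \<Longrightarrow>
      0 \<le> d (pr (x, xd, law M \<zeta>, law M \<eta>, v, vd)) (pr (x', xd', law M \<zeta>', law M \<eta>', v', vd')) \<and>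
      d (pr (x, xd, law M \<zeta>, law M \<eta>, v, vd)) (pr (x', xd', law M \<zeta>', law M \<eta>', v', vd'))
        \<le> lift_dist M x xd \<zeta> \<eta> v vd x' xd' \<zeta>' \<eta>' v' vd'"
  shows "\<exists>L\<ge>0. \<exists>C\<ge>0. \<forall>t\<in>I. lip_lift M U a L C (\<lambda>z y. f t (pr z))"
proof -
  obtain L C where L: "\<forall>t\<in>I. \<forall>z\<in>Z. \<forall>z'\<in>Z. norm (f t z - f t z') \<le> L * d z z'" and C: "\<forall>t\<in>I. \<forall>z\<in>Z. norm (f t z) \<le> C * g z"
    using f unfolding lip_growth_def by blast
  show ?thesis
  proof (rule exI[of _ "\<bar>L\<bar>"], rule conjI[OF abs_ge_zero], rule exI[of _ "\<bar>C\<bar>"], rule conjI[OF abs_ge_zero], rule ballI)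
    fix t assume t: "t \<in> I"
    show "lip_lift M U a \<bar>L\<bar> \<bar>C\<bar> (\<lambda>z y. f t (pr z))"
      unfolding lip_lift_def
    proof (intro conjI allI ballI)
      fix x xd x' xd' y y' :: "real^'n" and \<zeta> \<eta> \<zeta>' \<eta>' :: "'a \<Rightarrow> real^'n" and v vd v' vd' :: "real^'k"
      assume *: "\<zeta> \<in> L2 M M" "\<eta> \<in> L2 M M" "v \<in> U" "vd \<in> U" "\<zeta>' \<in> L2 M M" "\<eta>' \<in> L2 M M" "v' \<in> U" "vd' \<in> U"
      show "norm (f t (pr (x, xd, law M \<zeta>, law M \<eta>, v, vd)) - f t (pr (x', xd', law M \<zeta>', law M \<eta>', v', vd')))
        \<le> \<bar>L\<bar> * (lift_dist M x xd \<zeta> \<eta> v vd x' xd' \<zeta>' \<eta>' v' vd' + norm (y - y'))"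
        by (rule order_trans[OF L[rule_format, OF t pr[OF *(1-4)] pr[OF *(5-8)]] mult_le_abs_mult])
           (use d[OF *(1,2,5,6)] in \<open>auto intro: add_increasing2\<close>)
    next
      fix x xd y :: "real^'n" and \<zeta> \<eta> :: "'a \<Rightarrow> real^'n" and v vd :: "real^'k"
      assume *: "\<zeta> \<in> L2 M M" "\<eta> \<in> L2 M M" "v \<in> U" "vd \<in> U"
      show "norm (f t (pr (x, xd, law M \<zeta>, law M \<eta>, v, vd))) \<le> \<bar>C\<bar> * growth a (x, xd, law M \<zeta>, law M \<eta>, v, vd)"
        by (rule order_trans[OF C[rule_format, OF t pr[OF *]] mult_le_abs_mult]) (use g in auto)
    qed
  qed
qed

lemma lifted_coefficientI:
  fixes M :: "'a measure" and U :: "(real^'k::finite) set" and c :: "('n::finite, 'k, 'c::euclidean_space) coefficient"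
  assumes M: "prob_space M" and U: "convex U" and a: "0 \<le> a" and diff: "differentiable_coefficient M T U c"
    and l: "\<exists>L\<ge>0. \<exists>C\<ge>0. \<forall>t\<in>{0..T}. lip_lift M U a L C (\<lambda>z y. D_x c t z)"
      "\<exists>L\<ge>0. \<exists>C\<ge>0. \<forall>t\<in>{0..T}. lip_lift M U a L C (\<lambda>z y. D_xd c t z)"
      "\<exists>L\<ge>0. \<exists>C\<ge>0. \<forall>t\<in>{0..T}. lip_lift M U a L C (D_mu c t)"
      "\<exists>L\<ge>0. \<exists>C\<ge>0. \<forall>t\<in>{0..T}. lip_lift M U a L C (D_mud c t)"
      "\<exists>L\<ge>0. \<exists>C\<ge>0. \<forall>t\<in>{0..T}. lip_lift M U a L C (\<lambda>z y. D_v c t z)"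
      "\<exists>L\<ge>0. \<exists>C\<ge>0. \<forall>t\<in>{0..T}. lip_lift M U a L C (\<lambda>z y. D_vd c t z)"
  shows "\<exists>L C. \<forall>t\<in>{0..T}. lifted_coefficient M U a L C c t"
proof -
  obtain L1 C1 where 1: "0 \<le> L1" "0 \<le> C1" "\<And>t. t \<in> {0..T} \<Longrightarrow> lip_lift M U a L1 C1 (\<lambda>z y. D_x c t z)" using l(1) by blast
  obtain K2 C2 where 2: "0 \<le> K2" "0 \<le> C2" "\<And>t. t \<in> {0..T} \<Longrightarrow> lip_lift M U a K2 C2 (\<lambda>z y. D_xd c t z)" using l(2) by blast
  obtain L3 C3 where 3: "0 \<le> L3" "0 \<le> C3" "\<And>t. t \<in> {0..T} \<Longrightarrow> lip_lift M U a L3 C3 (D_mu c t)" using l(3) by blast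
  obtain L4 C4 where 4: "0 \<le> L4" "0 \<le> C4" "\<And>t. t \<in> {0..T} \<Longrightarrow> lip_lift M U a L4 C4 (D_mud c t)" using l(4) by blast
  obtain L5 C5 where 5: "0 \<le> L5" "0 \<le> C5" "\<And>t. t \<in> {0..T} \<Longrightarrow> lip_lift M U a L5 C5 (\<lambda>z y. D_v c t z)" using l(5) by blast
  obtain L6 C6 where 6: "0 \<le> L6" "0 \<le> C6" "\<And>t. t \<in> {0..T} \<Longrightarrow> lip_lift M U a L6 C6 (\<lambda>z y. D_vd c t z)" using l(6) by blast
  \<comment> \<open>Sums serve as common constants for the six derivatives, all summands being
    nonnegative.\<close>
  let ?L = "L1 + K2 + L3 + L4 + L5 + L6" and ?C = "C1 + C2 + C3 + C4 + C5 + C6"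
  show ?thesis
  proof (rule exI[of _ ?L], rule exI[of _ ?C], rule ballI)
    fix t assume t: "t \<in> {0..T}"
    have A: "lip_lift M U a ?L ?C (\<lambda>z y. D_x c t z)" "lip_lift M U a ?L ?C (\<lambda>z y. D_xd c t z)"
      "lip_lift M U a ?L ?C (D_mu c t)" "lip_lift M U a ?L ?C (D_mud c t)"
      "lip_lift M U a ?L ?C (\<lambda>z y. D_v c t z)" "lip_lift M U a ?L ?C (\<lambda>z y. D_vd c t z)"
      by (rule lip_lift_mono[OF 1(3)[OF t] _ _ a] lip_lift_mono[OF 2(3)[OF t] _ _ a] lip_lift_mono[OF 3(3)[OF t] _ _ a]
          lip_lift_mono[OF 4(3)[OF t] _ _ a] lip_lift_mono[OF 5(3)[OF t] _ _ a] lip_lift_mono[OF 6(3)[OF t] _ _ a];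
          use 1(1,2) 2(1,2) 3(1,2) 4(1,2) 5(1,2) 6(1,2) in linarith)+
    note dd = diff[unfolded differentiable_coefficient_def, rule_format, OF t law_P2[OF M] law_P2[OF M]]
    have lip0: "norm (D (x, xd, law M \<zeta>, law M \<eta>, v, vd) - D (x', xd', law M \<zeta>', law M \<eta>', v', vd'))
          \<le> ?L * lift_dist M x xd \<zeta> \<eta> v vd x' xd' \<zeta>' \<eta>' v' vd'"
      if "lip_lift M U a ?L ?C (\<lambda>z y. D z)" "\<zeta> \<in> L2 M M" "\<eta> \<in> L2 M M" "v \<in> U" "vd \<in> U" "\<zeta>' \<in> L2 M M" "\<eta>' \<in> L2 M M" "v' \<in> U" "vd' \<in> U"
      for D :: "('n, 'k) args6 \<Rightarrow> 'z::real_normed_vector" and x xd \<zeta> \<eta> v vd x' xd' \<zeta>' \<eta>' v' vd'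
    proof -
      have "norm (D (x, xd, law M \<zeta>, law M \<eta>, v, vd) - D (x', xd', law M \<zeta>', law M \<eta>', v', vd'))
          \<le> ?L * (lift_dist M x xd \<zeta> \<eta> v vd x' xd' \<zeta>' \<eta>' v' vd' + norm ((0::real^'n) - 0))"
        by (rule lip_liftD(1)[OF that])
      then show ?thesis by simp
    qed
    have gr0: "norm (D (x, xd, law M \<zeta>, law M \<eta>, v, vd)) \<le> ?C * growth a (x, xd, law M \<zeta>, law M \<eta>, v, vd)"
      if "lip_lift M U a ?L ?C (\<lambda>z y. D z)" "\<zeta> \<in> L2 M M" "\<eta> \<in> L2 M M" "v \<in> U" "vd \<in> U"
      for D :: "('n, 'k) args6 \<Rightarrow> 'z::real_normed_vector" and x xd \<zeta> \<eta> v vd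
      by (rule lip_liftD(2)[OF that])
    have lipy: "norm (D (x, xd, law M \<zeta>, law M \<eta>, v, vd) y - D (x', xd', law M \<zeta>', law M \<eta>', v', vd') y')
          \<le> ?L * (lift_dist M x xd \<zeta> \<eta> v vd x' xd' \<zeta>' \<eta>' v' vd' + norm (y - y'))"
      if "lip_lift M U a ?L ?C D" "\<zeta> \<in> L2 M M" "\<eta> \<in> L2 M M" "v \<in> U" "vd \<in> U" "\<zeta>' \<in> L2 M M" "\<eta>' \<in> L2 M M" "v' \<in> U" "vd' \<in> U"
      for D :: "('n, 'k) args6 \<Rightarrow> real^'n \<Rightarrow> 'z::real_normed_vector" and x xd \<zeta> \<eta> v vd x' xd' \<zeta>' \<eta>' v' vd' y y'
      by (rule lip_liftD(1)[OF that])
    have gry: "norm (D (x, xd, law M \<zeta>, law M \<eta>, v, vd) y) \<le> ?C * growth a (x, xd, law M \<zeta>, law M \<eta>, v, vd)"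
      if "lip_lift M U a ?L ?C D" "\<zeta> \<in> L2 M M" "\<eta> \<in> L2 M M" "v \<in> U" "vd \<in> U"
      for D :: "('n, 'k) args6 \<Rightarrow> real^'n \<Rightarrow> 'z::real_normed_vector" and x xd \<zeta> \<eta> v vd y
      by (rule lip_liftD(2)[OF that])
    show "lifted_coefficient M U a ?L ?C c t"
    proof (intro lifted_coefficient.intro lifted_coefficient_axioms.intro M U a)
      show "0 \<le> ?L" "0 \<le> ?C" using 1 2 3 4 5 6 by auto
    next
      fix x xd x' xd' :: "real^'n" and \<zeta> \<eta> \<zeta>' \<eta>' :: "'a \<Rightarrow> real^'n" and v vd v' vd' :: "real^'k" and D :: "('n, 'k) args6 \<Rightarrow> (real^'n) \<Rightarrow>\<^sub>L 'c"
      assume *: "\<zeta> \<in> L2 M M" "\<eta> \<in> L2 M M" "v \<in> U" "vd \<in> U" "\<zeta>' \<in> L2 M M" "\<eta>' \<in> L2 M M" "v' \<in> U" "vd' \<in> U"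
        and D: "D \<in> {D_x c t, D_xd c t}"
      show "norm (D (x, xd, law M \<zeta>, law M \<eta>, v, vd) - D (x', xd', law M \<zeta>', law M \<eta>', v', vd'))
          \<le> ?L * lift_dist M x xd \<zeta> \<eta> v vd x' xd' \<zeta>' \<eta>' v' vd'"
        using D A(1,2) by (intro lip0 *) auto
    next
      fix x xd x' xd' :: "real^'n" and \<zeta> \<eta> \<zeta>' \<eta>' :: "'a \<Rightarrow> real^'n" and v vd v' vd' :: "real^'k" and D :: "('n, 'k) args6 \<Rightarrow> (real^'k) \<Rightarrow>\<^sub>L 'c"
      assume *: "\<zeta> \<in> L2 M M" "\<eta> \<in> L2 M M" "v \<in> U" "vd \<in> U" "\<zeta>' \<in> L2 M M" "\<eta>' \<in> L2 M M" "v' \<in> U" "vd' \<in> U"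
        and D: "D \<in> {D_v c t, D_vd c t}"
      show "norm (D (x, xd, law M \<zeta>, law M \<eta>, v, vd) - D (x', xd', law M \<zeta>', law M \<eta>', v', vd'))
          \<le> ?L * lift_dist M x xd \<zeta> \<eta> v vd x' xd' \<zeta>' \<eta>' v' vd'"
        using D A(5,6) by (intro lip0 *) auto
    next
      fix x xd x' xd' y y' :: "real^'n" and \<zeta> \<eta> \<zeta>' \<eta>' :: "'a \<Rightarrow> real^'n" and v vd v' vd' :: "real^'k" and D :: "('n, 'k) args6 \<Rightarrow> real^'n \<Rightarrow> (real^'n) \<Rightarrow>\<^sub>L 'c"
      assume *: "\<zeta> \<in> L2 M M" "\<eta> \<in> L2 M M" "v \<in> U" "vd \<in> U" "\<zeta>' \<in> L2 M M" "\<eta>' \<in> L2 M M" "v' \<in> U" "vd' \<in> U"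
        and D: "D \<in> {D_mu c t, D_mud c t}"
      show "norm (D (x, xd, law M \<zeta>, law M \<eta>, v, vd) y - D (x', xd', law M \<zeta>', law M \<eta>', v', vd') y')
          \<le> ?L * (lift_dist M x xd \<zeta> \<eta> v vd x' xd' \<zeta>' \<eta>' v' vd' + norm (y - y'))"
        using D A(3,4) by (intro lipy *) auto
    next
      fix x xd :: "real^'n" and \<zeta> \<eta> :: "'a \<Rightarrow> real^'n" and v vd :: "real^'k" and D :: "('n, 'k) args6 \<Rightarrow> (real^'n) \<Rightarrow>\<^sub>L 'c"
      assume *: "\<zeta> \<in> L2 M M" "\<eta> \<in> L2 M M" "v \<in> U" "vd \<in> U" and D: "D \<in> {D_x c t, D_xd c t}"
      show "norm (D (x, xd, law M \<zeta>, law M \<eta>, v, vd)) \<le> ?C * growth a (x, xd, law M \<zeta>, law M \<eta>, v, vd)"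
        using D A(1,2) by (intro gr0 *) auto
    next
      fix x xd :: "real^'n" and \<zeta> \<eta> :: "'a \<Rightarrow> real^'n" and v vd :: "real^'k" and D :: "('n, 'k) args6 \<Rightarrow> (real^'k) \<Rightarrow>\<^sub>L 'c"
      assume *: "\<zeta> \<in> L2 M M" "\<eta> \<in> L2 M M" "v \<in> U" "vd \<in> U" and D: "D \<in> {D_v c t, D_vd c t}"
      show "norm (D (x, xd, law M \<zeta>, law M \<eta>, v, vd)) \<le> ?C * growth a (x, xd, law M \<zeta>, law M \<eta>, v, vd)"
        using D A(5,6) by (intro gr0 *) auto
    next
      fix x xd y :: "real^'n" and \<zeta> \<eta> :: "'a \<Rightarrow> real^'n" and v vd :: "real^'k" and D :: "('n, 'k) args6 \<Rightarrow> real^'n \<Rightarrow> (real^'n) \<Rightarrow>\<^sub>L 'c"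
      assume *: "\<zeta> \<in> L2 M M" "\<eta> \<in> L2 M M" "v \<in> U" "vd \<in> U" and D: "D \<in> {D_mu c t, D_mud c t}"
      show "norm (D (x, xd, law M \<zeta>, law M \<eta>, v, vd) y) \<le> ?C * growth a (x, xd, law M \<zeta>, law M \<eta>, v, vd)"
        using D A(3,4) by (intro gry *) auto
    qed ((rule dd[THEN conjunct1] dd[THEN conjunct2, THEN conjunct1] dd[THEN conjunct2, THEN conjunct2, THEN conjunct1]
        dd[THEN conjunct2, THEN conjunct2, THEN conjunct2, THEN conjunct1]
        dd[THEN conjunct2, THEN conjunct2, THEN conjunct2, THEN conjunct2, THEN conjunct1]
        dd[THEN conjunct2, THEN conjunct2, THEN conjunct2, THEN conjunct2, THEN conjunct2]; assumption)+)
  qed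
qed

section \<open>Hypothesis (H) for the coefficients, the running cost and the terminal cost\<close>

context
  fixes M :: "'a measure" and U :: "(real^'k::finite) set"
  assumes M: "prob_space M" and U: "convex U"
begin

lemma dist6_lift:
  assumes "\<zeta> \<in> L2 M M" "\<eta> \<in> L2 M M" "\<zeta>' \<in> L2 M M" "\<eta>' \<in> L2 M M"
  shows "0 \<le> dist6 (x, xd, law M \<zeta>, law M \<eta>, v, vd) (x', xd', law M \<zeta>', law M \<eta>', v', vd') \<and>
      dist6 (x, xd, law M \<zeta>, law M \<eta>, v, vd) (x', xd', law M \<zeta>', law M \<eta>', v', vd')
        \<le> lift_dist M x xd \<zeta> \<eta> v vd x' xd' \<zeta>' \<eta>' v' vd'"
  using W2_nonneg[OF M assms(1,3)] W2_nonneg[OF M assms(2,4)] W2_le_L2_norm[OF M assms(1,3)] W2_le_L2_norm[OF M assms(2,4)]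
  unfolding dist6_def prod.case by (auto intro!: add_mono add_nonneg_nonneg)

lemma H_coefficient_lifted:
  assumes "H_coefficient M T U c"
  shows "\<exists>L C. \<forall>t\<in>{0..T}. lifted_coefficient M U 0 L C c t"
proof (rule lifted_coefficientI[OF M U])
  have in6: "(x, xd, law M \<zeta>, law M \<eta>, v, vd) \<in> dom6 U" if "\<zeta> \<in> L2 M M" "\<eta> \<in> L2 M M" "v \<in> U" "vd \<in> U" for x xd \<zeta> \<eta> v vd
    using that law_P2[OF M] by (auto simp: dom6_def)
  note A = assms[unfolded H_coefficient_def]
  show "differentiable_coefficient M T U c" using A by blast
  have g: "0 \<le> (1::real) \<and> 1 \<le> growth 0 z" for z by (cases z) (simp add: growth_def)
  have 1: "\<exists>L\<ge>0. \<exists>C\<ge>0. \<forall>t\<in>{0..T}. lip_lift M U 0 L C (\<lambda>z y. D t z)" if "lip_growth {0..T} (dom6 U) dist6 (\<lambda>_. 1) D"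
    for D :: "real \<Rightarrow> _ \<Rightarrow> 'z::real_normed_vector"
    by (rule lip_lift_of_lip_growth[where pr="\<lambda>z. z", OF M that in6 g dist6_lift])
  have 2: "\<exists>L\<ge>0. \<exists>C\<ge>0. \<forall>t\<in>{0..T}. lip_lift M U 0 L C (D t)" if "lip_growth_y {0..T} (dom6 U) dist6 (\<lambda>_. 1) D"
    for D :: "real \<Rightarrow> _ \<Rightarrow> _ \<Rightarrow> 'z::real_normed_vector"
    by (rule lip_lift_of_lip_growth_y[where pr="\<lambda>z. z", OF M that in6 g dist6_lift])
  show "\<exists>L\<ge>0. \<exists>C\<ge>0. \<forall>t\<in>{0..T}. lip_lift M U 0 L C (\<lambda>z y. D_x c t z)" by (rule 1) (use A in blast)
  show "\<exists>L\<ge>0. \<exists>C\<ge>0. \<forall>t\<in>{0..T}. lip_lift M U 0 L C (\<lambda>z y. D_xd c t z)" by (rule 1) (use A in blast)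
  show "\<exists>L\<ge>0. \<exists>C\<ge>0. \<forall>t\<in>{0..T}. lip_lift M U 0 L C (\<lambda>z y. D_v c t z)" by (rule 1) (use A in blast)
  show "\<exists>L\<ge>0. \<exists>C\<ge>0. \<forall>t\<in>{0..T}. lip_lift M U 0 L C (\<lambda>z y. D_vd c t z)" by (rule 1) (use A in blast)
  show "\<exists>L\<ge>0. \<exists>C\<ge>0. \<forall>t\<in>{0..T}. lip_lift M U 0 L C (D_mu c t)" by (rule 2) (use A in blast)
  show "\<exists>L\<ge>0. \<exists>C\<ge>0. \<forall>t\<in>{0..T}. lip_lift M U 0 L C (D_mud c t)" by (rule 2) (use A in blast)
qed simp

lemma has_measure_derivative_const: "has_measure_derivative M (\<lambda>m. k) (\<lambda>y. 0) \<mu>"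
  unfolding has_measure_derivative_def by (auto intro!: exI[of _ 1])

lemma zero_lift: "0 \<le> a \<Longrightarrow> \<exists>L\<ge>0. \<exists>C\<ge>0. \<forall>t\<in>I. lip_lift M U a L C (\<lambda>z y. 0)"
  using lip_lift_zero[of a M U] by blast

lemma H_running_cost_lifted:
  fixes h :: "('n::finite, 'k) running_cost"
  assumes "H_running_cost M T U h"
  shows "\<exists>L C. \<forall>t\<in>{0..T}. lifted_coefficient M U 1 L C (running_coefficient h) t"
proof (rule lifted_coefficientI[OF M U])
  let ?pr = "\<lambda>(x, xd, \<mu>, \<mu>d, v, vd). (x, \<mu>, v, vd)"
  let ?g = "\<lambda>(x :: real^'n, \<mu> :: (real^'n) measure, v :: real^'k, vd :: real^'k). 1 + norm x + norm v + norm vd"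
  have in4: "?pr (x, xd, law M \<zeta>, law M \<eta>, v, vd) \<in> dom4 U" if "\<zeta> \<in> L2 M M" "\<eta> \<in> L2 M M" "v \<in> U" "vd \<in> U" for x xd \<zeta> \<eta> v vd
    using that law_P2[OF M] by (auto simp: dom4_def)
  note A = assms[unfolded H_running_cost_def Let_def]
  show "differentiable_coefficient M T U (running_coefficient h)"
    using A unfolding differentiable_coefficient_def differentiable_running_cost_def running_coefficient_def
    by (simp add: has_measure_derivative_const zero_blinfun.rep_eq)
  have g: "0 \<le> ?g (?pr z) \<and> ?g (?pr z) \<le> growth 1 z" for z :: "('n, 'k) args6"
    by (cases z) (auto simp: growth_def add_nonneg_nonneg)
  have d: "0 \<le> dist4 (?pr (x, xd, law M \<zeta>, law M \<eta>, v, vd)) (?pr (x', xd', law M \<zeta>', law M \<eta>', v', vd')) \<and>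
      dist4 (?pr (x, xd, law M \<zeta>, law M \<eta>, v, vd)) (?pr (x', xd', law M \<zeta>', law M \<eta>', v', vd'))
        \<le> lift_dist M x xd \<zeta> \<eta> v vd x' xd' \<zeta>' \<eta>' v' vd'"
    if "\<zeta> \<in> L2 M M" "\<eta> \<in> L2 M M" "\<zeta>' \<in> L2 M M" "\<eta>' \<in> L2 M M"
    for x xd x' xd' :: "real^'n" and \<zeta> \<eta> \<zeta>' \<eta>' and v vd v' vd' :: "real^'k"
  proof -
    have "norm (x - x') + W2 (law M \<zeta>) (law M \<zeta>') + norm (v - v') + norm (vd - vd') \<le> lift_dist M x xd \<zeta> \<eta> v vd x' xd' \<zeta>' \<eta>' v' vd'"
      using W2_le_L2_norm[OF M that(1,3)] norm_ge_zero[of "xd - xd'"] L2_norm_nonneg[of M "\<lambda>\<omega>. \<eta> \<omega> - \<eta>' \<omega>"] by linarith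
    then show ?thesis
      using W2_nonneg[OF M that(1,3)] unfolding dist4_def by (simp add: add_nonneg_nonneg)
  qed
  note e = running_coefficient_def coefficient.simps case_prod_unfold
  have 1: "\<exists>L\<ge>0. \<exists>C\<ge>0. \<forall>t\<in>{0..T}. lip_lift M U 1 L C (\<lambda>z y. D t (?pr z))" if "lip_growth {0..T} (dom4 U) dist4 ?g D"
    for D :: "real \<Rightarrow> _ \<Rightarrow> 'z::real_normed_vector"
    by (rule lip_lift_of_lip_growth[where pr="?pr", OF M that in4 g d])
  have 2: "\<exists>L\<ge>0. \<exists>C\<ge>0. \<forall>t\<in>{0..T}. lip_lift M U 1 L C (\<lambda>z. D t (?pr z))" if "lip_growth_y {0..T} (dom4 U) dist4 ?g D"
    for D :: "real \<Rightarrow> _ \<Rightarrow> _ \<Rightarrow> 'z::real_normed_vector"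
    by (rule lip_lift_of_lip_growth_y[where pr="?pr", OF M that in4 g d])
  show "\<exists>L\<ge>0. \<exists>C\<ge>0. \<forall>t\<in>{0..T}. lip_lift M U 1 L C (\<lambda>z y. D_x (running_coefficient h) t z)"
    using 1[of "rc_x h"] A by (simp add: e)
  show "\<exists>L\<ge>0. \<exists>C\<ge>0. \<forall>t\<in>{0..T}. lip_lift M U 1 L C (\<lambda>z y. D_v (running_coefficient h) t z)"
    using 1[of "rc_v h"] A by (simp add: e)
  show "\<exists>L\<ge>0. \<exists>C\<ge>0. \<forall>t\<in>{0..T}. lip_lift M U 1 L C (\<lambda>z y. D_vd (running_coefficient h) t z)"
    using 1[of "rc_vd h"] A by (simp add: e)
  show "\<exists>L\<ge>0. \<exists>C\<ge>0. \<forall>t\<in>{0..T}. lip_lift M U 1 L C (D_mu (running_coefficient h) t)"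
    using 2[of "rc_mu h"] A by (simp add: e)
  show "\<exists>L\<ge>0. \<exists>C\<ge>0. \<forall>t\<in>{0..T}. lip_lift M U 1 L C (\<lambda>z y. D_xd (running_coefficient h) t z)"
    "\<exists>L\<ge>0. \<exists>C\<ge>0. \<forall>t\<in>{0..T}. lip_lift M U 1 L C (D_mud (running_coefficient h) t)"
    unfolding running_coefficient_def coefficient.simps by (rule zero_lift, simp)+
qed simp

lemma H_terminal_cost_lifted:
  fixes \<Phi> :: "'n::finite terminal_cost"
  assumes "H_terminal_cost M \<Phi>"
  shows "\<exists>L C. \<forall>t\<in>{0..T}. lifted_coefficient M U 1 L C (terminal_coefficient \<Phi>) t"
proof (rule lifted_coefficientI[OF M U])
  let ?pr = "\<lambda>(x, xd, \<mu>, \<mu>d, v, vd). (x, \<mu>)"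
  let ?g = "\<lambda>(x :: real^'n, \<mu> :: (real^'n) measure). 1 + norm x"
  have in2: "?pr (x, xd, law M \<zeta>, law M \<eta>, v, vd) \<in> dom2" if "\<zeta> \<in> L2 M M" "\<eta> \<in> L2 M M" "v \<in> U" "vd \<in> U" for x xd \<zeta> \<eta> v vd
    using that law_P2[OF M] by (auto simp: dom2_def)
  note A = assms[unfolded H_terminal_cost_def]
  show "differentiable_coefficient M T U (terminal_coefficient \<Phi>)"
    using A unfolding differentiable_coefficient_def differentiable_terminal_cost_def terminal_coefficient_def
    by (simp add: has_measure_derivative_const zero_blinfun.rep_eq)
  have g: "0 \<le> ?g (?pr z) \<and> ?g (?pr z) \<le> growth 1 z" for z :: "('n, 'k) args6"
    by (cases z) (auto simp: growth_def add_nonneg_nonneg)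
  have d: "0 \<le> dist2 (?pr (x, xd, law M \<zeta>, law M \<eta>, v, vd)) (?pr (x', xd', law M \<zeta>', law M \<eta>', v', vd')) \<and>
      dist2 (?pr (x, xd, law M \<zeta>, law M \<eta>, v, vd)) (?pr (x', xd', law M \<zeta>', law M \<eta>', v', vd'))
        \<le> lift_dist M x xd \<zeta> \<eta> v vd x' xd' \<zeta>' \<eta>' v' vd'"
    if "\<zeta> \<in> L2 M M" "\<eta> \<in> L2 M M" "\<zeta>' \<in> L2 M M" "\<eta>' \<in> L2 M M"
    for x xd x' xd' :: "real^'n" and \<zeta> \<eta> \<zeta>' \<eta>' and v vd v' vd' :: "real^'k"
  proof -
    have "norm (x - x') + W2 (law M \<zeta>) (law M \<zeta>') \<le> lift_dist M x xd \<zeta> \<eta> v vd x' xd' \<zeta>' \<eta>' v' vd'"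
      using W2_le_L2_norm[OF M that(1,3)] norm_ge_zero[of "xd - xd'"] L2_norm_nonneg[of M "\<lambda>\<omega>. \<eta> \<omega> - \<eta>' \<omega>"]
        norm_ge_zero[of "v - v'"] norm_ge_zero[of "vd - vd'"] by linarith
    then show ?thesis
      using W2_nonneg[OF M that(1,3)] unfolding dist2_def by (simp add: add_nonneg_nonneg)
  qed
  note e = terminal_coefficient_def coefficient.simps case_prod_unfold
  show "\<exists>L\<ge>0. \<exists>C\<ge>0. \<forall>t\<in>{0..T}. lip_lift M U 1 L C (\<lambda>z y. D_x (terminal_coefficient \<Phi>) t z)"
  proof -
    \<comment> \<open>The terminal cost has no time argument; its bounds are indexed by the unit
      type and then hold at every \<open>t\<close>.\<close>
    have "\<exists>L\<ge>0. \<exists>C\<ge>0. \<forall>t\<in>{()}. lip_lift M U 1 L C (\<lambda>z y. tc_x \<Phi> (?pr z))"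
      by (rule lip_lift_of_lip_growth[where pr="?pr", OF M _ in2 g d]) (use A in blast)
    then show ?thesis unfolding e by blast
  qed
  show "\<exists>L\<ge>0. \<exists>C\<ge>0. \<forall>t\<in>{0..T}. lip_lift M U 1 L C (D_mu (terminal_coefficient \<Phi>) t)"
  proof -
    have "\<exists>L\<ge>0. \<exists>C\<ge>0. \<forall>t\<in>{()}. lip_lift M U 1 L C (\<lambda>z. tc_mu \<Phi> (?pr z))"
      by (rule lip_lift_of_lip_growth_y[where pr="?pr", OF M _ in2 g d]) (use A in blast)
    then show ?thesis unfolding e by blast
  qed
  show "\<exists>L\<ge>0. \<exists>C\<ge>0. \<forall>t\<in>{0..T}. lip_lift M U 1 L C (\<lambda>z y. D_xd (terminal_coefficient \<Phi>) t z)"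
    "\<exists>L\<ge>0. \<exists>C\<ge>0. \<forall>t\<in>{0..T}. lip_lift M U 1 L C (D_mud (terminal_coefficient \<Phi>) t)"
    "\<exists>L\<ge>0. \<exists>C\<ge>0. \<forall>t\<in>{0..T}. lip_lift M U 1 L C (\<lambda>z y. D_v (terminal_coefficient \<Phi>) t z)"
    "\<exists>L\<ge>0. \<exists>C\<ge>0. \<forall>t\<in>{0..T}. lip_lift M U 1 L C (\<lambda>z y. D_vd (terminal_coefficient \<Phi>) t z)"
    unfolding terminal_coefficient_def coefficient.simps by (rule zero_lift, simp)+
qed simp

end

section \<open>Brownian increments and the Ito integral\<close>

text \<open>The norm of \<open>real^'d^'n\<close> is the Hilbert-Schmidt norm, which dominates the
  operator norm.\<close>

lemma norm_matrix_vector_mult_le: "norm (A *v x) \<le> norm (A::real^'d^'n) * norm x"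
proof (rule power2_le_imp_le)
  have "(norm (A *v x))\<^sup>2 = (\<Sum>i\<in>UNIV. (A $ i \<bullet> x)\<^sup>2)"
    unfolding power2_norm_eq_inner inner_vec_def[of "A *v x"]
    by (simp add: matrix_vector_mul_component power2_eq_square)
  also have "\<dots> \<le> (\<Sum>i\<in>UNIV. (norm (A $ i))\<^sup>2 * (norm x)\<^sup>2)"
  proof (rule sum_mono)
    fix i
    show "(A $ i \<bullet> x)\<^sup>2 \<le> (norm (A $ i))\<^sup>2 * (norm x)\<^sup>2"
      using Cauchy_Schwarz_ineq[of "A $ i" x] by (simp add: power2_norm_eq_inner)
  qed
  also have "\<dots> = (norm A * norm x)\<^sup>2"
    unfolding power_mult_distrib sum_distrib_right[symmetric]
    by (simp add: power2_norm_eq_inner inner_vec_def[of A])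
  finally show "(norm (A *v x))\<^sup>2 \<le> (norm A * norm x)\<^sup>2" .
qed simp

lemma inner_matrix_vector_mult_sum:
  "z \<bullet> (A *v x) = (\<Sum>i\<in>UNIV. \<Sum>j\<in>UNIV. (z $ i * (A::real^'d^'n) $ i $ j) * x $ j)"
  by (simp add: inner_vec_def matrix_vector_mult_def sum_distrib_left mult.assoc)

lemma matrix_vector_mult_inner_sum:
  "((A::real^'d^'n) *v x) \<bullet> (C *v x)
     = (\<Sum>i\<in>UNIV. \<Sum>j\<in>UNIV. \<Sum>k\<in>UNIV. (A $ i $ j * C $ i $ k) * (x $ j * x $ k))"
  by (simp add: inner_vec_def matrix_vector_mult_def sum_product mult.assoc mult.left_commute)

lemma Int_stable_vimage: "Int_stable {f -` A \<inter> S | A. A \<in> sets N}"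
proof (rule Int_stableI)
  fix a b assume "a \<in> {f -` A \<inter> S | A. A \<in> sets N}" "b \<in> {f -` A \<inter> S | A. A \<in> sets N}"
  then obtain A A' where "A \<in> sets N" "A' \<in> sets N" "a = f -` A \<inter> S" "b = f -` A' \<inter> S" by blast
  then have "a \<inter> b = f -` (A \<inter> A') \<inter> S" "A \<inter> A' \<in> sets N" by auto
  then show "a \<inter> b \<in> {f -` A \<inter> S | A. A \<in> sets N}" by blast
qed

lemma borel_measurable_matrix_vector_mult [measurable]:
  fixes A :: "'a \<Rightarrow> real^'d^'n"
  assumes [measurable]: "A \<in> borel_measurable M" "x \<in> borel_measurable M"
  shows "(\<lambda>\<omega>. A \<omega> *v x \<omega>) \<in> borel_measurable M"
proof (subst borel_measurable_euclidean_space, rule ballI)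
  fix b :: "real^'n"
  have "(\<lambda>\<omega>. \<Sum>i\<in>UNIV. \<Sum>j\<in>UNIV. (b $ i * A \<omega> $ i $ j) * x \<omega> $ j) \<in> borel_measurable M"
    by measurable
  then show "(\<lambda>\<omega>. (A \<omega> *v x \<omega>) \<bullet> b) \<in> borel_measurable M"
    by (simp add: inner_commute[of _ b] inner_matrix_vector_mult_sum)
qed

locale brownian_basis = prob_space M for M :: "'a measure" +
  fixes G :: "'a measure" and T :: real and B :: "real \<Rightarrow> 'a \<Rightarrow> real^'d"
    and F :: "real \<Rightarrow> 'a measure"
  assumes T_pos: "0 < T"
    and bm: "brownian_motion M T B"
    and sub_G: "subalgebra M G"
    and indep_G: "indep_set (sets G)
       (sigma_sets (space M) {B r -` A \<inter> space M | r A. r \<in> {0..T} \<and> A \<in> sets borel})"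
    and F_eq: "F = bm_filtration M G B"
begin

lemma B_measurable: "t \<in> {0..T} \<Longrightarrow> B t \<in> borel_measurable M"
  using bm by (auto simp: brownian_motion_def)

definition "gens t = sets G \<union> null_sets M \<union> {B r -` A \<inter> space M | r A. 0 \<le> r \<and> r \<le> t \<and> A \<in> sets borel}"

lemma gens_sub: "t \<le> T \<Longrightarrow> gens t \<subseteq> sets M"
  using sub_G B_measurable by (auto simp: gens_def subalgebra_def null_sets_def intro!: measurable_sets)

lemma space_F [simp]: "space (F t) = space M"
  by (simp add: F_eq bm_filtration_def space_measure_of_conv)

lemma gens_Pow: "gens t \<subseteq> Pow (space M)"
  using sub_G sets.sets_into_space by (fastforce simp: gens_def subalgebra_def null_sets_def)

lemma sets_F: "sets (F t) = sigma_sets (space M) (gens t)"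
  unfolding F_eq bm_filtration_def using gens_Pow[of t] by (simp add: gens_def sets_measure_of)

lemma sub_F: "t \<le> T \<Longrightarrow> subalgebra M (F t)"
  using sets.sigma_sets_subset[OF gens_sub] by (simp add: subalgebra_def sets_F)

lemma F_mono: "s \<le> t \<Longrightarrow> sets (F s) \<subseteq> sets (F t)"
  unfolding sets_F by (rule sigma_sets_mono') (auto simp: gens_def intro: order_trans)

lemma sub_F_F: "s \<le> t \<Longrightarrow> subalgebra (F t) (F s)"
  using F_mono by (simp add: subalgebra_def)

lemma F_measurable_mono: "f \<in> borel_measurable (F s) \<Longrightarrow> s \<le> t \<Longrightarrow> f \<in> borel_measurable (F t)"
  using measurable_from_subalg[OF sub_F_F] by blast

lemma F_measurable_M: "f \<in> borel_measurable (F s) \<Longrightarrow> s \<le> T \<Longrightarrow> f \<in> borel_measurable M"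
  using measurable_from_subalg[OF sub_F] by blast

lemma B_F: "0 \<le> r \<Longrightarrow> r \<le> t \<Longrightarrow> B r \<in> borel_measurable (F t)"
  by (rule measurableI) (auto simp: sets_F gens_def intro!: sigma_sets.Basic)

text \<open>The definition of Brownian motion gives independence of the increment from the past of
  \<open>B\<close> only. The initial sigma-algebra and the null sets are added by a pi-system
  argument: \<open>prob (g \<inter> (a \<inter> c)) = prob g * prob (a \<inter> c) = prob g * prob a
  * prob c\<close>, where the first equality uses that \<open>G\<close> is independent of the whole
  of \<open>B\<close>.\<close>

lemma indep_F:
  assumes st: "0 \<le> s" "s < t" "t \<le> T"
  shows "indep_set (sets (F s)) {(\<lambda>\<omega>. B t \<omega> - B s \<omega>) -` A \<inter> space M | A. A \<in> sets borel}" (is "indep_set _ ?C")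
proof -
  let ?gA = "{B r -` A \<inter> space M | r A. r \<in> {0..s} \<and> A \<in> sets borel}"
  let ?gT = "{B r -` A \<inter> space M | r A. r \<in> {0..T} \<and> A \<in> sets borel}"
  let ?A = "sigma_sets (space M) ?gA"
  let ?S = "sigma (space M) ?gT"
  have gT: "?gT \<subseteq> Pow (space M)" by auto
  have AC: "indep_set ?A ?C"
    using bm st by (auto simp: brownian_motion_def)
  have A_ev: "?A \<subseteq> events" and C_ev: "?C \<subseteq> events" using AC by (auto simp: indep_sets2_eq)
  have A_S: "?A \<subseteq> sigma_sets (space M) ?gT"
  proof (rule sigma_sets_mono', safe)
    fix r :: real and A :: "(real^'d) set" assume "r \<in> {0..s}" "A \<in> sets borel"
    then show "\<exists>r' A'. B r -` A \<inter> space M = B r' -` A' \<inter> space M \<and> r' \<in> {0..T} \<and> A' \<in> sets borel"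
      using st by (intro exI[of _ r] exI[of _ A]) auto
  qed
  have BS: "B r \<in> borel_measurable ?S" if "r \<in> {0..T}" for r
    by (rule measurableI) (use that gT in \<open>auto simp: space_measure_of_conv sets_measure_of intro!: sigma_sets.Basic\<close>)
  have C_S: "c \<in> sigma_sets (space M) ?gT" if "c \<in> ?C" for c
  proof -
    have "(\<lambda>\<omega>. B t \<omega> - B s \<omega>) \<in> borel_measurable ?S"
      using st by (intro borel_measurable_diff BS) auto
    then have "\<And>A. A \<in> sets borel \<Longrightarrow> (\<lambda>\<omega>. B t \<omega> - B s \<omega>) -` A \<inter> space ?S \<in> sets ?S" by (rule measurable_sets)
    then show ?thesis using that gT by (auto simp: space_measure_of_conv sets_measure_of)
  qed
  \<comment> \<open>Events that agree almost surely with an event of \<open>G\<close> intersected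
    with one of the past of \<open>B\<close>. The class is stable under intersections and contains
    all three kinds of generators.\<close>
  define P where "P = {D \<in> events. \<exists>g\<in>sets G. \<exists>a\<in>?A. AE \<omega> in M. \<omega> \<in> D \<longleftrightarrow> \<omega> \<in> g \<inter> a}"
  have PI: "D \<in> P" if "D \<in> events" "g \<in> sets G" "a \<in> ?A" "AE \<omega> in M. \<omega> \<in> D \<longleftrightarrow> \<omega> \<in> g \<inter> a" for D g a
    unfolding P_def using that by blast
  have G_ev: "sets G \<subseteq> events" using sub_G by (auto simp: subalgebra_def)
  have spG: "space M \<in> sets G" using sub_G by (metis sets.top subalgebra_def)
  have spA: "space M \<in> ?A" by (rule sigma_sets_top)
  have "indep_set P ?C"
  proof (rule indep_setI)
    show "P \<subseteq> events" by (auto simp: P_def)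
    show "?C \<subseteq> events" by fact
    fix D c assume "D \<in> P" and c: "c \<in> ?C"
    then obtain g a where g: "g \<in> sets G" and a: "a \<in> ?A" and D: "D \<in> events"
      and eq: "AE \<omega> in M. \<omega> \<in> D \<longleftrightarrow> \<omega> \<in> g \<inter> a"
      by (auto simp: P_def)
    have ev: "g \<in> events" "a \<in> events" "c \<in> events" using g a c G_ev A_ev C_ev by auto
    have ac: "a \<inter> c \<in> sigma_sets (space M) ?gT"
    proof -
      interpret sa: sigma_algebra "space M" "sigma_sets (space M) ?gT"
        by (rule sigma_algebra_sigma_sets) fact
      show ?thesis by (rule sa.Int[OF subsetD[OF A_S a] C_S[OF c]])
    qed
    have "prob (D \<inter> c) = prob (g \<inter> (a \<inter> c))"
      by (rule measure_eq_AE) (use eq D ev in auto)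
    also have "\<dots> = prob g * prob (a \<inter> c)"
      by (rule indep_setD[OF indep_G g ac])
    also have "\<dots> = prob g * prob a * prob c"
      using indep_setD[OF AC a c] by simp
    also have "prob g * prob a = prob (g \<inter> a)"
      by (rule indep_setD[OF indep_G g subsetD[OF A_S a], symmetric])
    also have "prob (g \<inter> a) = prob D"
      by (rule measure_eq_AE) (use eq D ev in auto)
    finally show "prob (D \<inter> c) = prob D * prob c" .
  qed
  moreover have "Int_stable P"
  proof (rule Int_stableI)
    fix D D' assume "D \<in> P" "D' \<in> P"
    then obtain g a g' a' where *: "g \<in> sets G" "a \<in> ?A" "g' \<in> sets G" "a' \<in> ?A" "D \<in> events" "D' \<in> events"
      "AE \<omega> in M. \<omega> \<in> D \<longleftrightarrow> \<omega> \<in> g \<inter> a" "AE \<omega> in M. \<omega> \<in> D' \<longleftrightarrow> \<omega> \<in> g' \<inter> a'"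
      by (auto simp: P_def)
    interpret sa: sigma_algebra "space M" ?A
      by (rule sigma_algebra_sigma_sets) auto
    have "AE \<omega> in M. \<omega> \<in> D \<inter> D' \<longleftrightarrow> \<omega> \<in> (g \<inter> g') \<inter> (a \<inter> a')"
      using *(7,8) by eventually_elim auto
    then show "D \<inter> D' \<in> P"
      by (rule PI[rotated 3]) (use * in \<open>blast intro: sets.Int sa.Int\<close>)+
  qed
  moreover have "Int_stable ?C" by (rule Int_stable_vimage)
  ultimately have ind: "indep_set (sigma_sets (space M) P) (sigma_sets (space M) ?C)"
    by (rule indep_set_sigma_sets)
  have "gens s \<subseteq> P"
  proof
    fix D assume "D \<in> gens s"
    then consider "D \<in> sets G" | "D \<in> null_sets M" | "D \<in> ?gA" by (auto simp: gens_def)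
    then show "D \<in> P"
    proof cases
      case 1
      show ?thesis
        by (rule PI[OF _ 1 spA]) (use 1 G_ev sets.sets_into_space in blast, auto)
    next
      case 2
      \<comment> \<open>A null set agrees almost surely with the empty event, which belongs to
        \<open>G\<close>.\<close>
      then have "AE \<omega> in M. \<omega> \<in> D \<longleftrightarrow> \<omega> \<in> {} \<inter> space M" using AE_not_in[OF 2] by auto
      then show ?thesis
        by (rule PI[rotated 3]) (use 2 spA in \<open>auto simp: null_sets_def\<close>)
    next
      case 3
      then have "D \<in> ?A" by (rule sigma_sets.Basic)
      then show ?thesis
        by (intro PI[OF _ spG]) (use A_ev sets.sets_into_space in blast, assumption, auto)
    qed
  qed
  then have "sets (F s) \<subseteq> sigma_sets (space M) P" unfolding sets_F by (rule sigma_sets_mono')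
  moreover have "?C \<subseteq> sigma_sets (space M) ?C" by (auto intro: sigma_sets.Basic)
  ultimately show ?thesis
    using ind unfolding indep_sets2_eq by blast
qed

lemma indep_var_F:
  fixes W :: "'a \<Rightarrow> real" and \<phi> :: "real^'d \<Rightarrow> real"
  assumes st: "0 \<le> s" "s < t" "t \<le> T" and W: "W \<in> borel_measurable (F s)" and \<phi>: "\<phi> \<in> borel_measurable borel"
  shows "indep_var borel W borel (\<lambda>\<omega>. \<phi> (B t \<omega> - B s \<omega>))"
proof -
  have rv: "W \<in> borel_measurable M" by (rule F_measurable_M[OF W]) (use st in auto)
  have d: "(\<lambda>\<omega>. B t \<omega> - B s \<omega>) \<in> borel_measurable M" using st by (intro borel_measurable_diff B_measurable) auto
  let ?W = "{W -` A \<inter> space M |A. A \<in> sets borel}"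
  let ?D = "{(\<lambda>\<omega>. \<phi> (B t \<omega> - B s \<omega>)) -` A \<inter> space M |A. A \<in> sets borel}"
  have W_F: "?W \<subseteq> sets (F s)"
  proof
    fix a assume "a \<in> ?W"
    then obtain A where "a = W -` A \<inter> space M" "A \<in> sets borel" by blast
    then show "a \<in> sets (F s)" using measurable_sets[OF W, of A] by simp
  qed
  have D_C: "?D \<subseteq> {(\<lambda>\<omega>. B t \<omega> - B s \<omega>) -` A \<inter> space M | A. A \<in> sets borel}"
  proof
    fix a assume "a \<in> ?D"
    then obtain A where a: "a = (\<lambda>\<omega>. \<phi> (B t \<omega> - B s \<omega>)) -` A \<inter> space M" and A: "A \<in> sets borel" by blast
    from A have "\<phi> -` A \<in> sets borel" using measurable_sets[OF \<phi>] by (metis Int_UNIV_right space_borel)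
    moreover have "a = (\<lambda>\<omega>. B t \<omega> - B s \<omega>) -` (\<phi> -` A) \<inter> space M" unfolding a by auto
    ultimately show "a \<in> {(\<lambda>\<omega>. B t \<omega> - B s \<omega>) -` A \<inter> space M | A. A \<in> sets borel}" by blast
  qed
  have "indep_set ?W ?D"
  proof (rule indep_setI)
    show "?W \<subseteq> events" using W_F sub_F[of s] st unfolding subalgebra_def by (meson order_trans less_imp_le)
    show "?D \<subseteq> events"
      using D_C indep_F[OF st] unfolding indep_sets2_eq by (meson order_trans)
  qed (use indep_setD[OF indep_F[OF st]] W_F D_C in \<open>meson subsetD\<close>)
  moreover have "Int_stable ?W" by (rule Int_stable_vimage)
  moreover have "Int_stable ?D" by (rule Int_stable_vimage)
  ultimately have "indep_set (sigma_sets (space M) ?W) (sigma_sets (space M) ?D)"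
    by (rule indep_set_sigma_sets)
  moreover have "(\<lambda>\<omega>. \<phi> (B t \<omega> - B s \<omega>)) \<in> borel_measurable M"
    using measurable_compose[OF d \<phi>] .
  ultimately show ?thesis unfolding indep_var_eq using rv by blast
qed

end

text \<open>\<open>lborel\<close> on \<open>real^'d\<close> is an image of the product measure
  indexed by \<open>Basis\<close>. The factor belonging to a basis vector is found by inverting
  \<open>i \<mapsto> axis i 1\<close>, which explains the definite descriptions in the
  proof.\<close>

lemma has_bochner_integral_lborel_vec_prod:
  fixes h :: "'d::finite \<Rightarrow> real \<Rightarrow> real"
  assumes h: "\<And>i. integrable lborel (h i)"
  shows "has_bochner_integral lborel (\<lambda>x::real^'d. \<Prod>i\<in>UNIV. h i (x $ i)) (\<Prod>i\<in>UNIV. \<integral>y. h i y \<partial>lborel)"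
proof -
  interpret product_sigma_finite "\<lambda>_::real^'d. lborel :: real measure" ..
  let ?P = "\<Pi>\<^sub>M b\<in>(Basis::(real^'d) set). (lborel :: real measure)"
  let ?g = "\<lambda>f::real^'d \<Rightarrow> real. \<Sum>b\<in>Basis. f b *\<^sub>R b"
  have [measurable]: "?g \<in> ?P \<rightarrow>\<^sub>M borel" by measurable
  have [measurable]: "h i \<in> borel_measurable borel" for i using h[of i] by (simp add: integrable_iff_bounded)
  have Basis: "(Basis::(real^'d) set) = (\<lambda>i. axis i 1) ` UNIV" by (auto simp: Basis_vec_def)
  have inj: "inj (\<lambda>i::'d. axis i (1::real))" by (auto simp: inj_on_def axis_eq_axis)
  have re: "(\<Prod>i\<in>UNIV. k i (axis i 1)) = (\<Prod>b\<in>Basis. k (THE i. axis i 1 = b) b)" for k :: "'d \<Rightarrow> real^'d \<Rightarrow> real"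
    unfolding Basis by (subst prod.reindex[OF inj]) (auto simp: axis_eq_axis)
  have comp: "?g f $ i = f (axis i 1)" for f i
  proof -
    have "?g f $ i = ?g f \<bullet> axis i 1" by (simp add: inner_axis)
    also have "\<dots> = f (axis i 1)"
      unfolding inner_sum_left by (subst sum.remove[of _ "axis i 1"])
        (auto simp: Basis inner_Basis intro!: sum.neutral)
    finally show ?thesis .
  qed
  have int: "integrable ?P (\<lambda>f. \<Prod>b\<in>Basis. h (THE i. axis i 1 = b) (f b))"
    and eq: "(\<integral>f. (\<Prod>b\<in>Basis. h (THE i. axis i 1 = b) (f b)) \<partial>?P)
      = (\<Prod>b\<in>(Basis::(real^'d) set). \<integral>y. h (THE i. axis i 1 = b) y \<partial>lborel)"
    using product_integrable_prod[where I=Basis and f="\<lambda>b. h (THE i. axis i 1 = b)"]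
      product_integral_prod[where I=Basis and f="\<lambda>b. h (THE i. axis i 1 = b)"]
    by (simp_all add: h)
  have "has_bochner_integral ?P (\<lambda>f. \<Prod>i\<in>UNIV. h i (?g f $ i)) (\<Prod>i\<in>UNIV. \<integral>y. h i y \<partial>lborel)"
  proof -
    have "(\<Prod>i\<in>UNIV. h i (f (axis i 1))) = (\<Prod>b\<in>Basis. h (THE i. axis i 1 = b) (f b))" for f :: "real^'d \<Rightarrow> real"
      by (rule re[of "\<lambda>i b. h i (f b)"])
    moreover have "(\<Prod>i\<in>UNIV. integral\<^sup>L lborel (h i)) = (\<Prod>b\<in>(Basis::(real^'d) set). integral\<^sup>L lborel (h (THE i. axis i 1 = b)))"
      by (rule re[of "\<lambda>i b. integral\<^sup>L lborel (h i)"])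
    ultimately show ?thesis unfolding has_bochner_integral_iff comp using int eq by presburger
  qed
  then show ?thesis
    unfolding lborel_eq[where 'a="real^'d"] by (subst has_bochner_integral_distr) auto
qed

section \<open>Moments of increments and stochastic integrals over a single step\<close>

context brownian_basis
begin

lemma increment_moments:
  assumes st: "0 \<le> s" "s < t" "t \<le> T"
  shows "has_bochner_integral M (\<lambda>\<omega>. (B t \<omega> - B s \<omega>) $ i) 0"
    and "has_bochner_integral M (\<lambda>\<omega>. (B t \<omega> - B s \<omega>) $ i * (B t \<omega> - B s \<omega>) $ j) (if i = j then t - s else 0)"
proof -
  let ?n = "normal_density 0 (sqrt (t - s))"
  have s0: "0 < sqrt (t - s)" using st by simp
  have D: "distributed M lborel (\<lambda>\<omega>. B t \<omega> - B s \<omega>) (\<lambda>x. ennreal (\<Prod>i\<in>UNIV. ?n (x $ i)))"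
    using bm st by (auto simp: brownian_motion_def)
  have dnn: "0 \<le> (\<Prod>i\<in>UNIV. ?n (x $ i))" for x :: "real^'d"
    by (intro prod_nonneg) (simp add: normal_density_nonneg)
  have tr: "has_bochner_integral M (\<lambda>\<omega>. g (B t \<omega> - B s \<omega>)) c"
    if "has_bochner_integral lborel (\<lambda>x::real^'d. (\<Prod>i\<in>UNIV. ?n (x $ i)) * g x) c" "g \<in> borel_measurable borel" for g c
    using distributed_integral[OF D, of g] distributed_integrable[OF D, of g] that dnn
    by (simp add: has_bochner_integral_iff)
  have m0: "has_bochner_integral lborel ?n 1"
    using integral_normal_density[OF s0, of 0] integrable_normal_density[OF s0, of 0]
    by (simp add: has_bochner_integral_iff)
  have m1: "has_bochner_integral lborel (\<lambda>x. ?n x * x) 0"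
    using normal_moment_odd[OF s0, of 0 0] by simp
  have m2: "has_bochner_integral lborel (\<lambda>x. ?n x * (x * x)) (t - s)"
    using normal_moment_even[OF s0, of 0 1] st by (simp add: power2_eq_square diff_divide_distrib)
  \<comment> \<open>The coordinate \<open>x $ i\<close> is written as a product over all coordinates
    with factor 1 off \<open>i\<close>, so that the integral factorises. The products of two
    coordinates below are treated in the same way.\<close>
  let ?h = "\<lambda>l x. ?n x * (if l = i then x else 1)"
  have h: "has_bochner_integral lborel (?h l) (if l = i then 0 else 1)" for l
    using m0 m1 by auto
  have p1: "(\<Prod>l\<in>UNIV. ?h l (x $ l)) = (\<Prod>l\<in>UNIV. ?n (x $ l)) * (x $ i)" for x :: "real^'d"
    unfolding prod.distrib by (simp add: prod.delta)
  have "has_bochner_integral lborel (\<lambda>x::real^'d. \<Prod>l\<in>UNIV. ?h l (x $ l)) (\<Prod>l\<in>UNIV. \<integral>y. ?h l y \<partial>lborel)"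
    by (rule has_bochner_integral_lborel_vec_prod) (use h in \<open>auto simp: has_bochner_integral_iff\<close>)
  moreover have "(\<Prod>l\<in>UNIV. \<integral>y. ?h l y \<partial>lborel) = 0"
  proof -
    have "(\<integral>y. ?h i y \<partial>lborel) = 0" using h[of i] by (simp add: has_bochner_integral_iff)
    then show ?thesis by (intro prod_zero[OF finite]) (rule bexI[OF _ UNIV_I])
  qed
  ultimately show "has_bochner_integral M (\<lambda>\<omega>. (B t \<omega> - B s \<omega>) $ i) 0"
    unfolding p1 by (intro tr[of "\<lambda>x. x $ i"]) auto
  let ?k = "\<lambda>l x. ?n x * ((if l = i then x else 1) * (if l = j then x else 1))"
  have k: "has_bochner_integral lborel (?k l)
      (if l = i then if l = j then t - s else 0 else if l = j then 0 else 1)" for l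
    using m0 m1 m2 by auto
  have p2: "(\<Prod>l\<in>UNIV. ?k l (x $ l)) = (\<Prod>l\<in>UNIV. ?n (x $ l)) * (x $ i * x $ j)" for x :: "real^'d"
    unfolding prod.distrib by (simp add: prod.delta)
  have "has_bochner_integral lborel (\<lambda>x::real^'d. \<Prod>l\<in>UNIV. ?k l (x $ l)) (\<Prod>l\<in>UNIV. \<integral>y. ?k l y \<partial>lborel)"
    by (rule has_bochner_integral_lborel_vec_prod) (use k in \<open>auto simp only: has_bochner_integral_iff\<close>)
  moreover have "(\<Prod>l\<in>UNIV. \<integral>y. ?k l y \<partial>lborel) = (if i = j then t - s else 0)"
  proof -
    have "(\<Prod>l\<in>UNIV. \<integral>y. ?k l y \<partial>lborel)
        = (\<Prod>l\<in>UNIV. if l = i then if l = j then t - s else 0 else if l = j then 0 else 1)"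
      using k unfolding has_bochner_integral_iff by (intro prod.cong) blast+
    also have "\<dots> = (if i = j then t - s else 0)"
    proof (cases "i = j")
      case True
      then have "(\<Prod>l\<in>UNIV. if l = i then if l = j then t - s else 0 else if l = j then 0 else 1)
        = (\<Prod>l\<in>UNIV. if l = j then t - s else 1)" by (intro prod.cong) auto
      then show ?thesis using True by (simp add: prod.delta)
    qed (auto intro!: prod_zero bexI[of _ i])
    finally show ?thesis .
  qed
  ultimately show "has_bochner_integral M (\<lambda>\<omega>. (B t \<omega> - B s \<omega>) $ i * (B t \<omega> - B s \<omega>) $ j) (if i = j then t - s else 0)"
    unfolding p2 by (intro tr[of "\<lambda>x. x $ i * x $ j"]) auto
qed

text \<open>Independence splits the expectation. The case \<open>s = t\<close> is included because
  steps cut at an intermediate time may be empty.\<close>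

lemma increment_mult1:
  fixes W :: "'a \<Rightarrow> real"
  assumes st: "0 \<le> s" "s \<le> t" "t \<le> T" and W: "W \<in> borel_measurable (F s)" "integrable M W"
  shows "has_bochner_integral M (\<lambda>\<omega>. W \<omega> * (B t \<omega> - B s \<omega>) $ j) 0"
proof (cases "s = t")
  case False
  then have st': "s < t" using st by simp
  have ind: "indep_var borel W borel (\<lambda>\<omega>. (B t \<omega> - B s \<omega>) $ j)"
    by (rule indep_var_F[OF st(1) st' st(3) W(1), where \<phi>="\<lambda>x. x $ j"]) auto
  note m = increment_moments(1)[OF st(1) st' st(3), of j]
  show ?thesis
    using indep_var_lebesgue_integral[OF ind] indep_var_integrable[OF ind] W(2) m
    by (simp add: has_bochner_integral_iff)
qed (simp add: has_bochner_integral_iff)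

lemma increment_mult2:
  fixes W :: "'a \<Rightarrow> real"
  assumes st: "0 \<le> s" "s \<le> t" "t \<le> T" and W: "W \<in> borel_measurable (F s)" "integrable M W"
  shows "has_bochner_integral M (\<lambda>\<omega>. W \<omega> * ((B t \<omega> - B s \<omega>) $ j * (B t \<omega> - B s \<omega>) $ k))
    (if j = k then (t - s) * (\<integral>\<omega>. W \<omega> \<partial>M) else 0)"
proof (cases "s = t")
  case False
  then have st': "s < t" using st by simp
  have ind: "indep_var borel W borel (\<lambda>\<omega>. (B t \<omega> - B s \<omega>) $ j * (B t \<omega> - B s \<omega>) $ k)"
    by (rule indep_var_F[OF st(1) st' st(3) W(1), where \<phi>="\<lambda>x. x $ j * x $ k"]) auto
  note m = increment_moments(2)[OF st(1) st' st(3), of j k]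
  show ?thesis
    using indep_var_lebesgue_integral[OF ind] indep_var_integrable[OF ind] W(2) m
    by (auto simp: has_bochner_integral_iff)
qed (simp add: has_bochner_integral_iff)

definition bdd_meas :: "real \<Rightarrow> ('a \<Rightarrow> 'b::euclidean_space) \<Rightarrow> bool" where
  "bdd_meas s \<eta> \<longleftrightarrow> \<eta> \<in> borel_measurable (F s) \<and> (\<exists>C. \<forall>\<omega>\<in>space M. norm (\<eta> \<omega>) \<le> C)"

lemma bdd_meas_M: "bdd_meas s \<eta> \<Longrightarrow> s \<le> T \<Longrightarrow> \<eta> \<in> borel_measurable M"
  unfolding bdd_meas_def using F_measurable_M by blast

lemma bdd_meas_mono: "bdd_meas s \<eta> \<Longrightarrow> s \<le> t \<Longrightarrow> bdd_meas t \<eta>"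
  by (auto simp: bdd_meas_def intro: F_measurable_mono)

abbreviation step :: "real \<Rightarrow> real \<Rightarrow> ('a \<Rightarrow> real^'d^'n) \<Rightarrow> 'a \<Rightarrow> real^'n" where
  "step a c \<eta> \<omega> \<equiv> \<eta> \<omega> *v (B c \<omega> - B a \<omega>)"

lemma step_F:
  assumes "0 \<le> a" "a \<le> c" "c \<le> T" "bdd_meas a \<eta>"
  shows "step a c \<eta> \<in> borel_measurable (F c)"
proof -
  have [measurable]: "\<eta> \<in> borel_measurable (F c)"
    using assms F_measurable_mono by (auto simp: bdd_meas_def)
  have [measurable]: "B c \<in> borel_measurable (F c)" "B a \<in> borel_measurable (F c)"
    using assms by (auto intro: B_F)
  show ?thesis by measurable
qed

lemma step_L2:
  assumes ac: "0 \<le> a" "a \<le> c" "c \<le> T" and \<eta>: "bdd_meas a \<eta>"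
  shows "step a c \<eta> \<in> L2 M M"
proof -
  obtain C where C: "\<And>\<omega>. \<omega> \<in> space M \<Longrightarrow> norm (\<eta> \<omega>) \<le> C" using \<eta> by (auto simp: bdd_meas_def)
  have d: "(\<lambda>\<omega>. B c \<omega> - B a \<omega>) \<in> L2 M M"
  proof -
    have "integrable M (\<lambda>\<omega>. \<Sum>i\<in>UNIV. (B c \<omega> - B a \<omega>) $ i * (B c \<omega> - B a \<omega>) $ i)"
    proof (rule Bochner_Integration.integrable_sum)
      fix i :: 'd
      show "integrable M (\<lambda>\<omega>. (B c \<omega> - B a \<omega>) $ i * (B c \<omega> - B a \<omega>) $ i)"
        using increment_mult2[OF ac borel_measurable_const integrable_const, of 1 i i]
        by (simp only: has_bochner_integral_iff mult_1_left)
    qed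
    then have "integrable M (\<lambda>\<omega>. (norm (B c \<omega> - B a \<omega>))\<^sup>2)"
      unfolding power2_norm_eq_inner inner_vec_def by simp
    then show ?thesis
      unfolding L2_iff using ac by (auto intro!: borel_measurable_diff B_measurable)
  qed
  show ?thesis
  proof (rule L2_bound[OF _ d, where C=C])
    show "step a c \<eta> \<in> borel_measurable M"
      using F_measurable_M[OF step_F[OF assms]] ac by simp
    show "AE \<omega> in M. norm (step a c \<eta> \<omega>) \<le> C * norm (B c \<omega> - B a \<omega>)"
      by (rule AE_I2) (meson C mult_right_mono norm_ge_zero norm_matrix_vector_mult_le order_trans)
  qed
qed

lemma bdd_meas_mult_integrable:
  fixes f :: "'a \<Rightarrow> real"
  assumes "bdd_meas s \<eta>" "s \<le> T" "integrable M f" "f \<in> borel_measurable M"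
    "\<And>\<omega>. \<bar>g \<omega>\<bar> \<le> norm (\<eta> \<omega>)" "g \<in> borel_measurable M"
  shows "integrable M (\<lambda>\<omega>. f \<omega> * g \<omega>)"
proof -
  obtain C where C: "\<And>\<omega>. \<omega> \<in> space M \<Longrightarrow> norm (\<eta> \<omega>) \<le> C" using assms(1) by (auto simp: bdd_meas_def)
  show ?thesis
  proof (rule Bochner_Integration.integrable_bound[where f="\<lambda>\<omega>. C * f \<omega>"])
    show "AE \<omega> in M. norm (f \<omega> * g \<omega>) \<le> norm (C * f \<omega>)"
    proof (rule AE_I2)
      fix \<omega> assume w: "\<omega> \<in> space M"
      have "\<bar>g \<omega>\<bar> \<le> \<bar>C\<bar>" using C[OF w] assms(5)[of \<omega>] by linarith
      then show "norm (f \<omega> * g \<omega>) \<le> norm (C * f \<omega>)" by (simp add: abs_mult mult.commute[of "\<bar>f \<omega>\<bar>"] mult_right_mono)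
    qed
  qed (use assms in auto)
qed

lemma matrix_component_le: "\<bar>(A::real^'d^'n) $ i $ j\<bar> \<le> norm A"
  by (meson Finite_Cartesian_Product.norm_nth_le component_le_norm_cart order_trans)

text \<open>In components, \<open>Z\<close> times the entries of \<open>\<eta>\<close> is measurable
  for \<open>F a\<close>, and the later increment is centred and independent of it.\<close>

lemma step_orthogonal:
  fixes \<eta> :: "'a \<Rightarrow> real^'d^'n"
  assumes ac: "0 \<le> a" "a \<le> c" "c \<le> T" and \<eta>: "bdd_meas a \<eta>" and Z: "Z \<in> borel_measurable (F a)" "Z \<in> L2 M M"
  shows "(\<integral>\<omega>. Z \<omega> \<bullet> step a c \<eta> \<omega> \<partial>M) = 0"
proof -
  have [measurable]: "\<eta> \<in> borel_measurable (F a)" using \<eta> by (auto simp: bdd_meas_def)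
  have [measurable]: "\<eta> \<in> borel_measurable M" "Z \<in> borel_measurable M"
    using bdd_meas_M[OF \<eta>] ac L2_measurable[OF Z(2)] by simp_all
  note [measurable] = Z(1)
  have Zi: "integrable M (\<lambda>\<omega>. Z \<omega> $ i)" for i
    by (rule Bochner_Integration.integrable_bound[OF L2_integrable1[OF Z(2)]])
       (auto simp: component_le_norm_cart)
  have "has_bochner_integral M (\<lambda>\<omega>. (Z \<omega> $ i * \<eta> \<omega> $ i $ j) * (B c \<omega> - B a \<omega>) $ j) 0" for i j
  proof (rule increment_mult1[OF ac])
    show "(\<lambda>\<omega>. Z \<omega> $ i * \<eta> \<omega> $ i $ j) \<in> borel_measurable (F a)" by measurable
    show "integrable M (\<lambda>\<omega>. Z \<omega> $ i * \<eta> \<omega> $ i $ j)"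
      by (rule bdd_meas_mult_integrable[OF \<eta>]) (use ac Zi in \<open>auto simp: matrix_component_le\<close>)
  qed
  then show ?thesis
    unfolding inner_matrix_vector_mult_sum has_bochner_integral_iff by simp
qed

text \<open>The covariance matrix of the increment is \<open>c - a\<close> times the identity, so
  only products of entries with equal column index survive.\<close>

lemma step_isometry1:
  fixes \<eta> \<zeta> :: "'a \<Rightarrow> real^'d^'n"
  assumes ac: "0 \<le> a" "a \<le> c" "c \<le> T" and \<eta>: "bdd_meas a \<eta>" and \<zeta>: "bdd_meas a \<zeta>"
  shows "(\<integral>\<omega>. step a c \<eta> \<omega> \<bullet> step a c \<zeta> \<omega> \<partial>M) = (c - a) * (\<integral>\<omega>. \<eta> \<omega> \<bullet> \<zeta> \<omega> \<partial>M)"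
proof -
  have [measurable]: "\<eta> \<in> borel_measurable (F a)" "\<zeta> \<in> borel_measurable (F a)" using \<eta> \<zeta> by (auto simp: bdd_meas_def)
  have [measurable]: "\<eta> \<in> borel_measurable M" "\<zeta> \<in> borel_measurable M"
    using bdd_meas_M[OF \<eta>] bdd_meas_M[OF \<zeta>] ac by simp_all
  have e1: "integrable M (\<lambda>\<omega>. \<eta> \<omega> $ i $ j * \<zeta> \<omega> $ i $ k)" for i j k
  proof (rule bdd_meas_mult_integrable[OF \<zeta>])
    have "integrable M (\<lambda>\<omega>. 1 * \<eta> \<omega> $ i $ j)"
      by (rule bdd_meas_mult_integrable[OF \<eta>]) (use ac in \<open>auto simp: matrix_component_le\<close>)
    then show "integrable M (\<lambda>\<omega>. \<eta> \<omega> $ i $ j)" by simp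
  qed (use ac in \<open>auto simp: matrix_component_le\<close>)
  have "has_bochner_integral M (\<lambda>\<omega>. (\<eta> \<omega> $ i $ j * \<zeta> \<omega> $ i $ k) * ((B c \<omega> - B a \<omega>) $ j * (B c \<omega> - B a \<omega>) $ k))
      (if j = k then (c - a) * (\<integral>\<omega>. \<eta> \<omega> $ i $ j * \<zeta> \<omega> $ i $ k \<partial>M) else 0)" for i j k
    by (rule increment_mult2[OF ac _ e1]) measurable
  then have "(\<integral>\<omega>. step a c \<eta> \<omega> \<bullet> step a c \<zeta> \<omega> \<partial>M)
     = (\<Sum>i\<in>UNIV. \<Sum>j\<in>UNIV. \<Sum>k\<in>UNIV. if j = k then (c - a) * (\<integral>\<omega>. \<eta> \<omega> $ i $ j * \<zeta> \<omega> $ i $ k \<partial>M) else 0)"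
    unfolding matrix_vector_mult_inner_sum has_bochner_integral_iff by simp
  also have "\<dots> = (c - a) * (\<Sum>i\<in>UNIV. \<Sum>j\<in>UNIV. \<integral>\<omega>. \<eta> \<omega> $ i $ j * \<zeta> \<omega> $ i $ j \<partial>M)"
    by (simp add: sum_distrib_left)
  also have "(\<Sum>i\<in>UNIV. \<Sum>j\<in>UNIV. \<integral>\<omega>. \<eta> \<omega> $ i $ j * \<zeta> \<omega> $ i $ j \<partial>M) = (\<integral>\<omega>. \<eta> \<omega> \<bullet> \<zeta> \<omega> \<partial>M)"
    by (simp add: inner_vec_def e1)
  finally show ?thesis .
qed

text \<open>If the intervals overlap, the first is cut at \<open>c\<close> and both at
  \<open>e = min b d\<close>, the end of the overlap. Terms over disjoint intervals vanish by
  \<open>step_orthogonal\<close>, and only the overlap from \<open>c\<close> to \<open>e\<close>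
  contributes.\<close>

lemma step_isometry_le:
  fixes \<eta> \<zeta> :: "'a \<Rightarrow> real^'d^'n"
  assumes ab: "0 \<le> a" "a \<le> b" "b \<le> T" and cd: "0 \<le> c" "c \<le> d" "d \<le> T" and "a \<le> c"
    and \<eta>: "bdd_meas a \<eta>" and \<zeta>: "bdd_meas c \<zeta>"
  shows "(\<integral>\<omega>. step a b \<eta> \<omega> \<bullet> step c d \<zeta> \<omega> \<partial>M) = max 0 (min b d - max a c) * (\<integral>\<omega>. \<eta> \<omega> \<bullet> \<zeta> \<omega> \<partial>M)"
proof (cases "b \<le> c")
  case True
  have "(\<integral>\<omega>. step a b \<eta> \<omega> \<bullet> step c d \<zeta> \<omega> \<partial>M) = 0"
    by (rule step_orthogonal[OF cd \<zeta> F_measurable_mono[OF step_F[OF ab \<eta>] True] step_L2[OF ab \<eta>]])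
  then show ?thesis using True \<open>a \<le> c\<close> ab cd by simp
next
  case False
  define e where "e = min b d"
  have ce: "c \<le> e" "e \<le> b" "e \<le> d" "e \<le> T" using False ab cd by (auto simp: e_def)
  have ac: "0 \<le> a" "a \<le> c" "c \<le> T" using ab cd ce \<open>a \<le> c\<close> by auto
  have \<eta>c: "bdd_meas c \<eta>" using bdd_meas_mono[OF \<eta> \<open>a \<le> c\<close>] .
  have \<eta>e: "bdd_meas e \<eta>" "bdd_meas e \<zeta>" using bdd_meas_mono \<eta>c \<zeta> ce by auto
  have L: "step a c \<eta> \<in> L2 M M" "step c e \<eta> \<in> L2 M M" "step e b \<eta> \<in> L2 M M" "step c d \<zeta> \<in> L2 M M"
    "step c e \<zeta> \<in> L2 M M" "step e d \<zeta> \<in> L2 M M"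
    using ab cd ce ac \<eta> \<eta>c \<eta>e \<zeta> by (auto intro!: step_L2)
  have "step a b \<eta> \<omega> \<bullet> step c d \<zeta> \<omega>
     = step a c \<eta> \<omega> \<bullet> step c d \<zeta> \<omega> + (step c e \<eta> \<omega> \<bullet> step c e \<zeta> \<omega> + step c e \<eta> \<omega> \<bullet> step e d \<zeta> \<omega>
       + step c e \<zeta> \<omega> \<bullet> step e b \<eta> \<omega> + step e b \<eta> \<omega> \<bullet> step e d \<zeta> \<omega>)" for \<omega>
  proof -
    have *: "x \<bullet> z = x1 \<bullet> z + (x2 \<bullet> z1 + x2 \<bullet> z2 + z1 \<bullet> x3 + x3 \<bullet> z2)"
      if "x = x1 + (x2 + x3)" "z = z1 + z2" for x x1 x2 x3 z z1 z2 :: "real^'n"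
      using that by (simp add: inner_add inner_commute)
    show ?thesis
      by (rule *) (simp_all add: matrix_vector_mult_diff_distrib)
  qed
  then have "(\<integral>\<omega>. step a b \<eta> \<omega> \<bullet> step c d \<zeta> \<omega> \<partial>M)
     = (\<integral>\<omega>. step a c \<eta> \<omega> \<bullet> step c d \<zeta> \<omega> + (step c e \<eta> \<omega> \<bullet> step c e \<zeta> \<omega> + step c e \<eta> \<omega> \<bullet> step e d \<zeta> \<omega>
       + step c e \<zeta> \<omega> \<bullet> step e b \<eta> \<omega> + step e b \<eta> \<omega> \<bullet> step e d \<zeta> \<omega>) \<partial>M)"
    by presburger
  also have "\<dots> = (\<integral>\<omega>. step a c \<eta> \<omega> \<bullet> step c d \<zeta> \<omega> \<partial>M) + ((\<integral>\<omega>. step c e \<eta> \<omega> \<bullet> step c e \<zeta> \<omega> \<partial>M)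
       + (\<integral>\<omega>. step c e \<eta> \<omega> \<bullet> step e d \<zeta> \<omega> \<partial>M) + (\<integral>\<omega>. step c e \<zeta> \<omega> \<bullet> step e b \<eta> \<omega> \<partial>M)
       + (\<integral>\<omega>. step e b \<eta> \<omega> \<bullet> step e d \<zeta> \<omega> \<partial>M))"
    using L2_integrable_inner[OF L(1,4)] L2_integrable_inner[OF L(2,5)] L2_integrable_inner[OF L(2,6)]
      L2_integrable_inner[OF L(5,3)] L2_integrable_inner[OF L(3,6)]
    by (simp only: Bochner_Integration.integral_add Bochner_Integration.integrable_add)
  also have "(\<integral>\<omega>. step a c \<eta> \<omega> \<bullet> step c d \<zeta> \<omega> \<partial>M) = 0"
    by (rule step_orthogonal[OF cd \<zeta> step_F[OF ac \<eta>] L(1)])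
  also have "(\<integral>\<omega>. step c e \<eta> \<omega> \<bullet> step e d \<zeta> \<omega> \<partial>M) = 0"
    by (rule step_orthogonal[OF _ _ _ \<eta>e(2) step_F L(2)]) (use cd ce \<eta>c in auto)
  also have "(\<integral>\<omega>. step c e \<zeta> \<omega> \<bullet> step e b \<eta> \<omega> \<partial>M) = 0"
    by (rule step_orthogonal[OF _ _ _ \<eta>e(1) step_F L(5)]) (use ab cd ce \<zeta> in auto)
  \<comment> \<open>One of the two remainders is empty, as \<open>e\<close> is the smaller of the
    right ends.\<close>
  also have "(\<integral>\<omega>. step e b \<eta> \<omega> \<bullet> step e d \<zeta> \<omega> \<partial>M) = 0"
    by (cases "b \<le> d") (auto simp: e_def min_def)
  also have "(\<integral>\<omega>. step c e \<eta> \<omega> \<bullet> step c e \<zeta> \<omega> \<partial>M) = (e - c) * (\<integral>\<omega>. \<eta> \<omega> \<bullet> \<zeta> \<omega> \<partial>M)"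
    by (rule step_isometry1[OF _ _ _ \<eta>c \<zeta>]) (use cd ce in auto)
  finally show ?thesis using ce \<open>a \<le> c\<close> by (simp add: e_def)
qed

lemma step_isometry:
  fixes \<eta> \<zeta> :: "'a \<Rightarrow> real^'d^'n"
  assumes ab: "0 \<le> a" "a \<le> b" "b \<le> T" and cd: "0 \<le> c" "c \<le> d" "d \<le> T"
    and \<eta>: "bdd_meas a \<eta>" and \<zeta>: "bdd_meas c \<zeta>"
  shows "(\<integral>\<omega>. step a b \<eta> \<omega> \<bullet> step c d \<zeta> \<omega> \<partial>M) = max 0 (min b d - max a c) * (\<integral>\<omega>. \<eta> \<omega> \<bullet> \<zeta> \<omega> \<partial>M)"
proof (cases "a \<le> c")
  case True
  then show ?thesis using step_isometry_le[OF ab cd _ \<eta> \<zeta>] by simp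
next
  case False
  then show ?thesis
    using step_isometry_le[OF cd ab _ \<zeta> \<eta>] by (simp add: inner_commute min.commute max.commute)
qed

end

section \<open>The product of time and chance, and the Ito isometry\<close>

lemma sets_restrict_lborel_pair: "sets (restrict_space lborel I \<Otimes>\<^sub>M M) = sets (restrict_space borel I \<Otimes>\<^sub>M M)"
  by (intro sets_pair_measure_cong sets_restrict_space_cong) auto

lemma finite_measure_restrict_lborel: "finite_measure (restrict_space lborel {0..T::real})"
  by standard (simp add: emeasure_restrict_space space_restrict_space emeasure_lborel_Icc_eq)

lemma integral_double_sum:
  fixes f :: "nat \<Rightarrow> nat \<Rightarrow> 'a \<Rightarrow> real"
  assumes "\<And>j k. j < m \<Longrightarrow> k < l \<Longrightarrow> integrable M (f j k)"
  shows "(\<integral>x. (\<Sum>k<l. \<Sum>j<m. f j k x) \<partial>M) = (\<Sum>k<l. \<Sum>j<m. \<integral>x. f j k x \<partial>M)"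
proof -
  have "(\<integral>x. (\<Sum>k<l. \<Sum>j<m. f j k x) \<partial>M) = (\<Sum>k<l. \<integral>x. (\<Sum>j<m. f j k x) \<partial>M)"
    by (rule Bochner_Integration.integral_sum) (auto intro!: Bochner_Integration.integrable_sum assms)
  also have "\<dots> = (\<Sum>k<l. \<Sum>j<m. \<integral>x. f j k x \<partial>M)"
    by (intro sum.cong refl Bochner_Integration.integral_sum) (auto intro!: assms)
  finally show ?thesis .
qed

context brownian_basis
begin

definition "Leb = restrict_space lborel {0..T}"
text \<open>The integrands of \<open>H2\<close> become elements of \<open>L2 Q Q\<close>, so that
  convergence of integrands and convergence of integrals are both statements about
  \<open>L2_norm\<close>.\<close>

definition "Q = Leb \<Otimes>\<^sub>M M"

lemma space_Leb [simp]: "space Leb = {0..T}" by (simp add: Leb_def space_restrict_space)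
lemma space_Q: "space Q = {0..T} \<times> space M" by (simp add: Q_def space_pair_measure)

sublocale Leb: finite_measure Leb
  unfolding Leb_def by (rule finite_measure_restrict_lborel)

sublocale LM: pair_sigma_finite Leb M ..

sublocale Q: finite_measure Q
  unfolding Q_def by (intro finite_measure_pair_measure finite_measure_axioms Leb.finite_measure_axioms)

lemma adapted_measurable_Q:
  "adapted_measurable M F {0..T} \<phi> \<Longrightarrow> (\<lambda>(t, \<omega>). \<phi> t \<omega>) \<in> borel_measurable Q"
  unfolding adapted_measurable_def Q_def Leb_def
  using measurable_cong_sets[OF sets_restrict_lborel_pair refl] by blast

lemma nn_integral_Q:
  assumes "g \<in> borel_measurable Q"
  shows "(\<integral>\<^sup>+\<omega>. (\<integral>\<^sup>+t\<in>{0..T}. g (t, \<omega>) \<partial>lborel) \<partial>M) = (\<integral>\<^sup>+z. g z \<partial>Q)"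
proof -
  have "(\<integral>\<^sup>+\<omega>. (\<integral>\<^sup>+t\<in>{0..T}. g (t, \<omega>) \<partial>lborel) \<partial>M) = (\<integral>\<^sup>+\<omega>. (\<integral>\<^sup>+t. g (t, \<omega>) \<partial>Leb) \<partial>M)"
    unfolding Leb_def by (subst nn_integral_restrict_space) auto
  also have "\<dots> = (\<integral>\<^sup>+z. g z \<partial>Q)"
    unfolding Q_def by (rule LM.nn_integral_snd) (use assms in \<open>simp add: Q_def\<close>)
  finally show ?thesis .
qed

lemma H2_L2:
  assumes "\<phi> \<in> H2 M F {0..T}"
  shows "(\<lambda>(t, \<omega>). \<phi> t \<omega>) \<in> L2 Q Q"
proof (rule L2_of_nn)
  show m: "(\<lambda>(t, \<omega>). \<phi> t \<omega>) \<in> borel_measurable Q"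
    using assms adapted_measurable_Q by (auto simp: H2_def)
  have "(\<integral>\<^sup>+z. ennreal ((norm (case z of (t, \<omega>) \<Rightarrow> \<phi> t \<omega>))\<^sup>2) \<partial>Q)
      = (\<integral>\<^sup>+\<omega>. (\<integral>\<^sup>+t\<in>{0..T}. ennreal ((norm (\<phi> t \<omega>))\<^sup>2) \<partial>lborel) \<partial>M)"
    using nn_integral_Q[of "\<lambda>z. ennreal ((norm (case z of (t, \<omega>) \<Rightarrow> \<phi> t \<omega>))\<^sup>2)"] m by simp
  also have "\<dots> < \<infinity>" using assms by (simp add: H2_def)
  finally show "(\<integral>\<^sup>+z. ennreal ((norm (case z of (t, \<omega>) \<Rightarrow> \<phi> t \<omega>))\<^sup>2) \<partial>Q) < \<infinity>" .
qed

lemma simple_integrandD: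
  assumes "simple_integrand M F T m \<tau> \<eta>" "j < m"
  shows "0 \<le> \<tau> j" "\<tau> j \<le> \<tau> (Suc j)" "\<tau> (Suc j) \<le> T" "bdd_meas (\<tau> j) (\<eta> j)"
proof -
  have lt: "\<forall>j<m. \<tau> j < \<tau> (Suc j)" and e: "\<tau> 0 = 0" "\<tau> m = T"
    using assms(1) by (auto simp: simple_integrand_def)
  have mono: "\<tau> i \<le> \<tau> (i + k)" if "i + k \<le> m" for i k
    using that
  proof (induction k)
    case (Suc k)
    then show ?case using lt[rule_format, of "i + k"] by simp
  qed simp
  show "0 \<le> \<tau> j" using mono[of 0 j] e assms(2) by simp
  show "\<tau> (Suc j) \<le> T" using mono[of "Suc j" "m - Suc j"] e assms(2) by simp
  show "\<tau> j \<le> \<tau> (Suc j)" using lt assms(2) by (simp add: less_imp_le)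
  show "bdd_meas (\<tau> j) (\<eta> j)" using assms by (auto simp: simple_integrand_def bdd_meas_def)
qed

lemma simple_integral_T:
  assumes "simple_integrand M F T m \<tau> \<eta>"
  shows "simple_integral B m \<tau> \<eta> T \<omega> = (\<Sum>j<m. step (\<tau> j) (\<tau> (Suc j)) (\<eta> j) \<omega>)"
  unfolding simple_integral_def
proof (rule sum.cong[OF refl])
  fix j assume "j \<in> {..<m}"
  then have "\<tau> j \<le> T" "\<tau> (Suc j) \<le> T"
    using simple_integrandD(2,3)[OF assms, of j] by auto
  then show "step (min (\<tau> j) T) (min (\<tau> (Suc j)) T) (\<eta> j) \<omega> = step (\<tau> j) (\<tau> (Suc j)) (\<eta> j) \<omega>"
    by (simp add: min_absorb1)
qed

text \<open>The part after \<open>s\<close> is again a sum of steps, with the nodes below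
  \<open>s\<close> moved up to \<open>s\<close>. In this form the orthogonality to
  \<open>F s\<close> can be read off term by term.\<close>

lemma simple_integral_diff:
  assumes "simple_integrand M F T m \<tau> \<eta>"
  shows "simple_integral B m \<tau> \<eta> T \<omega> - simple_integral B m \<tau> \<eta> s \<omega>
     = (\<Sum>j<m. step (max (\<tau> j) s) (max (\<tau> (Suc j)) s) (\<eta> j) \<omega>)"
proof -
  have B: "B x \<omega> - B (min x s) \<omega> = B (max x s) \<omega> - B s \<omega>" for x
    by (simp add: min_def max_def)
  show ?thesis
    unfolding simple_integral_T[OF assms] unfolding simple_integral_def sum_subtractf[symmetric]
  proof (rule sum.cong[OF refl])
    fix j
    have "step (\<tau> j) (\<tau> (Suc j)) (\<eta> j) \<omega> - step (min (\<tau> j) s) (min (\<tau> (Suc j)) s) (\<eta> j) \<omega>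
       = \<eta> j \<omega> *v ((B (\<tau> (Suc j)) \<omega> - B (min (\<tau> (Suc j)) s) \<omega>) - (B (\<tau> j) \<omega> - B (min (\<tau> j) s) \<omega>))"
      by (simp add: matrix_vector_mult_diff_distrib)
    then show "step (\<tau> j) (\<tau> (Suc j)) (\<eta> j) \<omega> - step (min (\<tau> j) s) (min (\<tau> (Suc j)) s) (\<eta> j) \<omega>
       = step (max (\<tau> j) s) (max (\<tau> (Suc j)) s) (\<eta> j) \<omega>" unfolding B by simp
  qed
qed

lemma simple_step_L2:
  assumes "simple_integrand M F T m \<tau> \<eta>" "0 \<le> s" "s \<le> T" "j < m"
  shows "step (max (\<tau> j) s) (max (\<tau> (Suc j)) s) (\<eta> j) \<in> L2 M M"
  by (rule step_L2) (use simple_integrandD[OF assms(1,4)] assms(2,3) in \<open>auto intro: bdd_meas_mono\<close>)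

lemma simple_integral_L2:
  assumes "simple_integrand M F T m \<tau> \<eta>" "0 \<le> s" "s \<le> T"
  shows "simple_integral B m \<tau> \<eta> s \<in> L2 M M"
proof -
  have "(\<lambda>\<omega>. (\<Sum>j<m. step (\<tau> j) (\<tau> (Suc j)) (\<eta> j) \<omega>)
      - (\<Sum>j<m. step (max (\<tau> j) s) (max (\<tau> (Suc j)) s) (\<eta> j) \<omega>)) \<in> L2 M M"
    by (intro L2_diff L2_sum simple_step_L2[OF assms] step_L2)
       (use simple_integrandD[OF assms(1)] in auto)
  then show ?thesis
    unfolding simple_integral_diff[OF assms(1), symmetric] simple_integral_T[OF assms(1), symmetric] by simp
qed

lemma simple_integral_orthogonal:
  assumes \<eta>: "simple_integrand M F T m \<tau> \<eta>" and s: "0 \<le> s" "s \<le> T"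
    and Z: "Z \<in> borel_measurable (F s)" "Z \<in> L2 M M"
  shows "(\<integral>\<omega>. Z \<omega> \<bullet> (simple_integral B m \<tau> \<eta> T \<omega> - simple_integral B m \<tau> \<eta> s \<omega>) \<partial>M) = 0"
proof -
  have "(\<integral>\<omega>. Z \<omega> \<bullet> step (max (\<tau> j) s) (max (\<tau> (Suc j)) s) (\<eta> j) \<omega> \<partial>M) = 0" if "j < m" for j
    by (rule step_orthogonal)
       (use simple_integrandD[OF \<eta> that] s Z in \<open>auto intro: bdd_meas_mono F_measurable_mono\<close>)
  moreover have "integrable M (\<lambda>\<omega>. Z \<omega> \<bullet> step (max (\<tau> j) s) (max (\<tau> (Suc j)) s) (\<eta> j) \<omega>)" if "j < m" for j
    by (rule L2_integrable_inner[OF Z(2) simple_step_L2[OF \<eta> s that]])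
  ultimately show ?thesis
    unfolding simple_integral_diff[OF \<eta>] inner_sum_right by simp
qed

lemma simple_process_L2:
  assumes \<eta>: "simple_integrand M F T m \<tau> \<eta>" and j: "j < m"
  shows "(\<lambda>(t, \<omega>). indicator {\<tau> j<..\<tau> (Suc j)} t *\<^sub>R \<eta> j \<omega>) \<in> L2 Q Q"
proof -
  obtain C where C: "\<And>\<omega>. \<omega> \<in> space M \<Longrightarrow> norm (\<eta> j \<omega>) \<le> C"
    using simple_integrandD(4)[OF \<eta> j] by (auto simp: bdd_meas_def)
  have [measurable]: "\<eta> j \<in> borel_measurable M"
    using bdd_meas_M[OF simple_integrandD(4)[OF \<eta> j]] simple_integrandD[OF \<eta> j] by simp
  have [measurable]: "(\<lambda>t. t) \<in> borel_measurable Leb" by (auto simp: Leb_def intro: measurable_restrict_space1)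
  show ?thesis
  proof (rule L2_bound[OF _ Q.L2_const[of "1::real"], where C=C])
    show "(\<lambda>(t, \<omega>). indicator {\<tau> j<..\<tau> (Suc j)} t *\<^sub>R \<eta> j \<omega>) \<in> borel_measurable Q"
      unfolding Q_def by measurable
    show "AE z in Q. norm (case z of (t, \<omega>) \<Rightarrow> indicator {\<tau> j<..\<tau> (Suc j)} t *\<^sub>R \<eta> j \<omega>) \<le> C * norm (1::real)"
    proof (rule AE_I2)
      fix z assume "z \<in> space Q"
      then have "norm (\<eta> j (snd z)) \<le> C" using C by (auto simp: space_Q)
      moreover from this have "0 \<le> C" using norm_ge_zero order_trans by blast
      ultimately show "norm (case z of (t, \<omega>) \<Rightarrow> indicator {\<tau> j<..\<tau> (Suc j)} t *\<^sub>R \<eta> j \<omega>) \<le> C * norm (1::real)"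
        by (cases z) (simp add: indicator_def)
    qed
  qed
qed

lemma simple_process_L2':
  assumes "simple_integrand M F T m \<tau> \<eta>"
  shows "(\<lambda>(t, \<omega>). simple_process m \<tau> \<eta> t \<omega>) \<in> L2 Q Q"
  using L2_sum[of "{..<m}" "\<lambda>j (t, \<omega>). indicator {\<tau> j<..\<tau> (Suc j)} t *\<^sub>R \<eta> j \<omega>" Q] simple_process_L2[OF assms]
  by (simp add: simple_process_def case_prod_unfold)

lemma integral_Q_indicator:
  fixes f :: "'a \<Rightarrow> real"
  assumes "0 \<le> a" "b \<le> T" "0 \<le> c" "d \<le> T"
    and int: "integrable Q (\<lambda>(t, \<omega>). indicator {a<..b} t * indicator {c<..d} t * f \<omega>)"
  shows "(\<integral>(t, \<omega>). indicator {a<..b} t * indicator {c<..d} t * f \<omega> \<partial>Q) = max 0 (min b d - max a c) * (\<integral>\<omega>. f \<omega> \<partial>M)"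
proof -
  have "(\<integral>(t, \<omega>). indicator {a<..b} t * indicator {c<..d} t * f \<omega> \<partial>Q)
      = (\<integral>t. (\<integral>\<omega>. indicator {a<..b} t * indicator {c<..d} t * f \<omega> \<partial>M) \<partial>Leb)"
    using LM.integral_fst'[of "\<lambda>(t, \<omega>). indicator {a<..b} t * indicator {c<..d} t * f \<omega>"] int by (simp add: Q_def)
  also have "\<dots> = (\<integral>t. indicator {max a c<..min b d} t * (\<integral>\<omega>. f \<omega> \<partial>M) \<partial>Leb)"
    by (intro Bochner_Integration.integral_cong) (auto simp: indicator_def)
  also have "\<dots> = measure Leb {max a c<..min b d} * (\<integral>\<omega>. f \<omega> \<partial>M)"
  proof -
    have "{max a c<..min b d} \<inter> {0..T} = {max a c<..min b d}" using assms by auto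
    then show ?thesis by simp
  qed
  also have "measure Leb {max a c<..min b d} = max 0 (min b d - max a c)"
  proof -
    have "measure Leb {max a c<..min b d} = measure lborel {max a c<..min b d}"
      unfolding Leb_def by (rule measure_restrict_space) (use assms in \<open>auto\<close>)
    also have "\<dots> = max 0 (min b d - max a c)"
      by (cases "max a c \<le> min b d") auto
    finally show ?thesis .
  qed
  finally show ?thesis .
qed

text \<open>No common refinement of the two partitions is formed: each pair of steps contributes the
  length of its overlap times the integral of \<open>\<eta> j \<bullet> \<zeta> k\<close>, on the
  left by \<open>step_isometry\<close> and on the right by integration over
  \<open>Q\<close>.\<close>

lemma simple_isometry:
  assumes \<eta>: "simple_integrand M F T m \<tau> \<eta>" and \<zeta>: "simple_integrand M F T l \<rho> \<zeta>"
  shows "(\<integral>\<omega>. simple_integral B m \<tau> \<eta> T \<omega> \<bullet> simple_integral B l \<rho> \<zeta> T \<omega> \<partial>M)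
     = (\<integral>z. (case z of (t, \<omega>) \<Rightarrow> simple_process m \<tau> \<eta> t \<omega>) \<bullet> (case z of (t, \<omega>) \<Rightarrow> simple_process l \<rho> \<zeta> t \<omega>) \<partial>Q)"
proof -
  note D = simple_integrandD[OF \<eta>] and E = simple_integrandD[OF \<zeta>]
  have i1: "integrable M (\<lambda>\<omega>. step (\<tau> j) (\<tau> (Suc j)) (\<eta> j) \<omega> \<bullet> step (\<rho> k) (\<rho> (Suc k)) (\<zeta> k) \<omega>)"
    if "j < m" "k < l" for j k
    by (intro L2_integrable_inner step_L2 D E that)
  have "(\<integral>\<omega>. simple_integral B m \<tau> \<eta> T \<omega> \<bullet> simple_integral B l \<rho> \<zeta> T \<omega> \<partial>M)
     = (\<Sum>k<l. \<Sum>j<m. \<integral>\<omega>. step (\<tau> j) (\<tau> (Suc j)) (\<eta> j) \<omega> \<bullet> step (\<rho> k) (\<rho> (Suc k)) (\<zeta> k) \<omega> \<partial>M)"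
    unfolding simple_integral_T[OF \<eta>] simple_integral_T[OF \<zeta>] inner_sum_left inner_sum_right
    by (rule integral_double_sum[OF i1])
  also have "\<dots> = (\<Sum>k<l. \<Sum>j<m. max 0 (min (\<tau> (Suc j)) (\<rho> (Suc k)) - max (\<tau> j) (\<rho> k)) * (\<integral>\<omega>. \<eta> j \<omega> \<bullet> \<zeta> k \<omega> \<partial>M))"
    by (intro sum.cong step_isometry D E refl) auto
  also have "\<dots> = (\<Sum>k<l. \<Sum>j<m. \<integral>z. (case z of (t, \<omega>) \<Rightarrow> indicator {\<tau> j<..\<tau> (Suc j)} t *\<^sub>R \<eta> j \<omega>) \<bullet>
        (case z of (t, \<omega>) \<Rightarrow> indicator {\<rho> k<..\<rho> (Suc k)} t *\<^sub>R \<zeta> k \<omega>) \<partial>Q)"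
  proof (intro sum.cong refl)
    fix k j assume "k \<in> {..<l}" "j \<in> {..<m}"
    then have jk: "j < m" "k < l" by auto
    have eq: "(case z of (t, \<omega>) \<Rightarrow> indicator {\<tau> j<..\<tau> (Suc j)} t *\<^sub>R \<eta> j \<omega>) \<bullet>
        (case z of (t, \<omega>) \<Rightarrow> indicator {\<rho> k<..\<rho> (Suc k)} t *\<^sub>R \<zeta> k \<omega>)
      = (case z of (t, \<omega>) \<Rightarrow> indicator {\<tau> j<..\<tau> (Suc j)} t * indicator {\<rho> k<..\<rho> (Suc k)} t * (\<eta> j \<omega> \<bullet> \<zeta> k \<omega>))" for z
      by (cases z) simp
    have "integrable Q (\<lambda>z. (case z of (t, \<omega>) \<Rightarrow> indicator {\<tau> j<..\<tau> (Suc j)} t *\<^sub>R \<eta> j \<omega>) \<bullet>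
        (case z of (t, \<omega>) \<Rightarrow> indicator {\<rho> k<..\<rho> (Suc k)} t *\<^sub>R \<zeta> k \<omega>))"
      by (rule L2_integrable_inner[OF simple_process_L2[OF \<eta> jk(1)] simple_process_L2[OF \<zeta> jk(2)]])
    then show "max 0 (min (\<tau> (Suc j)) (\<rho> (Suc k)) - max (\<tau> j) (\<rho> k)) * (\<integral>\<omega>. \<eta> j \<omega> \<bullet> \<zeta> k \<omega> \<partial>M)
      = (\<integral>z. (case z of (t, \<omega>) \<Rightarrow> indicator {\<tau> j<..\<tau> (Suc j)} t *\<^sub>R \<eta> j \<omega>) \<bullet>
        (case z of (t, \<omega>) \<Rightarrow> indicator {\<rho> k<..\<rho> (Suc k)} t *\<^sub>R \<zeta> k \<omega>) \<partial>Q)"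
      unfolding eq by (intro integral_Q_indicator[symmetric]) (use D E jk in auto)
  qed
  also have "\<dots> = (\<integral>z. (case z of (t, \<omega>) \<Rightarrow> simple_process m \<tau> \<eta> t \<omega>) \<bullet> (case z of (t, \<omega>) \<Rightarrow> simple_process l \<rho> \<zeta> t \<omega>) \<partial>Q)"
  proof -
    have *: "(case z of (t, \<omega>) \<Rightarrow> simple_process m \<tau> \<eta> t \<omega>) \<bullet> (case z of (t, \<omega>) \<Rightarrow> simple_process l \<rho> \<zeta> t \<omega>)
      = (\<Sum>k<l. \<Sum>j<m. (case z of (t, \<omega>) \<Rightarrow> indicator {\<tau> j<..\<tau> (Suc j)} t *\<^sub>R \<eta> j \<omega>) \<bullet>
        (case z of (t, \<omega>) \<Rightarrow> indicator {\<rho> k<..\<rho> (Suc k)} t *\<^sub>R \<zeta> k \<omega>))" for z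
      by (cases z) (simp only: simple_process_def inner_sum_left inner_sum_right prod.case)
    have i2: "integrable Q (\<lambda>z. (case z of (t, \<omega>) \<Rightarrow> indicator {\<tau> j<..\<tau> (Suc j)} t *\<^sub>R \<eta> j \<omega>) \<bullet>
        (case z of (t, \<omega>) \<Rightarrow> indicator {\<rho> k<..\<rho> (Suc k)} t *\<^sub>R \<zeta> k \<omega>))" if "j < m" "k < l" for j k
      by (rule L2_integrable_inner[OF simple_process_L2[OF \<eta> that(1)] simple_process_L2[OF \<zeta> that(2)]])
    show ?thesis
      unfolding * by (rule integral_double_sum[OF i2, symmetric])
  qed
  finally show ?thesis .
qed

lemma ito_approx:
  assumes "ito_integral M F T B \<phi> Y"
  obtains m \<tau> \<eta> where "\<And>k. simple_integrand M F T (m k) (\<tau> k) (\<eta> k)"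
    "(\<lambda>k. L2_norm Q (\<lambda>z. (case z of (t, \<omega>) \<Rightarrow> simple_process (m k) (\<tau> k) (\<eta> k) t \<omega>) - (case z of (t, \<omega>) \<Rightarrow> \<phi> t \<omega>)))
      \<longlonglongrightarrow> 0"
    "\<And>t. t \<in> {0..T} \<Longrightarrow> (\<lambda>k. L2_norm M (\<lambda>\<omega>. simple_integral B (m k) (\<tau> k) (\<eta> k) t \<omega> - Y t \<omega>)) \<longlonglongrightarrow> 0"
proof -
  obtain m \<tau> \<eta> where s: "\<forall>k::nat. simple_integrand M F T (m k) (\<tau> k) (\<eta> k)"
    and c1: "(\<lambda>k. \<integral>\<^sup>+\<omega>. (\<integral>\<^sup>+t\<in>{0..T}.
            ennreal ((norm (simple_process (m k) (\<tau> k) (\<eta> k) t \<omega> - \<phi> t \<omega>))\<^sup>2) \<partial>lborel) \<partial>M) \<longlonglongrightarrow> 0"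
    and c2: "\<forall>t\<in>{0..T}. (\<lambda>k. \<integral>\<^sup>+\<omega>.
            ennreal ((norm (simple_integral B (m k) (\<tau> k) (\<eta> k) t \<omega> - Y t \<omega>))\<^sup>2) \<partial>M) \<longlonglongrightarrow> 0"
    and \<phi>: "\<phi> \<in> H2 M F {0..T}" and Y: "\<And>t. t \<in> {0..T} \<Longrightarrow> Y t \<in> L2 M M"
    using assms unfolding ito_integral_def by blast
  show ?thesis
  proof (rule that[of m \<tau> \<eta>])
    show "simple_integrand M F T (m k) (\<tau> k) (\<eta> k)" for k using s by simp
    let ?d = "\<lambda>k z. (case z of (t, \<omega>) \<Rightarrow> simple_process (m k) (\<tau> k) (\<eta> k) t \<omega>) - (case z of (t, \<omega>) \<Rightarrow> \<phi> t \<omega>)"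
    have d: "?d k \<in> borel_measurable Q" for k
      by (intro L2_measurable L2_diff simple_process_L2' H2_L2 \<phi> s[rule_format])
    show "(\<lambda>k. L2_norm Q (?d k)) \<longlonglongrightarrow> 0"
    proof (rule L2_norm_tendsto_of_nn[OF d])
      have "(\<integral>\<^sup>+z. ennreal ((norm (?d k z))\<^sup>2) \<partial>Q) = (\<integral>\<^sup>+\<omega>. (\<integral>\<^sup>+t\<in>{0..T}.
            ennreal ((norm (simple_process (m k) (\<tau> k) (\<eta> k) t \<omega> - \<phi> t \<omega>))\<^sup>2) \<partial>lborel) \<partial>M)" for k
        using nn_integral_Q[of "\<lambda>z. ennreal ((norm (?d k z))\<^sup>2)"] d[of k] by simp
      then show "(\<lambda>k. \<integral>\<^sup>+z. ennreal ((norm (?d k z))\<^sup>2) \<partial>Q) \<longlonglongrightarrow> 0" using c1 by simp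
    qed
    show "(\<lambda>k. L2_norm M (\<lambda>\<omega>. simple_integral B (m k) (\<tau> k) (\<eta> k) t \<omega> - Y t \<omega>)) \<longlonglongrightarrow> 0" if "t \<in> {0..T}" for t
      by (rule L2_norm_tendsto_of_nn)
         (use that c2 s in \<open>auto intro!: L2_measurable L2_diff Y simple_integral_L2\<close>)
  qed
qed

lemma ito_L2: "ito_integral M F T B \<phi> Y \<Longrightarrow> t \<in> {0..T} \<Longrightarrow> Y t \<in> L2 M M"
  by (simp add: ito_integral_def)

text \<open>Limit of the orthogonality for simple integrands; it stands in for the martingale
  property in the product rule.\<close>

lemma ito_orthogonal:
  assumes Y: "ito_integral M F T B \<phi> Y" and s: "0 \<le> s" "s \<le> T"
    and Z: "Z \<in> borel_measurable (F s)" "Z \<in> L2 M M"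
  shows "(\<integral>\<omega>. Z \<omega> \<bullet> (Y T \<omega> - Y s \<omega>) \<partial>M) = 0"
proof -
  have T: "0 \<le> T" using T_pos by simp
  obtain m \<tau> \<eta> where a: "\<And>k. simple_integrand M F T (m k) (\<tau> k) (\<eta> k)"
    "(\<lambda>k. L2_norm Q (\<lambda>z. (case z of (t, \<omega>) \<Rightarrow> simple_process (m k) (\<tau> k) (\<eta> k) t \<omega>) - (case z of (t, \<omega>) \<Rightarrow> \<phi> t \<omega>))) \<longlonglongrightarrow> 0"
    "\<And>t. t \<in> {0..T} \<Longrightarrow> (\<lambda>k. L2_norm M (\<lambda>\<omega>. simple_integral B (m k) (\<tau> k) (\<eta> k) t \<omega> - Y t \<omega>)) \<longlonglongrightarrow> 0"
    by (rule ito_approx[OF Y]) blast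
  let ?I = "\<lambda>k. simple_integral B (m k) (\<tau> k) (\<eta> k)"
  have L: "?I k t \<in> L2 M M" if "t \<in> {0..T}" for k t using simple_integral_L2[OF a(1)] that by auto
  have lim: "(\<lambda>k. \<integral>\<omega>. Z \<omega> \<bullet> ?I k t \<omega> \<partial>M) \<longlonglongrightarrow> (\<integral>\<omega>. Z \<omega> \<bullet> Y t \<omega> \<partial>M)" if "t \<in> {0..T}" for t
    by (rule L2_inner_tendsto[OF Z(2) Z(2) _ L[OF that] ito_L2[OF Y that] a(3)[OF that]]) (simp add: L2_norm_def)
  have "(\<integral>\<omega>. Z \<omega> \<bullet> ?I k T \<omega> \<partial>M) - (\<integral>\<omega>. Z \<omega> \<bullet> ?I k s \<omega> \<partial>M) = 0" for k
    using simple_integral_orthogonal[OF a(1) s Z, of k] L[of T k] L[of s k] s T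
    by (simp add: inner_diff_right L2_integrable_inner[OF Z(2)])
  then have "(\<lambda>k. 0) \<longlonglongrightarrow> (\<integral>\<omega>. Z \<omega> \<bullet> Y T \<omega> \<partial>M) - (\<integral>\<omega>. Z \<omega> \<bullet> Y s \<omega> \<partial>M)"
    using tendsto_diff[OF lim[of T] lim[of s]] s T by simp
  then have "(\<integral>\<omega>. Z \<omega> \<bullet> Y T \<omega> \<partial>M) - (\<integral>\<omega>. Z \<omega> \<bullet> Y s \<omega> \<partial>M) = 0"
    using LIMSEQ_unique tendsto_const by blast
  then show ?thesis
    using ito_L2[OF Y, of T] ito_L2[OF Y, of s] s T
    by (simp add: inner_diff_right L2_integrable_inner[OF Z(2)])
qed

text \<open>Simple integrals vanish at time 0 because all their nodes are nonnegative, and the limit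
  inherits this.\<close>

lemma ito_zero:
  assumes Y: "ito_integral M F T B \<phi> Y"
  shows "AE \<omega> in M. Y 0 \<omega> = 0"
proof -
  have T: "0 \<in> {0..T}" using T_pos by simp
  obtain m \<tau> \<eta> where a: "\<And>k. simple_integrand M F T (m k) (\<tau> k) (\<eta> k)"
    "(\<lambda>k. L2_norm Q (\<lambda>z. (case z of (t, \<omega>) \<Rightarrow> simple_process (m k) (\<tau> k) (\<eta> k) t \<omega>) - (case z of (t, \<omega>) \<Rightarrow> \<phi> t \<omega>))) \<longlonglongrightarrow> 0"
    "\<And>t. t \<in> {0..T} \<Longrightarrow> (\<lambda>k. L2_norm M (\<lambda>\<omega>. simple_integral B (m k) (\<tau> k) (\<eta> k) t \<omega> - Y t \<omega>)) \<longlonglongrightarrow> 0"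
    by (rule ito_approx[OF Y]) blast
  have "simple_integral B (m k) (\<tau> k) (\<eta> k) 0 \<omega> = 0" for k \<omega>
    unfolding simple_integral_def
  proof (rule sum.neutral, rule ballI)
    fix j assume "j \<in> {..<m k}"
    then have "0 \<le> \<tau> k j" "0 \<le> \<tau> k (Suc j)" using simple_integrandD[OF a(1), of j k] by auto
    then show "step (min (\<tau> k j) 0) (min (\<tau> k (Suc j)) 0) (\<eta> k j) \<omega> = 0" by (simp add: min_def)
  qed
  then have "(\<lambda>k. L2_norm M (Y 0)) \<longlonglongrightarrow> 0"
    using a(3)[OF T] by (simp add: L2_norm_def)
  then have "L2_norm M (Y 0) = 0" using LIMSEQ_unique tendsto_const by blast
  then have "(\<integral>\<omega>. (norm (Y 0 \<omega>))\<^sup>2 \<partial>M) = 0" using L2_norm_sq[of M "Y 0"] by simp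
  then show ?thesis
    using integral_nonneg_eq_0_iff_AE[OF L2_integrable[OF ito_L2[OF Y T]]] by simp
qed

text \<open>Simultaneous limit along two approximating sequences. The polarised form is what pairs
  the adjoint integrand \<open>q\<close> with the difference of two diffusion coefficients.\<close>

lemma ito_isometry:
  assumes Y: "ito_integral M F T B \<phi> Y" and Y': "ito_integral M F T B \<psi> Y'"
  shows "(\<integral>\<omega>. Y T \<omega> \<bullet> Y' T \<omega> \<partial>M) = (\<integral>z. (case z of (t, \<omega>) \<Rightarrow> \<phi> t \<omega>) \<bullet> (case z of (t, \<omega>) \<Rightarrow> \<psi> t \<omega>) \<partial>Q)"
proof -
  have T: "T \<in> {0..T}" "0 \<le> T" using T_pos by auto
  obtain m \<tau> \<eta> where a: "\<And>k. simple_integrand M F T (m k) (\<tau> k) (\<eta> k)"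
    "(\<lambda>k. L2_norm Q (\<lambda>z. (case z of (t, \<omega>) \<Rightarrow> simple_process (m k) (\<tau> k) (\<eta> k) t \<omega>) - (case z of (t, \<omega>) \<Rightarrow> \<phi> t \<omega>))) \<longlonglongrightarrow> 0"
    "\<And>t. t \<in> {0..T} \<Longrightarrow> (\<lambda>k. L2_norm M (\<lambda>\<omega>. simple_integral B (m k) (\<tau> k) (\<eta> k) t \<omega> - Y t \<omega>)) \<longlonglongrightarrow> 0"
    by (rule ito_approx[OF Y]) blast
  obtain m' \<tau>' \<eta>' where b: "\<And>k. simple_integrand M F T (m' k) (\<tau>' k) (\<eta>' k)"
    "(\<lambda>k. L2_norm Q (\<lambda>z. (case z of (t, \<omega>) \<Rightarrow> simple_process (m' k) (\<tau>' k) (\<eta>' k) t \<omega>) - (case z of (t, \<omega>) \<Rightarrow> \<psi> t \<omega>))) \<longlonglongrightarrow> 0"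
    "\<And>t. t \<in> {0..T} \<Longrightarrow> (\<lambda>k. L2_norm M (\<lambda>\<omega>. simple_integral B (m' k) (\<tau>' k) (\<eta>' k) t \<omega> - Y' t \<omega>)) \<longlonglongrightarrow> 0"
    by (rule ito_approx[OF Y']) blast
  have H: "\<phi> \<in> H2 M F {0..T}" "\<psi> \<in> H2 M F {0..T}" using Y Y' by (auto simp: ito_integral_def)
  have "(\<lambda>k. \<integral>\<omega>. simple_integral B (m k) (\<tau> k) (\<eta> k) T \<omega> \<bullet> simple_integral B (m' k) (\<tau>' k) (\<eta>' k) T \<omega> \<partial>M)
     \<longlonglongrightarrow> (\<integral>\<omega>. Y T \<omega> \<bullet> Y' T \<omega> \<partial>M)"
    by (rule L2_inner_tendsto[OF simple_integral_L2[OF a(1)] ito_L2[OF Y T(1)] a(3)[OF T(1)]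
        simple_integral_L2[OF b(1)] ito_L2[OF Y' T(1)] b(3)[OF T(1)]]) (use T in auto)
  moreover have "(\<lambda>k. \<integral>z. (case z of (t, \<omega>) \<Rightarrow> simple_process (m k) (\<tau> k) (\<eta> k) t \<omega>)
       \<bullet> (case z of (t, \<omega>) \<Rightarrow> simple_process (m' k) (\<tau>' k) (\<eta>' k) t \<omega>) \<partial>Q)
     \<longlonglongrightarrow> (\<integral>z. (case z of (t, \<omega>) \<Rightarrow> \<phi> t \<omega>) \<bullet> (case z of (t, \<omega>) \<Rightarrow> \<psi> t \<omega>) \<partial>Q)"
    by (rule L2_inner_tendsto[OF simple_process_L2'[OF a(1)] H2_L2[OF H(1)] a(2)
        simple_process_L2'[OF b(1)] H2_L2[OF H(2)] b(2)])
  ultimately show ?thesis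
    unfolding simple_isometry[OF a(1) b(1)] by (rule LIMSEQ_unique)
qed

end

section \<open>The product rule in expectation\<close>

context brownian_basis
begin

lemma AE_Q_snd:
  assumes "AE \<omega> in M. P \<omega>"
  shows "AE z in Q. P (snd z)"
proof -
  obtain N where N: "{\<omega>\<in>space M. \<not> P \<omega>} \<subseteq> N" "N \<in> null_sets M" using assms unfolding eventually_ae_filter by auto
  have "emeasure Q ({0..T} \<times> N) = 0"
    unfolding Q_def by (subst emeasure_pair_measure_Times) (use N in \<open>auto simp: null_sets_def Leb_def sets_restrict_space\<close>)
  then have "{0..T} \<times> N \<in> null_sets Q"
    using N sets.top[of Leb] by (auto simp: null_sets_def Q_def intro!: pair_measureI)
  then show ?thesis
    by (rule AE_I') (use N in \<open>auto simp: space_Q\<close>)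
qed

lemma AE_Leb: "(AE t in Leb. P t) \<longleftrightarrow> (AE t in lborel. t \<in> {0..T} \<longrightarrow> P t)"
  unfolding Leb_def by (subst AE_restrict_space_iff) auto

lemma Q_sections:
  fixes g :: "real \<times> 'a \<Rightarrow> 'b::euclidean_space"
  assumes "integrable Q g"
  shows "AE t in Leb. integrable M (\<lambda>\<omega>. g (t, \<omega>))" "AE \<omega> in M. integrable Leb (\<lambda>t. g (t, \<omega>))"
    "(\<integral>z. g z \<partial>Q) = (\<integral>t. (\<integral>\<omega>. g (t, \<omega>) \<partial>M) \<partial>Leb)" "(\<integral>z. g z \<partial>Q) = (\<integral>\<omega>. (\<integral>t. g (t, \<omega>) \<partial>Leb) \<partial>M)"
    "integrable Leb (\<lambda>t. \<integral>\<omega>. g (t, \<omega>) \<partial>M)" "integrable M (\<lambda>\<omega>. \<integral>t. g (t, \<omega>) \<partial>Leb)"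
proof -
  have i: "integrable (Leb \<Otimes>\<^sub>M M) g" using assms by (simp add: Q_def)
  have i2: "integrable (Leb \<Otimes>\<^sub>M M) (case_prod (\<lambda>t \<omega>. g (t, \<omega>)))" using i by simp
  show "AE t in Leb. integrable M (\<lambda>\<omega>. g (t, \<omega>))" by (rule LM.AE_integrable_fst'[OF i])
  show "AE \<omega> in M. integrable Leb (\<lambda>t. g (t, \<omega>))" using LM.AE_integrable_snd[OF i2] .
  show "(\<integral>z. g z \<partial>Q) = (\<integral>t. (\<integral>\<omega>. g (t, \<omega>) \<partial>M) \<partial>Leb)" using LM.integral_fst'[OF i] by (simp add: Q_def)
  show "(\<integral>z. g z \<partial>Q) = (\<integral>\<omega>. (\<integral>t. g (t, \<omega>) \<partial>Leb) \<partial>M)" using LM.integral_snd[OF i2] by (simp add: Q_def)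
  show "integrable Leb (\<lambda>t. \<integral>\<omega>. g (t, \<omega>) \<partial>M)" by (rule LM.integrable_fst'[OF i])
  show "integrable M (\<lambda>\<omega>. \<integral>t. g (t, \<omega>) \<partial>Leb)" by (rule LM.integrable_snd[OF i2])
qed

lemma L2_Q_sections:
  fixes g :: "real \<Rightarrow> 'a \<Rightarrow> 'b::euclidean_space"
  assumes g: "(\<lambda>z. g (fst z) (snd z)) \<in> L2 Q Q"
  shows "AE t in Leb. g t \<in> L2 M M" "AE \<omega> in M. (\<lambda>t. g t \<omega>) \<in> L2 Leb Leb"
    "integrable M (\<lambda>\<omega>. \<integral>t. (norm (g t \<omega>))\<^sup>2 \<partial>Leb)"
proof -
  have [measurable]: "(\<lambda>z. g (fst z) (snd z)) \<in> borel_measurable (Leb \<Otimes>\<^sub>M M)" using g by (simp add: L2_iff Q_def)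
  note s = Q_sections[OF L2_integrable[OF g]]
  have m1: "g t \<in> borel_measurable M" if "t \<in> space Leb" for t
  proof -
    have "(\<lambda>\<omega>. (t, \<omega>)) \<in> M \<rightarrow>\<^sub>M Leb \<Otimes>\<^sub>M M" using that by (intro measurable_Pair1') 
    from measurable_compose[OF this, of "\<lambda>z. g (fst z) (snd z)" borel] show ?thesis by simp
  qed
  have m2: "(\<lambda>t. g t \<omega>) \<in> borel_measurable Leb" if "\<omega> \<in> space M" for \<omega>
  proof -
    have "(\<lambda>t. (t, \<omega>)) \<in> Leb \<rightarrow>\<^sub>M Leb \<Otimes>\<^sub>M M" using that by (intro measurable_Pair2')
    from measurable_compose[OF this, of "\<lambda>z. g (fst z) (snd z)" borel] show ?thesis by simp
  qed
  show "AE t in Leb. g t \<in> L2 M M"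
    using s(1) AE_space by eventually_elim (auto simp: L2_iff m1)
  show "AE \<omega> in M. (\<lambda>t. g t \<omega>) \<in> L2 Leb Leb"
    using s(2) AE_space by eventually_elim (auto simp: L2_iff m2)
  show "integrable M (\<lambda>\<omega>. \<integral>t. (norm (g t \<omega>))\<^sup>2 \<partial>Leb)" using s(6) by simp
qed

lemma L2_Q_const: 
  assumes "g \<in> L2 M M"
  shows "(\<lambda>z. g (snd z)) \<in> L2 Q Q"
proof -
  have [measurable]: "g \<in> borel_measurable M" using assms by (simp add: L2_iff)
  have "integrable (Leb \<Otimes>\<^sub>M M) (\<lambda>z. (\<lambda>_. 1) (fst z) * (norm (g (snd z)))\<^sup>2)"
    by (rule LM.integrable_product_mult) (use assms in \<open>auto simp: L2_iff\<close>)
  then show ?thesis unfolding L2_iff Q_def by simp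
qed

lemma id_Leb [measurable]: "(\<lambda>t. t) \<in> Leb \<rightarrow>\<^sub>M borel"
  by (auto simp: Leb_def intro: measurable_restrict_space1)

text \<open>The relation \<open>R\<close> covers both the integrals up to \<open>t\<close> and those
  from \<open>t\<close> on. Cauchy-Schwarz against the constant 1 on \<open>[0, T]\<close> gives the
  factor \<open>T\<close>.\<close>

lemma partial_integral_L2:
  fixes g :: "real \<Rightarrow> 'a \<Rightarrow> 'b::euclidean_space" and R :: "real \<Rightarrow> real \<Rightarrow> bool"
  assumes g: "(\<lambda>z. g (fst z) (snd z)) \<in> L2 Q Q"
    and R: "(\<lambda>z. R (fst z) (snd z)) \<in> measurable (borel \<Otimes>\<^sub>M borel) (count_space UNIV)"
  shows "(\<lambda>z. \<integral>r. (if R (fst z) r then g r (snd z) else 0) \<partial>Leb) \<in> L2 Q Q"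
    and "(\<lambda>\<omega>. \<integral>r. (if R t r then g r \<omega> else 0) \<partial>Leb) \<in> L2 M M"
proof -
  have [measurable]: "(\<lambda>z. g (fst z) (snd z)) \<in> borel_measurable (Leb \<Otimes>\<^sub>M M)" using g by (simp add: L2_iff Q_def)
  note [measurable] = R
  let ?A = "\<lambda>t \<omega>. \<integral>r. (if R t r then g r \<omega> else 0) \<partial>Leb"
  \<comment> \<open>One null set serves all \<open>t\<close>, since the bound involves the integral
    over the whole of \<open>[0, T]\<close>.\<close>
  have bound: "AE \<omega> in M. \<forall>t. (norm (?A t \<omega>))\<^sup>2 \<le> T * (\<integral>t. (norm (g t \<omega>))\<^sup>2 \<partial>Leb)"
    using L2_Q_sections(2)[OF g]
  proof eventually_elim
    case (elim \<omega>)
    show ?case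
    proof
      fix t
      have gm: "(\<lambda>r. g r \<omega>) \<in> borel_measurable Leb" using elim by (simp add: L2_iff)
      have Rm: "Measurable.pred Leb (R t)"
      proof -
        have "(\<lambda>r. (t, r)) \<in> Leb \<rightarrow>\<^sub>M borel \<Otimes>\<^sub>M borel" by measurable
        from measurable_compose[OF this R] show ?thesis by simp
      qed
      have i: "integrable Leb (\<lambda>r. norm (g r \<omega>))" using Leb.L2_integrable1[OF elim] by simp
      have ii: "integrable Leb (\<lambda>r. if R t r then g r \<omega> else 0)"
        by (rule Bochner_Integration.integrable_bound[OF i]) (use gm Rm in \<open>auto intro!: measurable_If\<close>)
      have "norm (?A t \<omega>) \<le> (\<integral>r. norm (g r \<omega>) \<partial>Leb)"
        by (rule order_trans[OF integral_norm_bound]) (rule integral_mono[OF integrable_norm[OF ii] i], auto)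
      also have "\<dots> \<le> L2_norm Leb (\<lambda>r. g r \<omega>) * L2_norm Leb (\<lambda>_. 1::real)"
        using L2_Cauchy_Schwarz[OF elim Leb.L2_const[of "1::real"]] by simp
      finally have "(norm (?A t \<omega>))\<^sup>2 \<le> (L2_norm Leb (\<lambda>r. g r \<omega>) * L2_norm Leb (\<lambda>_. 1::real))\<^sup>2"
        by (intro power_mono) auto
      also have "\<dots> = T * (\<integral>t. (norm (g t \<omega>))\<^sup>2 \<partial>Leb)"
        using T_pos by (simp add: power_mult_distrib L2_norm_sq Leb_def measure_restrict_space)
      finally show "(norm (?A t \<omega>))\<^sup>2 \<le> T * (\<integral>t. (norm (g t \<omega>))\<^sup>2 \<partial>Leb)" .
    qed
  qed
  have int: "integrable M (\<lambda>\<omega>. T * (\<integral>t. (norm (g t \<omega>))\<^sup>2 \<partial>Leb))" using L2_Q_sections(3)[OF g] by simp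
  have m3: "(\<lambda>w. g (snd w) (snd (fst w))) \<in> borel_measurable ((Leb \<Otimes>\<^sub>M M) \<Otimes>\<^sub>M Leb)"
  proof -
    have "(\<lambda>w. (snd w, snd (fst w))) \<in> (Leb \<Otimes>\<^sub>M M) \<Otimes>\<^sub>M Leb \<rightarrow>\<^sub>M Leb \<Otimes>\<^sub>M M" by measurable
    from measurable_compose[OF this, of "\<lambda>z. g (fst z) (snd z)" borel] show ?thesis by simp
  qed
  have m4: "(\<lambda>w. g (snd w) (fst w)) \<in> borel_measurable (M \<Otimes>\<^sub>M Leb)"
  proof -
    have "(\<lambda>w. (snd w, fst w)) \<in> M \<Otimes>\<^sub>M Leb \<rightarrow>\<^sub>M Leb \<Otimes>\<^sub>M M" by measurable
    from measurable_compose[OF this, of "\<lambda>z. g (fst z) (snd z)" borel] show ?thesis by simp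
  qed
  have mR3: "(\<lambda>w. R (fst (fst w)) (snd w)) \<in> measurable ((Leb \<Otimes>\<^sub>M M) \<Otimes>\<^sub>M Leb) (count_space UNIV)"
  proof -
    have "(\<lambda>w. (fst (fst w), snd w)) \<in> (Leb \<Otimes>\<^sub>M M) \<Otimes>\<^sub>M Leb \<rightarrow>\<^sub>M borel \<Otimes>\<^sub>M borel" by measurable
    from measurable_compose[OF this R] show ?thesis by simp
  qed
  have mR4: "(\<lambda>w. R t (snd w)) \<in> measurable (M \<Otimes>\<^sub>M Leb) (count_space UNIV)"
  proof -
    have "(\<lambda>w. (t, snd w)) \<in> M \<Otimes>\<^sub>M Leb \<rightarrow>\<^sub>M borel \<Otimes>\<^sub>M borel" by measurable
    from measurable_compose[OF this R] show ?thesis by simp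
  qed
  show "(\<lambda>z. ?A (fst z) (snd z)) \<in> L2 Q Q"
  proof (rule L2_bound_sq)
    have "(\<lambda>(z, r). if R (fst z) r then g r (snd z) else 0) \<in> borel_measurable ((Leb \<Otimes>\<^sub>M M) \<Otimes>\<^sub>M Leb)"
      unfolding case_prod_unfold by (rule measurable_If[OF m3 _ mR3[unfolded pred_def]]) simp
    from Leb.borel_measurable_lebesgue_integral[OF this]
    show "(\<lambda>z. ?A (fst z) (snd z)) \<in> borel_measurable Q" unfolding Q_def .
    show "integrable Q (\<lambda>z. T * (\<integral>t. (norm (g t (snd z)))\<^sup>2 \<partial>Leb))"
      using LM.integrable_product_mult[OF _ int, of "\<lambda>_. 1"] by (simp add: Q_def)
    show "AE z in Q. (norm (?A (fst z) (snd z)))\<^sup>2 \<le> T * (\<integral>t. (norm (g t (snd z)))\<^sup>2 \<partial>Leb)"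
      using AE_Q_snd[OF bound] by eventually_elim blast
  qed
  show "(\<lambda>\<omega>. ?A t \<omega>) \<in> L2 M M"
  proof (rule L2_bound_sq[OF _ int])
    have "(\<lambda>(\<omega>, r). if R t r then g r \<omega> else 0) \<in> borel_measurable (M \<Otimes>\<^sub>M Leb)"
      unfolding case_prod_unfold by (rule measurable_If[OF m4 _ mR4[unfolded pred_def]]) simp
    from Leb.borel_measurable_lebesgue_integral[OF this]
    show "(\<lambda>\<omega>. ?A t \<omega>) \<in> borel_measurable M" .
    show "AE \<omega> in M. (norm (?A t \<omega>))\<^sup>2 \<le> T * (\<integral>t. (norm (g t \<omega>))\<^sup>2 \<partial>Leb)"
      using bound by eventually_elim blast
  qed
qed

text \<open>Fubini on the triangle \<open>s \<le> r\<close>; it makes the two leftover terms of the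
  product rule cancel.\<close>

lemma triangle_swap:
  fixes f \<beta> :: "real \<Rightarrow> 'b::euclidean_space"
  assumes f: "integrable Leb f" and \<beta>: "integrable Leb \<beta>"
  shows "(\<integral>s. (\<integral>r. (if s \<le> r then f r else 0) \<partial>Leb) \<bullet> \<beta> s \<partial>Leb) = (\<integral>r. f r \<bullet> (\<integral>s. (if s \<le> r then \<beta> s else 0) \<partial>Leb) \<partial>Leb)"
proof -
  interpret LL: pair_sigma_finite Leb Leb ..
  have [measurable]: "f \<in> borel_measurable Leb" "\<beta> \<in> borel_measurable Leb" using f \<beta> by auto
  have fi: "integrable Leb (\<lambda>r. if s \<le> r then f r else 0)" for s
    by (rule Bochner_Integration.integrable_bound[OF f]) auto
  have bi: "integrable Leb (\<lambda>s. if s \<le> r then \<beta> s else 0)" for r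
    by (rule Bochner_Integration.integrable_bound[OF \<beta>]) auto
  have "integrable (Leb \<Otimes>\<^sub>M Leb) (\<lambda>z. if fst z \<le> snd z then f (snd z) \<bullet> \<beta> (fst z) else 0)"
  proof (rule Bochner_Integration.integrable_bound)
    show "integrable (Leb \<Otimes>\<^sub>M Leb) (\<lambda>z. norm (\<beta> (fst z)) * norm (f (snd z)))"
      by (rule LL.integrable_product_mult) (use f \<beta> in auto)
    show "AE z in Leb \<Otimes>\<^sub>M Leb. norm (if fst z \<le> snd z then f (snd z) \<bullet> \<beta> (fst z) else 0) \<le> norm (norm (\<beta> (fst z)) * norm (f (snd z)))"
    proof (rule AE_I2)
      fix z :: "real \<times> real"
      show "norm (if fst z \<le> snd z then f (snd z) \<bullet> \<beta> (fst z) else 0) \<le> norm (norm (\<beta> (fst z)) * norm (f (snd z)))"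
        using Cauchy_Schwarz_ineq2[of "f (snd z)" "\<beta> (fst z)"] by (simp add: mult.commute)
    qed
  qed measurable
  then have i: "integrable (Leb \<Otimes>\<^sub>M Leb) (case_prod (\<lambda>s r. if s \<le> r then f r \<bullet> \<beta> s else 0))"
    by (simp add: case_prod_unfold)
  have "(\<integral>s. (\<integral>r. (if s \<le> r then f r else 0) \<partial>Leb) \<bullet> \<beta> s \<partial>Leb) = (\<integral>s. (\<integral>r. (if s \<le> r then f r \<bullet> \<beta> s else 0) \<partial>Leb) \<partial>Leb)"
    by (subst integral_inner_left[symmetric]) (auto intro!: fi Bochner_Integration.integral_cong)
  also have "\<dots> = (\<integral>r. (\<integral>s. (if s \<le> r then f r \<bullet> \<beta> s else 0) \<partial>Leb) \<partial>Leb)"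
    by (rule LL.Fubini_integral[OF i, symmetric])
  also have "\<dots> = (\<integral>r. f r \<bullet> (\<integral>s. (if s \<le> r then \<beta> s else 0) \<partial>Leb) \<partial>Leb)"
    by (subst integral_inner_right[symmetric]) (auto intro!: bi Bochner_Integration.integral_cong)
  finally show ?thesis .
qed

text \<open>With \<open>A t\<close> the integral of \<open>f\<close> over \<open>[t, T]\<close>,
  \<open>E t\<close> that of \<open>\<beta>\<close> over \<open>[0, t]\<close> and
  \<open>V = Y1 - Y2\<close>, the equations read \<open>p T = p t - A t + (Y T - Y t)\<close> and
  \<open>X t = E t + V t\<close>. Each of the two parts of \<open>X T\<close> is paired with the
  decomposition of \<open>p T\<close> at a suitable time, where \<open>ito_orthogonal\<close>
  removes the stochastic increments. Neither Ito's formula nor a quadratic covariation is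
  involved.\<close>

lemma product_expectation:
  fixes p X f \<beta> :: "real \<Rightarrow> 'a \<Rightarrow> real^'n" and q s1 s2 :: "real \<Rightarrow> 'a \<Rightarrow> real^'d^'n"
  assumes p: "(\<lambda>z. p (fst z) (snd z)) \<in> L2 Q Q" "\<And>t. t \<in> {0..T} \<Longrightarrow> p t \<in> L2 M M" "p 0 \<in> borel_measurable (F 0)"
    and X: "(\<lambda>z. X (fst z) (snd z)) \<in> L2 Q Q" "\<And>t. t \<in> {0..T} \<Longrightarrow> X t \<in> L2 M M"
    and f: "(\<lambda>z. f (fst z) (snd z)) \<in> L2 Q Q" "AE t in Leb. f t \<in> borel_measurable (F t)"
    and \<beta>: "(\<lambda>z. \<beta> (fst z) (snd z)) \<in> L2 Q Q" "AE t in Leb. \<beta> t \<in> borel_measurable (F t)"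
    and Y: "ito_integral M F T B q Y" and Y1: "ito_integral M F T B s1 Y1" and Y2: "ito_integral M F T B s2 Y2"
    and p_eq: "\<And>t. t \<in> {0..T} \<Longrightarrow> AE \<omega> in M. p t \<omega> = p T \<omega> + (\<integral>r. (if t \<le> r then f r \<omega> else 0) \<partial>Leb) - (Y T \<omega> - Y t \<omega>)"
    and X_eq: "\<And>t. t \<in> {0..T} \<Longrightarrow> AE \<omega> in M. X t \<omega> = (\<integral>r. (if r \<le> t then \<beta> r \<omega> else 0) \<partial>Leb) + (Y1 t \<omega> - Y2 t \<omega>)"
  shows "(\<integral>\<omega>. p T \<omega> \<bullet> X T \<omega> \<partial>M) = (\<integral>z. p (fst z) (snd z) \<bullet> \<beta> (fst z) (snd z) \<partial>Q)
     + (\<integral>z. q (fst z) (snd z) \<bullet> (s1 (fst z) (snd z) - s2 (fst z) (snd z)) \<partial>Q) - (\<integral>z. f (fst z) (snd z) \<bullet> X (fst z) (snd z) \<partial>Q)"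
proof -
  have T: "T \<in> {0..T}" "0 \<in> {0..T}" "0 \<le> T" using T_pos by auto
  define A where "A t \<omega> = (\<integral>r. (if t \<le> r then f r \<omega> else 0) \<partial>Leb)" for t \<omega>
  define E where "E t \<omega> = (\<integral>r. (if r \<le> t then \<beta> r \<omega> else 0) \<partial>Leb)" for t \<omega>
  have A: "(\<lambda>z. A (fst z) (snd z)) \<in> L2 Q Q" "A t \<in> L2 M M" for t
    unfolding A_def by (rule partial_integral_L2[OF f(1), of "\<lambda>t r. t \<le> r"], measurable)+
  have E: "(\<lambda>z. E (fst z) (snd z)) \<in> L2 Q Q" "E t \<in> L2 M M" for t
    unfolding E_def by (rule partial_integral_L2[OF \<beta>(1), of "\<lambda>t r. r \<le> t"], measurable)+
  define V where "V t \<omega> = Y1 t \<omega> - Y2 t \<omega>" for t \<omega>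
  have L: "Y t \<in> L2 M M" "Y1 t \<in> L2 M M" "Y2 t \<in> L2 M M" "V t \<in> L2 M M" if "t \<in> {0..T}" for t
    unfolding V_def using ito_L2[OF Y that] ito_L2[OF Y1 that] ito_L2[OF Y2 that] by (auto intro: L2_diff)
  have orth: "(\<integral>\<omega>. Z \<omega> \<bullet> V T \<omega> \<partial>M) = (\<integral>\<omega>. Z \<omega> \<bullet> V t \<omega> \<partial>M)"
    if t: "t \<in> {0..T}" and Z: "Z \<in> borel_measurable (F t)" "Z \<in> L2 M M" for t Z
  proof -
    have "(\<integral>\<omega>. Z \<omega> \<bullet> (Y1 T \<omega> - Y1 t \<omega>) \<partial>M) = 0" "(\<integral>\<omega>. Z \<omega> \<bullet> (Y2 T \<omega> - Y2 t \<omega>) \<partial>M) = 0"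
      using ito_orthogonal[OF Y1 _ _ Z] ito_orthogonal[OF Y2 _ _ Z] t by auto
    then show ?thesis
      unfolding V_def inner_diff_right
      using L2_integrable_inner[OF Z(2)] L T t by simp
  qed
  have pT: "p T \<in> L2 M M" "p 0 \<in> L2 M M" using p(2) T by auto
  have "(\<integral>\<omega>. p T \<omega> \<bullet> X T \<omega> \<partial>M) = (\<integral>\<omega>. p T \<omega> \<bullet> E T \<omega> + p T \<omega> \<bullet> V T \<omega> \<partial>M)"
  proof (rule integral_cong_AE)
    show "AE \<omega> in M. p T \<omega> \<bullet> X T \<omega> = p T \<omega> \<bullet> E T \<omega> + p T \<omega> \<bullet> V T \<omega>"
      using X_eq[OF T(1)] by eventually_elim (simp add: E_def V_def inner_add_right)
  qed (use p(2)[OF T(1)] X(2)[OF T(1)] E(2)[of T] L(4)[OF T(1)] in \<open>auto simp: L2_iff\<close>)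
  also have "\<dots> = (\<integral>\<omega>. p T \<omega> \<bullet> E T \<omega> \<partial>M) + (\<integral>\<omega>. p T \<omega> \<bullet> V T \<omega> \<partial>M)"
    using L2_integrable_inner[OF pT(1) E(2)] L2_integrable_inner[OF pT(1) L(4)[OF T(1)]] by simp
  \<comment> \<open>Drift part: \<open>\<beta> t\<close> is measurable for \<open>F t\<close> and
    hence orthogonal to \<open>Y T - Y t\<close>, so \<open>p T\<close> may be replaced by
    \<open>p t - A t\<close>.\<close>
  also have "(\<integral>\<omega>. p T \<omega> \<bullet> E T \<omega> \<partial>M)
      = (\<integral>z. p (fst z) (snd z) \<bullet> \<beta> (fst z) (snd z) \<partial>Q) - (\<integral>z. A (fst z) (snd z) \<bullet> \<beta> (fst z) (snd z) \<partial>Q)"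
  proof -
    note i = L2_integrable_inner[OF L2_Q_const[OF pT(1)] \<beta>(1)]
    note i1 = L2_integrable_inner[OF p(1) \<beta>(1)] and i2 = L2_integrable_inner[OF A(1) \<beta>(1)]
    have "(\<integral>\<omega>. p T \<omega> \<bullet> E T \<omega> \<partial>M) = (\<integral>\<omega>. (\<integral>t. p T \<omega> \<bullet> \<beta> t \<omega> \<partial>Leb) \<partial>M)"
    proof (rule integral_cong_AE)
      show "AE \<omega> in M. p T \<omega> \<bullet> E T \<omega> = (\<integral>t. p T \<omega> \<bullet> \<beta> t \<omega> \<partial>Leb)"
        using L2_Q_sections(2)[OF \<beta>(1)]
      proof eventually_elim
        case (elim \<omega>)
        have "E T \<omega> = (\<integral>r. \<beta> r \<omega> \<partial>Leb)"
          unfolding E_def by (intro Bochner_Integration.integral_cong) auto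
        then show ?case using Leb.L2_integrable1[OF elim] by simp
      qed
      show "(\<lambda>\<omega>. \<integral>t. p T \<omega> \<bullet> \<beta> t \<omega> \<partial>Leb) \<in> borel_measurable M" using Q_sections(6)[OF i] by simp
    qed (use pT(1) E(2)[of T] in \<open>auto simp: L2_iff\<close>)
    also have "\<dots> = (\<integral>t. (\<integral>\<omega>. p T \<omega> \<bullet> \<beta> t \<omega> \<partial>M) \<partial>Leb)"
      using Q_sections(3,4)[OF i] by simp
    also have "\<dots> = (\<integral>t. (\<integral>\<omega>. p t \<omega> \<bullet> \<beta> t \<omega> \<partial>M) - (\<integral>\<omega>. A t \<omega> \<bullet> \<beta> t \<omega> \<partial>M) \<partial>Leb)"
    proof (rule integral_cong_AE)
      show "AE t in Leb. (\<integral>\<omega>. p T \<omega> \<bullet> \<beta> t \<omega> \<partial>M) = (\<integral>\<omega>. p t \<omega> \<bullet> \<beta> t \<omega> \<partial>M) - (\<integral>\<omega>. A t \<omega> \<bullet> \<beta> t \<omega> \<partial>M)"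
        using \<beta>(2) L2_Q_sections(1)[OF \<beta>(1)] AE_space
      proof eventually_elim
        case (elim t)
        then have t: "t \<in> {0..T}" by simp
        note b = elim(2)
        note ii = L2_integrable_inner[OF p(2)[OF t] b] L2_integrable_inner[OF A(2)[of t] b]
          L2_integrable_inner[OF b L2_diff[OF L(1)[OF T(1)] L(1)[OF t]]]
        have "(\<integral>\<omega>. p T \<omega> \<bullet> \<beta> t \<omega> \<partial>M) = (\<integral>\<omega>. p t \<omega> \<bullet> \<beta> t \<omega> - A t \<omega> \<bullet> \<beta> t \<omega> + \<beta> t \<omega> \<bullet> (Y T \<omega> - Y t \<omega>) \<partial>M)"
        proof (rule integral_cong_AE)
          show "AE \<omega> in M. p T \<omega> \<bullet> \<beta> t \<omega> = p t \<omega> \<bullet> \<beta> t \<omega> - A t \<omega> \<bullet> \<beta> t \<omega> + \<beta> t \<omega> \<bullet> (Y T \<omega> - Y t \<omega>)"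
            using p_eq[OF t] by eventually_elim (simp add: A_def inner_add inner_diff inner_commute)
        qed (use pT(1) b ii in \<open>auto simp: L2_iff\<close>)
        also have "\<dots> = (\<integral>\<omega>. p t \<omega> \<bullet> \<beta> t \<omega> \<partial>M) - (\<integral>\<omega>. A t \<omega> \<bullet> \<beta> t \<omega> \<partial>M) + (\<integral>\<omega>. \<beta> t \<omega> \<bullet> (Y T \<omega> - Y t \<omega>) \<partial>M)"
          using ii by simp
        finally show ?case using ito_orthogonal[OF Y _ _ elim(1) b] t by simp
      qed
    qed (use Q_sections(5)[OF i] Q_sections(5)[OF i1] Q_sections(5)[OF i2] in auto)
    also have "\<dots> = (\<integral>z. p (fst z) (snd z) \<bullet> \<beta> (fst z) (snd z) \<partial>Q) - (\<integral>z. A (fst z) (snd z) \<bullet> \<beta> (fst z) (snd z) \<partial>Q)"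
      unfolding Q_sections(3)[OF i1] Q_sections(3)[OF i2]
      using Q_sections(5)[OF i1] Q_sections(5)[OF i2] by simp
    finally show ?thesis .
  qed
  \<comment> \<open>Martingale part: \<open>p T = p 0 - A 0 + Y T\<close>, where \<open>p 0\<close>
    is orthogonal to \<open>V T\<close> and the isometry evaluates \<open>Y T\<close> against
    \<open>V T\<close>.\<close>
  also have "(\<integral>\<omega>. p T \<omega> \<bullet> V T \<omega> \<partial>M) = (\<integral>z. q (fst z) (snd z) \<bullet> (s1 (fst z) (snd z) - s2 (fst z) (snd z)) \<partial>Q)
      - ((\<integral>z. f (fst z) (snd z) \<bullet> X (fst z) (snd z) \<partial>Q) - (\<integral>z. f (fst z) (snd z) \<bullet> E (fst z) (snd z) \<partial>Q))"
  proof -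
    note j = L2_integrable_inner[OF pT(2) L(4)[OF T(1)]] L2_integrable_inner[OF A(2)[of 0] L(4)[OF T(1)]]
      L2_integrable_inner[OF L(1)[OF T(1)] L(4)[OF T(1)]]
    have "(\<integral>\<omega>. p T \<omega> \<bullet> V T \<omega> \<partial>M) = (\<integral>\<omega>. p 0 \<omega> \<bullet> V T \<omega> - A 0 \<omega> \<bullet> V T \<omega> + Y T \<omega> \<bullet> V T \<omega> \<partial>M)"
    proof (rule integral_cong_AE)
      show "AE \<omega> in M. p T \<omega> \<bullet> V T \<omega> = p 0 \<omega> \<bullet> V T \<omega> - A 0 \<omega> \<bullet> V T \<omega> + Y T \<omega> \<bullet> V T \<omega>"
        using p_eq[OF T(2)] ito_zero[OF Y] by eventually_elim (simp add: A_def inner_add inner_diff)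
    qed (use pT L(4)[OF T(1)] j in \<open>auto simp: L2_iff\<close>)
    also have "\<dots> = (\<integral>\<omega>. p 0 \<omega> \<bullet> V T \<omega> \<partial>M) - (\<integral>\<omega>. A 0 \<omega> \<bullet> V T \<omega> \<partial>M) + (\<integral>\<omega>. Y T \<omega> \<bullet> V T \<omega> \<partial>M)"
      using j by simp
    also have "(\<integral>\<omega>. p 0 \<omega> \<bullet> V T \<omega> \<partial>M) = 0"
    proof -
      have "(\<integral>\<omega>. p 0 \<omega> \<bullet> V 0 \<omega> \<partial>M) = (\<integral>\<omega>. 0 \<partial>M)"
      proof (rule integral_cong_AE)
        show "AE \<omega> in M. p 0 \<omega> \<bullet> V 0 \<omega> = 0"
          using ito_zero[OF Y1] ito_zero[OF Y2] by eventually_elim (simp add: V_def)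
      qed (use pT L(4)[OF T(2)] in \<open>auto simp: L2_iff\<close>)
      then show ?thesis using orth[OF T(2) p(3) pT(2)] by simp
    qed
    also have "(\<integral>\<omega>. Y T \<omega> \<bullet> V T \<omega> \<partial>M) = (\<integral>z. q (fst z) (snd z) \<bullet> (s1 (fst z) (snd z) - s2 (fst z) (snd z)) \<partial>Q)"
    proof -
      have H: "q \<in> H2 M F {0..T}" "s1 \<in> H2 M F {0..T}" "s2 \<in> H2 M F {0..T}" using Y Y1 Y2 by (auto simp: ito_integral_def)
      note HL = H2_L2[OF H(1)] H2_L2[OF H(2)] H2_L2[OF H(3)]
      have "(\<integral>\<omega>. Y T \<omega> \<bullet> V T \<omega> \<partial>M) = (\<integral>\<omega>. Y T \<omega> \<bullet> Y1 T \<omega> \<partial>M) - (\<integral>\<omega>. Y T \<omega> \<bullet> Y2 T \<omega> \<partial>M)"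
        unfolding V_def inner_diff_right using L[OF T(1)] by (simp add: L2_integrable_inner)
      also have "\<dots> = (\<integral>z. q (fst z) (snd z) \<bullet> (s1 (fst z) (snd z) - s2 (fst z) (snd z)) \<partial>Q)"
        unfolding ito_isometry[OF Y Y1] ito_isometry[OF Y Y2] inner_diff_right
        using L2_integrable_inner[OF HL(1,2)] L2_integrable_inner[OF HL(1,3)] by (simp add: case_prod_unfold)
      finally show ?thesis .
    qed
    \<comment> \<open>As \<open>f t\<close> is measurable for \<open>F t\<close>, \<open>V T\<close>
      may be replaced by \<open>V t = X t - E t\<close> under the time integral.\<close>
    also have "(\<integral>\<omega>. A 0 \<omega> \<bullet> V T \<omega> \<partial>M) = (\<integral>z. f (fst z) (snd z) \<bullet> X (fst z) (snd z) \<partial>Q) - (\<integral>z. f (fst z) (snd z) \<bullet> E (fst z) (snd z) \<partial>Q)"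
    proof -
      note i = L2_integrable_inner[OF f(1) L2_Q_const[OF L(4)[OF T(1)]]]
      note i1 = L2_integrable_inner[OF f(1) X(1)] and i2 = L2_integrable_inner[OF f(1) E(1)]
      have "(\<integral>\<omega>. A 0 \<omega> \<bullet> V T \<omega> \<partial>M) = (\<integral>\<omega>. (\<integral>t. f t \<omega> \<bullet> V T \<omega> \<partial>Leb) \<partial>M)"
      proof (rule integral_cong_AE)
        show "AE \<omega> in M. A 0 \<omega> \<bullet> V T \<omega> = (\<integral>t. f t \<omega> \<bullet> V T \<omega> \<partial>Leb)"
          using L2_Q_sections(2)[OF f(1)]
        proof eventually_elim
          case (elim \<omega>)
          have "A 0 \<omega> = (\<integral>r. f r \<omega> \<partial>Leb)"
            unfolding A_def by (intro Bochner_Integration.integral_cong) auto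
          then show ?case using Leb.L2_integrable1[OF elim] by simp
        qed
        show "(\<lambda>\<omega>. \<integral>t. f t \<omega> \<bullet> V T \<omega> \<partial>Leb) \<in> borel_measurable M" using Q_sections(6)[OF i] by simp
      qed (use j in auto)
      also have "\<dots> = (\<integral>t. (\<integral>\<omega>. f t \<omega> \<bullet> V T \<omega> \<partial>M) \<partial>Leb)"
        using Q_sections(3,4)[OF i] by simp
      also have "\<dots> = (\<integral>t. (\<integral>\<omega>. f t \<omega> \<bullet> X t \<omega> \<partial>M) - (\<integral>\<omega>. f t \<omega> \<bullet> E t \<omega> \<partial>M) \<partial>Leb)"
      proof (rule integral_cong_AE)
        show "AE t in Leb. (\<integral>\<omega>. f t \<omega> \<bullet> V T \<omega> \<partial>M) = (\<integral>\<omega>. f t \<omega> \<bullet> X t \<omega> \<partial>M) - (\<integral>\<omega>. f t \<omega> \<bullet> E t \<omega> \<partial>M)"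
          using f(2) L2_Q_sections(1)[OF f(1)] AE_space
        proof eventually_elim
          case (elim t)
          then have t: "t \<in> {0..T}" by simp
          note b = elim(2)
          note ii = L2_integrable_inner[OF b X(2)[OF t]] L2_integrable_inner[OF b E(2)[of t]]
          have "(\<integral>\<omega>. f t \<omega> \<bullet> V T \<omega> \<partial>M) = (\<integral>\<omega>. f t \<omega> \<bullet> V t \<omega> \<partial>M)" by (rule orth[OF t elim(1) b])
          also have "\<dots> = (\<integral>\<omega>. f t \<omega> \<bullet> X t \<omega> - f t \<omega> \<bullet> E t \<omega> \<partial>M)"
          proof (rule integral_cong_AE)
            show "AE \<omega> in M. f t \<omega> \<bullet> V t \<omega> = f t \<omega> \<bullet> X t \<omega> - f t \<omega> \<bullet> E t \<omega>"
              using X_eq[OF t] by eventually_elim (simp add: E_def V_def inner_add_right)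
          qed (use b L(4)[OF t] ii in \<open>auto simp: L2_iff\<close>)
          finally show ?case using ii by simp
        qed
      qed (use Q_sections(5)[OF i] Q_sections(5)[OF i1] Q_sections(5)[OF i2] in auto)
      also have "\<dots> = (\<integral>z. f (fst z) (snd z) \<bullet> X (fst z) (snd z) \<partial>Q) - (\<integral>z. f (fst z) (snd z) \<bullet> E (fst z) (snd z) \<partial>Q)"
        unfolding Q_sections(3)[OF i1] Q_sections(3)[OF i2]
        using Q_sections(5)[OF i1] Q_sections(5)[OF i2] by simp
      finally show ?thesis .
    qed
    finally show ?thesis by simp
  qed
  \<comment> \<open>The two remainders, \<open>A\<close> against \<open>\<beta>\<close> and
    \<open>f\<close> against \<open>E\<close>, are the same double integral over a triangle.\<close>
  also have "(\<integral>z. f (fst z) (snd z) \<bullet> E (fst z) (snd z) \<partial>Q) = (\<integral>z. A (fst z) (snd z) \<bullet> \<beta> (fst z) (snd z) \<partial>Q)"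
  proof -
    note i1 = L2_integrable_inner[OF A(1) \<beta>(1)] and i2 = L2_integrable_inner[OF f(1) E(1)]
    have "(\<integral>\<omega>. (\<integral>t. f t \<omega> \<bullet> E t \<omega> \<partial>Leb) \<partial>M) = (\<integral>\<omega>. (\<integral>t. A t \<omega> \<bullet> \<beta> t \<omega> \<partial>Leb) \<partial>M)"
    proof (rule integral_cong_AE)
      show "AE \<omega> in M. (\<integral>t. f t \<omega> \<bullet> E t \<omega> \<partial>Leb) = (\<integral>t. A t \<omega> \<bullet> \<beta> t \<omega> \<partial>Leb)"
        using L2_Q_sections(2)[OF f(1)] L2_Q_sections(2)[OF \<beta>(1)]
      proof eventually_elim
        case (elim \<omega>)
        show ?case unfolding A_def E_def
          by (rule triangle_swap[OF Leb.L2_integrable1[OF elim(1)] Leb.L2_integrable1[OF elim(2)], symmetric])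
      qed
    qed (use Q_sections(6)[OF i1] Q_sections(6)[OF i2] in auto)
    then show ?thesis unfolding Q_sections(4)[OF i1] Q_sections(4)[OF i2] by simp
  qed
  finally show ?thesis by simp
qed

end

section \<open>Delayed processes\<close>

lemma L2_norm_mono:
  assumes "f \<in> L2 M M" "g \<in> L2 M M" "0 \<le> C" "AE x in M. norm (f x) \<le> C * norm (g x)"
  shows "L2_norm M f \<le> C * L2_norm M g"
proof (rule power2_le_imp_le)
  have "(L2_norm M f)\<^sup>2 \<le> (\<integral>x. C\<^sup>2 * (norm (g x))\<^sup>2 \<partial>M)"
    unfolding L2_norm_sq
  proof (rule integral_mono_AE)
    show "AE x in M. (norm (f x))\<^sup>2 \<le> C\<^sup>2 * (norm (g x))\<^sup>2"
      using assms(4) by eventually_elim (auto simp: power_mult_distrib[symmetric] intro!: power_mono)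
  qed (use assms in \<open>auto simp: L2_iff\<close>)
  then show "(L2_norm M f)\<^sup>2 \<le> (C * L2_norm M g)\<^sup>2" by (simp add: power_mult_distrib L2_norm_sq)
qed (use assms in auto)

lemma borel_measurable_L2_norm:
  assumes "sigma_finite_measure M" and W: "(\<lambda>z. W (fst z) (snd z)) \<in> borel_measurable (N \<Otimes>\<^sub>M M)"
  shows "(\<lambda>t. L2_norm M (W t)) \<in> borel_measurable N"
proof -
  interpret sigma_finite_measure M by fact
  note [measurable] = W
  have "(\<lambda>(t, \<omega>). (norm (W t \<omega>))\<^sup>2) \<in> borel_measurable (N \<Otimes>\<^sub>M M)"
    unfolding case_prod_unfold by measurable
  from borel_measurable_lebesgue_integral[OF this] show ?thesis unfolding L2_norm_def by measurable
qed

lemma nn_integral_shift_le: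
  fixes k m :: "real \<Rightarrow> ennreal"
  assumes "k \<in> borel_measurable borel" "\<And>s. k (s + c) \<le> m s"
  shows "(\<integral>\<^sup>+t. k t \<partial>lborel) \<le> (\<integral>\<^sup>+t. m t \<partial>lborel)"
proof -
  have "(\<integral>\<^sup>+t. k t \<partial>lborel) = (\<integral>\<^sup>+t. k (c + t) \<partial>lborel)"
    using nn_integral_real_affine[OF assms(1), of 1 c] by simp
  also have "\<dots> \<le> (\<integral>\<^sup>+t. m t \<partial>lborel)"
    by (rule nn_integral_mono) (use assms(2) in \<open>simp add: add.commute\<close>)
  finally show ?thesis .
qed

context brownian_basis
begin

lemma AE_Q_fst:
  assumes "AE t in Leb. P t"
  shows "AE z in Q. P (fst z)"
proof -
  obtain N where N: "{t\<in>space Leb. \<not> P t} \<subseteq> N" "N \<in> null_sets Leb" using assms unfolding eventually_ae_filter by auto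
  have "emeasure Q (N \<times> space M) = 0"
    unfolding Q_def by (subst emeasure_pair_measure_Times) (use N in \<open>auto simp: null_sets_def\<close>)
  then have "N \<times> space M \<in> null_sets Q"
    using N by (auto simp: null_sets_def Q_def intro!: pair_measureI)
  then show ?thesis
    by (rule AE_I') (use N in \<open>auto simp: space_Q\<close>)
qed

lemma measurable_Q_section:
  fixes W :: "real \<Rightarrow> 'a \<Rightarrow> 'e::euclidean_space"
  assumes "(\<lambda>z. W (fst z) (snd z)) \<in> borel_measurable Q"
  shows "t \<in> {0..T} \<Longrightarrow> W t \<in> borel_measurable M" and "\<omega> \<in> space M \<Longrightarrow> (\<lambda>t. W t \<omega>) \<in> borel_measurable Leb"
proof -
  have m: "(\<lambda>z. W (fst z) (snd z)) \<in> borel_measurable (Leb \<Otimes>\<^sub>M M)" using assms by (simp add: Q_def)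
  show "W t \<in> borel_measurable M" if "t \<in> {0..T}"
  proof -
    have "(\<lambda>\<omega>. (t, \<omega>)) \<in> M \<rightarrow>\<^sub>M Leb \<Otimes>\<^sub>M M" using that by (intro measurable_Pair1') simp
    from measurable_compose[OF this m] show ?thesis by simp
  qed
  show "(\<lambda>t. W t \<omega>) \<in> borel_measurable Leb" if "\<omega> \<in> space M"
  proof -
    have "(\<lambda>t. (t, \<omega>)) \<in> Leb \<rightarrow>\<^sub>M Leb \<Otimes>\<^sub>M M" using that by (intro measurable_Pair2')
    from measurable_compose[OF this m] show ?thesis by simp
  qed
qed

lemma L2_norm_Q:
  fixes W :: "real \<Rightarrow> 'a \<Rightarrow> 'e::euclidean_space"
  assumes W: "(\<lambda>z. W (fst z) (snd z)) \<in> L2 Q Q"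
  shows "(\<lambda>t. L2_norm M (W t)) \<in> L2 Leb Leb" "(\<lambda>z. L2_norm M (W (fst z))) \<in> L2 Q Q"
proof -
  have m: "(\<lambda>t. L2_norm M (W t)) \<in> borel_measurable Leb"
    by (rule borel_measurable_L2_norm) (use W in \<open>auto simp: L2_iff Q_def sigma_finite_measure_axioms\<close>)
  have i: "integrable Leb (\<lambda>t. (L2_norm M (W t))\<^sup>2)"
    unfolding L2_norm_sq using Q_sections(5)[OF L2_integrable[OF W]] by simp
  show "(\<lambda>t. L2_norm M (W t)) \<in> L2 Leb Leb" unfolding L2_iff using m i by simp
  have "integrable (Leb \<Otimes>\<^sub>M M) (\<lambda>z. (L2_norm M (W (fst z)))\<^sup>2 * (\<lambda>_. 1) (snd z))"
    by (rule LM.integrable_product_mult[OF i]) simp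
  moreover have "(\<lambda>z. L2_norm M (W (fst z))) \<in> borel_measurable (Leb \<Otimes>\<^sub>M M)" using m by measurable
  ultimately show "(\<lambda>z. L2_norm M (W (fst z))) \<in> L2 Q Q" unfolding L2_iff Q_def by simp
qed

text \<open>Tonelli: bounds on the norms of almost all sections suffice. The adjoint driver is
  estimated in this way, being determined section by section up to null sets.\<close>

lemma L2_Q_of_sections:
  fixes W :: "real \<Rightarrow> 'a \<Rightarrow> 'e::euclidean_space"
  assumes m: "(\<lambda>z. W (fst z) (snd z)) \<in> borel_measurable Q"
    and R: "R \<in> L2 Leb Leb" and b: "AE t in Leb. W t \<in> L2 M M \<and> L2_norm M (W t) \<le> R t"
  shows "(\<lambda>z. W (fst z) (snd z)) \<in> L2 Q Q"
proof (rule L2_of_nn[OF m])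
  have "(\<integral>\<^sup>+z. ennreal ((norm (W (fst z) (snd z)))\<^sup>2) \<partial>Q) = (\<integral>\<^sup>+t. (\<integral>\<^sup>+\<omega>. ennreal ((norm (W t \<omega>))\<^sup>2) \<partial>M) \<partial>Leb)"
    unfolding Q_def by (subst nn_integral_fst[symmetric]) (use m in \<open>auto simp: Q_def\<close>)
  also have "\<dots> \<le> (\<integral>\<^sup>+t. ennreal ((norm (R t))\<^sup>2) \<partial>Leb)"
  proof (rule nn_integral_mono_AE)
    show "AE t in Leb. (\<integral>\<^sup>+\<omega>. ennreal ((norm (W t \<omega>))\<^sup>2) \<partial>M) \<le> ennreal ((norm (R t))\<^sup>2)"
      using b
    proof eventually_elim
      case (elim t)
      then have "(\<integral>\<^sup>+\<omega>. ennreal ((norm (W t \<omega>))\<^sup>2) \<partial>M) = ennreal ((L2_norm M (W t))\<^sup>2)"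
        unfolding L2_norm_sq by (intro nn_integral_eq_integral L2_integrable) auto
      also have "\<dots> \<le> ennreal ((norm (R t))\<^sup>2)"
        using elim by (intro ennreal_leI power_mono) auto
      finally show ?case .
    qed
  qed
  also have "\<dots> < \<infinity>" by (rule L2_nn[OF R])
  finally show "(\<integral>\<^sup>+z. ennreal ((norm (W (fst z) (snd z)))\<^sup>2) \<partial>Q) < \<infinity>" .
qed

lemma H2_L2': "\<phi> \<in> H2 M F {0..T} \<Longrightarrow> (\<lambda>z. \<phi> (fst z) (snd z)) \<in> L2 Q Q"
  using H2_L2[of \<phi>] by (simp add: case_prod_unfold)

lemma S2_section_L2:
  assumes X: "X \<in> S2 M F {0..T}" and t: "t \<in> {0..T}"
  shows "X t \<in> L2 M M"
proof (rule L2_of_nn)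
  have "X t \<in> borel_measurable (F t)" using X t by (auto simp: S2_def adapted_measurable_def)
  then show "X t \<in> borel_measurable M" by (rule F_measurable_M) (use t in auto)
  have "(\<integral>\<^sup>+\<omega>. ennreal ((norm (X t \<omega>))\<^sup>2) \<partial>M) \<le> (\<integral>\<^sup>+\<omega>. (SUP t\<in>{0..T}. ennreal ((norm (X t \<omega>))\<^sup>2)) \<partial>M)"
    by (intro nn_integral_mono SUP_upper t)
  also have "\<dots> < \<infinity>" using X by (auto simp: S2_def)
  finally show "(\<integral>\<^sup>+\<omega>. ennreal ((norm (X t \<omega>))\<^sup>2) \<partial>M) < \<infinity>" .
qed

lemma S2_subset_H2:
  assumes X: "X \<in> S2 M F {0..T}"
  shows "X \<in> H2 M F {0..T}"
proof -
  have ad: "adapted_measurable M F {0..T} X" using X by (auto simp: S2_def)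
  have m: "(\<lambda>(t, \<omega>). X t \<omega>) \<in> borel_measurable Q" by (rule adapted_measurable_Q[OF ad])
  have m': "(\<lambda>z. ennreal ((norm (X (fst z) (snd z)))\<^sup>2)) \<in> borel_measurable Q" using m by (simp add: case_prod_unfold)
  let ?S = "\<integral>\<^sup>+\<omega>. (SUP t\<in>{0..T}. ennreal ((norm (X t \<omega>))\<^sup>2)) \<partial>M"
  have "(\<integral>\<^sup>+\<omega>. (\<integral>\<^sup>+t\<in>{0..T}. ennreal ((norm (X t \<omega>))\<^sup>2) \<partial>lborel) \<partial>M) = (\<integral>\<^sup>+z. ennreal ((norm (X (fst z) (snd z)))\<^sup>2) \<partial>Q)"
    using nn_integral_Q[OF m'] by simp
  also have "\<dots> = (\<integral>\<^sup>+t. (\<integral>\<^sup>+\<omega>. ennreal ((norm (X t \<omega>))\<^sup>2) \<partial>M) \<partial>Leb)"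
    unfolding Q_def by (subst nn_integral_fst[symmetric]) (use m' in \<open>auto simp: Q_def\<close>)
  also have "\<dots> \<le> (\<integral>\<^sup>+t. ?S \<partial>Leb)"
    by (intro nn_integral_mono SUP_upper) auto
  also have "\<dots> < \<infinity>"
  proof -
    have "emeasure Leb {0..T} < \<infinity>" using Leb.emeasure_finite[of "space Leb"] by (simp add: less_top[symmetric])
    moreover have "?S < \<infinity>" using X by (auto simp: S2_def)
    ultimately show ?thesis by (simp add: ennreal_mult_less_top)
  qed
  finally show ?thesis using ad by (simp add: H2_def)
qed

end

locale delayed_basis = brownian_basis M G T B F
  for M G :: "'a measure" and T and B :: "real \<Rightarrow> 'a \<Rightarrow> real^'d" and F +
  fixes \<delta> :: real
  assumes \<delta>: "0 \<le> \<delta>" "\<delta> \<le> T"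
begin

text \<open>A shift of time by \<open>\<delta>\<close> preserves \<open>lborel\<close>, so the
  square of \<open>W\<close> integrates to at most that of \<open>V\<close> over
  \<open>I\<close>.\<close>

lemma delayed_part_L2:
  fixes W V :: "real \<Rightarrow> 'a \<Rightarrow> 'e::euclidean_space"
  assumes W: "(\<lambda>z. W (fst z) (snd z)) \<in> borel_measurable Q"
    and b: "\<And>t \<omega>. t \<in> {0..T} \<Longrightarrow> \<omega> \<in> space M \<Longrightarrow> norm (W t \<omega>) \<le> (if t - \<delta> \<in> I then norm (V (t - \<delta>) \<omega>) else 0)"
    and V: "(\<integral>\<^sup>+\<omega>. (\<integral>\<^sup>+t\<in>I. ennreal ((norm (V t \<omega>))\<^sup>2) \<partial>lborel) \<partial>M) < \<infinity>"
  shows "(\<lambda>z. W (fst z) (snd z)) \<in> L2 Q Q"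
proof (rule L2_of_nn[OF W])
  have m: "(\<lambda>z. ennreal ((norm (W (fst z) (snd z)))\<^sup>2)) \<in> borel_measurable Q" using W by measurable
  have "(\<integral>\<^sup>+z. ennreal ((norm (W (fst z) (snd z)))\<^sup>2) \<partial>Q) = (\<integral>\<^sup>+\<omega>. (\<integral>\<^sup>+t\<in>{0..T}. ennreal ((norm (W t \<omega>))\<^sup>2) \<partial>lborel) \<partial>M)"
    using nn_integral_Q[OF m] by simp
  also have "\<dots> \<le> (\<integral>\<^sup>+\<omega>. (\<integral>\<^sup>+t\<in>I. ennreal ((norm (V t \<omega>))\<^sup>2) \<partial>lborel) \<partial>M)"
  proof (rule nn_integral_mono)
    fix \<omega> assume w: "\<omega> \<in> space M"
    have [measurable]: "(\<lambda>t. W t \<omega>) \<in> borel_measurable Leb" by (rule measurable_Q_section(2)[OF W w])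
    have "(\<lambda>t. ennreal ((norm (W t \<omega>))\<^sup>2)) \<in> borel_measurable Leb" by measurable
    then have bm: "(\<lambda>t. ennreal ((norm (W t \<omega>))\<^sup>2) * indicator {0..T} t) \<in> borel_measurable borel"
      unfolding Leb_def by (subst (asm) borel_measurable_restrict_space_iff_ennreal) auto
    show "(\<integral>\<^sup>+t\<in>{0..T}. ennreal ((norm (W t \<omega>))\<^sup>2) \<partial>lborel) \<le> (\<integral>\<^sup>+t\<in>I. ennreal ((norm (V t \<omega>))\<^sup>2) \<partial>lborel)"
    proof (rule nn_integral_shift_le[OF bm, of \<delta>])
      fix s
      show "ennreal ((norm (W (s + \<delta>) \<omega>))\<^sup>2) * indicator {0..T} (s + \<delta>) \<le> ennreal ((norm (V s \<omega>))\<^sup>2) * indicator I s"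
      proof (cases "s + \<delta> \<in> {0..T}")
        case True
        have "(norm (W (s + \<delta>) \<omega>))\<^sup>2 \<le> (if s \<in> I then norm (V s \<omega>) else 0)\<^sup>2"
          using b[OF True w] by (intro power_mono) auto
        then show ?thesis using True by (auto simp: indicator_def intro: ennreal_leI)
      qed simp
    qed
  qed
  also note V
  finally show "(\<integral>\<^sup>+z. ennreal ((norm (W (fst z) (snd z)))\<^sup>2) \<partial>Q) < \<infinity>" .
qed

text \<open>Before \<open>\<delta>\<close> the delayed process reads the initial path, afterwards
  the process itself; the two pieces are treated separately and added.\<close>

lemma delayed_process:
  fixes Z Z0 :: "real \<Rightarrow> 'a \<Rightarrow> 'e::euclidean_space"
  assumes Z: "Z \<in> H2 M F {0..T}" and Z0: "Z0 \<in> H2 M F {-\<delta>..<0}"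
    and eq: "\<And>s \<omega>. s \<in> {-\<delta>..<0} \<Longrightarrow> \<omega> \<in> space M \<Longrightarrow> Z s \<omega> = Z0 s \<omega>"
  shows "(\<lambda>z. Z (fst z - \<delta>) (snd z)) \<in> L2 Q Q"
    and "t \<in> {0..T} \<Longrightarrow> Z (t - \<delta>) \<in> borel_measurable (F t)"
proof -
  show "Z (t - \<delta>) \<in> borel_measurable (F t)" if t: "t \<in> {0..T}"
  proof (cases "t - \<delta> < 0")
    case True
    then have s: "t - \<delta> \<in> {-\<delta>..<0}" using t by auto
    have "Z0 (t - \<delta>) \<in> borel_measurable (F (t - \<delta>))" using Z0 s by (auto simp: H2_def adapted_measurable_def)
    then have "Z (t - \<delta>) \<in> borel_measurable (F (t - \<delta>))"
      by (subst measurable_cong[of _ _ "Z0 (t - \<delta>)"]) (auto intro: eq[OF s])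
    then show ?thesis by (rule F_measurable_mono) (use \<delta> in auto)
  next
    case False
    have "Z (t - \<delta>) \<in> borel_measurable (F (t - \<delta>))" using Z False t \<delta> by (auto simp: H2_def adapted_measurable_def)
    then show ?thesis by (rule F_measurable_mono) (use \<delta> in auto)
  qed
  show "(\<lambda>z. Z (fst z - \<delta>) (snd z)) \<in> L2 Q Q"
  proof (cases "\<delta> = 0")
    case True
    then show ?thesis using H2_L2'[OF Z] by simp
  next
    case False
    then have \<delta>0: "0 < \<delta>" using \<delta> by simp
    have mZ: "(\<lambda>z. Z (fst z) (snd z)) \<in> borel_measurable (restrict_space borel {0..T} \<Otimes>\<^sub>M M)"
      and mZ0: "(\<lambda>z. Z0 (fst z) (snd z)) \<in> borel_measurable (restrict_space borel {-\<delta>..<0} \<Otimes>\<^sub>M M)"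
      using Z Z0 by (auto simp: H2_def adapted_measurable_def case_prod_unfold)
    \<comment> \<open>The two time maps are clamped to the domains on which the processes are
      jointly measurable; the clamped values are masked by the case distinctions in
      \<open>W1\<close> and \<open>W2\<close>.\<close>
    have r1: "(\<lambda>z. (max 0 (fst z - \<delta>), snd z)) \<in> Leb \<Otimes>\<^sub>M M \<rightarrow>\<^sub>M restrict_space borel {0..T} \<Otimes>\<^sub>M M"
      by (intro measurable_Pair measurable_restrict_space2) (use \<delta> in \<open>auto simp: space_pair_measure\<close>)
    have r2: "(\<lambda>z. (if fst z < \<delta> then fst z - \<delta> else - \<delta>, snd z)) \<in> Leb \<Otimes>\<^sub>M M \<rightarrow>\<^sub>M restrict_space borel {-\<delta>..<0} \<Otimes>\<^sub>M M"
      by (intro measurable_Pair measurable_restrict_space2) (use \<delta>0 in \<open>auto simp: space_pair_measure\<close>)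
    define W1 where "W1 t \<omega> = (if t < \<delta> then 0 else Z (max 0 (t - \<delta>)) \<omega>)" for t \<omega>
    define W2 where "W2 t \<omega> = (if t < \<delta> then Z0 (if t < \<delta> then t - \<delta> else - \<delta>) \<omega> else 0)" for t \<omega>
    have lt: "Measurable.pred (Leb \<Otimes>\<^sub>M M) (\<lambda>z. fst z < \<delta>)" by measurable
    have m1: "(\<lambda>z. W1 (fst z) (snd z)) \<in> borel_measurable Q"
      unfolding W1_def Q_def using measurable_compose[OF r1 mZ] lt by (intro measurable_If) (auto simp: pred_def)
    have m2: "(\<lambda>z. W2 (fst z) (snd z)) \<in> borel_measurable Q"
      unfolding W2_def Q_def using measurable_compose[OF r2 mZ0] lt by (intro measurable_If) (auto simp: pred_def)
    have l1: "(\<lambda>z. W1 (fst z) (snd z)) \<in> L2 Q Q"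
      by (rule delayed_part_L2[OF m1, of "{0..T}" Z]) (use Z \<delta> in \<open>auto simp: W1_def H2_def\<close>)
    have l2: "(\<lambda>z. W2 (fst z) (snd z)) \<in> L2 Q Q"
      by (rule delayed_part_L2[OF m2, of "{-\<delta>..<0}" Z0]) (use Z0 \<delta> in \<open>auto simp: W2_def H2_def\<close>)
    have "(\<lambda>z. W1 (fst z) (snd z) + W2 (fst z) (snd z)) \<in> L2 Q Q \<longleftrightarrow> (\<lambda>z. Z (fst z - \<delta>) (snd z)) \<in> L2 Q Q"
      by (rule L2_cong) (auto simp: W1_def W2_def space_Q eq)
    then show ?thesis using L2_add[OF l1 l2] by simp
  qed
qed

text \<open>Times with a property that holds almost everywhere can be substituted for all the others; this avoids
  evaluating coefficients at times where a process is not square-integrable.\<close>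

lemma good_set:
  assumes "AE t in Leb. P t"
  obtains r where "r \<in> Leb \<rightarrow>\<^sub>M Leb" "\<And>t. t \<in> {0..T} \<Longrightarrow> P (r t)" "AE t in Leb. r t = t" "\<And>t. t \<in> {0..T} \<Longrightarrow> r t \<in> {0..T}"
proof -
  obtain N where N: "{t\<in>space Leb. \<not> P t} \<subseteq> N" "N \<in> null_sets Leb" using assms unfolding eventually_ae_filter by auto
  have "\<not> {0..T} \<subseteq> N"
  proof
    assume "{0..T} \<subseteq> N"
    then have "space Leb \<in> null_sets Leb" using null_sets_subset[OF N(2) sets.top] by simp
    then have "emeasure Leb (space Leb) = 0" by auto
    then show False using T_pos by (simp add: Leb_def emeasure_restrict_space)
  qed
  then obtain t0 where t0: "t0 \<in> {0..T}" "t0 \<notin> N" by blast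
  define r where "r t = (if t \<in> N then t0 else t)" for t
  show ?thesis
  proof (rule that[of r])
    have NL: "N \<in> sets Leb" using N by (auto simp: null_sets_def)
    have "{t \<in> space Leb. t \<in> N} = N" using sets.sets_into_space[OF NL] by blast
    then show "r \<in> Leb \<rightarrow>\<^sub>M Leb" unfolding r_def
      by (intro measurable_If measurable_const measurable_ident_sets refl) (use t0 NL in simp_all)
    show "P (r t)" if "t \<in> {0..T}" for t using that t0 N by (auto simp: r_def)
    show "r t \<in> {0..T}" if "t \<in> {0..T}" for t using that t0 by (auto simp: r_def)
    show "AE t in Leb. r t = t" using AE_not_in[OF N(2)] by eventually_elim (simp add: r_def)
  qed
qed

end

lemma (in prob_space) L2_norm_le_const:
  assumes "f \<in> L2 M M" "AE x in M. norm (f x) \<le> k" "0 \<le> k"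
  shows "L2_norm M f \<le> k"
proof (rule power2_le_imp_le)
  have "(L2_norm M f)\<^sup>2 \<le> (\<integral>x. k\<^sup>2 \<partial>M)"
    unfolding L2_norm_sq
  proof (rule integral_mono_AE)
    show "AE x in M. (norm (f x))\<^sup>2 \<le> k\<^sup>2"
      using assms(2) by eventually_elim (auto intro!: power_mono)
  qed (use assms in \<open>auto simp: L2_iff\<close>)
  then show "(L2_norm M f)\<^sup>2 \<le> k\<^sup>2" by (simp add: prob_space)
qed fact

section \<open>Derivative terms as elements of L2\<close>

context weighted_coefficient
begin

text \<open>The growth bound is uniform in the last argument, so the averaged term is bounded by the
  constant \<open>C\<close> times the mean of \<open>w\<close>, which is at most its L2
  norm.\<close>

lemma measure_derivative_term_L2:
  assumes D: "D \<in> {D_mu c t, D_mud c t}" and W: "W \<in> borel_measurable M"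
  shows "(\<lambda>\<omega>. \<integral>\<omega>'. tr (D (\<Theta> \<omega>') (W \<omega>)) (P \<omega>') \<partial>M) \<in> L2 M M" (is ?L)
    and "L2_norm M (\<lambda>\<omega>. \<integral>\<omega>'. tr (D (\<Theta> \<omega>') (W \<omega>)) (P \<omega>') \<partial>M) \<le> C * L2_norm M w"
proof -
  note [measurable] = W
  note [measurable] = derivative_measurable(3)[OF XL vm vU D W]
  have "(\<lambda>z. tr (D (\<Theta> (fst z)) (W (snd z))) (P (fst z))) \<in> borel_measurable (M \<Otimes>\<^sub>M M)"
    by (rule borel_measurable_tr) measurable
  from measurable_compose[OF measurable_pair_swap' this]
  have "(\<lambda>(\<omega>, \<omega>'). tr (D (\<Theta> \<omega>') (W \<omega>)) (P \<omega>')) \<in> borel_measurable (M \<Otimes>\<^sub>M M)"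
    by (simp add: case_prod_unfold)
  from borel_measurable_lebesgue_integral[OF this]
  have m: "(\<lambda>\<omega>. \<integral>\<omega>'. tr (D (\<Theta> \<omega>') (W \<omega>)) (P \<omega>') \<partial>M) \<in> borel_measurable M" .
  have b: "norm (\<integral>\<omega>'. tr (D (\<Theta> \<omega>') y) (P \<omega>') \<partial>M) \<le> C * (\<integral>\<omega>. w \<omega> \<partial>M)" for y
    by (rule measure_derivative_term(2)[OF D L2_zero L2_zero])
  have w0: "0 \<le> C * (\<integral>\<omega>. w \<omega> \<partial>M)" using nn w_nonneg by (simp add: integral_nonneg_AE)
  show l: ?L
    by (rule L2_bound[OF m L2_const[of "C * (\<integral>\<omega>. w \<omega> \<partial>M)"], where C=1]) (use b w0 in auto)
  have "L2_norm M (\<lambda>\<omega>. \<integral>\<omega>'. tr (D (\<Theta> \<omega>') (W \<omega>)) (P \<omega>') \<partial>M) \<le> C * (\<integral>\<omega>. w \<omega> \<partial>M)"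
    by (rule L2_norm_le_const[OF l _ w0]) (use b in auto)
  also have "(\<integral>\<omega>. w \<omega> \<partial>M) \<le> L2_norm M w"
    using integral_norm_le_L2_norm[OF w_L2] w_nonneg by simp
  finally show "L2_norm M (\<lambda>\<omega>. \<integral>\<omega>'. tr (D (\<Theta> \<omega>') (W \<omega>)) (P \<omega>') \<partial>M) \<le> C * L2_norm M w"
    using nn by (simp add: mult_left_mono)
qed

lemma space_derivative_term_norm:
  assumes D: "D \<in> {D_x c t, D_xd c t}"
  shows "L2_norm M (\<lambda>\<omega>. tr (D (\<Theta> \<omega>)) (P \<omega>)) \<le> C * L2_norm M w"
proof -
  have "AE \<omega> in M. norm (tr (D (\<Theta> \<omega>)) (P \<omega>)) \<le> C * norm (w \<omega>)"
    by (rule AE_I2) (use space_derivative_term(2)[OF D] w_nonneg in simp)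
  then show ?thesis
    by (rule L2_norm_mono[OF space_derivative_term(1)[OF D] w_L2 nn(3)])
qed

definition lin where
  "lin h h' k k' \<omega> = blinfun_apply (D_x c t (\<Theta> \<omega>)) (h \<omega>) + blinfun_apply (D_xd c t (\<Theta> \<omega>)) (h' \<omega>)
    + (\<integral>\<omega>'. blinfun_apply (D_mu c t (\<Theta> \<omega>) (X \<omega>')) (h \<omega>') \<partial>M)
    + (\<integral>\<omega>'. blinfun_apply (D_mud c t (\<Theta> \<omega>) (Xd \<omega>')) (h' \<omega>') \<partial>M)
    + blinfun_apply (D_v c t (\<Theta> \<omega>)) (k \<omega>) + blinfun_apply (D_vd c t (\<Theta> \<omega>)) (k' \<omega>)"

text \<open>After \<open>measure_derivative_term\<close> has exchanged the copies, every term is a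
  random vector paired with a direction, as in the adjoint driver and in the optimality
  condition.\<close>

lemma lin_integral:
  assumes h: "h \<in> L2 M M" "h' \<in> L2 M M" and k: "k \<in> L2 M M" "k' \<in> L2 M M"
  shows "integrable M (\<lambda>\<omega>. P \<omega> \<bullet> lin h h' k k' \<omega>)"
    and "(\<integral>\<omega>. P \<omega> \<bullet> lin h h' k k' \<omega> \<partial>M) =
      (\<integral>\<omega>. tr (D_x c t (\<Theta> \<omega>)) (P \<omega>) \<bullet> h \<omega> \<partial>M) + (\<integral>\<omega>. tr (D_xd c t (\<Theta> \<omega>)) (P \<omega>) \<bullet> h' \<omega> \<partial>M)
      + (\<integral>\<omega>. (\<integral>\<omega>'. tr (D_mu c t (\<Theta> \<omega>') (X \<omega>)) (P \<omega>') \<partial>M) \<bullet> h \<omega> \<partial>M)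
      + (\<integral>\<omega>. (\<integral>\<omega>'. tr (D_mud c t (\<Theta> \<omega>') (Xd \<omega>)) (P \<omega>') \<partial>M) \<bullet> h' \<omega> \<partial>M)
      + (\<integral>\<omega>. tr (D_v c t (\<Theta> \<omega>)) (P \<omega>) \<bullet> k \<omega> \<partial>M) + (\<integral>\<omega>. tr (D_vd c t (\<Theta> \<omega>)) (P \<omega>) \<bullet> k' \<omega> \<partial>M)"
proof -
  have i1: "integrable M (\<lambda>\<omega>. P \<omega> \<bullet> blinfun_apply (D_x c t (\<Theta> \<omega>)) (h \<omega>))" by (rule space_derivative_term(3)) (use h in auto)
  have i2: "integrable M (\<lambda>\<omega>. P \<omega> \<bullet> blinfun_apply (D_xd c t (\<Theta> \<omega>)) (h' \<omega>))" by (rule space_derivative_term(3)) (use h in auto)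
  have i3: "integrable M (\<lambda>\<omega>. P \<omega> \<bullet> (\<integral>\<omega>'. blinfun_apply (D_mu c t (\<Theta> \<omega>) (X \<omega>')) (h \<omega>') \<partial>M))"
    by (rule measure_derivative_term(3)) (use h XL in auto)
  have i4: "integrable M (\<lambda>\<omega>. P \<omega> \<bullet> (\<integral>\<omega>'. blinfun_apply (D_mud c t (\<Theta> \<omega>) (Xd \<omega>')) (h' \<omega>') \<partial>M))"
    by (rule measure_derivative_term(3)) (use h XL in auto)
  have i5: "integrable M (\<lambda>\<omega>. P \<omega> \<bullet> blinfun_apply (D_v c t (\<Theta> \<omega>)) (k \<omega>))" by (rule control_derivative_term(2)) (use k in auto)
  have i6: "integrable M (\<lambda>\<omega>. P \<omega> \<bullet> blinfun_apply (D_vd c t (\<Theta> \<omega>)) (k' \<omega>))" by (rule control_derivative_term(2)) (use k in auto)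
  show "integrable M (\<lambda>\<omega>. P \<omega> \<bullet> lin h h' k k' \<omega>)"
    unfolding lin_def inner_add_right
    by (rule Bochner_Integration.integrable_add[OF Bochner_Integration.integrable_add[OF Bochner_Integration.integrable_add[OF
        Bochner_Integration.integrable_add[OF Bochner_Integration.integrable_add[OF i1 i2] i3] i4] i5] i6])
  have m1: "D_mu c t \<in> {D_mu c t, D_mud c t}" and m2: "D_mud c t \<in> {D_mu c t, D_mud c t}" by auto
  show "(\<integral>\<omega>. P \<omega> \<bullet> lin h h' k k' \<omega> \<partial>M) =
      (\<integral>\<omega>. tr (D_x c t (\<Theta> \<omega>)) (P \<omega>) \<bullet> h \<omega> \<partial>M) + (\<integral>\<omega>. tr (D_xd c t (\<Theta> \<omega>)) (P \<omega>) \<bullet> h' \<omega> \<partial>M)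
      + (\<integral>\<omega>. (\<integral>\<omega>'. tr (D_mu c t (\<Theta> \<omega>') (X \<omega>)) (P \<omega>') \<partial>M) \<bullet> h \<omega> \<partial>M)
      + (\<integral>\<omega>. (\<integral>\<omega>'. tr (D_mud c t (\<Theta> \<omega>') (Xd \<omega>)) (P \<omega>') \<partial>M) \<bullet> h' \<omega> \<partial>M)
      + (\<integral>\<omega>. tr (D_v c t (\<Theta> \<omega>)) (P \<omega>) \<bullet> k \<omega> \<partial>M) + (\<integral>\<omega>. tr (D_vd c t (\<Theta> \<omega>)) (P \<omega>) \<bullet> k' \<omega> \<partial>M)"
    unfolding lin_def inner_add_right tr_inner
      measure_derivative_term(5)[OF m1 XL(1) h(1), symmetric] measure_derivative_term(5)[OF m2 XL(2) h(2), symmetric]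
    using i1 i2 i3 i4 i5 i6 by (simp only: Bochner_Integration.integral_add Bochner_Integration.integrable_add)
qed

text \<open>The constant \<open>K\<close> may depend on \<open>\<omega>\<close>, because convexity
  is exploited for each \<open>\<omega>\<close> separately before integrating.\<close>

lemma linear_approx_along:
  assumes h: "h \<in> L2 M M" "h' \<in> L2 M M" and \<omega>: "\<omega> \<in> space M" and k: "v \<omega> + k \<omega> \<in> U" "vd \<omega> + k' \<omega> \<in> U"
  shows "\<exists>K. \<forall>s\<in>{0..1}. norm (fn c t (X \<omega> + s *\<^sub>R h \<omega>, Xd \<omega> + s *\<^sub>R h' \<omega>, law M (\<lambda>\<omega>. X \<omega> + s *\<^sub>R h \<omega>),
      law M (\<lambda>\<omega>. Xd \<omega> + s *\<^sub>R h' \<omega>), v \<omega> + s *\<^sub>R k \<omega>, vd \<omega> + s *\<^sub>R k' \<omega>) - fn c t (\<Theta> \<omega>) - s *\<^sub>R lin h h' k k' \<omega>) \<le> K * s\<^sup>2"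
proof -
  interpret cp: coefficient_path M U a L C c t "X \<omega>" "Xd \<omega>" X Xd "v \<omega>" "vd \<omega>" "h \<omega>" "h' \<omega>" h h' "k \<omega>" "k' \<omega>"
    by unfold_locales (use XL h vU[OF \<omega>] k in auto)
  have "cp.lin = lin h h' k k' \<omega>" unfolding cp.lin_def lin_def ..
  then show ?thesis using cp.linear_approx by (intro exI[of _ "12 * L * cp.K\<^sup>2"]) simp
qed

end

section \<open>Restricting and shifting time\<close>

lemma (in brownian_basis) H2_subset:
  assumes \<phi>: "\<phi> \<in> H2 M F I" and "J \<subseteq> I"
  shows "\<phi> \<in> H2 M F J"
proof -
  have "(\<lambda>z. (fst z, snd z)) \<in> restrict_space borel J \<Otimes>\<^sub>M M \<rightarrow>\<^sub>M restrict_space borel I \<Otimes>\<^sub>M M"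
    by (intro measurable_Pair measurable_restrict_space2 measurable_compose[OF measurable_fst measurable_restrict_space1])
      (use assms(2) in \<open>auto simp: space_pair_measure space_restrict_space\<close>)
  moreover have "(\<lambda>z. \<phi> (fst z) (snd z)) \<in> borel_measurable (restrict_space borel I \<Otimes>\<^sub>M M)"
    using \<phi> by (simp add: H2_def adapted_measurable_def case_prod_unfold)
  ultimately have "(\<lambda>z. \<phi> (fst z) (snd z)) \<in> borel_measurable (restrict_space borel J \<Otimes>\<^sub>M M)"
    using measurable_compose by fastforce
  then have ad: "adapted_measurable M F J \<phi>"
    using assms by (auto simp: H2_def adapted_measurable_def case_prod_unfold)
  have "(\<integral>\<^sup>+\<omega>. (\<integral>\<^sup>+t\<in>J. ennreal ((norm (\<phi> t \<omega>))\<^sup>2) \<partial>lborel) \<partial>M)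
      \<le> (\<integral>\<^sup>+\<omega>. (\<integral>\<^sup>+t\<in>I. ennreal ((norm (\<phi> t \<omega>))\<^sup>2) \<partial>lborel) \<partial>M)"
    by (intro nn_integral_mono) (use assms(2) in \<open>auto simp: indicator_def\<close>)
  also have "\<dots> < \<infinity>" using \<phi> by (simp add: H2_def)
  finally show ?thesis using ad by (simp add: H2_def)
qed

lemma (in brownian_basis) AE_Leb_shift:
  assumes "AE t in Leb. P t" and "0 \<le> c"
  shows "AE t in Leb. t + c \<le> T \<longrightarrow> P (t + c)"
  using AE_lborel_shift[OF assms(1)[unfolded AE_Leb], of c] assms(2)
  unfolding AE_Leb by (auto elim!: eventually_mono)

lemma (in brownian_basis) integral_Leb_if:
  fixes g :: "real \<Rightarrow> 'e::euclidean_space"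
  shows "t \<in> {0..T} \<Longrightarrow> (LINT s:{0..t}|lborel. g s) = (\<integral>s. (if s \<le> t then g s else 0) \<partial>Leb)"
    and "t \<in> {0..T} \<Longrightarrow> (LINT s:{t..T}|lborel. g s) = (\<integral>s. (if t \<le> s then g s else 0) \<partial>Leb)"
  unfolding Leb_def set_lebesgue_integral_def
  by (subst integral_restrict_space; auto simp: indicator_def intro!: Bochner_Integration.integral_cong)+

lemma (in delayed_basis) shifted_L2_Leb:
  fixes \<rho> :: "real \<Rightarrow> real"
  assumes \<rho>: "\<rho> \<in> L2 Leb Leb"
  shows "(\<lambda>t. if t + \<delta> \<le> T then \<rho> (t + \<delta>) else 0) \<in> L2 Leb Leb"
proof (rule L2_of_nn)
  have m: "\<rho> \<in> borel_measurable Leb" using \<rho> by (simp add: L2_iff)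
  \<comment> \<open>The clamped shift stays in \<open>[0, T]\<close>, where \<open>\<rho>\<close> is
    measurable.\<close>
  have "(\<lambda>t. min T (t + \<delta>)) \<in> Leb \<rightarrow>\<^sub>M Leb"
    unfolding Leb_def by (intro measurable_restrict_space2 measurable_restrict_space1)
      (use T_pos \<delta> in \<open>auto simp: space_restrict_space\<close>)
  from measurable_compose[OF this m] have "(\<lambda>t. if t + \<delta> \<le> T then \<rho> (min T (t + \<delta>)) else 0) \<in> borel_measurable Leb"
    by measurable
  then show m2: "(\<lambda>t. if t + \<delta> \<le> T then \<rho> (t + \<delta>) else 0) \<in> borel_measurable Leb"
    by (rule measurable_cong[THEN iffD1, rotated]) (auto simp: min_def)
  have r: "(\<integral>\<^sup>+t. g t \<partial>Leb) = (\<integral>\<^sup>+t. g t * indicator {0..T} t \<partial>lborel)" for g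
    unfolding Leb_def by (subst nn_integral_restrict_space) auto
  have bm: "(\<lambda>t. ennreal ((norm (\<rho> t))\<^sup>2) * indicator {0..T} t) \<in> borel_measurable borel"
  proof -
    have "(\<lambda>t. ennreal ((norm (\<rho> t))\<^sup>2)) \<in> borel_measurable Leb" using m by measurable
    then show ?thesis unfolding Leb_def by (subst (asm) borel_measurable_restrict_space_iff_ennreal) auto
  qed
  have "(\<integral>\<^sup>+t. ennreal ((norm (if t + \<delta> \<le> T then \<rho> (t + \<delta>) else 0))\<^sup>2) \<partial>Leb)
      \<le> (\<integral>\<^sup>+t. ennreal ((norm (\<rho> (\<delta> + 1 * t)))\<^sup>2) * indicator {0..T} (\<delta> + 1 * t) \<partial>lborel)"
    unfolding r by (intro nn_integral_mono) (use \<delta> in \<open>auto simp: indicator_def add.commute\<close>)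
  also have "\<dots> = (\<integral>\<^sup>+t. ennreal ((norm (\<rho> t))\<^sup>2) * indicator {0..T} t \<partial>lborel)"
    using nn_integral_real_affine[OF bm, of 1 \<delta>] by simp
  also have "\<dots> < \<infinity>" using L2_nn[OF \<rho>] unfolding r .
  finally show "(\<integral>\<^sup>+t. ennreal ((norm (if t + \<delta> \<le> T then \<rho> (t + \<delta>) else 0))\<^sup>2) \<partial>Leb) < \<infinity>" .
qed

section \<open>Controlled processes and the adjoint equation\<close>

locale delayed_control = delayed_basis M G T B F \<delta>
  for M G :: "'a measure" and T and B :: "real \<Rightarrow> 'a \<Rightarrow> real^'d" and F \<delta> +
  fixes U :: "(real^'k::finite) set" and \<xi> :: "real \<Rightarrow> 'a \<Rightarrow> real^'n::finite" and \<gamma> :: "real \<Rightarrow> 'a \<Rightarrow> real^'k"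
  assumes U: "convex U" and initial: "initial_data M F \<delta> U \<xi> \<gamma>"
begin

definition controlled :: "(real \<Rightarrow> 'a \<Rightarrow> real^'k) \<Rightarrow> (real \<Rightarrow> 'a \<Rightarrow> real^'n) \<Rightarrow> bool" where
  "controlled v X \<longleftrightarrow> v \<in> admissible M F T \<delta> U \<gamma> \<and> X \<in> S2 M F {0..T} \<and>
     (\<forall>t\<in>{-\<delta>..0}. \<forall>\<omega>\<in>space M. X t \<omega> = \<xi> t \<omega>)"

text \<open>\<open>X t\<close> is square-integrable for every \<open>t\<close> in
  \<open>[0, T]\<close>, whereas controls and initial paths are known to be so only at almost every
  time.\<close>

definition good :: "(real \<Rightarrow> 'a \<Rightarrow> real^'k) \<Rightarrow> (real \<Rightarrow> 'a \<Rightarrow> real^'n) \<Rightarrow> real \<Rightarrow> bool" where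
  "good v X t \<longleftrightarrow> X t \<in> L2 M M \<and> X (t - \<delta>) \<in> L2 M M \<and> v t \<in> L2 M M \<and> v (t - \<delta>) \<in> L2 M M"

context
  fixes v X assumes c: "controlled v X"
begin

lemma controlled_L2:
  shows "(\<lambda>z. X (fst z) (snd z)) \<in> L2 Q Q" "(\<lambda>z. X (fst z - \<delta>) (snd z)) \<in> L2 Q Q"
    "(\<lambda>z. v (fst z) (snd z)) \<in> L2 Q Q" "(\<lambda>z. v (fst z - \<delta>) (snd z)) \<in> L2 Q Q"
    "t \<in> {0..T} \<Longrightarrow> X t \<in> L2 M M"
    and controlled_adapted: "t \<in> {0..T} \<Longrightarrow> X t \<in> borel_measurable (F t)" "t \<in> {0..T} \<Longrightarrow> X (t - \<delta>) \<in> borel_measurable (F t)"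
      "t \<in> {0..T} \<Longrightarrow> v t \<in> borel_measurable (F t)" "t \<in> {0..T} \<Longrightarrow> v (t - \<delta>) \<in> borel_measurable (F t)"
proof -
  have XH: "X \<in> H2 M F {0..T}" using S2_subset_H2 c by (auto simp: controlled_def)
  have vH: "v \<in> H2 M F {0..T}" using c by (auto simp: controlled_def admissible_def)
  have \<xi>H: "\<xi> \<in> H2 M F {-\<delta>..<0}"
    by (rule H2_subset[of \<xi> "{-\<delta>..0}"]) (use initial in \<open>auto simp: initial_data_def\<close>)
  have \<gamma>H: "\<gamma> \<in> H2 M F {-\<delta>..<0}" using initial by (auto simp: initial_data_def)
  have Xe: "X s \<omega> = \<xi> s \<omega>" if "s \<in> {-\<delta>..<0}" "\<omega> \<in> space M" for s \<omega> using c that by (auto simp: controlled_def)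
  have ve: "v s \<omega> = \<gamma> s \<omega>" if "s \<in> {-\<delta>..<0}" "\<omega> \<in> space M" for s \<omega> using c that by (auto simp: controlled_def admissible_def)
  show "(\<lambda>z. X (fst z) (snd z)) \<in> L2 Q Q" by (rule H2_L2'[OF XH])
  show "(\<lambda>z. v (fst z) (snd z)) \<in> L2 Q Q" by (rule H2_L2'[OF vH])
  show "(\<lambda>z. X (fst z - \<delta>) (snd z)) \<in> L2 Q Q" by (rule delayed_process(1)[OF XH \<xi>H Xe])
  show "(\<lambda>z. v (fst z - \<delta>) (snd z)) \<in> L2 Q Q" by (rule delayed_process(1)[OF vH \<gamma>H ve])
  show "X t \<in> L2 M M" if "t \<in> {0..T}" using S2_section_L2 c that by (auto simp: controlled_def)
  show "X t \<in> borel_measurable (F t)" "v t \<in> borel_measurable (F t)" if "t \<in> {0..T}"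
    using XH vH that by (auto simp: H2_def adapted_measurable_def)
  show "X (t - \<delta>) \<in> borel_measurable (F t)" if "t \<in> {0..T}" by (rule delayed_process(2)[OF XH \<xi>H Xe that])
  show "v (t - \<delta>) \<in> borel_measurable (F t)" if "t \<in> {0..T}" by (rule delayed_process(2)[OF vH \<gamma>H ve that])
qed

lemma controlled_U:
  assumes "t \<in> {0..T}" "\<omega> \<in> space M"
  shows "v t \<omega> \<in> U" "v (t - \<delta>) \<omega> \<in> U"
proof -
  have v: "v t \<omega> \<in> U" if "t \<in> {0..T}" for t using c that assms(2) by (auto simp: controlled_def admissible_def)
  show "v t \<omega> \<in> U" by (rule v[OF assms(1)])
  show "v (t - \<delta>) \<omega> \<in> U"
  proof (cases "t - \<delta> < 0")
    case True
    then have s: "t - \<delta> \<in> {-\<delta>..<0}" using assms by auto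
    then have "v (t - \<delta>) \<omega> = \<gamma> (t - \<delta>) \<omega>" using c assms(2) by (auto simp: controlled_def admissible_def)
    also have "\<dots> \<in> U" using initial s assms(2) by (auto simp: initial_data_def)
    finally show ?thesis .
  next
    case False
    then show ?thesis using assms \<delta> by (intro v) auto
  qed
qed

lemma AE_good: "AE t in Leb. good v X t"
  using L2_Q_sections(1)[OF controlled_L2(1)] L2_Q_sections(1)[OF controlled_L2(3)]
    L2_Q_sections(1)[of "\<lambda>t. X (t - \<delta>)", OF controlled_L2(2)] L2_Q_sections(1)[of "\<lambda>t. v (t - \<delta>)", OF controlled_L2(4)]
  by eventually_elim (simp add: good_def)

end

lemma controlled_initial:
  assumes "controlled v X" "controlled v' X'" "0 \<le> t" "t < \<delta>" "\<omega> \<in> space M"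
  shows "X (t - \<delta>) \<omega> = X' (t - \<delta>) \<omega>" "v (t - \<delta>) \<omega> = v' (t - \<delta>) \<omega>"
proof -
  have "t - \<delta> \<in> {-\<delta>..0}" "t - \<delta> \<in> {-\<delta>..<0}" using assms by auto
  then show "X (t - \<delta>) \<omega> = X' (t - \<delta>) \<omega>" "v (t - \<delta>) \<omega> = v' (t - \<delta>) \<omega>"
    using assms(1,2,5) by (simp_all add: controlled_def admissible_def)
qed

text \<open>(H) bounds derivatives and hence differences of coefficients: the difference is at most
  \<open>C * g * k\<close> with \<open>g\<close> and \<open>k\<close> in \<open>L2 Q Q\<close>. For
  \<open>a = 0\<close> the factor \<open>g\<close> is 1, and the difference is even
  square-integrable. Evaluating \<open>\<beta>\<close> at substituted good times makes it jointly
  measurable and changes it only at a null set of times.\<close>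

lemma coefficient_difference:
  fixes cf :: "('n, 'k, 'c::euclidean_space) coefficient"
  assumes lc: "\<And>t. t \<in> {0..T} \<Longrightarrow> lifted_coefficient M U a L C cf t"
    and tm: "time_measurable T (dom6 U) (fn cf)" and c: "controlled v X" "controlled v' X'"
  obtains \<beta> where "integrable Q (\<lambda>z. \<beta> (fst z) (snd z))" "a = 0 \<Longrightarrow> (\<lambda>z. \<beta> (fst z) (snd z)) \<in> L2 Q Q"
    "AE t in Leb. \<forall>\<omega>\<in>space M. \<beta> t \<omega> = fn cf t (Theta M \<delta> X' v' t \<omega>) - fn cf t (Theta M \<delta> X v t \<omega>)"
    "AE t in Leb. \<beta> t \<in> borel_measurable (F t)"
proof -
  have "AE t in Leb. good v X t \<and> good v' X' t" using AE_good[OF c(1)] AE_good[OF c(2)] by eventually_elim simp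
  then obtain r where r [measurable]: "r \<in> Leb \<rightarrow>\<^sub>M Leb"
    and gd: "\<And>t. t \<in> {0..T} \<Longrightarrow> good v X (r t) \<and> good v' X' (r t)" and rt: "AE t in Leb. r t = t" and rI: "\<And>t. t \<in> {0..T} \<Longrightarrow> r t \<in> {0..T}"
    by (rule good_set[of "\<lambda>t. good v X t \<and> good v' X' t"]) (erule that, blast+)
  have rr: "(\<lambda>z. (r (fst z), snd z)) \<in> Leb \<Otimes>\<^sub>M M \<rightarrow>\<^sub>M Leb \<Otimes>\<^sub>M M" by measurable
  have m: "(\<lambda>(t, \<omega>). fn cf (r t) (Y (r t) \<omega>, Y (r t - \<delta>) \<omega>, law M (Y (r t)), law M (Y (r t - \<delta>)), w (r t) \<omega>, w (r t - \<delta>) \<omega>))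
      \<in> borel_measurable (Leb \<Otimes>\<^sub>M M)" if cw: "controlled w Y" and gw: "\<And>t. t \<in> {0..T} \<Longrightarrow> good w Y (r t)" for w Y
  proof (rule joint_measurable_coefficient[of M _ U a L C])
    show "prob_space M" by (rule prob_space_axioms)
    show "lifted_coefficient M U a L C cf (r t)" if "t \<in> space Leb" for t using lc rI that by simp
    show "(\<lambda>t. fn cf (r t) z) \<in> borel_measurable Leb" if "z \<in> dom6 U" for z
    proof (rule measurable_compose[OF r])
      have "sets Leb = sets (restrict_space borel {0..T})" unfolding Leb_def by (rule sets_restrict_space_cong) simp
      then show "(\<lambda>t. fn cf t z) \<in> borel_measurable Leb"
        using tm that unfolding time_measurable_def by (auto cong: measurable_cong_sets)
    qed
    show "(\<lambda>(t, \<omega>). Y (r t) \<omega>) \<in> borel_measurable (Leb \<Otimes>\<^sub>M M)"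
      using measurable_compose[OF rr, of "\<lambda>z. Y (fst z) (snd z)" borel] controlled_L2(1)[OF cw] by (simp add: L2_iff Q_def case_prod_unfold)
    show "(\<lambda>(t, \<omega>). Y (r t - \<delta>) \<omega>) \<in> borel_measurable (Leb \<Otimes>\<^sub>M M)"
      using measurable_compose[OF rr, of "\<lambda>z. Y (fst z - \<delta>) (snd z)" borel] controlled_L2(2)[OF cw] by (simp add: L2_iff Q_def case_prod_unfold)
    show "(\<lambda>(t, \<omega>). w (r t) \<omega>) \<in> borel_measurable (Leb \<Otimes>\<^sub>M M)"
      using measurable_compose[OF rr, of "\<lambda>z. w (fst z) (snd z)" borel] controlled_L2(3)[OF cw] by (simp add: L2_iff Q_def case_prod_unfold)
    show "(\<lambda>(t, \<omega>). w (r t - \<delta>) \<omega>) \<in> borel_measurable (Leb \<Otimes>\<^sub>M M)"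
      using measurable_compose[OF rr, of "\<lambda>z. w (fst z - \<delta>) (snd z)" borel] controlled_L2(4)[OF cw] by (simp add: L2_iff Q_def case_prod_unfold)
  qed (use gw controlled_U[OF cw] rI in \<open>auto simp: good_def\<close>)
  define \<beta> where "\<beta> t \<omega> = fn cf (r t) (Theta M \<delta> X' v' (r t) \<omega>) - fn cf (r t) (Theta M \<delta> X v (r t) \<omega>)" for t \<omega>
  have \<beta>m: "(\<lambda>z. \<beta> (fst z) (snd z)) \<in> borel_measurable Q"
    using m[OF c(1)] m[OF c(2)] gd by (simp add: \<beta>_def Theta_def Q_def case_prod_unfold)
  let ?x = "\<lambda>z. norm (X (fst z) (snd z))" and ?y = "\<lambda>z. norm (X (fst z - \<delta>) (snd z))"
    and ?v = "\<lambda>z. norm (v (fst z) (snd z))" and ?w = "\<lambda>z. norm (v (fst z - \<delta>) (snd z))"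
    and ?x' = "\<lambda>z. norm (X' (fst z) (snd z) - X (fst z) (snd z))"
    and ?y' = "\<lambda>z. norm (X' (fst z - \<delta>) (snd z) - X (fst z - \<delta>) (snd z))"
    and ?v' = "\<lambda>z. norm (v' (fst z) (snd z) - v (fst z) (snd z))"
    and ?w' = "\<lambda>z. norm (v' (fst z - \<delta>) (snd z) - v (fst z - \<delta>) (snd z))"
    and ?m = "\<lambda>z. L2_norm M (\<lambda>\<omega>. X' (fst z) \<omega> - X (fst z) \<omega>)" and ?n = "\<lambda>z. L2_norm M (\<lambda>\<omega>. X' (fst z - \<delta>) \<omega> - X (fst z - \<delta>) \<omega>)"
  define k where "k z = ?x' z + ?y' z + ?m z + ?n z + ?v' z + ?w' z" for z
  define g where "g z = 1 + a * (?x z + ?x' z + ?y z + ?y' z + ?v z + ?v' z + ?w z + ?w' z)" for z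
  note d = L2_diff[OF controlled_L2(1)[OF c(2)] controlled_L2(1)[OF c(1)]] L2_diff[OF controlled_L2(2)[OF c(2)] controlled_L2(2)[OF c(1)]]
    L2_diff[OF controlled_L2(3)[OF c(2)] controlled_L2(3)[OF c(1)]] L2_diff[OF controlled_L2(4)[OF c(2)] controlled_L2(4)[OF c(1)]]
  have kL: "k \<in> L2 Q Q" unfolding k_def
    by (intro L2_add L2_norm_fun d L2_norm_Q(2)[of "\<lambda>t \<omega>. X' t \<omega> - X t \<omega>"] L2_norm_Q(2)[of "\<lambda>t \<omega>. X' (t - \<delta>) \<omega> - X (t - \<delta>) \<omega>"])
  have gL: "g \<in> L2 Q Q" unfolding g_def
    by (intro L2_add Q.L2_const L2_mult L2_norm_fun d controlled_L2[OF c(1)])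
  have b: "AE z in Q. norm (\<beta> (fst z) (snd z)) \<le> C * g z * k z"
    using AE_Q_fst[OF rt] AE_space
  proof eventually_elim
    case (elim z)
    obtain t \<omega> where z: "z = (t, \<omega>)" "t \<in> {0..T}" "\<omega> \<in> space M" using elim(2) by (auto simp: space_Q)
    have t: "r t = t" using elim(1) z by simp
    interpret lifted_coefficient M U a L C cf t by (rule lc[OF z(2)])
    have "good v X t" "good v' X' t" using gd[OF z(2)] t by auto
    from growth_lipschitz[of "X t" "X (t - \<delta>)" "X' t" "X' (t - \<delta>)", OF _ _ _ _ controlled_U[OF c(1) z(2,3)] controlled_U[OF c(2) z(2,3)]]
    show ?case using \<open>good v X t\<close> \<open>good v' X' t\<close> unfolding good_def z(1) \<beta>_def k_def g_def fst_conv snd_conv t Theta_def by blast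
  qed
  show ?thesis
  proof (rule that[of \<beta>])
    have "integrable Q (\<lambda>z. C * (g z * k z))" by (intro integrable_mult_right L2_integrable_mult gL kL)
    then show "integrable Q (\<lambda>z. \<beta> (fst z) (snd z))"
      by (rule Bochner_Integration.integrable_bound[OF _ \<beta>m]) (use b in \<open>auto simp: mult.assoc elim!: eventually_mono\<close>)
    show "(\<lambda>z. \<beta> (fst z) (snd z)) \<in> L2 Q Q" if "a = 0"
    proof (rule L2_bound[OF \<beta>m kL, where C="\<bar>C\<bar>"])
      show "AE z in Q. norm (\<beta> (fst z) (snd z)) \<le> \<bar>C\<bar> * norm (k z)"
        using b by eventually_elim (use that in \<open>simp add: g_def, metis abs_ge_self abs_mult order_trans\<close>)
    qed
    show "AE t in Leb. \<forall>\<omega>\<in>space M. \<beta> t \<omega> = fn cf t (Theta M \<delta> X' v' t \<omega>) - fn cf t (Theta M \<delta> X v t \<omega>)"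
      using rt by eventually_elim (simp add: \<beta>_def)
    show "AE t in Leb. \<beta> t \<in> borel_measurable (F t)"
      using rt AE_space
    proof eventually_elim
      case (elim t)
      then have t: "t \<in> {0..T}" by simp
      interpret lifted_coefficient M U a L C cf t by (rule lc[OF t])
      have "good v X t" "good v' X' t" using gd[OF t] elim by auto
      then have "(\<lambda>\<omega>. fn cf t (Theta M \<delta> X' v' t \<omega>)) \<in> borel_measurable (F t)" "(\<lambda>\<omega>. fn cf t (Theta M \<delta> X v t \<omega>)) \<in> borel_measurable (F t)"
        unfolding Theta_def good_def
        by (auto intro!: fn_measurable controlled_adapted[OF c(1) t] controlled_adapted[OF c(2) t] controlled_U[OF c(1) t] controlled_U[OF c(2) t])
      then show ?case using elim(1) unfolding \<beta>_def by simp
    qed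
  qed
qed

end

lemma vec_cond_exp_L2_norm:
  fixes Z :: "'a \<Rightarrow> real^'m"
  assumes "prob_space M" "subalgebra M N" and Z: "Z \<in> L2 M M"
  shows "L2_norm M (vec_cond_exp M N Z) \<le> L2_norm M Z"
  using vec_cond_exp_L2(2)[OF assms] by (simp add: L2_norm_def)

text \<open>The assumption is conditional because the processes are under control only up to
  \<open>T\<close>; afterwards the convention makes every quantity 0.\<close>

lemma (in delayed_basis) zero_after_L2:
  fixes f :: "real \<Rightarrow> 'a \<Rightarrow> 'e::euclidean_space"
  assumes "t + \<delta> \<le> T \<Longrightarrow> f (t + \<delta>) \<in> L2 M M"
  shows "(\<lambda>\<omega>. zero_after T (t + \<delta>) (f (t + \<delta>) \<omega>)) \<in> L2 M M"
    and "L2_norm M (\<lambda>\<omega>. zero_after T (t + \<delta>) (f (t + \<delta>) \<omega>)) = (if t + \<delta> \<le> T then L2_norm M (f (t + \<delta>)) else 0)"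
    and "(\<integral>\<omega>. zero_after T (t + \<delta>) (f (t + \<delta>) \<omega>) \<bullet> h \<omega> \<partial>M) = (if t + \<delta> \<le> T then \<integral>\<omega>. f (t + \<delta>) \<omega> \<bullet> h \<omega> \<partial>M else 0)"
  using assms by (cases "t + \<delta> \<le> T"; simp add: zero_after_def L2_zero L2_norm_def)+

text \<open>The time-dependent form of \<open>weighted_coefficient\<close>. The weight is in
  \<open>L2 Q Q\<close> because it bounds the terms of the adjoint driver.\<close>

locale weighted_process = delayed_control M G T B F \<delta> U \<xi> \<gamma>
  for M G :: "'a measure" and T and B :: "real \<Rightarrow> 'a \<Rightarrow> real^'d" and F \<delta>
    and U :: "(real^'k::finite) set" and \<xi> :: "real \<Rightarrow> 'a \<Rightarrow> real^'n::finite" and \<gamma> :: "real \<Rightarrow> 'a \<Rightarrow> real^'k" +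
  fixes u X and a L C :: real and cf :: "('n, 'k, 'c::euclidean_space) coefficient" and P :: "real \<Rightarrow> 'a \<Rightarrow> 'c"
  assumes u: "controlled u X"
    and lc: "\<And>t. t \<in> {0..T} \<Longrightarrow> lifted_coefficient M U a L C cf t"
    and P: "(\<lambda>z. P (fst z) (snd z)) \<in> L2 Q Q"
    and weight: "(\<lambda>z. growth a (Theta M \<delta> X u (fst z) (snd z)) * norm (P (fst z) (snd z))) \<in> L2 Q Q"
begin

definition "wt t = L2_norm M (\<lambda>\<omega>. growth a (Theta M \<delta> X u t \<omega>) * norm (P t \<omega>))"
definition "x_term t \<omega> = tr (D_x cf t (Theta M \<delta> X u t \<omega>)) (P t \<omega>)"
definition "xd_term t \<omega> = tr (D_xd cf t (Theta M \<delta> X u t \<omega>)) (P t \<omega>)"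
definition "mu_term t \<omega> = (\<integral>\<omega>'. tr (D_mu cf t (Theta M \<delta> X u t \<omega>') (X t \<omega>)) (P t \<omega>') \<partial>M)"
definition "mud_term t \<omega> = (\<integral>\<omega>'. tr (D_mud cf t (Theta M \<delta> X u t \<omega>') (X (t - \<delta>) \<omega>)) (P t \<omega>') \<partial>M)"
definition "v_term t \<omega> = tr (D_v cf t (Theta M \<delta> X u t \<omega>)) (P t \<omega>)"
definition "vd_term t \<omega> = tr (D_vd cf t (Theta M \<delta> X u t \<omega>)) (P t \<omega>)"

definition "regular t \<longleftrightarrow> weighted_coefficient M U a L C cf t (X t) (X (t - \<delta>)) (u t) (u (t - \<delta>)) (P t)"

lemma wt_L2: "wt \<in> L2 Leb Leb"
  unfolding wt_def[abs_def] by (rule L2_norm_Q(1)[of "\<lambda>t \<omega>. growth a (Theta M \<delta> X u t \<omega>) * norm (P t \<omega>)", OF weight])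

lemma C_nonneg: "0 \<le> C"
proof -
  have "0 \<in> {0..T}" using T_pos by simp
  from lifted_coefficient.nn(3)[OF lc[OF this]] show ?thesis .
qed

lemma AE_regular: "AE t in Leb. regular t"
  using AE_good[OF u] L2_Q_sections(1)[OF P] 
    L2_Q_sections(1)[of "\<lambda>t \<omega>. growth a (Theta M \<delta> X u t \<omega>) * norm (P t \<omega>)", OF weight] AE_space
proof eventually_elim
  case (elim t)
  then have t: "t \<in> {0..T}" by simp
  interpret lifted_coefficient M U a L C cf t by (rule lc[OF t])
  show ?case unfolding regular_def
    by unfold_locales (use elim controlled_U[OF u t] in \<open>auto simp: good_def Theta_def L2_iff\<close>)
qed

lemma regular_terms:
  assumes "regular t"
  shows "x_term t \<in> L2 M M" "xd_term t \<in> L2 M M" "mu_term t \<in> L2 M M" "mud_term t \<in> L2 M M" "v_term t \<in> L2 M M" "vd_term t \<in> L2 M M"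
    "L2_norm M (x_term t) \<le> C * wt t" "L2_norm M (xd_term t) \<le> C * wt t"
    "L2_norm M (mu_term t) \<le> C * wt t" "L2_norm M (mud_term t) \<le> C * wt t"
    "integrable M (\<lambda>\<omega>'. tr (D_mu cf t (Theta M \<delta> X u t \<omega>') y) (P t \<omega>'))"
    "integrable M (\<lambda>\<omega>'. tr (D_mud cf t (Theta M \<delta> X u t \<omega>') y) (P t \<omega>'))"
proof -
  interpret w: weighted_coefficient M U a L C cf t "X t" "X (t - \<delta>)" "u t" "u (t - \<delta>)" "P t"
    using assms by (simp add: regular_def)
  have e: "Theta M \<delta> X u t = w.\<Theta>" by (rule ext) (simp add: Theta_def)
  have wt: "wt t = L2_norm M w.w" unfolding wt_def w.w_def[abs_def] e ..
  have [measurable]: "X t \<in> borel_measurable M" "X (t - \<delta>) \<in> borel_measurable M" using w.XL by (auto simp: L2_iff)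
  show "x_term t \<in> L2 M M" "xd_term t \<in> L2 M M" "v_term t \<in> L2 M M" "vd_term t \<in> L2 M M"
    unfolding x_term_def[abs_def] xd_term_def[abs_def] v_term_def[abs_def] vd_term_def[abs_def] e
    by (rule w.space_derivative_term(1) w.control_derivative_term(1), simp)+
  show "mu_term t \<in> L2 M M" "mud_term t \<in> L2 M M" "L2_norm M (mu_term t) \<le> C * wt t" "L2_norm M (mud_term t) \<le> C * wt t"
    unfolding mu_term_def[abs_def] mud_term_def[abs_def] e wt
    by (rule w.measure_derivative_term_L2, simp, measurable)+
  show "L2_norm M (x_term t) \<le> C * wt t" "L2_norm M (xd_term t) \<le> C * wt t"
    unfolding x_term_def[abs_def] xd_term_def[abs_def] e wt
    by (rule w.space_derivative_term_norm, simp)+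
  show "integrable M (\<lambda>\<omega>'. tr (D_mu cf t (Theta M \<delta> X u t \<omega>') y) (P t \<omega>'))"
    "integrable M (\<lambda>\<omega>'. tr (D_mud cf t (Theta M \<delta> X u t \<omega>') y) (P t \<omega>'))"
    unfolding e by (rule w.measure_derivative_term(1)[OF _ w.XL(1) w.XL(1)], simp)+
qed

text \<open>The linear part is already paired with the multiplier, so that the slopes of the three
  summands of the Hamiltonian can be added.\<close>

definition "slope t h h' k k' \<omega> = P t \<omega> \<bullet> (blinfun_apply (D_x cf t (Theta M \<delta> X u t \<omega>)) (h \<omega>)
    + blinfun_apply (D_xd cf t (Theta M \<delta> X u t \<omega>)) (h' \<omega>)
    + (\<integral>\<omega>'. blinfun_apply (D_mu cf t (Theta M \<delta> X u t \<omega>) (X t \<omega>')) (h \<omega>') \<partial>M)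
    + (\<integral>\<omega>'. blinfun_apply (D_mud cf t (Theta M \<delta> X u t \<omega>) (X (t - \<delta>) \<omega>')) (h' \<omega>') \<partial>M)
    + blinfun_apply (D_v cf t (Theta M \<delta> X u t \<omega>)) (k \<omega>) + blinfun_apply (D_vd cf t (Theta M \<delta> X u t \<omega>)) (k' \<omega>))"

text \<open>Transfers the fixed-time results; the remainder constant acquires the factor
  \<open>norm (P t \<omega>)\<close> and still does not depend on \<open>s\<close>.\<close>

lemma regular_slope:
  assumes "regular t" and h: "h \<in> L2 M M" "h' \<in> L2 M M" "k \<in> L2 M M" "k' \<in> L2 M M"
  shows "integrable M (slope t h h' k k')"
    "(\<integral>\<omega>. slope t h h' k k' \<omega> \<partial>M) = (\<integral>\<omega>. x_term t \<omega> \<bullet> h \<omega> \<partial>M) + (\<integral>\<omega>. xd_term t \<omega> \<bullet> h' \<omega> \<partial>M)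
      + (\<integral>\<omega>. mu_term t \<omega> \<bullet> h \<omega> \<partial>M) + (\<integral>\<omega>. mud_term t \<omega> \<bullet> h' \<omega> \<partial>M)
      + (\<integral>\<omega>. v_term t \<omega> \<bullet> k \<omega> \<partial>M) + (\<integral>\<omega>. vd_term t \<omega> \<bullet> k' \<omega> \<partial>M)"
    "\<omega> \<in> space M \<Longrightarrow> u t \<omega> + k \<omega> \<in> U \<Longrightarrow> u (t - \<delta>) \<omega> + k' \<omega> \<in> U \<Longrightarrow>
      \<exists>K. \<forall>s\<in>{0..1}. \<bar>fn cf t (X t \<omega> + s *\<^sub>R h \<omega>, X (t - \<delta>) \<omega> + s *\<^sub>R h' \<omega>, law M (\<lambda>\<omega>. X t \<omega> + s *\<^sub>R h \<omega>),
      law M (\<lambda>\<omega>. X (t - \<delta>) \<omega> + s *\<^sub>R h' \<omega>), u t \<omega> + s *\<^sub>R k \<omega>, u (t - \<delta>) \<omega> + s *\<^sub>R k' \<omega>) \<bullet> P t \<omega>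
      - fn cf t (Theta M \<delta> X u t \<omega>) \<bullet> P t \<omega> - s * slope t h h' k k' \<omega>\<bar> \<le> K * s\<^sup>2"
proof -
  interpret w: weighted_coefficient M U a L C cf t "X t" "X (t - \<delta>)" "u t" "u (t - \<delta>)" "P t"
    using assms by (simp add: regular_def)
  have e: "Theta M \<delta> X u t = w.\<Theta>" by (rule ext) (simp add: Theta_def)
  have sl: "slope t h h' k k' = (\<lambda>\<omega>. P t \<omega> \<bullet> w.lin h h' k k' \<omega>)"
    unfolding slope_def[abs_def] w.lin_def e ..
  show "integrable M (slope t h h' k k')" unfolding sl by (rule w.lin_integral(1)[OF h])
  show "(\<integral>\<omega>. slope t h h' k k' \<omega> \<partial>M) = (\<integral>\<omega>. x_term t \<omega> \<bullet> h \<omega> \<partial>M) + (\<integral>\<omega>. xd_term t \<omega> \<bullet> h' \<omega> \<partial>M)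
      + (\<integral>\<omega>. mu_term t \<omega> \<bullet> h \<omega> \<partial>M) + (\<integral>\<omega>. mud_term t \<omega> \<bullet> h' \<omega> \<partial>M)
      + (\<integral>\<omega>. v_term t \<omega> \<bullet> k \<omega> \<partial>M) + (\<integral>\<omega>. vd_term t \<omega> \<bullet> k' \<omega> \<partial>M)"
    unfolding sl w.lin_integral(2)[OF h] x_term_def xd_term_def mu_term_def mud_term_def v_term_def vd_term_def e ..
  show "\<exists>K. \<forall>s\<in>{0..1}. \<bar>fn cf t (X t \<omega> + s *\<^sub>R h \<omega>, X (t - \<delta>) \<omega> + s *\<^sub>R h' \<omega>, law M (\<lambda>\<omega>. X t \<omega> + s *\<^sub>R h \<omega>),
      law M (\<lambda>\<omega>. X (t - \<delta>) \<omega> + s *\<^sub>R h' \<omega>), u t \<omega> + s *\<^sub>R k \<omega>, u (t - \<delta>) \<omega> + s *\<^sub>R k' \<omega>) \<bullet> P t \<omega>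
      - fn cf t (Theta M \<delta> X u t \<omega>) \<bullet> P t \<omega> - s * slope t h h' k k' \<omega>\<bar> \<le> K * s\<^sup>2"
    if \<omega>: "\<omega> \<in> space M" and kU: "u t \<omega> + k \<omega> \<in> U" "u (t - \<delta>) \<omega> + k' \<omega> \<in> U"
  proof -
    let ?f = "\<lambda>s. fn cf t (X t \<omega> + s *\<^sub>R h \<omega>, X (t - \<delta>) \<omega> + s *\<^sub>R h' \<omega>, law M (\<lambda>\<omega>. X t \<omega> + s *\<^sub>R h \<omega>),
      law M (\<lambda>\<omega>. X (t - \<delta>) \<omega> + s *\<^sub>R h' \<omega>), u t \<omega> + s *\<^sub>R k \<omega>, u (t - \<delta>) \<omega> + s *\<^sub>R k' \<omega>)"
    obtain K where K: "\<And>s. s \<in> {0..1} \<Longrightarrow> norm (?f s - fn cf t (w.\<Theta> \<omega>) - s *\<^sub>R w.lin h h' k k' \<omega>) \<le> K * s\<^sup>2"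
      using w.linear_approx_along[of h h' \<omega> k k', OF h(1,2) \<omega> kU] by blast
    show ?thesis unfolding sl
    proof (rule exI[of _ "K * norm (P t \<omega>)"], rule ballI)
      fix s :: real assume s: "s \<in> {0..1}"
      have "\<bar>?f s \<bullet> P t \<omega> - fn cf t (Theta M \<delta> X u t \<omega>) \<bullet> P t \<omega> - s * (P t \<omega> \<bullet> w.lin h h' k k' \<omega>)\<bar>
          = \<bar>(?f s - fn cf t (w.\<Theta> \<omega>) - s *\<^sub>R w.lin h h' k k' \<omega>) \<bullet> P t \<omega>\<bar>"
        by (simp add: inner_diff_left inner_commute[of "P t \<omega>"] e)
      also have "\<dots> \<le> norm (?f s - fn cf t (w.\<Theta> \<omega>) - s *\<^sub>R w.lin h h' k k' \<omega>) * norm (P t \<omega>)"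
        by (rule Cauchy_Schwarz_ineq2)
      also have "\<dots> \<le> K * s\<^sup>2 * norm (P t \<omega>)" by (rule mult_right_mono[OF K[OF s] norm_ge_zero])
      also have "\<dots> = K * norm (P t \<omega>) * s\<^sup>2" by simp
      finally show "\<bar>?f s \<bullet> P t \<omega> - fn cf t (Theta M \<delta> X u t \<omega>) \<bullet> P t \<omega> - s * (P t \<omega> \<bullet> w.lin h h' k k' \<omega>)\<bar> \<le> K * norm (P t \<omega>) * s\<^sup>2" .
    qed
  qed
qed

end

lemma L2_norm_add_le:
  "f \<in> L2 M M \<Longrightarrow> g \<in> L2 M M \<Longrightarrow> L2_norm M f \<le> k \<Longrightarrow> L2_norm M g \<le> l \<Longrightarrow> L2_norm M (\<lambda>x. f x + g x) \<le> k + l"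
  using L2_norm_triangle[of f M g] by simp

lemma growth_zero: "growth 0 z = 1"
  by (cases z) (simp add: growth_def)

lemma hamiltonian_eq:
  "hamiltonian b \<sigma> h t \<theta> p q = fn b t \<theta> \<bullet> p + fn \<sigma> t \<theta> \<bullet> q + fn (running_coefficient h) t \<theta> \<bullet> 1"
  by (cases \<theta>) (simp add: hamiltonian_def running_coefficient_def)

section \<open>Comparison of the given control with a competitor\<close>

locale adjoint_pair = delayed_control M G T B F \<delta> U \<xi> \<gamma>
  for M G :: "'a measure" and T and B :: "real \<Rightarrow> 'a \<Rightarrow> real^'d::finite" and F \<delta>
    and U :: "(real^'k::finite) set" and \<xi> :: "real \<Rightarrow> 'a \<Rightarrow> real^'n::finite" and \<gamma> :: "real \<Rightarrow> 'a \<Rightarrow> real^'k" +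
  fixes b :: "('n, 'k, real^'n) coefficient" and \<sigma> :: "('n, 'k, real^'d^'n) coefficient"
    and h :: "('n, 'k) running_cost" and Lb Cb Ls Cs Lh Ch :: real
    and u v :: "real \<Rightarrow> 'a \<Rightarrow> real^'k" and X X' p :: "real \<Rightarrow> 'a \<Rightarrow> real^'n" and q :: "real \<Rightarrow> 'a \<Rightarrow> real^'d^'n"
  assumes cu: "controlled u X" and cv: "controlled v X'"
    and lb: "\<And>t. t \<in> {0..T} \<Longrightarrow> lifted_coefficient M U 0 Lb Cb b t"
    and ls: "\<And>t. t \<in> {0..T} \<Longrightarrow> lifted_coefficient M U 0 Ls Cs \<sigma> t"
    and lh: "\<And>t. t \<in> {0..T} \<Longrightarrow> lifted_coefficient M U 1 Lh Ch (running_coefficient h) t"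
    and pS: "p \<in> S2 M F {0..T}" and qH: "q \<in> H2 M F {0..T}"
begin

lemma pL: "(\<lambda>z. p (fst z) (snd z)) \<in> L2 Q Q" and qL: "(\<lambda>z. q (fst z) (snd z)) \<in> L2 Q Q"
  by (rule H2_L2'[OF S2_subset_H2[OF pS]] H2_L2'[OF qH])+

text \<open>The Hamiltonian is a sum of three coefficients paired with multipliers, and each becomes
  a weighted process. For \<open>b\<close> and \<open>\<sigma>\<close> the weight is the norm of the
  multiplier, for \<open>h\<close> it is the growth function.\<close>

sublocale wb: weighted_process M G T B F \<delta> U \<xi> \<gamma> u X 0 Lb Cb b p
  by (intro weighted_process.intro weighted_process_axioms.intro delayed_control_axioms cu lb pL)
    (assumption, unfold growth_zero mult_1_left, rule L2_norm_fun[OF pL])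

sublocale ws: weighted_process M G T B F \<delta> U \<xi> \<gamma> u X 0 Ls Cs \<sigma> q
  by (intro weighted_process.intro weighted_process_axioms.intro delayed_control_axioms cu ls qL)
    (assumption, unfold growth_zero mult_1_left, rule L2_norm_fun[OF qL])

sublocale wh: weighted_process M G T B F \<delta> U \<xi> \<gamma> u X 1 Lh Ch "running_coefficient h" "\<lambda>_ _. 1"
proof (intro weighted_process.intro weighted_process_axioms.intro delayed_control_axioms cu lh Q.L2_const)
  show "(\<lambda>z. growth 1 (Theta M \<delta> X u (fst z) (snd z)) * norm (1::real)) \<in> L2 Q Q"
    unfolding growth_def Theta_def prod.case norm_one mult_1_left mult_1_right
    by (intro L2_add Q.L2_const L2_norm_fun controlled_L2[OF cu])
qed

abbreviation "dX t \<omega> \<equiv> X' t \<omega> - X t \<omega>"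
abbreviation "dv t \<omega> \<equiv> v t \<omega> - u t \<omega>"

lemma wh_delayed: "wh.xd_term t \<omega> = 0" "wh.mud_term t \<omega> = 0"
proof -
  have tr0: "tr (0 :: (real^'n) \<Rightarrow>\<^sub>L real) 1 = 0" using norm_tr_le[of "0 :: (real^'n) \<Rightarrow>\<^sub>L real" 1] by simp
  show "wh.xd_term t \<omega> = 0" "wh.mud_term t \<omega> = 0"
    unfolding wh.xd_term_def wh.mud_term_def by (simp_all add: running_coefficient_def tr0)
qed

definition "ok t \<longleftrightarrow> t \<in> {0..T} \<and> good u X t \<and> good v X' t \<and> wb.regular t \<and> ws.regular t \<and> wh.regular t"

lemma AE_ok: "AE t in Leb. ok t \<and> (t + \<delta> \<le> T \<longrightarrow> ok (t + \<delta>))"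
proof -
  have o: "AE t in Leb. ok t"
    using AE_good[OF cu] AE_good[OF cv] wb.AE_regular ws.AE_regular wh.AE_regular AE_space
    by eventually_elim (simp add: ok_def)
  then show ?thesis using AE_Leb_shift[OF o \<delta>(1)] by eventually_elim simp
qed

lemma ok_diff: "ok t \<Longrightarrow> dX t \<in> L2 M M \<and> dX (t - \<delta>) \<in> L2 M M \<and> dv t \<in> L2 M M \<and> dv (t - \<delta>) \<in> L2 M M"
  by (auto simp: ok_def good_def intro!: L2_diff)

text \<open>The expected slope of the Hamiltonian, sorted by argument: present state and its law,
  present control, delayed state and its law, delayed control. The sum
  \<open>past t + past_control t\<close> is the function that telescopes over the delay. The running
  cost contributes nothing to \<open>past\<close>, as it does not contain the delayed state.\<close>

definition "present t = (\<integral>\<omega>. wb.x_term t \<omega> \<bullet> dX t \<omega> \<partial>M) + (\<integral>\<omega>. ws.x_term t \<omega> \<bullet> dX t \<omega> \<partial>M) + (\<integral>\<omega>. wh.x_term t \<omega> \<bullet> dX t \<omega> \<partial>M)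
  + (\<integral>\<omega>. wb.mu_term t \<omega> \<bullet> dX t \<omega> \<partial>M) + (\<integral>\<omega>. ws.mu_term t \<omega> \<bullet> dX t \<omega> \<partial>M) + (\<integral>\<omega>. wh.mu_term t \<omega> \<bullet> dX t \<omega> \<partial>M)"
definition "control t = (\<integral>\<omega>. wb.v_term t \<omega> \<bullet> dv t \<omega> \<partial>M) + (\<integral>\<omega>. ws.v_term t \<omega> \<bullet> dv t \<omega> \<partial>M) + (\<integral>\<omega>. wh.v_term t \<omega> \<bullet> dv t \<omega> \<partial>M)"
definition "past t = (\<integral>\<omega>. wb.xd_term t \<omega> \<bullet> dX (t - \<delta>) \<omega> \<partial>M) + (\<integral>\<omega>. ws.xd_term t \<omega> \<bullet> dX (t - \<delta>) \<omega> \<partial>M)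
  + (\<integral>\<omega>. wb.mud_term t \<omega> \<bullet> dX (t - \<delta>) \<omega> \<partial>M) + (\<integral>\<omega>. ws.mud_term t \<omega> \<bullet> dX (t - \<delta>) \<omega> \<partial>M)"
definition "past_control t = (\<integral>\<omega>. wb.vd_term t \<omega> \<bullet> dv (t - \<delta>) \<omega> \<partial>M) + (\<integral>\<omega>. ws.vd_term t \<omega> \<bullet> dv (t - \<delta>) \<omega> \<partial>M)
  + (\<integral>\<omega>. wh.vd_term t \<omega> \<bullet> dv (t - \<delta>) \<omega> \<partial>M)"

lemma past_initial:
  assumes "0 \<le> t" "t < \<delta>"
  shows "past t + past_control t = 0"
proof -
  have "(\<integral>\<omega>. f \<omega> \<bullet> dX (t - \<delta>) \<omega> \<partial>M) = 0" "(\<integral>\<omega>. g \<omega> \<bullet> dv (t - \<delta>) \<omega> \<partial>M) = 0" for f :: "'a \<Rightarrow> real^'n" and g :: "'a \<Rightarrow> real^'k"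
    using controlled_initial[OF cv cu assms] by (auto intro!: integral_eq_zero_AE)
  then show ?thesis unfolding past_def past_control_def by simp
qed

text \<open>For almost every \<open>\<omega>\<close> the multipliers are frozen, and the
  one-dimensional gradient inequality is applied along the segment that joins the two controlled
  points. Integrability is asked of the difference \<open>K\<close> only, since (H) controls
  differences of coefficients.\<close>

lemma hamiltonian_slope:
  assumes ok: "ok t"
    and conv: "AE \<omega> in M. lift_convex6 M U (\<lambda>\<theta>. hamiltonian b \<sigma> h t \<theta> (p t \<omega>) (q t \<omega>))"
    and K: "integrable M K"
      "\<And>\<omega>. \<omega> \<in> space M \<Longrightarrow> K \<omega> = hamiltonian b \<sigma> h t (Theta M \<delta> X' v t \<omega>) (p t \<omega>) (q t \<omega>)
         - hamiltonian b \<sigma> h t (Theta M \<delta> X u t \<omega>) (p t \<omega>) (q t \<omega>)"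
  shows "present t + control t + (past t + past_control t) \<le> (\<integral>\<omega>. K \<omega> \<partial>M)"
proof -
  have t: "t \<in> {0..T}" using ok by (simp add: ok_def)
  have d: "dX t \<in> L2 M M" "dX (t - \<delta>) \<in> L2 M M" "dv t \<in> L2 M M" "dv (t - \<delta>) \<in> L2 M M" using ok_diff[OF ok] by auto
  have L: "X t \<in> L2 M M" "X' t \<in> L2 M M" "X (t - \<delta>) \<in> L2 M M" "X' (t - \<delta>) \<in> L2 M M"
    using ok by (auto simp: ok_def good_def)
  have r: "wb.regular t" "ws.regular t" "wh.regular t" using ok by (auto simp: ok_def)
  define S1 where "S1 = wb.slope t (dX t) (dX (t - \<delta>)) (dv t) (dv (t - \<delta>))"
  note S1 = wb.regular_slope[OF r(1) d, folded S1_def]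
  define S2 where "S2 = ws.slope t (dX t) (dX (t - \<delta>)) (dv t) (dv (t - \<delta>))"
  note S2 = ws.regular_slope[OF r(2) d, folded S2_def]
  define S3 where "S3 = wh.slope t (dX t) (dX (t - \<delta>)) (dv t) (dv (t - \<delta>))"
  note S3 = wh.regular_slope[OF r(3) d, folded S3_def]
  have "present t + control t + (past t + past_control t) = (\<integral>\<omega>. S1 \<omega> + S2 \<omega> + S3 \<omega> \<partial>M)"
    using S1(1,2) S2(1,2) S3(1,2) by (simp add: present_def control_def past_def past_control_def wh_delayed)
  also have "\<dots> \<le> (\<integral>\<omega>. K \<omega> \<partial>M)"
  proof (rule integral_mono_AE)
    show "AE \<omega> in M. S1 \<omega> + S2 \<omega> + S3 \<omega> \<le> K \<omega>"
      using conv AE_space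
    proof eventually_elim
      case (elim \<omega>)
      note Us = controlled_U[OF cu t elim(2)] controlled_U[OF cv t elim(2)]
      define \<theta> where "\<theta> s = (X t \<omega> + s *\<^sub>R dX t \<omega>, X (t - \<delta>) \<omega> + s *\<^sub>R dX (t - \<delta>) \<omega>, law M (\<lambda>\<omega>. X t \<omega> + s *\<^sub>R dX t \<omega>),
        law M (\<lambda>\<omega>. X (t - \<delta>) \<omega> + s *\<^sub>R dX (t - \<delta>) \<omega>), u t \<omega> + s *\<^sub>R dv t \<omega>, u (t - \<delta>) \<omega> + s *\<^sub>R dv (t - \<delta>) \<omega>)" for s :: real
      have c: "x + s *\<^sub>R (y - x) = (1 - s) *\<^sub>R x + s *\<^sub>R y" for s and x y :: "'z::real_vector" by (simp add: algebra_simps)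
      have \<theta>01: "\<theta> 0 = Theta M \<delta> X u t \<omega>" "\<theta> 1 = Theta M \<delta> X' v t \<omega>" by (simp_all add: \<theta>_def Theta_def)
      define \<phi> where "\<phi> s = hamiltonian b \<sigma> h t (\<theta> s) (p t \<omega>) (q t \<omega>)" for s
      have U1: "u t \<omega> + dv t \<omega> \<in> U" "u (t - \<delta>) \<omega> + dv (t - \<delta>) \<omega> \<in> U" using Us by simp_all
      from S1(3)[OF elim(2) U1] obtain k1 where k1: "\<And>s. s \<in> {0..1} \<Longrightarrow> \<bar>fn b t (\<theta> s) \<bullet> p t \<omega> - fn b t (\<theta> 0) \<bullet> p t \<omega> - s * S1 \<omega>\<bar> \<le> k1 * s\<^sup>2"
        unfolding \<theta>01 unfolding \<theta>_def by blast
      from S2(3)[OF elim(2) U1] obtain k2 where k2: "\<And>s. s \<in> {0..1} \<Longrightarrow> \<bar>fn \<sigma> t (\<theta> s) \<bullet> q t \<omega> - fn \<sigma> t (\<theta> 0) \<bullet> q t \<omega> - s * S2 \<omega>\<bar> \<le> k2 * s\<^sup>2"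
        unfolding \<theta>01 unfolding \<theta>_def by blast
      from S3(3)[OF elim(2) U1] obtain k3 where k3: "\<And>s. s \<in> {0..1} \<Longrightarrow> \<bar>fn (running_coefficient h) t (\<theta> s) \<bullet> 1 - fn (running_coefficient h) t (\<theta> 0) \<bullet> 1 - s * S3 \<omega>\<bar> \<le> k3 * s\<^sup>2"
        unfolding \<theta>01 unfolding \<theta>_def by blast
      have "S1 \<omega> + S2 \<omega> + S3 \<omega> \<le> \<phi> 1 - \<phi> 0"
      proof (rule convex_gradient_inequality[where k="k1 + k2 + k3"])
        fix s :: real assume s: "s \<in> {0..1}"
        show "\<phi> s \<le> (1 - s) * \<phi> 0 + s * \<phi> 1"
          unfolding \<phi>_def \<theta>01 unfolding \<theta>_def c Theta_def
          by (rule elim(1)[unfolded lift_convex6_def, rule_format]) (use L Us s in simp_all)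
        show "\<bar>\<phi> s - \<phi> 0 - s * (S1 \<omega> + S2 \<omega> + S3 \<omega>)\<bar> \<le> (k1 + k2 + k3) * s\<^sup>2"
          using k1[OF s] k2[OF s] k3[OF s] unfolding \<phi>_def hamiltonian_eq distrib_left distrib_right by linarith
      qed
      then show ?case unfolding \<phi>_def \<theta>01 K(2)[OF elim(2)] .
    qed
  qed (use K(1) S1(1) S2(1) S3(1) in auto)
  finally show ?thesis .
qed

text \<open>\<open>dv t\<close> is measurable for \<open>F t\<close>, which removes the conditional
  expectation, and it equals \<open>dv ((t + \<delta>) - \<delta>)\<close>, so the second term
  becomes \<open>past_control\<close> at the later time.\<close>

lemma optimality_integrated:
  assumes ok: "ok t" "t + \<delta> \<le> T \<longrightarrow> ok (t + \<delta>)"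
    and opt: "AE \<omega> in M. hamiltonian_v b \<sigma> h t (Theta M \<delta> X u t \<omega>) (p t \<omega>) (q t \<omega>) \<bullet> (v t \<omega> - u t \<omega>)
        + vec_cond_exp M (F t)
            (\<lambda>\<omega>'. zero_after T (t + \<delta>)
               (hamiltonian_vd b \<sigma> h (t + \<delta>) (Theta M \<delta> X u (t + \<delta>) \<omega>')
                  (p (t + \<delta>) \<omega>') (q (t + \<delta>) \<omega>'))) \<omega> \<bullet> (v t \<omega> - u t \<omega>)
        \<ge> 0"
  shows "0 \<le> control t + (if t + \<delta> \<le> T then past_control (t + \<delta>) else 0)"
proof -
  have t: "t \<in> {0..T}" using ok by (simp add: ok_def)
  have d: "dv t \<in> L2 M M" using ok_diff[OF ok(1)] by auto
  have dF: "dv t \<in> borel_measurable (F t)" using controlled_adapted(3)[OF cu t] controlled_adapted(3)[OF cv t] by simp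
  define V where "V \<omega> = wb.v_term t \<omega> + ws.v_term t \<omega> + wh.v_term t \<omega>" for \<omega>
  define W where "W t \<omega> = wb.vd_term t \<omega> + ws.vd_term t \<omega> + wh.vd_term t \<omega>" for t \<omega>
  have rt: "wb.v_term s \<in> L2 M M \<and> ws.v_term s \<in> L2 M M \<and> wh.v_term s \<in> L2 M M \<and>
    wb.vd_term s \<in> L2 M M \<and> ws.vd_term s \<in> L2 M M \<and> wh.vd_term s \<in> L2 M M" if "ok s" for s
    using that wb.regular_terms(5,6) ws.regular_terms(5,6) wh.regular_terms(5,6) by (auto simp: ok_def)
  have VL: "V \<in> L2 M M" unfolding V_def using rt[OF ok(1)] by (auto intro!: L2_add)
  have WL: "W (t + \<delta>) \<in> L2 M M" if "t + \<delta> \<le> T" unfolding W_def using rt[of "t + \<delta>"] ok(2) that by (auto intro!: L2_add)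
  have V: "hamiltonian_v b \<sigma> h t (Theta M \<delta> X u t \<omega>) (p t \<omega>) (q t \<omega>) = V \<omega>" for \<omega>
    unfolding V_def wb.v_term_def ws.v_term_def wh.v_term_def by (simp add: hamiltonian_v_def Theta_def running_coefficient_def)
  have W: "hamiltonian_vd b \<sigma> h (t + \<delta>) (Theta M \<delta> X u (t + \<delta>) \<omega>) (p (t + \<delta>) \<omega>) (q (t + \<delta>) \<omega>) = W (t + \<delta>) \<omega>" for \<omega>
    unfolding W_def wb.vd_term_def ws.vd_term_def wh.vd_term_def by (simp add: hamiltonian_vd_def Theta_def running_coefficient_def)
  let ?Z = "\<lambda>\<omega>. zero_after T (t + \<delta>) (W (t + \<delta>) \<omega>)"
  have ZL: "?Z \<in> L2 M M" by (rule zero_after_L2(1)) (rule WL)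
  have sub: "subalgebra M (F t)" using sub_F t by simp
  note E = vec_cond_exp_L2[OF prob_space_axioms sub ZL]
  have "0 \<le> (\<integral>\<omega>. V \<omega> \<bullet> dv t \<omega> + vec_cond_exp M (F t) ?Z \<omega> \<bullet> dv t \<omega> \<partial>M)"
    by (rule integral_nonneg_AE) (use opt in \<open>simp add: V W\<close>)
  also have "\<dots> = (\<integral>\<omega>. V \<omega> \<bullet> dv t \<omega> \<partial>M) + (\<integral>\<omega>. ?Z \<omega> \<bullet> dv t \<omega> \<partial>M)"
    using L2_integrable_inner[OF VL d] L2_integrable_inner[OF E(1) d] E(3)[OF d dF] by simp
  also have "(\<integral>\<omega>. V \<omega> \<bullet> dv t \<omega> \<partial>M) = control t"
    unfolding V_def control_def inner_add_left using rt[OF ok(1)] L2_integrable_inner[OF _ d] by simp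
  also have "(\<integral>\<omega>. ?Z \<omega> \<bullet> dv t \<omega> \<partial>M) = (if t + \<delta> \<le> T then past_control (t + \<delta>) else 0)"
  proof -
    have "(\<integral>\<omega>. W (t + \<delta>) \<omega> \<bullet> dv t \<omega> \<partial>M) = past_control (t + \<delta>)" if "t + \<delta> \<le> T"
      unfolding W_def past_control_def inner_add_left using rt[of "t + \<delta>"] ok(2) that L2_integrable_inner[OF _ d] by simp
    then show ?thesis unfolding zero_after_L2(3)[of t W, OF WL, simplified] by simp
  qed
  finally show ?thesis .
qed

definition "driver t \<omega> = adjoint_driver M F T \<delta> b \<sigma> h u X p q t \<omega>"

text \<open>Brings the driver to the terms whose norms and pairings are known. The argument
  \<open>X t\<close> of its delayed measure derivatives is
  \<open>X ((t + \<delta>) - \<delta>)\<close>, the one that \<open>mud_term\<close> has at time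
  \<open>t + \<delta>\<close>.\<close>

lemma driver_eq:
  assumes ok: "ok t" "t + \<delta> \<le> T \<longrightarrow> ok (t + \<delta>)"
  shows "driver t \<omega> = wb.x_term t \<omega> + ws.x_term t \<omega> + wh.x_term t \<omega>
    + (wb.mu_term t \<omega> + ws.mu_term t \<omega> + wh.mu_term t \<omega>)
    + vec_cond_exp M (F t) (\<lambda>\<omega>'. zero_after T (t + \<delta>) (wb.xd_term (t + \<delta>) \<omega>')) \<omega>
    + vec_cond_exp M (F t) (\<lambda>\<omega>'. zero_after T (t + \<delta>) (ws.xd_term (t + \<delta>) \<omega>')) \<omega>
    + (zero_after T (t + \<delta>) (wb.mud_term (t + \<delta>) \<omega>) + zero_after T (t + \<delta>) (ws.mud_term (t + \<delta>) \<omega>))"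
proof -
  have x: "grad (rc_x h t (Theta_h M \<delta> X u t \<omega>)) = wh.x_term t \<omega>" for \<omega>
    unfolding wh.x_term_def by (simp add: running_coefficient_def Theta_def Theta_h_def)
  have m: "grad (rc_mu h t (Theta_h M \<delta> X u t \<omega>') y) = tr (D_mu (running_coefficient h) t (Theta M \<delta> X u t \<omega>') y) 1" for \<omega>' y
    by (simp add: running_coefficient_def Theta_def Theta_h_def)
  have r: "wb.regular t" "ws.regular t" "wh.regular t" using ok by (auto simp: ok_def)
  have e1: "(\<integral>\<omega>'. tr (D_mu b t (Theta M \<delta> X u t \<omega>') (X t \<omega>)) (p t \<omega>')
             + tr (D_mu \<sigma> t (Theta M \<delta> X u t \<omega>') (X t \<omega>)) (q t \<omega>')
             + grad (rc_mu h t (Theta_h M \<delta> X u t \<omega>') (X t \<omega>)) \<partial>M) = wb.mu_term t \<omega> + ws.mu_term t \<omega> + wh.mu_term t \<omega>"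
    unfolding m wb.mu_term_def ws.mu_term_def wh.mu_term_def
    using wb.regular_terms(11)[OF r(1)] ws.regular_terms(11)[OF r(2)] wh.regular_terms(11)[OF r(3)] by simp
  have e2: "(\<integral>\<omega>'. zero_after T (t + \<delta>) (tr (D_mud b (t + \<delta>) (Theta M \<delta> X u (t + \<delta>) \<omega>') (X t \<omega>)) (p (t + \<delta>) \<omega>'))
             + zero_after T (t + \<delta>) (tr (D_mud \<sigma> (t + \<delta>) (Theta M \<delta> X u (t + \<delta>) \<omega>') (X t \<omega>)) (q (t + \<delta>) \<omega>')) \<partial>M)
      = zero_after T (t + \<delta>) (wb.mud_term (t + \<delta>) \<omega>) + zero_after T (t + \<delta>) (ws.mud_term (t + \<delta>) \<omega>)"
  proof (cases "t + \<delta> \<le> T")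
    case True
    then have r': "wb.regular (t + \<delta>)" "ws.regular (t + \<delta>)" using ok by (auto simp: ok_def)
    show ?thesis
      unfolding wb.mud_term_def ws.mud_term_def
      using wb.regular_terms(12)[OF r'(1)] ws.regular_terms(12)[OF r'(2)] True by (simp add: zero_after_def)
  qed (simp add: zero_after_def)
  show ?thesis
    unfolding driver_def adjoint_driver_def Let_def e1 e2 x wb.x_term_def[symmetric] ws.x_term_def[symmetric]
      wb.xd_term_def[symmetric] ws.xd_term_def[symmetric] ..
qed

definition "wt t = Cb * wb.wt t + Cs * ws.wt t + Ch * wh.wt t"

text \<open>At time \<open>t\<close> each summand of \<open>wt\<close> is used twice, for a state
  and for a measure derivative. The shifted weight bounds the anticipating terms, on which
  conditional expectation acts as a contraction. Paired with \<open>dX t\<close>, which is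
  measurable for \<open>F t\<close>, these terms give \<open>past\<close> at
  \<open>t + \<delta>\<close>.\<close>

lemma driver_terms:
  assumes ok: "ok t" "t + \<delta> \<le> T \<longrightarrow> ok (t + \<delta>)"
  shows "driver t \<in> L2 M M" (is ?L)
    and "L2_norm M (driver t) \<le> 2 * wt t + 2 * (if t + \<delta> \<le> T then wt (t + \<delta>) else 0)" (is ?N)
    and "(\<integral>\<omega>. driver t \<omega> \<bullet> dX t \<omega> \<partial>M) = present t + (if t + \<delta> \<le> T then past (t + \<delta>) else 0)" (is ?I)
proof -
  have t: "t \<in> {0..T}" using ok by (simp add: ok_def)
  have sub: "subalgebra M (F t)" using sub_F t by simp
  have d: "dX t \<in> L2 M M" using ok_diff[OF ok(1)] by auto
  have dF: "dX t \<in> borel_measurable (F t)" using controlled_adapted(1)[OF cu t] controlled_adapted(1)[OF cv t] by simp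
  have r: "wb.regular t" "ws.regular t" "wh.regular t" using ok by (auto simp: ok_def)
  have r': "wb.regular (t + \<delta>)" "ws.regular (t + \<delta>)" "wh.regular (t + \<delta>)" if "t + \<delta> \<le> T" using ok that by (auto simp: ok_def)
  note b = wb.regular_terms[OF r(1)] and s = ws.regular_terms[OF r(2)] and h = wh.regular_terms[OF r(3)]
  let ?i = "\<lambda>k::real. if t + \<delta> \<le> T then k else 0"
  define A1 A2 A3 A4 where "A1 \<omega> = zero_after T (t + \<delta>) (wb.xd_term (t + \<delta>) \<omega>)" and "A2 \<omega> = zero_after T (t + \<delta>) (ws.xd_term (t + \<delta>) \<omega>)"
    and "A3 \<omega> = zero_after T (t + \<delta>) (wb.mud_term (t + \<delta>) \<omega>)" and "A4 \<omega> = zero_after T (t + \<delta>) (ws.mud_term (t + \<delta>) \<omega>)" for \<omega>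
  have A: "A1 \<in> L2 M M" "A2 \<in> L2 M M" "A3 \<in> L2 M M" "A4 \<in> L2 M M"
    unfolding A1_def A2_def A3_def A4_def
    using zero_after_L2(1) wb.regular_terms(2,4)[OF r'(1)] ws.regular_terms(2,4)[OF r'(2)] by blast+
  have nA: "L2_norm M A1 \<le> ?i (Cb * wb.wt (t + \<delta>))" "L2_norm M A2 \<le> ?i (Cs * ws.wt (t + \<delta>))"
    "L2_norm M A3 \<le> ?i (Cb * wb.wt (t + \<delta>))" "L2_norm M A4 \<le> ?i (Cs * ws.wt (t + \<delta>))"
    unfolding A1_def A2_def A3_def A4_def
    using wb.regular_terms[OF r'(1)] ws.regular_terms[OF r'(2)]
      zero_after_L2(2)[of t wb.xd_term] zero_after_L2(2)[of t ws.xd_term] zero_after_L2(2)[of t wb.mud_term] zero_after_L2(2)[of t ws.mud_term] by auto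
  have iA: "(\<integral>\<omega>. A1 \<omega> \<bullet> dX t \<omega> \<partial>M) + (\<integral>\<omega>. A2 \<omega> \<bullet> dX t \<omega> \<partial>M) + ((\<integral>\<omega>. A3 \<omega> \<bullet> dX t \<omega> \<partial>M) + (\<integral>\<omega>. A4 \<omega> \<bullet> dX t \<omega> \<partial>M)) = ?i (past (t + \<delta>))"
    unfolding A1_def A2_def A3_def A4_def past_def
    using wb.regular_terms(2,4)[OF r'(1)] ws.regular_terms(2,4)[OF r'(2)]
      zero_after_L2(3)[of t wb.xd_term] zero_after_L2(3)[of t ws.xd_term] zero_after_L2(3)[of t wb.mud_term] zero_after_L2(3)[of t ws.mud_term]
    by auto
  let ?E = "vec_cond_exp M (F t)"
  note E1 = vec_cond_exp_L2(1,3)[OF prob_space_axioms sub A(1)] and E2 = vec_cond_exp_L2(1,3)[OF prob_space_axioms sub A(2)]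
  note nE = order_trans[OF vec_cond_exp_L2_norm[OF prob_space_axioms sub A(1)] nA(1)] order_trans[OF vec_cond_exp_L2_norm[OF prob_space_axioms sub A(2)] nA(2)]
  have eq: "driver t = (\<lambda>\<omega>. wb.x_term t \<omega> + ws.x_term t \<omega> + wh.x_term t \<omega> + (wb.mu_term t \<omega> + ws.mu_term t \<omega> + wh.mu_term t \<omega>)
      + ?E A1 \<omega> + ?E A2 \<omega> + (A3 \<omega> + A4 \<omega>))"
    by (rule ext) (simp only: driver_eq[OF ok] A1_def[abs_def] A2_def[abs_def] A3_def A4_def)
  show ?L unfolding eq by (intro L2_add b s h A E1 E2)
  have "L2_norm M (driver t) \<le> Cb * wb.wt t + Cs * ws.wt t + Ch * wh.wt t + (Cb * wb.wt t + Cs * ws.wt t + Ch * wh.wt t)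
      + ?i (Cb * wb.wt (t + \<delta>)) + ?i (Cs * ws.wt (t + \<delta>)) + (?i (Cb * wb.wt (t + \<delta>)) + ?i (Cs * ws.wt (t + \<delta>)))"
    unfolding eq by (intro L2_norm_add_le L2_add b s h A E1 E2 nA nE)
  also have "\<dots> \<le> 2 * wt t + 2 * ?i (wt (t + \<delta>))"
    using wh.C_nonneg L2_norm_nonneg unfolding wt_def wh.wt_def by auto
  finally show ?N .
  note i = L2_integrable_inner[OF _ d]
  have "(\<integral>\<omega>. driver t \<omega> \<bullet> dX t \<omega> \<partial>M) = present t + (\<integral>\<omega>. ?E A1 \<omega> \<bullet> dX t \<omega> \<partial>M) + (\<integral>\<omega>. ?E A2 \<omega> \<bullet> dX t \<omega> \<partial>M)
      + ((\<integral>\<omega>. A3 \<omega> \<bullet> dX t \<omega> \<partial>M) + (\<integral>\<omega>. A4 \<omega> \<bullet> dX t \<omega> \<partial>M))"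
    unfolding eq inner_add_left present_def using i[OF b(1)] i[OF s(1)] i[OF h(1)] i[OF b(3)] i[OF s(3)] i[OF h(3)]
      i[OF E1(1)] i[OF E2(1)] i[OF A(3)] i[OF A(4)] by simp
  then show ?I unfolding E1(2)[OF d dF] E2(2)[OF d dF] using iA by simp
qed

text \<open>The definition of a solution demands only pathwise integrability of the drift, whereas
  the product rule pairs it with processes in \<open>L2 Q Q\<close>. The bound on the norms of the
  sections closes this gap.\<close>

lemma AE_driver_L2:
  assumes f: "(\<lambda>z. f (fst z) (snd z)) \<in> borel_measurable Q" and eq: "AE t in Leb. AE \<omega> in M. f t \<omega> = driver t \<omega>"
  shows "(\<lambda>z. f (fst z) (snd z)) \<in> L2 Q Q"
proof (rule L2_Q_of_sections[OF f])
  have w: "wt \<in> L2 Leb Leb"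
    unfolding wt_def[abs_def] by (intro L2_add L2_mult wb.wt_L2 ws.wt_L2 wh.wt_L2)
  show "(\<lambda>t. 2 * wt t + 2 * (if t + \<delta> \<le> T then wt (t + \<delta>) else 0)) \<in> L2 Leb Leb"
    by (intro L2_add L2_mult w shifted_L2_Leb)
  show "AE t in Leb. f t \<in> L2 M M \<and> L2_norm M (f t) \<le> 2 * wt t + 2 * (if t + \<delta> \<le> T then wt (t + \<delta>) else 0)"
    using AE_ok eq AE_space
  proof eventually_elim
    case (elim t)
    note D = driver_terms(1,2)[OF conjunct1[OF elim(1)] conjunct2[OF elim(1)]]
    have m: "f t \<in> borel_measurable M" by (rule measurable_Q_section(1)[OF f]) (use elim in simp)
    have b: "AE \<omega> in M. norm (f t \<omega>) \<le> 1 * norm (driver t \<omega>)" using elim(2) by eventually_elim simp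
    have l: "f t \<in> L2 M M" by (rule L2_bound[OF m D(1) b])
    show ?case using l L2_norm_mono[OF l D(1) _ b] D(2) by simp
  qed
qed

end

text \<open>Lets the measurable version of a difference of coefficients stand in for the difference
  of two pathwise integrals.\<close>

lemma (in brownian_basis) difference_integral:
  fixes f1 f2 g :: "real \<Rightarrow> 'e::euclidean_space"
  assumes f: "set_integrable lborel {0..T} f1" "set_integrable lborel {0..T} f2" and g: "g \<in> borel_measurable Leb"
    and eq: "AE s in Leb. g s = f1 s - f2 s" and t: "t \<in> {0..T}"
  shows "(LINT s:{0..t}|lborel. f1 s) - (LINT s:{0..t}|lborel. f2 s) = (\<integral>s. (if s \<le> t then g s else 0) \<partial>Leb)"
proof -
  have i: "integrable Leb f1" "integrable Leb f2"
    using f unfolding Leb_def set_integrable_def by (simp_all add: integrable_restrict_space)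
  have [measurable]: "f1 \<in> borel_measurable Leb" "f2 \<in> borel_measurable Leb" using i by auto
  have j: "integrable Leb (\<lambda>s. if s \<le> t then f1 s else 0)" "integrable Leb (\<lambda>s. if s \<le> t then f2 s else 0)"
    by (rule Bochner_Integration.integrable_bound[OF i(1)] Bochner_Integration.integrable_bound[OF i(2)]; simp)+
  have "(\<integral>s. (if s \<le> t then g s else 0) \<partial>Leb) = (\<integral>s. (if s \<le> t then f1 s else 0) - (if s \<le> t then f2 s else 0) \<partial>Leb)"
    by (rule integral_cong_AE) (use g eq in \<open>auto elim!: eventually_mono\<close>)
  then show ?thesis unfolding integral_Leb_if(1)[OF t] using j by simp
qed

text \<open>The terminal cost, as a coefficient with dummy delayed and control arguments, is
  expanded along the segment from \<open>X T\<close> to \<open>X' T\<close>. Fubini turns the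
  averaged direction into the averaged multiplier, which is the second term of the terminal
  condition.\<close>

lemma (in delayed_control) terminal_cost_le:
  fixes \<Phi> :: "'n terminal_cost"
  assumes c: "controlled u X" "controlled v X'"
    and lt: "lifted_coefficient M U 1 L C (terminal_coefficient \<Phi> :: ('n, 'k, real) coefficient) T"
    and conv: "lift_convex2 M (tc \<Phi>)"
    and pT: "AE \<omega> in M. p \<omega> = grad (tc_x \<Phi> (X T \<omega>, law M (X T))) + (\<integral>\<omega>'. grad (tc_mu \<Phi> (X T \<omega>', law M (X T)) (X T \<omega>)) \<partial>M)"
    and pm: "p \<in> borel_measurable M"
  shows "integrable M (\<lambda>\<omega>. tc \<Phi> (X' T \<omega>, law M (X' T)) - tc \<Phi> (X T \<omega>, law M (X T)))" (is "integrable M ?D")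
    and "(\<integral>\<omega>. p \<omega> \<bullet> (X' T \<omega> - X T \<omega>) \<partial>M) \<le> (\<integral>\<omega>. tc \<Phi> (X' T \<omega>, law M (X' T)) - tc \<Phi> (X T \<omega>, law M (X T)) \<partial>M)"
proof -
  have T: "T \<in> {0..T}" using T_pos by simp
  \<comment> \<open>The dummy control arguments require some point of \<open>U\<close>; a value of
    the control provides one.\<close>
  obtain \<omega>0 where "\<omega>0 \<in> space M" using not_empty by auto
  then obtain u0 where u0: "u0 \<in> U" using controlled_U(1)[OF c(1) T] by blast
  interpret lifted_coefficient M U 1 L C "terminal_coefficient \<Phi> :: ('n, 'k, real) coefficient" T by (rule lt)
  have XL: "X T \<in> L2 M M" "X' T \<in> L2 M M" using controlled_L2(5)[OF c(1) T] controlled_L2(5)[OF c(2) T] by auto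
  have XT: "X T \<in> borel_measurable M" "X' T \<in> borel_measurable M" using XL by (auto simp: L2_iff)
  have d: "(\<lambda>\<omega>. X' T \<omega> - X T \<omega>) \<in> L2 M M" by (intro L2_diff XL)
  let ?c = "terminal_coefficient \<Phi> :: ('n, 'k, real) coefficient"
  have f: "fn ?c T (x, y, m, m', w, w') = tc \<Phi> (x, m)" for x y m m' w w' by (simp add: terminal_coefficient_def)
  have mD: "?D \<in> borel_measurable M"
    using fn_measurable[OF XL(1,1) refl XT(1,1), of "\<lambda>_. u0" "\<lambda>_. u0"] fn_measurable[OF XL(2,2) refl XT(2,2), of "\<lambda>_. u0" "\<lambda>_. u0"] u0
    by (simp add: f)
  show iD: "integrable M ?D"
  proof (rule L2_integrable_bound_mult[OF _ _ mD, where C=C])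
    show "(\<lambda>\<omega>. 1 + 1 * (norm (X T \<omega>) + norm (X' T \<omega> - X T \<omega>) + norm (X T \<omega>) + 0 + norm u0 + 0 + norm u0 + 0)) \<in> L2 M M"
      by (intro L2_add L2_const L2_mult L2_norm_fun XL d)
    show "(\<lambda>\<omega>. norm (X' T \<omega> - X T \<omega>) + 0 + L2_norm M (\<lambda>\<omega>. X' T \<omega> - X T \<omega>) + 0 + 0 + 0) \<in> L2 M M"
      by (intro L2_add L2_const L2_norm_fun d)
    fix \<omega> assume "\<omega> \<in> space M"
    have n0: "L2_norm M (\<lambda>\<omega>. 0 :: real^'n) = 0" by (simp add: L2_norm_def)
    show "norm (?D \<omega>) \<le> C * (norm (1 + 1 * (norm (X T \<omega>) + norm (X' T \<omega> - X T \<omega>) + norm (X T \<omega>) + 0 + norm u0 + 0 + norm u0 + 0))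
      * norm (norm (X' T \<omega> - X T \<omega>) + 0 + L2_norm M (\<lambda>\<omega>. X' T \<omega> - X T \<omega>) + 0 + 0 + 0))"
      using growth_lipschitz[OF XL(1,1,2,1) u0 u0 u0 u0, of "X' T \<omega>" "X T \<omega>" "X T \<omega>" "X T \<omega>"]
      by (simp add: f n0 mult.assoc)
  qed
  interpret w: weighted_coefficient M U 1 L C ?c T "X T" "X T" "\<lambda>_. u0" "\<lambda>_. u0" "\<lambda>_. 1"
  proof (intro weighted_coefficient.intro weighted_coefficient_axioms.intro lt XL)
    show "(\<lambda>\<omega>. growth 1 (Th (X T) (X T) (\<lambda>_. u0) (\<lambda>_. u0) \<omega>) * norm (1::real)) \<in> L2 M M"
      unfolding growth_def prod.case norm_one mult_1_left mult_1_right
      by (intro L2_add L2_const L2_norm_fun XL)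
  qed (use u0 in auto)
  let ?h = "\<lambda>\<omega>. X' T \<omega> - X T \<omega>" and ?z = "\<lambda>\<omega>::'a. 0 :: real^'n" and ?y = "\<lambda>\<omega>::'a. 0 :: real^'k"
  define S where "S = w.lin ?h ?z ?y ?y"
  note li = w.lin_integral[OF d L2_zero L2_zero L2_zero, folded S_def]
  have m: "D_mu ?c T \<in> {D_mu ?c T, D_mud ?c T}" and m': "D_x ?c T \<in> {D_x ?c T, D_xd ?c T}" by auto
  have eqp: "(\<integral>\<omega>. p \<omega> \<bullet> ?h \<omega> \<partial>M) = (\<integral>\<omega>. (tr (D_x ?c T (w.\<Theta> \<omega>)) 1 + (\<integral>\<omega>'. tr (D_mu ?c T (w.\<Theta> \<omega>') (X T \<omega>)) 1 \<partial>M)) \<bullet> ?h \<omega> \<partial>M)"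
  proof (rule integral_cong_AE)
    show "AE \<omega> in M. p \<omega> \<bullet> ?h \<omega> = (tr (D_x ?c T (w.\<Theta> \<omega>)) 1 + (\<integral>\<omega>'. tr (D_mu ?c T (w.\<Theta> \<omega>') (X T \<omega>)) 1 \<partial>M)) \<bullet> ?h \<omega>"
      using pT by eventually_elim (simp add: terminal_coefficient_def)
    show "(\<lambda>\<omega>. p \<omega> \<bullet> ?h \<omega>) \<in> borel_measurable M" using pm XT by measurable
    have "(\<lambda>\<omega>. tr (D_x ?c T (w.\<Theta> \<omega>)) 1 + (\<integral>\<omega>'. tr (D_mu ?c T (w.\<Theta> \<omega>') (X T \<omega>)) 1 \<partial>M)) \<in> L2 M M"
      by (intro L2_add w.space_derivative_term(1)[OF m'] w.measure_derivative_term_L2(1)[OF m XT(1)])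
    from L2_integrable_inner[OF this d]
    show "(\<lambda>\<omega>. (tr (D_x ?c T (w.\<Theta> \<omega>)) 1 + (\<integral>\<omega>'. tr (D_mu ?c T (w.\<Theta> \<omega>') (X T \<omega>)) 1 \<partial>M)) \<bullet> ?h \<omega>) \<in> borel_measurable M"
      by auto
  qed
  have "(\<integral>\<omega>. p \<omega> \<bullet> ?h \<omega> \<partial>M) = (\<integral>\<omega>. 1 \<bullet> S \<omega> \<partial>M)"
    unfolding eqp li(2) inner_add_left
    using L2_integrable_inner[OF w.space_derivative_term(1)[OF m'] d] L2_integrable_inner[OF w.measure_derivative_term_L2(1)[OF m XT(1)] d]
    by simp
  also have "\<dots> \<le> (\<integral>\<omega>. ?D \<omega> \<partial>M)"
  proof (rule integral_mono_AE[OF li(1) iD], rule AE_I2)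
    fix \<omega> assume \<omega>: "\<omega> \<in> space M"
    define \<phi> where "\<phi> s = tc \<Phi> (X T \<omega> + s *\<^sub>R ?h \<omega>, law M (\<lambda>\<omega>. X T \<omega> + s *\<^sub>R ?h \<omega>))" for s
    have "u0 + 0 \<in> U" using u0 by simp
    from w.linear_approx_along[of ?h ?z \<omega> ?y ?y, OF d L2_zero \<omega> this this]
    obtain K where K: "\<And>s. s \<in> {0..1} \<Longrightarrow> norm (\<phi> s - tc \<Phi> (X T \<omega>, law M (X T)) - s *\<^sub>R S \<omega>) \<le> K * s\<^sup>2"
      unfolding f S_def[symmetric] \<phi>_def by blast
    have \<phi>01: "\<phi> 0 = tc \<Phi> (X T \<omega>, law M (X T))" "\<phi> 1 = tc \<Phi> (X' T \<omega>, law M (X' T))" by (simp_all add: \<phi>_def)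
    have cc: "x + s *\<^sub>R (y - x) = (1 - s) *\<^sub>R x + s *\<^sub>R y" for s and x y :: "real^'n" by (simp add: algebra_simps)
    have "S \<omega> \<le> \<phi> 1 - \<phi> 0"
    proof (rule convex_gradient_inequality[where k=K])
      fix s :: real assume s: "s \<in> {0..1}"
      show "\<phi> s \<le> (1 - s) * \<phi> 0 + s * \<phi> 1"
        unfolding \<phi>01 unfolding \<phi>_def cc
        by (rule conv[unfolded lift_convex2_def, rule_format]) (use XL s in auto)
      show "\<bar>\<phi> s - \<phi> 0 - s * S \<omega>\<bar> \<le> K * s\<^sup>2" using K[OF s] by (simp add: \<phi>01)
    qed
    then show "1 \<bullet> S \<omega> \<le> ?D \<omega>" by (simp add: \<phi>01)
  qed
  finally show "(\<integral>\<omega>. p \<omega> \<bullet> ?h \<omega> \<partial>M) \<le> (\<integral>\<omega>. ?D \<omega> \<partial>M)" .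
qed

section \<open>The inequality at a fixed time and the comparison of costs\<close>

context adjoint_pair
begin

text \<open>Pairing the driver with \<open>dX t\<close> gives
  \<open>present t + past (t + \<delta>)\<close>, optimality gives
  \<open>0 \<le> control t + past_control (t + \<delta>)\<close>, and convexity bounds
  \<open>present t + control t + past t + past_control t\<close> by the mean of \<open>K\<close>.
  Eliminating \<open>present\<close> and \<open>control\<close> leaves the claim; the shifted terms
  are 0 after \<open>T\<close>.\<close>

lemma fixed_time_inequality:
  assumes ok: "ok t" "t + \<delta> \<le> T \<longrightarrow> ok (t + \<delta>)"
    and conv: "AE \<omega> in M. lift_convex6 M U (\<lambda>\<theta>. hamiltonian b \<sigma> h t \<theta> (p t \<omega>) (q t \<omega>))"
    and K: "integrable M K"
      "\<And>\<omega>. \<omega> \<in> space M \<Longrightarrow> K \<omega> = hamiltonian b \<sigma> h t (Theta M \<delta> X' v t \<omega>) (p t \<omega>) (q t \<omega>)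
         - hamiltonian b \<sigma> h t (Theta M \<delta> X u t \<omega>) (p t \<omega>) (q t \<omega>)"
    and opt: "AE \<omega> in M. hamiltonian_v b \<sigma> h t (Theta M \<delta> X u t \<omega>) (p t \<omega>) (q t \<omega>) \<bullet> (v t \<omega> - u t \<omega>)
        + vec_cond_exp M (F t)
            (\<lambda>\<omega>'. zero_after T (t + \<delta>)
               (hamiltonian_vd b \<sigma> h (t + \<delta>) (Theta M \<delta> X u (t + \<delta>) \<omega>')
                  (p (t + \<delta>) \<omega>') (q (t + \<delta>) \<omega>'))) \<omega> \<bullet> (v t \<omega> - u t \<omega>)
        \<ge> 0"
    and f: "f \<in> borel_measurable M" "AE \<omega> in M. f \<omega> = driver t \<omega>"
  shows "(\<integral>\<omega>. f \<omega> \<bullet> dX t \<omega> \<partial>M) + (past t + past_control t)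
    - (if t + \<delta> \<le> T then past (t + \<delta>) + past_control (t + \<delta>) else 0) \<le> (\<integral>\<omega>. K \<omega> \<partial>M)"
proof -
  have d: "dX t \<in> L2 M M" using ok_diff[OF ok(1)] by auto
  have "(\<integral>\<omega>. f \<omega> \<bullet> dX t \<omega> \<partial>M) = (\<integral>\<omega>. driver t \<omega> \<bullet> dX t \<omega> \<partial>M)"
  proof (rule integral_cong_AE)
    show "(\<lambda>\<omega>. driver t \<omega> \<bullet> dX t \<omega>) \<in> borel_measurable M"
      using L2_integrable_inner[OF driver_terms(1)[OF ok] d] by auto
    show "(\<lambda>\<omega>. f \<omega> \<bullet> dX t \<omega>) \<in> borel_measurable M"
      using f(1) L2_measurable[OF d] by (intro borel_measurable_inner)
  qed (use f(2) in \<open>auto elim: eventually_mono\<close>)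
  then show ?thesis
    using driver_terms(3)[OF ok] hamiltonian_slope[OF ok(1) conv K] optimality_integrated[OF ok opt]
    by (auto split: if_splits)
qed

lemma cost_le:
  fixes \<Phi> :: "'n terminal_cost"
  assumes tm: "time_measurable T (dom6 U) (fn b)" "time_measurable T (dom6 U) (fn (running_coefficient h))"
    and sol: "state_solution M F T \<delta> B \<xi> b \<sigma> u X" "state_solution M F T \<delta> B \<xi> b \<sigma> v X'"
    and cost: "cost_well_defined M T \<delta> h \<Phi> u X" "cost_well_defined M T \<delta> h \<Phi> v X'"
    and adj: "adjoint_solution M F T \<delta> B b \<sigma> h \<Phi> u X p q"
    and opt: "AE t in Leb. AE \<omega> in M. hamiltonian_v b \<sigma> h t (Theta M \<delta> X u t \<omega>) (p t \<omega>) (q t \<omega>) \<bullet> (v t \<omega> - u t \<omega>)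
        + vec_cond_exp M (F t)
            (\<lambda>\<omega>'. zero_after T (t + \<delta>)
               (hamiltonian_vd b \<sigma> h (t + \<delta>) (Theta M \<delta> X u (t + \<delta>) \<omega>')
                  (p (t + \<delta>) \<omega>') (q (t + \<delta>) \<omega>'))) \<omega> \<bullet> (v t \<omega> - u t \<omega>)
        \<ge> 0"
    and conv2: "lift_convex2 M (tc \<Phi>)"
    and conv6: "AE t in Leb. AE \<omega> in M. lift_convex6 M U (\<lambda>\<theta>. hamiltonian b \<sigma> h t \<theta> (p t \<omega>) (q t \<omega>))"
    and lt: "lifted_coefficient M U 1 L C (terminal_coefficient \<Phi> :: ('n, 'k, real) coefficient) T"
  shows "cost_J M T \<delta> h \<Phi> u X \<le> cost_J M T \<delta> h \<Phi> v X'"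
proof -
  have T: "T \<in> {0..T}" "0 \<in> {0..T}" using T_pos by auto
  \<comment> \<open>Bounded derivatives, \<open>a = 0\<close>, make the drift difference
    square-integrable; for the running cost below, \<open>a = 1\<close> gives integrability.\<close>
  have "\<exists>\<beta>. (AE t in Leb. \<forall>\<omega>\<in>space M. \<beta> t \<omega> = fn b t (Theta M \<delta> X' v t \<omega>) - fn b t (Theta M \<delta> X u t \<omega>)) \<and>
    (AE t in Leb. \<beta> t \<in> borel_measurable (F t)) \<and> (\<lambda>z. \<beta> (fst z) (snd z)) \<in> L2 Q Q"
    by (rule coefficient_difference[OF lb tm(1) cu cv], assumption, intro exI conjI, assumption, assumption, simp)
  then obtain \<beta> where \<beta>: "(\<lambda>z. \<beta> (fst z) (snd z)) \<in> L2 Q Q"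
    "AE t in Leb. \<forall>\<omega>\<in>space M. \<beta> t \<omega> = fn b t (Theta M \<delta> X' v t \<omega>) - fn b t (Theta M \<delta> X u t \<omega>)"
    "AE t in Leb. \<beta> t \<in> borel_measurable (F t)"
    by (elim exE conjE) (rule that)
  have "\<exists>\<eta>. (AE t in Leb. \<forall>\<omega>\<in>space M. \<eta> t \<omega> = fn (running_coefficient h) t (Theta M \<delta> X' v t \<omega>) - fn (running_coefficient h) t (Theta M \<delta> X u t \<omega>)) \<and>
    integrable Q (\<lambda>z. \<eta> (fst z) (snd z))"
    by (rule coefficient_difference[OF lh tm(2) cu cv], assumption, intro exI conjI)
  then obtain \<eta> where \<eta>: "integrable Q (\<lambda>z. \<eta> (fst z) (snd z))"
    "AE t in Leb. \<forall>\<omega>\<in>space M. \<eta> t \<omega> = fn (running_coefficient h) t (Theta M \<delta> X' v t \<omega>) - fn (running_coefficient h) t (Theta M \<delta> X u t \<omega>)"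
    by (elim exE conjE) (rule that)
  let ?s = "\<lambda>X v s \<omega>. fn \<sigma> s (Theta M \<delta> X v s \<omega>)" and ?b = "\<lambda>X v s \<omega>. fn b s (Theta M \<delta> X v s \<omega>)"
  obtain Y1 where Y1: "ito_integral M F T B (?s X' v) Y1" "AE \<omega> in M. \<forall>t\<in>{0..T}. X' t \<omega> = \<xi> 0 \<omega> + (LINT s:{0..t}|lborel. ?b X' v s \<omega>) + Y1 t \<omega>"
    and b1: "AE \<omega> in M. set_integrable lborel {0..T} (\<lambda>s. ?b X' v s \<omega>)"
    using sol(2) unfolding state_solution_def by blast
  obtain Y2 where Y2: "ito_integral M F T B (?s X u) Y2" "AE \<omega> in M. \<forall>t\<in>{0..T}. X t \<omega> = \<xi> 0 \<omega> + (LINT s:{0..t}|lborel. ?b X u s \<omega>) + Y2 t \<omega>"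
    and b2: "AE \<omega> in M. set_integrable lborel {0..T} (\<lambda>s. ?b X u s \<omega>)"
    using sol(1) unfolding state_solution_def by blast
  have pT: "AE \<omega> in M. p T \<omega> = grad (tc_x \<Phi> (X T \<omega>, law M (X T))) + (\<integral>\<omega>'. grad (tc_mu \<Phi> (X T \<omega>', law M (X T)) (X T \<omega>)) \<partial>M)"
    using adj unfolding adjoint_solution_def by blast
  obtain f Y where f: "adapted_measurable M F {0..T} f"
      "AE t in lborel. t \<in> {0..T} \<longrightarrow> (AE \<omega> in M. f t \<omega> = adjoint_driver M F T \<delta> b \<sigma> h u X p q t \<omega>)"
    and Y: "ito_integral M F T B q Y"
      "AE \<omega> in M. \<forall>t\<in>{0..T}. p t \<omega> = p T \<omega> + (LINT s:{t..T}|lborel. f s \<omega>) - (Y T \<omega> - Y t \<omega>)"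
    using adj unfolding adjoint_solution_def by blast
  have fm: "(\<lambda>z. f (fst z) (snd z)) \<in> borel_measurable Q" using adapted_measurable_Q[OF f(1)] by (simp add: case_prod_unfold)
  have fd: "AE t in Leb. AE \<omega> in M. f t \<omega> = driver t \<omega>" using f(2) by (simp add: AE_Leb driver_def)
  have fL: "(\<lambda>z. f (fst z) (snd z)) \<in> L2 Q Q" by (rule AE_driver_L2[OF fm fd])
  have fF: "AE t in Leb. f t \<in> borel_measurable (F t)" using f(1) by (auto simp: adapted_measurable_def)
  have dL: "(\<lambda>z. dX (fst z) (snd z)) \<in> L2 Q Q" by (intro L2_diff controlled_L2(1)[OF cu] controlled_L2(1)[OF cv])
  have dt: "dX t \<in> L2 M M" if "t \<in> {0..T}" for t by (intro L2_diff controlled_L2(5)[OF cu that] controlled_L2(5)[OF cv that])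
  have pt: "p t \<in> L2 M M" if "t \<in> {0..T}" for t by (rule S2_section_L2[OF pS that])
  have p0: "p 0 \<in> borel_measurable (F 0)" using pS T by (auto simp: S2_def adapted_measurable_def)
  have p_eq: "AE \<omega> in M. p t \<omega> = p T \<omega> + (\<integral>r. (if t \<le> r then f r \<omega> else 0) \<partial>Leb) - (Y T \<omega> - Y t \<omega>)" if "t \<in> {0..T}" for t
    using Y(2) unfolding integral_Leb_if(2)[OF that, symmetric] by (rule eventually_mono) (erule bspec[OF _ that])
  \<comment> \<open>The common initial value \<open>\<xi> 0\<close> cancels, so the difference of
    the states starts at 0.\<close>
  have X_eq: "AE \<omega> in M. dX t \<omega> = (\<integral>r. (if r \<le> t then \<beta> r \<omega> else 0) \<partial>Leb) + (Y1 t \<omega> - Y2 t \<omega>)" if t: "t \<in> {0..T}" for t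
    using Y1(2) Y2(2) b1 b2 AE_space
  proof eventually_elim
    case (elim \<omega>)
    have "AE s in Leb. \<beta> s \<omega> = ?b X' v s \<omega> - ?b X u s \<omega>" using \<beta>(2) by eventually_elim (use elim(5) in blast)
    from difference_integral[OF elim(3,4) measurable_Q_section(2)[OF L2_measurable[OF \<beta>(1)] elim(5)] this t]
    show ?case using bspec[OF elim(1) t] bspec[OF elim(2) t] by simp
  qed
  note pe = product_expectation[OF pL pt p0 dL dt fL fF \<beta>(1,3) Y(1) Y1(1) Y2(1) p_eq X_eq]
  have s: "(\<lambda>z. ?s X' v (fst z) (snd z) - ?s X u (fst z) (snd z)) \<in> L2 Q Q"
    by (intro L2_diff H2_L2') (use Y1(1) Y2(1) in \<open>auto simp: ito_integral_def\<close>)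
  \<comment> \<open>For almost every time this is the difference of the Hamiltonians along the two
    controls.\<close>
  define K where "K z = \<eta> (fst z) (snd z) + (p (fst z) (snd z) \<bullet> \<beta> (fst z) (snd z)
    + q (fst z) (snd z) \<bullet> (?s X' v (fst z) (snd z) - ?s X u (fst z) (snd z)))" for z
  note ii = \<eta>(1) L2_integrable_inner[OF pL \<beta>(1)] L2_integrable_inner[OF qL s] L2_integrable_inner[OF fL dL]
  have Ki: "integrable Q K" unfolding K_def[abs_def]
    by (intro Bochner_Integration.integrable_add ii)
  \<comment> \<open>The product rule trades the pairings with \<open>\<beta>\<close> and with the
    diffusion difference for the pairing at time \<open>T\<close> and the pairing with the
    driver.\<close>
  have KI: "(\<integral>z. K z \<partial>Q) = (\<integral>z. \<eta> (fst z) (snd z) \<partial>Q) + (\<integral>\<omega>. p T \<omega> \<bullet> dX T \<omega> \<partial>M) + (\<integral>z. f (fst z) (snd z) \<bullet> dX (fst z) (snd z) \<partial>Q)"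
    unfolding K_def[abs_def] using pe ii(1-3) by simp
  have "(\<integral>z. f (fst z) (snd z) \<bullet> dX (fst z) (snd z) \<partial>Q) = (\<integral>t. (\<integral>\<omega>. f t \<omega> \<bullet> dX t \<omega> \<partial>M) \<partial>restrict_space lborel {0..T})"
    using Q_sections(3)[OF ii(4)] by (simp add: Leb_def)
  also have "\<dots> \<le> (\<integral>t. (\<integral>\<omega>. K (t, \<omega>) \<partial>M) \<partial>restrict_space lborel {0..T})"
  proof (rule delayed_integral_le[OF \<delta>(1) T_pos, where G="\<lambda>t. past t + past_control t"])
    show "integrable (restrict_space lborel {0..T}) (\<lambda>t. \<integral>\<omega>. K (t, \<omega>) \<partial>M)"
      "integrable (restrict_space lborel {0..T}) (\<lambda>t. \<integral>\<omega>. f t \<omega> \<bullet> dX t \<omega> \<partial>M)"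
      using Q_sections(5)[OF Ki] Q_sections(5)[OF ii(4)] by (simp_all add: Leb_def)
    show "past t + past_control t = 0" if "0 \<le> t" "t < \<delta>" for t by (rule past_initial[OF that])
    have "AE t in Leb. (\<integral>\<omega>. f t \<omega> \<bullet> dX t \<omega> \<partial>M) + (past t + past_control t)
      - (if t + \<delta> \<le> T then past (t + \<delta>) + past_control (t + \<delta>) else 0) \<le> (\<integral>\<omega>. K (t, \<omega>) \<partial>M)"
      using AE_ok opt conv6 Q_sections(1)[OF Ki] \<beta>(2) \<eta>(2) fd AE_space
    proof eventually_elim
      case (elim t)
      show ?case
      proof (rule fixed_time_inequality[OF conjunct1[OF elim(1)] conjunct2[OF elim(1)] elim(3,4) _ elim(2) _ elim(7)])
        show "K (t, \<omega>) = hamiltonian b \<sigma> h t (Theta M \<delta> X' v t \<omega>) (p t \<omega>) (q t \<omega>)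
            - hamiltonian b \<sigma> h t (Theta M \<delta> X u t \<omega>) (p t \<omega>) (q t \<omega>)" if "\<omega> \<in> space M" for \<omega>
          using bspec[OF elim(5) that] bspec[OF elim(6) that]
          by (simp add: K_def hamiltonian_eq inner_diff_right inner_commute)
        show "f t \<in> borel_measurable M" using measurable_Q_section(1)[OF fm] elim(8) by simp
      qed
    qed
    then show "AE t in lborel. t \<in> {0..T} \<longrightarrow> (\<integral>\<omega>. f t \<omega> \<bullet> dX t \<omega> \<partial>M) + (past t + past_control t)
      - (if t + \<delta> \<le> T then past (t + \<delta>) + past_control (t + \<delta>) else 0) \<le> (\<integral>\<omega>. K (t, \<omega>) \<partial>M)"
      unfolding AE_Leb .
  qed
  also have "\<dots> = (\<integral>z. K z \<partial>Q)" using Q_sections(3)[OF Ki] by (simp add: Leb_def)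
  \<comment> \<open>The integral of \<open>f \<bullet> dX\<close> occurs on both sides and
    cancels.\<close>
  finally have main: "0 \<le> (\<integral>z. \<eta> (fst z) (snd z) \<partial>Q) + (\<integral>\<omega>. p T \<omega> \<bullet> dX T \<omega> \<partial>M)" using KI by simp
  let ?D = "\<lambda>\<omega>. tc \<Phi> (X' T \<omega>, law M (X' T)) - tc \<Phi> (X T \<omega>, law M (X T))"
  note t = terminal_cost_le[OF cu cv lt conv2 pT L2_measurable[OF pt[OF T(1)]]]
  have wd: "AE \<omega> in M. set_integrable lborel {0..T} (\<lambda>t. rc h t (Theta_h M \<delta> X u t \<omega>))"
      "AE \<omega> in M. set_integrable lborel {0..T} (\<lambda>t. rc h t (Theta_h M \<delta> X' v t \<omega>))"
    and ic: "integrable M (cost_at M T \<delta> h \<Phi> u X)" "integrable M (cost_at M T \<delta> h \<Phi> v X')"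
    using cost unfolding cost_well_defined_def by auto
  have "cost_J M T \<delta> h \<Phi> v X' - cost_J M T \<delta> h \<Phi> u X = (\<integral>\<omega>. cost_at M T \<delta> h \<Phi> v X' \<omega> - cost_at M T \<delta> h \<Phi> u X \<omega> \<partial>M)"
    unfolding cost_J_def using ic by simp
  also have "\<dots> = (\<integral>\<omega>. (\<integral>t. \<eta> t \<omega> \<partial>Leb) + ?D \<omega> \<partial>M)"
  proof (rule integral_cong_AE)
    show "AE \<omega> in M. cost_at M T \<delta> h \<Phi> v X' \<omega> - cost_at M T \<delta> h \<Phi> u X \<omega> = (\<integral>t. \<eta> t \<omega> \<partial>Leb) + ?D \<omega>"
      using wd AE_space
    proof eventually_elim
      case (elim \<omega>)
      have "AE s in Leb. \<eta> s \<omega> = rc h s (Theta_h M \<delta> X' v s \<omega>) - rc h s (Theta_h M \<delta> X u s \<omega>)"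
        using \<eta>(2) by eventually_elim (use elim(3) in \<open>simp add: running_coefficient_def Theta_def Theta_h_def\<close>)
      from difference_integral[OF elim(2,1) measurable_Q_section(2)[OF borel_measurable_integrable[OF \<eta>(1)] elim(3)] this T(1)]
      have "(LINT t:{0..T}|lborel. rc h t (Theta_h M \<delta> X' v t \<omega>)) - (LINT t:{0..T}|lborel. rc h t (Theta_h M \<delta> X u t \<omega>))
        = (\<integral>s. (if s \<le> T then \<eta> s \<omega> else 0) \<partial>Leb)" .
      also have "\<dots> = (\<integral>s. \<eta> s \<omega> \<partial>Leb)" by (rule Bochner_Integration.integral_cong) auto
      finally show ?case unfolding cost_at_def by simp
    qed
    show "(\<lambda>\<omega>. cost_at M T \<delta> h \<Phi> v X' \<omega> - cost_at M T \<delta> h \<Phi> u X \<omega>) \<in> borel_measurable M" using ic by measurable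
    show "(\<lambda>\<omega>. (\<integral>t. \<eta> t \<omega> \<partial>Leb) + ?D \<omega>) \<in> borel_measurable M"
      using Q_sections(6)[OF \<eta>(1)] t(1) by (intro borel_measurable_add) auto
  qed
  also have "\<dots> = (\<integral>z. \<eta> (fst z) (snd z) \<partial>Q) + (\<integral>\<omega>. ?D \<omega> \<partial>M)"
    using Q_sections(4,6)[OF \<eta>(1)] t(1) by simp
  finally show ?thesis using main t(2) by simp
qed

end

theorem theorem5p2:
  fixes M G :: "'a measure" and F :: "real \<Rightarrow> 'a measure"
    and B :: "real \<Rightarrow> 'a \<Rightarrow> real^'d::finite"
    and T \<delta> :: real and U :: "(real^'k::finite) set"
    and \<xi> :: "real \<Rightarrow> 'a \<Rightarrow> real^'n::finite" and \<gamma> :: "real \<Rightarrow> 'a \<Rightarrow> real^'k"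
    and b :: "('n, 'k, real^'n) coefficient" and \<sigma> :: "('n, 'k, real^'d^'n) coefficient"
    and h :: "('n, 'k) running_cost" and \<Phi> :: "'n terminal_cost"
    and X :: "(real \<Rightarrow> 'a \<Rightarrow> real^'k) \<Rightarrow> real \<Rightarrow> 'a \<Rightarrow> real^'n"
    and u :: "real \<Rightarrow> 'a \<Rightarrow> real^'k"
    and p :: "real \<Rightarrow> 'a \<Rightarrow> real^'n" and q :: "real \<Rightarrow> 'a \<Rightarrow> real^'d^'n"
  assumes "0 < T" and "0 \<le> \<delta>" and "\<delta> \<le> T"
    and "stochastic_basis TYPE('n) M G T B F"
    and "convex U" and "initial_data M F \<delta> U \<xi> \<gamma>"
    and "measurable_coefficient T U b" and "measurable_coefficient T U \<sigma>"
    and "measurable_running_cost T U h"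
    and "state_map M F T \<delta> B U \<xi> \<gamma> b \<sigma> h \<Phi> X"
    and "hypothesis_H M T U b \<sigma> h \<Phi>"
    and "u \<in> admissible M F T \<delta> U \<gamma>"
    and "adjoint_solution M F T \<delta> B b \<sigma> h \<Phi> u (X u) p q"
    and "\<And>v. v \<in> admissible M F T \<delta> U \<gamma> \<Longrightarrow>
      AE t in lborel. t \<in> {0..T} \<longrightarrow> (AE \<omega> in M.
        hamiltonian_v b \<sigma> h t (Theta M \<delta> (X u) u t \<omega>) (p t \<omega>) (q t \<omega>) \<bullet> (v t \<omega> - u t \<omega>)
        + vec_cond_exp M (F t)
            (\<lambda>\<omega>'. zero_after T (t + \<delta>)
               (hamiltonian_vd b \<sigma> h (t + \<delta>) (Theta M \<delta> (X u) u (t + \<delta>) \<omega>')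
                  (p (t + \<delta>) \<omega>') (q (t + \<delta>) \<omega>'))) \<omega> \<bullet> (v t \<omega> - u t \<omega>)
        \<ge> 0)"
    and "lift_convex2 M (tc \<Phi>)"
    and "AE t in lborel. t \<in> {0..T} \<longrightarrow> (AE \<omega> in M.
      lift_convex6 M U (\<lambda>\<theta>. hamiltonian b \<sigma> h t \<theta> (p t \<omega>) (q t \<omega>)))"
  shows "\<forall>v\<in>admissible M F T \<delta> U \<gamma>. cost_J M T \<delta> h \<Phi> u (X u) \<le> cost_J M T \<delta> h \<Phi> v (X v)"
proof
  fix v assume v: "v \<in> admissible M F T \<delta> U \<gamma>"
  note basis = assms(4)[unfolded stochastic_basis_def]
  interpret prob_space M using basis by blast
  interpret delayed_control M G T B F \<delta> U \<xi> \<gamma>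
    by unfold_locales (use assms(1-6) basis in blast)+
  have sm: "state_solution M F T \<delta> B \<xi> b \<sigma> w (X w)" "cost_well_defined M T \<delta> h \<Phi> w (X w)"
    if "w \<in> admissible M F T \<delta> U \<gamma>" for w
    using assms(10) that unfolding state_map_def by blast+
  have c: "controlled w (X w)" if "w \<in> admissible M F T \<delta> U \<gamma>" for w
    using sm(1)[OF that] that unfolding controlled_def state_solution_def by blast
  note H = assms(11)[unfolded hypothesis_H_def]
  obtain Lb Cb where lb: "\<And>t. t \<in> {0..T} \<Longrightarrow> lifted_coefficient M U 0 Lb Cb b t"
    using H_coefficient_lifted[OF prob_space_axioms assms(5)] H by blast
  obtain Ls Cs where ls: "\<And>t. t \<in> {0..T} \<Longrightarrow> lifted_coefficient M U 0 Ls Cs \<sigma> t"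
    using H_coefficient_lifted[OF prob_space_axioms assms(5)] H by blast
  obtain Lh Ch where lh: "\<And>t. t \<in> {0..T} \<Longrightarrow> lifted_coefficient M U 1 Lh Ch (running_coefficient h) t"
    using H_running_cost_lifted[OF prob_space_axioms assms(5)] H by blast
  obtain L C where "\<forall>t\<in>{0..T}. lifted_coefficient M U 1 L C (terminal_coefficient \<Phi> :: ('n, 'k, real) coefficient) t"
    using H_terminal_cost_lifted[OF prob_space_axioms assms(5)] H by blast
  then have lt: "lifted_coefficient M U 1 L C (terminal_coefficient \<Phi> :: ('n, 'k, real) coefficient) T"
    using assms(1) by simp
  \<comment> \<open>The competitor \<open>v\<close> is fixed here; the adjoint processes
    \<open>p\<close> and \<open>q\<close> are those of \<open>u\<close> and serve every
    competitor.\<close>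
  interpret adjoint_pair M G T B F \<delta> U \<xi> \<gamma> b \<sigma> h Lb Cb Ls Cs Lh Ch u v "X u" "X v" p q
    by (intro adjoint_pair.intro adjoint_pair_axioms.intro delayed_control_axioms c v assms(12) lb ls lh)
      (use assms(13) in \<open>auto simp: adjoint_solution_def\<close>)
  have tb: "time_measurable T (dom6 U) (fn b)" using assms(7) by (simp add: measurable_coefficient_def)
  have th: "time_measurable T (dom6 U) (fn (running_coefficient h))"
    using assms(9) by (auto simp: measurable_running_cost_def time_measurable_def running_coefficient_def dom6_def dom4_def)
  show "cost_J M T \<delta> h \<Phi> u (X u) \<le> cost_J M T \<delta> h \<Phi> v (X v)"
    by (rule cost_le[OF tb th sm(1)[OF assms(12)] sm(1)[OF v] sm(2)[OF assms(12)] sm(2)[OF v] assms(13)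
        assms(14)[OF v, folded AE_Leb] assms(15) assms(16)[folded AE_Leb] lt])
qed

end
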